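(* Let $n\ge 1$, let $V$ be a finite-dimensional $\mathfrak S_n$-module with character $\chi^V$, and suppose $f\in\Sigma(\mathfrak S_n)$ satisfies $\theta(f)=\chi^V$. Let $\Gamma=\Gamma(\mathfrak S_n,\mathrm{supp}(f))$ be the Cayley graph with weights $\omega(\sigma)=[\sigma]f$ for $\sigma\in \mathrm{supp}(f)$. For each standard tableau $t$ with $n$ squares let $\sigma_t\in\mathfrak S_n$ be a permutation with recording tableau $Q(\sigma_t)=t$. Then for every partition $\lambda\vdash n$ and every $d\ge 0$, the multiplicity of $V^\lambda$ in $V^{\otimes d}$ equals $$\sum_{\substack{t\in STab_n\\ \mathrm{shape}(t)=\lambda}}\ \sum_{w\in w(\sigma_t,d;\Gamma)}\omega(w).$$ In particular, the multiplicity of the trivial module in $V^{\otimes d}$ is $\sum_{w\in w(e,d;\Gamma)}\omega(w)$.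
   Context: $\mathfrak S_n$ is the symmetric group on $\{1,\dots,n\}$ with identity $e$, product $(\sigma\tau)(i)=\sigma(\tau(i))$. Modules are over $\mathbb C$, and $\mathfrak S_n$ acts diagonally on $V^{\otimes d}$ ($V^{\otimes 0}$ is the trivial module). $V^\lambda$ is the simple $\mathfrak S_n$-module (Specht module) indexed by $\lambda\vdash n$, with character $\chi^\lambda$; $V^{(n)}$ is trivial. $STab_n$ is the set of standard tableaux with $n$ squares (drawn in French notation: rows of lengths $\lambda_1\ge\lambda_2\ge\cdots$ from bottom to top, entries $1,\dots,n$ increasing along rows left to right and up columns). The Robinson-Schensted correspondence (row insertion of $\sigma(1),\dots,\sigma(n)$) sends $\sigma$ to a pair $(P(\sigma),Q(\sigma))$ of standard tableaux of the same shape, where $P(\sigma)$ is the insertion tableau and $Q(\sigma)$ the recording tableau. Descent algebra: $Des(\sigma)=\{i\in\{1,\dots,n-1\}:\sigma(i)>\sigma(i+1)\}$; for $K\subseteq\{1,\dots,n-1\}$, $D_K=\sum_{Des(\sigma)=K}\sigma\in\mathbb Q\mathfrak S_n$. The span $\Sigma(\mathfrak S_n)$ of the $D_K$ is a subalgebra of $\mathbb Q\mathfrak S_n$ (Solomon's descent algebra, known). For a standard tableau $t$, $Des(t)=\{i : i+1 \text{ is in a row strictly above that of } i\text{ in }t\}$. $\mathbb Q\,\mathrm{Irr}(\mathfrak S_n)$ is the algebra of $\mathbb Q$-linear combinations of irreducible characters with pointwise product. Solomon's map $\theta:\Sigma(\mathfrak S_n)\to\mathbb Q\,\mathrm{Irr}(\mathfrak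 S_n)$, known to be an algebra morphism, is the linear map $\theta(D_K)=\sum_{t\in STab_n,\ Des(t)=K}\chi^{\mathrm{shape}(t)}$. For $f\in\mathbb Q\mathfrak S_n$, $[\sigma]f$ is the coefficient of $\sigma$ in $f$ and $\mathrm{supp}(f)=\{\sigma: [\sigma]f\ne0\}$. For a finite group $G$ and $S\subseteq G$, the Cayley graph $\Gamma(G,S)$ has vertex set $G$ and a directed edge $g\to gs$ for each $g\in G,s\in S$ ($S$ need not generate $G$). For $g\in G$, $w(g,d;\Gamma)$ is the set of words of length $d$ which reduce to $g$, i.e. sequences $(s_1,\dots,s_d)\in S^d$ with $s_1s_2\cdots s_d=g$ in $G$. With weights $\omega(s)$, $s\in S$, the weight of the word $w=s_1\cdots s_d$ is $\omega(w)=\omega(s_1)\cdots\omega(s_d)$. *)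

theory Defs
  imports
    Complex_Main
    "HOL-Library.Function_Algebras"
    "HOL-Combinatorics.Permutations"
    "HOL-Algebra.Sym_Groups"
begin

section \<open>Complex representations of a group\<close>

text \<open>
  A module is a subspace \<open>carr\<close> of an arbitrary complex vector space (an abelian group type with
  a scalar multiplication \<open>smul\<close>), with a linear group action \<open>act\<close>.  Only the behaviour of
  \<open>act g\<close> on \<open>carr\<close> matters, so that submodules are obtained by replacing \<open>carr\<close>.
\<close>

record ('g, 'v) gmod =
  carr :: "'v set"
  smul :: "complex \<Rightarrow> 'v \<Rightarrow> 'v"
  act  :: "'g \<Rightarrow> 'v \<Rightarrow> 'v"

locale gmodule = group G + vector_space "smul M"
  for G (structure) and M :: "('g, 'v::ab_group_add) gmod" +
  assumes subspace_carr: "subspace (carr M)"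
    and act_closed: "\<lbrakk>g \<in> carrier G; v \<in> carr M\<rbrakk> \<Longrightarrow> act M g v \<in> carr M"
    and act_add: "\<lbrakk>g \<in> carrier G; v \<in> carr M; w \<in> carr M\<rbrakk>
                    \<Longrightarrow> act M g (v + w) = act M g v + act M g w"
    and act_smul: "\<lbrakk>g \<in> carrier G; v \<in> carr M\<rbrakk> \<Longrightarrow> act M g (smul M c v) = smul M c (act M g v)"
    and act_one: "v \<in> carr M \<Longrightarrow> act M \<one> v = v"
    and act_mult: "\<lbrakk>g \<in> carrier G; h \<in> carrier G; v \<in> carr M\<rbrakk>
                    \<Longrightarrow> act M (g \<otimes> h) v = act M g (act M h v)"

definition finite_dim :: "('g, 'v::ab_group_add) gmod \<Rightarrow> bool" where
  "finite_dim M \<longleftrightarrow> (\<exists>B. finite B \<and> module.span (smul M) B = carr M)"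

definition is_basis :: "('g, 'v::ab_group_add) gmod \<Rightarrow> 'v set \<Rightarrow> bool" where
  "is_basis M B \<longleftrightarrow> \<not> module.dependent (smul M) B \<and> module.span (smul M) B = carr M"

text \<open>The trace of \<open>g\<close> on a (finite-dimensional) module, computed in an arbitrary basis;
  characters are extended by \<open>0\<close> outside the group.\<close>

definition character :: "('g, 'r) monoid_scheme \<Rightarrow> ('g, 'v::ab_group_add) gmod \<Rightarrow> 'g \<Rightarrow> complex" where
  "character G M g =
     (if g \<in> carrier G
      then let B = (SOME B. is_basis M B)
           in \<Sum>b\<in>B. module.representation (smul M) B (act M g b) b
      else 0)"

definition submodule :: "('g, 'r) monoid_scheme \<Rightarrow> ('g, 'v::ab_group_add) gmod \<Rightarrow> 'v set \<Rightarrow> bool" where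
  "submodule G M W \<longleftrightarrow> W \<subseteq> carr M \<and> module.subspace (smul M) W \<and>
     (\<forall>g\<in>carrier G. \<forall>w\<in>W. act M g w \<in> W)"

definition simple_module :: "('g, 'r) monoid_scheme \<Rightarrow> ('g, 'v::ab_group_add) gmod \<Rightarrow> bool" where
  "simple_module G M \<longleftrightarrow> carr M \<noteq> {0} \<and> (\<forall>W. submodule G M W \<longrightarrow> W = {0} \<or> W = carr M)"

definition isomorphic_modules ::
    "('g, 'r) monoid_scheme \<Rightarrow> ('g, 'v::ab_group_add) gmod \<Rightarrow> ('g, 'w::ab_group_add) gmod \<Rightarrow> bool" where
  "isomorphic_modules G M N \<longleftrightarrow>
     (\<exists>h. bij_betw h (carr M) (carr N) \<and>
          (\<forall>v\<in>carr M. \<forall>w\<in>carr M. h (v + w) = h v + h w) \<and>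
          (\<forall>c. \<forall>v\<in>carr M. h (smul M c v) = smul N c (h v)) \<and>
          (\<forall>g\<in>carrier G. \<forall>v\<in>carr M. h (act M g v) = act N g (h v)))"

text \<open>\<open>M\<close> is the internal direct sum of the list \<open>Ws\<close> of simple submodules.\<close>

definition simple_decomposition ::
    "('g, 'r) monoid_scheme \<Rightarrow> ('g, 'v::ab_group_add) gmod \<Rightarrow> 'v set list \<Rightarrow> bool" where
  "simple_decomposition G M Ws \<longleftrightarrow>
     (\<forall>W\<in>set Ws. submodule G M W \<and> simple_module G (M\<lparr>carr := W\<rparr>)) \<and>
     (\<forall>v\<in>carr M. \<exists>!ws. length ws = length Ws \<and> (\<forall>i<length Ws. ws ! i \<in> Ws ! i) \<and> sum_list ws = v)"

text \<open>The number of summands isomorphic to the simple module \<open>S\<close> in a decomposition of \<open>M\<close> into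
  simple modules.  For finite \<open>G\<close> and finite-dimensional \<open>M\<close> such decompositions exist (Maschke)
  and this number does not depend on the decomposition.\<close>

definition multiplicity ::
    "('g, 'r) monoid_scheme \<Rightarrow> ('g, 's::ab_group_add) gmod \<Rightarrow> ('g, 'v::ab_group_add) gmod \<Rightarrow> nat" where
  "multiplicity G S M =
     (THE m. \<exists>Ws. simple_decomposition G M Ws \<and>
                  m = length (filter (\<lambda>W. isomorphic_modules G S (M\<lparr>carr := W\<rparr>)) Ws))"

definition trivial_module :: "('g, complex) gmod" where
  "trivial_module = \<lparr>carr = UNIV, smul = (*), act = (\<lambda>g v. v)\<rparr>"

definition fscale :: "complex \<Rightarrow> ('x \<Rightarrow> complex) \<Rightarrow> ('x \<Rightarrow> complex)" where
  "fscale c v = (\<lambda>x. c * v x)"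


subsection \<open>Tensor powers\<close>

text \<open>
  The \<open>d\<close>-th tensor power of a finite-dimensional space \<open>V\<close> is realised as the span of the
  multilinear forms \<open>v\<^sub>1 \<otimes> \<dots> \<otimes> v\<^sub>d : (\<phi>\<^sub>1, \<dots>, \<phi>\<^sub>d) \<mapsto> \<phi>\<^sub>1 v\<^sub>1 \<cdots> \<phi>\<^sub>d v\<^sub>d\<close> on the dual space.  Forms are
  set to \<open>0\<close> on lists of the wrong length or with an entry that is not linear on \<open>V\<close>.  The action
  below is the diagonal one: it sends \<open>v\<^sub>1 \<otimes> \<dots> \<otimes> v\<^sub>d\<close> to \<open>g v\<^sub>1 \<otimes> \<dots> \<otimes> g v\<^sub>d\<close>, and for \<open>d = 0\<close> it is
  the trivial action on \<open>\<complex>\<close>.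
\<close>

definition linear_form :: "('g, 'v::ab_group_add) gmod \<Rightarrow> ('v \<Rightarrow> complex) \<Rightarrow> bool" where
  "linear_form M \<phi> \<longleftrightarrow>
     (\<forall>v\<in>carr M. \<forall>w\<in>carr M. \<phi> (v + w) = \<phi> v + \<phi> w) \<and>
     (\<forall>c. \<forall>v\<in>carr M. \<phi> (smul M c v) = c * \<phi> v)"

definition pure_tensor ::
    "('g, 'v::ab_group_add) gmod \<Rightarrow> 'v list \<Rightarrow> ('v \<Rightarrow> complex) list \<Rightarrow> complex" where
  "pure_tensor M vs = (\<lambda>\<phi>s. if length \<phi>s = length vs \<and> (\<forall>\<phi>\<in>set \<phi>s. linear_form M \<phi>)
                            then \<Prod>i<length vs. (\<phi>s ! i) (vs ! i) else 0)"

definition tensor_power ::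
    "('g, 'v::ab_group_add) gmod \<Rightarrow> nat \<Rightarrow> ('g, ('v \<Rightarrow> complex) list \<Rightarrow> complex) gmod" where
  "tensor_power M d =
     \<lparr>carr = module.span fscale {pure_tensor M vs | vs. length vs = d \<and> set vs \<subseteq> carr M},
      smul = fscale,
      act = (\<lambda>g F \<phi>s. F (map (\<lambda>\<phi>. \<phi> \<circ> act M g) \<phi>s))\<rparr>"


section \<open>Partitions, tableaux and Specht modules\<close>

definition is_partition :: "nat \<Rightarrow> nat list \<Rightarrow> bool" where
  "is_partition n \<mu> \<longleftrightarrow> sorted_wrt (\<ge>) \<mu> \<and> 0 \<notin> set \<mu> \<and> sum_list \<mu> = n"

text \<open>A tableau is the list of its rows, from bottom to top in French notation, so that \<open>t ! 0\<close> is
  the longest row.\<close>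

type_synonym tableau = "nat list list"

definition shape :: "tableau \<Rightarrow> nat list" where
  "shape t = map length t"

definition numbering :: "nat \<Rightarrow> nat list \<Rightarrow> tableau \<Rightarrow> bool" where
  "numbering n \<mu> t \<longleftrightarrow> shape t = \<mu> \<and> distinct (concat t) \<and> set (concat t) = {1..n}"

definition STab :: "nat \<Rightarrow> tableau set" where
  "STab n = {t. is_partition n (shape t) \<and> numbering n (shape t) t \<and>
               (\<forall>r\<in>set t. sorted_wrt (<) r) \<and>
               (\<forall>i j. Suc i < length t \<and> j < length (t ! Suc i) \<longrightarrow> t ! i ! j < t ! Suc i ! j)}"

definition tab_Des :: "tableau \<Rightarrow> nat set" where
  "tab_Des t = {i. \<exists>r s. r < s \<and> s < length t \<and> i \<in> set (t ! r) \<and> Suc i \<in> set (t ! s)}"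

definition column :: "tableau \<Rightarrow> nat \<Rightarrow> nat set" where
  "column t j = {r ! j | r. r \<in> set t \<and> j < length r}"

definition column_group :: "nat \<Rightarrow> tableau \<Rightarrow> (nat \<Rightarrow> nat) set" where
  "column_group n t = {\<pi>. \<pi> permutes {1..n} \<and> (\<forall>j. \<pi> ` column t j = column t j)}"

text \<open>The tabloid of \<open>t\<close>, i.e. its class under row equivalence, is the list of its row sets.\<close>

definition tabloid :: "tableau \<Rightarrow> nat set list" where
  "tabloid t = map set t"

definition polytabloid :: "nat \<Rightarrow> tableau \<Rightarrow> nat set list \<Rightarrow> complex" where
  "polytabloid n t =
     (\<lambda>X. \<Sum>\<pi>\<in>column_group n t. of_int (sign \<pi>) * (if tabloid (map (map \<pi>) t) = X then 1 else 0))"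

text \<open>The Specht module is spanned by the polytabloids inside the space of functions on tabloids;
  \<open>\<sigma>\<close> acts by \<open>(\<sigma> v)(X) = v(\<sigma>\<^sup>-\<^sup>1 X)\<close>, that is, it permutes the basis of tabloids.\<close>

definition specht :: "nat \<Rightarrow> nat list \<Rightarrow> (nat \<Rightarrow> nat, nat set list \<Rightarrow> complex) gmod" where
  "specht n \<mu> =
     \<lparr>carr = module.span fscale {polytabloid n t | t. numbering n \<mu> t},
      smul = fscale,
      act = (\<lambda>\<sigma> v X. v (map (vimage \<sigma>) X))\<rparr>"


section \<open>The Robinson-Schensted correspondence\<close>

text \<open>Inserting \<open>x\<close> into a row: either \<open>x\<close> is put at the end, or it replaces the leftmost larger
  entry, which is bumped.\<close>

fun row_insert :: "nat \<Rightarrow> nat list \<Rightarrow> nat list \<times> nat option" where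
  "row_insert x [] = ([x], None)"
| "row_insert x (y # ys) =
     (if x < y then (x # ys, Some y)
      else let (zs, b) = row_insert x ys in (y # zs, b))"

text \<open>Inserting \<open>x\<close> into a tableau; also returns the index of the row containing the new box.\<close>

fun tab_insert :: "nat \<Rightarrow> tableau \<Rightarrow> tableau \<times> nat" where
  "tab_insert x [] = ([[x]], 0)"
| "tab_insert x (r # rs) =
     (case row_insert x r of
        (r', None) \<Rightarrow> (r' # rs, 0)
      | (r', Some y) \<Rightarrow> (let (rs', i) = tab_insert y rs in (r' # rs', Suc i)))"

definition add_box :: "nat \<Rightarrow> nat \<Rightarrow> tableau \<Rightarrow> tableau" where
  "add_box i k t = (if i < length t then t[i := t ! i @ [k]] else t @ [[k]])"

definition RS :: "nat \<Rightarrow> (nat \<Rightarrow> nat) \<Rightarrow> tableau \<times> tableau" where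
  "RS n \<sigma> = foldl (\<lambda>(P, Q) k. let (P', i) = tab_insert (\<sigma> k) P in (P', add_box i k Q))
                  ([], []) [1..<Suc n]"

definition recording_tableau :: "nat \<Rightarrow> (nat \<Rightarrow> nat) \<Rightarrow> tableau" where
  "recording_tableau n \<sigma> = snd (RS n \<sigma>)"


section \<open>The descent algebra and Solomon's map\<close>

text \<open>Elements of \<open>\<rat>\<SS>\<^sub>n\<close> are functions \<open>(nat \<Rightarrow> nat) \<Rightarrow> rat\<close> vanishing outside \<open>\<SS>\<^sub>n\<close>.\<close>

definition perm_Des :: "nat \<Rightarrow> (nat \<Rightarrow> nat) \<Rightarrow> nat set" where
  "perm_Des n \<sigma> = {i \<in> {1..<n}. \<sigma> i > \<sigma> (Suc i)}"

definition D :: "nat \<Rightarrow> nat set \<Rightarrow> (nat \<Rightarrow> nat) \<Rightarrow> rat" where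
  "D n K = (\<lambda>\<sigma>. if \<sigma> permutes {1..n} \<and> perm_Des n \<sigma> = K then 1 else 0)"

definition descent_algebra :: "nat \<Rightarrow> ((nat \<Rightarrow> nat) \<Rightarrow> rat) set" where
  "descent_algebra n = {f. \<exists>c. f = (\<lambda>\<sigma>. \<Sum>K\<in>Pow {1..<n}. c K * D n K \<sigma>)}"

definition theta_D :: "nat \<Rightarrow> nat set \<Rightarrow> (nat \<Rightarrow> nat) \<Rightarrow> complex" where
  "theta_D n K = (\<lambda>\<sigma>. \<Sum>t | t \<in> STab n \<and> tab_Des t = K.
                         character (sym_group n) (specht n (shape t)) \<sigma>)"

text \<open>The linear extension of \<open>D\<^sub>K \<mapsto> theta_D n K\<close>; see \<open>theta_eq\<close> below.\<close>

definition theta :: "nat \<Rightarrow> ((nat \<Rightarrow> nat) \<Rightarrow> rat) \<Rightarrow> (nat \<Rightarrow> nat) \<Rightarrow> complex" where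
  "theta n f = (THE \<psi>. \<exists>c. f = (\<lambda>\<sigma>. \<Sum>K\<in>Pow {1..<n}. c K * D n K \<sigma>) \<and>
                            \<psi> = (\<lambda>\<sigma>. \<Sum>K\<in>Pow {1..<n}. of_rat (c K) * theta_D n K \<sigma>))"

lemma ex_perm_Des: "K \<subseteq> {1..<n} \<Longrightarrow> \<exists>\<sigma>. \<sigma> permutes {1..n} \<and> perm_Des n \<sigma> = K"
proof (induction n arbitrary: K)
  case 0
  then show ?case by (auto simp: perm_Des_def)
next
  case (Suc n)
  have "K - {n} \<subseteq> {1..<n}" using Suc.prems by auto
  then obtain \<sigma> where \<sigma>: "\<sigma> permutes {1..n}" "perm_Des n \<sigma> = K - {n}" using Suc.IH by blast
  have rng: "\<sigma> i \<in> {1..n} \<longleftrightarrow> i \<in> {1..n}" for i using permutes_in_image[OF \<sigma>(1)] .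
  have D: "i \<in> K - {n} \<longleftrightarrow> i \<in> {1..<n} \<and> \<sigma> i > \<sigma> (Suc i)" for i
    using \<sigma>(2) unfolding perm_Des_def by blast
  show ?case
  proof (cases "n \<in> K")
    case False
    have fix1: "\<sigma> (Suc n) = Suc n" using \<sigma>(1) by (simp add: permutes_def)
    have "\<sigma> permutes {1..Suc n}" using \<sigma>(1) by (rule permutes_subset) auto
    moreover have "perm_Des (Suc n) \<sigma> = K"
    proof (rule Set.set_eqI)
      fix i show "i \<in> perm_Des (Suc n) \<sigma> \<longleftrightarrow> i \<in> K"
        using D[of i] False fix1 rng[of n] by (cases "i = n") (auto simp: perm_Des_def less_Suc_eq)
    qed
    ultimately show ?thesis by blast
  next
    case True
    then have n: "n \<ge> 1" using Suc.prems by auto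
    define \<tau> where "\<tau> i = (if i \<in> {1..n} then Suc (\<sigma> i) else if i = Suc n then 1 else i)" for i
    have "bij_betw \<tau> {1..Suc n} {1..Suc n}"
    proof -
      have inj: "inj_on \<tau> {1..Suc n}"
      proof (rule inj_onI)
        fix x y assume xy: "x \<in> {1..Suc n}" "y \<in> {1..Suc n}" "\<tau> x = \<tau> y"
        show "x = y"
        proof (cases "x = Suc n \<or> y = Suc n")
          case True
          have "\<tau> z \<noteq> 1" if "z \<in> {1..n}" for z
            using that rng[of z] by (simp add: \<tau>_def)
          moreover have "\<tau> (Suc n) = 1" by (simp add: \<tau>_def)
          moreover have "z = Suc n \<or> z \<in> {1..n}" if "z \<in> {1..Suc n}" for z
            using that by auto
          ultimately show ?thesis using True xy by metis
        next
          case False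
          then have "x \<in> {1..n}" "y \<in> {1..n}" using xy by auto
          then have "\<sigma> x = \<sigma> y" using xy(3) by (simp add: \<tau>_def)
          then show ?thesis using permutes_inj[OF \<sigma>(1)] by (rule injD[rotated])
        qed
      qed
      moreover have "\<tau> ` {1..Suc n} \<subseteq> {1..Suc n}"
      proof (rule image_subsetI)
        fix i assume "i \<in> {1..Suc n}"
        then show "\<tau> i \<in> {1..Suc n}" using rng[of i] by (cases "i \<in> {1..n}") (simp_all add: \<tau>_def)
      qed
      ultimately show ?thesis unfolding bij_betw_def using endo_inj_surj by blast
    qed
    then have "\<tau> permutes {1..Suc n}"
      by (rule bij_imp_permutes) (auto simp: \<tau>_def)
    moreover have "perm_Des (Suc n) \<tau> = K"
    proof (rule Set.set_eqI)
      fix i show "i \<in> perm_Des (Suc n) \<tau> \<longleftrightarrow> i \<in> K"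
      proof (cases "i = n")
        case True
        then show ?thesis using \<open>n \<in> K\<close> n rng[of n] by (simp add: perm_Des_def \<tau>_def)
      next
        case False
        then have "i \<in> perm_Des (Suc n) \<tau> \<longleftrightarrow> i \<in> {1..<n} \<and> \<sigma> i > \<sigma> (Suc i)"
          by (auto simp: perm_Des_def \<tau>_def)
        then show ?thesis using D[of i] False by simp
      qed
    qed
    ultimately show ?thesis by blast
  qed
qed

lemma theta_eq:
  "theta n (\<lambda>\<sigma>. \<Sum>K\<in>Pow {1..<n}. c K * D n K \<sigma>)
     = (\<lambda>\<sigma>. \<Sum>K\<in>Pow {1..<n}. of_rat (c K) * theta_D n K \<sigma>)"
proof -
  have coeff: "(\<Sum>K\<in>Pow {1..<n}. b K * D n K \<sigma>) = b (perm_Des n \<sigma>)"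
    if "\<sigma> permutes {1..n}" for b \<sigma>
  proof -
    have "(\<Sum>K\<in>Pow {1..<n}. b K * D n K \<sigma>) = (\<Sum>K\<in>Pow {1..<n}. if perm_Des n \<sigma> = K then b K else 0)"
      using that by (intro sum.cong) (auto simp: D_def)
    also have "\<dots> = b (perm_Des n \<sigma>)"
      by (subst sum.delta') (auto simp: perm_Des_def)
    finally show ?thesis .
  qed
  have uniq: "b K = c K"
    if eq: "(\<lambda>\<sigma>. \<Sum>K\<in>Pow {1..<n}. c K * D n K \<sigma>) = (\<lambda>\<sigma>. \<Sum>K\<in>Pow {1..<n}. b K * D n K \<sigma>)"
      and K: "K \<in> Pow {1..<n}" for b K
  proof -
    obtain \<sigma> where "\<sigma> permutes {1..n}" "perm_Des n \<sigma> = K" using ex_perm_Des K by blast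
    then show ?thesis using fun_cong[OF eq, of \<sigma>] coeff[of \<sigma> b] coeff[of \<sigma> c] by metis
  qed
  show ?thesis
    unfolding theta_def
  proof (rule the_equality)
    fix \<psi>
    assume "\<exists>b. (\<lambda>\<sigma>. \<Sum>K\<in>Pow {1..<n}. c K * D n K \<sigma>) = (\<lambda>\<sigma>. \<Sum>K\<in>Pow {1..<n}. b K * D n K \<sigma>) \<and>
      \<psi> = (\<lambda>\<sigma>. \<Sum>K\<in>Pow {1..<n}. of_rat (b K) * theta_D n K \<sigma>)"
    then obtain b where
      b: "(\<lambda>\<sigma>. \<Sum>K\<in>Pow {1..<n}. c K * D n K \<sigma>) = (\<lambda>\<sigma>. \<Sum>K\<in>Pow {1..<n}. b K * D n K \<sigma>)"
      and \<psi>: "\<psi> = (\<lambda>\<sigma>. \<Sum>K\<in>Pow {1..<n}. of_rat (b K) * theta_D n K \<sigma>)" by blast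
    show "\<psi> = (\<lambda>\<sigma>. \<Sum>K\<in>Pow {1..<n}. of_rat (c K) * theta_D n K \<sigma>)"
      unfolding \<psi> by (intro ext sum.cong refl) (simp only: uniq[OF b])
  qed (rule exI[of _ c], simp)
qed


section \<open>Words in a Cayley graph\<close>

text \<open>The words of length \<open>d\<close> in the Cayley graph of \<open>G\<close> with respect to \<open>S\<close> that reduce to \<open>g\<close>,
  i.e. the label sequences of its walks of length \<open>d\<close> from \<open>\<one>\<close> to \<open>g\<close>.\<close>

definition cayley_words :: "('g, 'r) monoid_scheme \<Rightarrow> 'g set \<Rightarrow> 'g \<Rightarrow> nat \<Rightarrow> 'g list set" where
  "cayley_words G S g d =
     {w. length w = d \<and> set w \<subseteq> S \<and> foldr (\<lambda>s x. s \<otimes>\<^bsub>G\<^esub> x) w \<one>\<^bsub>G\<^esub> = g}"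

definition word_weight :: "('g \<Rightarrow> 'a::monoid_mult) \<Rightarrow> 'g list \<Rightarrow> 'a" where
  "word_weight \<omega> w = prod_list (map \<omega> w)"

definition supp :: "('g \<Rightarrow> 'a::zero) \<Rightarrow> 'g set" where
  "supp f = {\<sigma>. f \<sigma> \<noteq> 0}"

end

theory Submission
  imports Defs
begin

text \<open>
  Let \<open>B\<^sub>A\<close> be the sum of the permutations with descent set contained in \<open>A\<close>, and \<open>M\<^sub>A\<close> the
  character of the permutation module on the rearrangements of the weakly increasing word whose
  steps are at the elements of \<open>A\<close> (\<open>fixed_words n (block A)\<close>). Grouping standard tableaux by
  their descent sets, \<open>\<theta>(B\<^sub>A)\<close> is the sum of the characters of the shapes of the tableaux with
  descents in \<open>A\<close>, and Young's rule (\<open>young_rule\<close>) says that this is \<open>M\<^sub>A\<close>. The products \<open>B\<^sub>A B\<^sub>B\<close>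
  and \<open>M\<^sub>A M\<^sub>B\<close> expand in the same way, as sums over the rearrangements of the word of \<open>A\<close> that
  increase along the blocks of \<open>B\<close> (\<open>card_factorizations\<close>, \<open>fixed_words_product\<close>). Hence if
  \<open>f = \<Sum> b\<^sub>A B\<^sub>A\<close> and \<open>\<chi>\<^sup>V = \<Sum> b\<^sub>A M\<^sub>A\<close>, then also the powers \<open>f\<^sup>d\<close> and \<open>(\<chi>\<^sup>V)\<^sup>d\<close> have common
  coefficients \<open>c\<^sub>A\<close> (\<open>word_sum_lifts\<close>).

  The coefficient of \<open>\<sigma>\<close> in \<open>f\<^sup>d\<close> is the weighted number of words reducing to \<open>\<sigma>\<close>
  (\<open>word_sum_Suc\<close>), and it is the sum of \<open>c\<^sub>A\<close> over the sets \<open>A\<close> containing the descents of \<open>\<sigma>\<close>.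
  The character of the tensor power is \<open>(\<chi>\<^sup>V)\<^sup>d\<close>, so the multiplicity of the Specht module of \<open>\<mu>\<close>
  is the sum of \<open>c\<^sub>A\<close> times the number of tableaux of shape \<open>\<mu>\<close> with descents in \<open>A\<close>. Summing
  over the tableaux first, each \<open>t\<close> contributes the coefficient of \<open>f\<^sup>d\<close> at any permutation with
  the descents of \<open>t\<close>; a permutation with recording tableau \<open>t\<close> is one
  (\<open>recording_tableau_Des\<close>). For one row the only tableau has no descents, and the identity is
  the only permutation without descents.

  Young's rule is squeezed between two bounds. The symmetrizations under a Young subgroup of the
  polytabloids of the tableaux with descents in \<open>A\<close> are linearly independent
  (\<open>symmetrized_independent\<close>), which bounds the multiplicities in \<open>M\<^sub>A\<close> from below. The norm of
  \<open>M\<^sub>A\<close> is the number of permutations \<open>g\<close> such that \<open>g\<close> and its inverse have descents in \<open>A\<close>, and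
  the Robinson-Schensted correspondence maps these injectively to pairs of such tableaux of
  equal shape (\<open>card_des_pairs_le\<close>), which bounds the norm from above by the sum of the squares
  of the lower bounds.

  The representation theory is developed from traces: Schur's lemma, Maschke's theorem, and
  multiplicities as inner products of characters (\<open>multiplicity_character\<close>). Following James,
  the column antisymmetrizer of a tableau maps every function on tabloids to a multiple of its
  polytabloid (\<open>column_antisym_eq\<close>); therefore Specht modules are simple, have only scalar
  endomorphisms, and are pairwise nonisomorphic.
\<close>

section \<open>Traces on subspaces\<close>

text \<open>
  A module is a subspace of an arbitrary vector space, and its action is linear only there; so
  linearity is required on \<open>S\<close> only.
\<close>

definition lin_map ::
    "('a \<Rightarrow> 'b \<Rightarrow> 'b) \<Rightarrow> 'b::ab_group_add set \<Rightarrow> ('a \<Rightarrow> 'c \<Rightarrow> 'c) \<Rightarrow> 'c::ab_group_add set \<Rightarrow> ('b \<Rightarrow> 'c) \<Rightarrow> bool" where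
  "lin_map s1 S s2 T f \<longleftrightarrow> f ` S \<subseteq> T \<and> (\<forall>v\<in>S. \<forall>w\<in>S. f (v + w) = f v + f w) \<and>
     (\<forall>c. \<forall>v\<in>S. f (s1 c v) = s2 c (f v))"

definition fin_dim :: "('a::comm_ring_1 \<Rightarrow> 'b \<Rightarrow> 'b) \<Rightarrow> 'b::ab_group_add set \<Rightarrow> bool" where
  "fin_dim s S \<longleftrightarrow> (\<exists>B. finite B \<and> module.span s B = S)"

text \<open>
  The formula by which characters are defined, for an arbitrary endomorphism of a subspace.
\<close>

definition trace_on :: "('a::comm_ring_1 \<Rightarrow> 'b \<Rightarrow> 'b) \<Rightarrow> 'b::ab_group_add set \<Rightarrow> ('b \<Rightarrow> 'b) \<Rightarrow> 'a" where
  "trace_on s S f =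
     (let B = (SOME B. \<not> module.dependent s B \<and> module.span s B = S)
      in \<Sum>b\<in>B. module.representation s B (f b) b)"

lemma lin_mapD:
  assumes "lin_map s1 S s2 T f"
  shows "v \<in> S \<Longrightarrow> f v \<in> T" "v \<in> S \<Longrightarrow> w \<in> S \<Longrightarrow> f (v + w) = f v + f w"
    "v \<in> S \<Longrightarrow> f (s1 c v) = s2 c (f v)"
  using assms by (auto simp: lin_map_def)

lemma lin_mapI:
  assumes "\<And>v. v \<in> S \<Longrightarrow> f v \<in> T" "\<And>v w. v \<in> S \<Longrightarrow> w \<in> S \<Longrightarrow> f (v + w) = f v + f w"
    "\<And>c v. v \<in> S \<Longrightarrow> f (s1 c v) = s2 c (f v)"
  shows "lin_map s1 S s2 T f"
  using assms by (auto simp: lin_map_def)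

lemma lin_map_compose:
  "lin_map s1 S s2 T f \<Longrightarrow> lin_map s2 T s3 U g \<Longrightarrow> lin_map s1 S s3 U (\<lambda>v. g (f v))"
  by (rule lin_mapI) (simp_all add: lin_mapD)

context vector_space
begin

lemma fin_dim_basis_extend:
  assumes "fin_dim scale S" "subspace W" "W \<subseteq> S" "E \<subseteq> W" "independent E"
  obtains B where "E \<subseteq> B" "finite B" "independent B" "span B = W"
proof -
  obtain B where B: "E \<subseteq> B" "B \<subseteq> W" "independent B" "W \<subseteq> span B"
    using maximal_independent_subset_extend assms(4,5) by blast
  obtain A where A: "finite A" "span A = S" using assms(1) by (auto simp: fin_dim_def)
  have "finite B" using independent_span_bound[OF A(1) B(3)] B(2) assms(3) A(2) by blast
  moreover have "span B = W" using B(2,4) assms(2) span_minimal by blast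
  ultimately show ?thesis using B that by blast
qed

lemma fin_dim_basis:
  assumes "fin_dim scale S"
  obtains B where "finite B" "independent B" "span B = S"
proof -
  have "subspace S" using assms by (auto simp: fin_dim_def)
  then show ?thesis
    using fin_dim_basis_extend[OF assms _ order_refl, of "{}"] that by (auto simp: independent_empty)
qed

lemma fin_dim_subspace: "fin_dim scale S \<Longrightarrow> subspace S"
  by (auto simp: fin_dim_def)

lemma fin_dim_subset: "fin_dim scale S \<Longrightarrow> subspace W \<Longrightarrow> W \<subseteq> S \<Longrightarrow> fin_dim scale W"
  using fin_dim_basis_extend[of S W "{}"] by (metis empty_subsetI fin_dim_def independent_empty)

lemma finite_basis:
  assumes "fin_dim scale S" "independent B" "span B = S"
  shows "finite B"
proof -
  obtain A where A: "finite A" "span A = S" using assms(1) by (auto simp: fin_dim_def)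
  then show ?thesis using independent_span_bound[OF A(1) assms(2)] assms(3) span_superset by blast
qed

end

context vector_space_pair
begin

lemma lin_map_zero: "lin_map s1 S s2 T f \<Longrightarrow> vs1.subspace S \<Longrightarrow> f 0 = 0"
  using lin_mapD(3)[of s1 S s2 T f 0 0] vs1.subspace_0 by simp

lemma lin_map_sum:
  assumes "lin_map s1 S s2 T f" "vs1.subspace S" "\<And>i. i \<in> I \<Longrightarrow> v i \<in> S"
  shows "f (\<Sum>i\<in>I. v i) = (\<Sum>i\<in>I. f (v i))"
  using assms(3)
proof (induction I rule: infinite_finite_induct)
  case (insert x F)
  have "sum v F \<in> S" by (rule vs1.subspace_sum[OF assms(2)]) (use insert in auto)
  then show ?case using insert lin_mapD(2)[OF assms(1)] by simp
qed (simp_all add: lin_map_zero[OF assms(1,2)])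

lemma lin_map_expand:
  assumes "lin_map s1 (vs1.span B) s2 T f" "finite B" "vs1.independent B" "v \<in> vs1.span B"
  shows "f v = (\<Sum>b\<in>B. s2 (vs1.representation B v b) (f b))"
proof -
  have b: "b \<in> vs1.span B" if "b \<in> B" for b using that vs1.span_base by blast
  have "f v = f (\<Sum>b\<in>B. s1 (vs1.representation B v b) b)"
    using vs1.sum_representation_eq[OF assms(3,4,2) order_refl] by simp
  also have "\<dots> = (\<Sum>b\<in>B. f (s1 (vs1.representation B v b) b))"
    by (rule lin_map_sum[OF assms(1)]) (auto intro: vs1.span_scale b)
  finally show ?thesis using lin_mapD(3)[OF assms(1)] b by simp
qed

lemma representation_lin_map:
  assumes "lin_map s1 (vs1.span B) s2 (vs2.span C) f" "finite B" "vs1.independent B"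
    "vs2.independent C" "v \<in> vs1.span B"
  shows "vs2.representation C (f v) c = (\<Sum>b\<in>B. vs1.representation B v b * vs2.representation C (f b) c)"
proof -
  have "f b \<in> vs2.span C" if "b \<in> B" for b using that lin_mapD(1)[OF assms(1)] vs1.span_base by blast
  then show ?thesis
    unfolding lin_map_expand[OF assms(1,2,3,5)]
    by (subst vs2.representation_sum) (auto simp: vs2.representation_scale assms intro: vs2.span_scale)
qed

text \<open>
  Both sides are the sum of all products of an entry of the matrix of \<open>f\<close> with the transposed
  entry of the matrix of \<open>g\<close>.
\<close>

lemma basis_trace_swap:
  assumes "finite B" "vs1.independent B" "finite C" "vs2.independent C"
    and f: "lin_map s1 (vs1.span B) s2 (vs2.span C) f"
    and g: "lin_map s2 (vs2.span C) s1 (vs1.span B) g"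
  shows "(\<Sum>b\<in>B. vs1.representation B (g (f b)) b) = (\<Sum>c\<in>C. vs2.representation C (f (g c)) c)"
proof -
  interpret swap: vector_space_pair s2 s1 ..
  have fb: "f b \<in> vs2.span C" if "b \<in> B" for b using that lin_mapD(1)[OF f] vs1.span_base by blast
  have gc: "g c \<in> vs1.span B" if "c \<in> C" for c using that lin_mapD(1)[OF g] vs2.span_base by blast
  have "(\<Sum>b\<in>B. vs1.representation B (g (f b)) b) =
      (\<Sum>b\<in>B. \<Sum>c\<in>C. vs2.representation C (f b) c * vs1.representation B (g c) b)"
    by (intro sum.cong refl swap.representation_lin_map) (use assms fb in auto)
  also have "\<dots> = (\<Sum>c\<in>C. \<Sum>b\<in>B. vs1.representation B (g c) b * vs2.representation C (f b) c)"
    by (subst sum.swap) (simp add: mult.commute)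
  also have "\<dots> = (\<Sum>c\<in>C. vs2.representation C (f (g c)) c)"
    by (intro sum.cong refl representation_lin_map[symmetric]) (use assms gc in auto)
  finally show ?thesis .
qed

end

context vector_space
begin

text \<open>
  Independence of the basis is the rule tr(gf) = tr(fg), applied to the identity read as a map
  from the space with one basis to the space with the other.
\<close>

lemma trace_on_basis:
  assumes "finite B" "independent B" "lin_map scale (span B) scale (span B) f"
  shows "trace_on scale (span B) f = (\<Sum>b\<in>B. representation B (f b) b)"
proof -
  interpret vector_space_pair scale scale ..
  define C where "C = (SOME C. independent C \<and> span C = span B)"
  have C: "independent C" "span C = span B"
    unfolding C_def by (rule someI2[of _ B]; use assms in simp)+
  have "fin_dim scale (span B)" using assms(1) by (auto simp: fin_dim_def)
  then have finC: "finite C" using finite_basis C by blast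
  have "trace_on scale (span B) f = (\<Sum>c\<in>C. representation C (id (f c)) c)"
    by (simp add: trace_on_def C_def Let_def)
  also have "\<dots> = (\<Sum>b\<in>B. representation B (f (id b)) b)"
    by (rule basis_trace_swap[symmetric])
       (use assms C finC in \<open>auto simp: lin_map_def\<close>)
  finally show ?thesis by simp
qed

lemma trace_on_cong:
  assumes "fin_dim scale S" "lin_map scale S scale S g" "\<And>v. v \<in> S \<Longrightarrow> f v = g v"
  shows "trace_on scale S f = trace_on scale S g"
proof -
  obtain B where B: "finite B" "independent B" "span B = S" using fin_dim_basis assms(1) by blast
  have f: "lin_map scale S scale S f"
    using assms(2,3) fin_dim_subspace[OF assms(1)]
    by (auto simp: lin_map_def subspace_add subspace_scale)
  show ?thesis
    using trace_on_basis[OF B(1,2), of f] trace_on_basis[OF B(1,2), of g] f assms(2,3) B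
    by (metis (no_types, lifting) span_base sum.cong)
qed

lemma lin_map_lincomb:
  assumes "subspace T" "\<And>i. i \<in> I \<Longrightarrow> lin_map s1 S scale T (f i)"
  shows "lin_map s1 S scale T (\<lambda>v. \<Sum>i\<in>I. scale (a i) (f i v))"
proof (rule lin_mapI)
  fix v assume v: "v \<in> S"
  show "(\<Sum>i\<in>I. scale (a i) (f i v)) \<in> T"
    by (intro subspace_sum[OF assms(1)] subspace_scale[OF assms(1)] lin_mapD(1)[OF assms(2)] v)
  fix w assume w: "w \<in> S"
  have "(\<Sum>i\<in>I. scale (a i) (f i (v + w))) = (\<Sum>i\<in>I. scale (a i) (f i v) + scale (a i) (f i w))"
    by (intro sum.cong refl) (simp add: lin_mapD(2)[OF assms(2) v w] scale_right_distrib)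
  then show "(\<Sum>i\<in>I. scale (a i) (f i (v + w))) = (\<Sum>i\<in>I. scale (a i) (f i v)) + (\<Sum>i\<in>I. scale (a i) (f i w))"
    by (simp add: sum.distrib)
next
  fix c v assume v: "v \<in> S"
  show "(\<Sum>i\<in>I. scale (a i) (f i (s1 c v))) = scale c (\<Sum>i\<in>I. scale (a i) (f i v))"
    unfolding scale_sum_right
    by (intro sum.cong refl) (simp add: lin_mapD(3)[OF assms(2) v] mult.commute)
qed

lemma lin_map_sum_maps:
  assumes "subspace T" "\<And>i. i \<in> I \<Longrightarrow> lin_map s1 S scale T (f i)"
  shows "lin_map s1 S scale T (\<lambda>v. \<Sum>i\<in>I. f i v)"
  using lin_map_lincomb[OF assms, of I "\<lambda>x. x" "\<lambda>_. 1"] by simp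

lemma trace_on_lincomb:
  assumes "fin_dim scale S" "\<And>i. i \<in> I \<Longrightarrow> lin_map scale S scale S (f i)"
  shows "trace_on scale S (\<lambda>v. \<Sum>i\<in>I. scale (a i) (f i v)) = (\<Sum>i\<in>I. a i * trace_on scale S (f i))"
proof -
  obtain B where B: "finite B" "independent B" "span B = S" using fin_dim_basis assms(1) by blast
  have S: "subspace S" using fin_dim_subspace assms(1) .
  have fib: "f i b \<in> S" if "i \<in> I" "b \<in> B" for i b
    using lin_mapD(1)[OF assms(2)] that B span_base by blast
  have "trace_on scale S (\<lambda>v. \<Sum>i\<in>I. scale (a i) (f i v))
      = (\<Sum>b\<in>B. representation B (\<Sum>i\<in>I. scale (a i) (f i b)) b)"
    using trace_on_basis[OF B(1,2)] lin_map_lincomb[of S I scale S f a, OF S assms(2)] B(3) by simp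
  also have "\<dots> = (\<Sum>b\<in>B. \<Sum>i\<in>I. a i * representation B (f i b) b)"
    by (intro sum.cong refl, subst representation_sum)
       (use fib B S in \<open>auto simp: representation_scale intro!: subspace_scale sum.cong\<close>)
  also have "\<dots> = (\<Sum>i\<in>I. a i * (\<Sum>b\<in>B. representation B (f i b) b))"
    by (subst sum.swap) (simp add: sum_distrib_left)
  also have "\<dots> = (\<Sum>i\<in>I. a i * trace_on scale S (f i))"
    using trace_on_basis[OF B(1,2)] assms(2) B(3) by (intro sum.cong refl) auto
  finally show ?thesis .
qed

lemma trace_on_sum:
  assumes "fin_dim scale S" "\<And>i. i \<in> I \<Longrightarrow> lin_map scale S scale S (f i)"
  shows "trace_on scale S (\<lambda>v. \<Sum>i\<in>I. f i v) = (\<Sum>i\<in>I. trace_on scale S (f i))"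
  using trace_on_lincomb[OF assms, of I "\<lambda>x. x" "\<lambda>_. 1"] by simp

text \<open>
  The diagonal entry at \<open>b\<close> is \<open>\<phi> b\<close> times the coordinate of \<open>w\<close> at \<open>b\<close>; these add up to \<open>\<phi>\<close>
  applied to the expansion of \<open>w\<close>.
\<close>

lemma trace_on_rank_one:
  assumes "fin_dim scale S" "lin_map scale S (*) UNIV \<phi>" "w \<in> S"
  shows "trace_on scale S (\<lambda>v. scale (\<phi> v) w) = \<phi> w"
proof -
  interpret P: vector_space_pair scale "(*)"
    by unfold_locales (auto simp: algebra_simps)
  obtain B where B: "finite B" "independent B" "span B = S" using fin_dim_basis assms(1) by blast
  have S: "subspace S" using fin_dim_subspace assms(1) .
  have "lin_map scale S scale S (\<lambda>v. scale (\<phi> v) w)"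
    by (rule lin_mapI) (use assms S in \<open>auto simp: lin_mapD subspace_scale scale_left_distrib\<close>)
  then have "trace_on scale S (\<lambda>v. scale (\<phi> v) w) = (\<Sum>b\<in>B. representation B (scale (\<phi> b) w) b)"
    using trace_on_basis[OF B(1,2)] B by simp
  also have "\<dots> = (\<Sum>b\<in>B. representation B w b * \<phi> b)"
    using B assms(3) by (simp add: representation_scale mult.commute)
  also have "\<dots> = \<phi> w"
    using P.lin_map_expand[of B UNIV \<phi> w] assms B by simp
  finally show ?thesis .
qed

lemma trace_on_id:
  assumes "finite B" "independent B"
  shows "trace_on scale (span B) (\<lambda>v. v) = of_nat (card B)"
  using trace_on_basis[OF assms, of "\<lambda>v. v"]
  by (simp add: lin_map_def representation_basis assms)

end

lemma (in vector_space_pair) trace_on_swap: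
  assumes "fin_dim s1 S" "fin_dim s2 T" "lin_map s1 S s2 T f" "lin_map s2 T s1 S g"
  shows "trace_on s1 S (\<lambda>v. g (f v)) = trace_on s2 T (\<lambda>w. f (g w))"
proof -
  obtain B where B: "finite B" "vs1.independent B" "vs1.span B = S"
    using vs1.fin_dim_basis assms(1) by blast
  obtain C where C: "finite C" "vs2.independent C" "vs2.span C = T"
    using vs2.fin_dim_basis assms(2) by blast
  show ?thesis
    using basis_trace_swap[OF B(1,2) C(1,2), of f g] assms(3,4) B C
      vs1.trace_on_basis[OF B(1,2)] vs2.trace_on_basis[OF C(1,2)]
      lin_map_compose[OF assms(3,4)] lin_map_compose[OF assms(4,3)] by simp
qed

text \<open>
  An idempotent is the inclusion of its image composed with itself as a map onto the image.
  Swapping the two factors gives the identity of the image, so the trace is the rank.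
\<close>

lemma (in vector_space) trace_on_idempotent_ge:
  fixes p :: "'b \<Rightarrow> 'b"
  assumes "fin_dim scale S" "lin_map scale S scale S p" "\<And>v. v \<in> S \<Longrightarrow> p (p v) = p v"
    "finite E" "independent E" "E \<subseteq> p ` S"
  obtains m where "trace_on scale S p = of_nat m" "m \<ge> card E"
proof -
  interpret P: vector_space_pair scale scale ..
  have S: "subspace S" using fin_dim_subspace assms(1) .
  have pS: "p ` S \<subseteq> S" using assms(2) by (auto simp: lin_map_def)
  have "subspace (p ` S)"
  proof (rule subspaceI)
    show "0 \<in> p ` S" using P.lin_map_zero[OF assms(2) S] subspace_0[OF S] by (metis image_eqI)
  next
    fix x y assume "x \<in> p ` S" "y \<in> p ` S"
    then obtain v w where vw: "v \<in> S" "w \<in> S" "x = p v" "y = p w" by auto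
    then have "x + y = p (v + w)" using lin_mapD(2)[OF assms(2)] by simp
    then show "x + y \<in> p ` S" using vw subspace_add[OF S] by blast
  next
    fix c x assume "x \<in> p ` S"
    then obtain v where v: "v \<in> S" "x = p v" by auto
    then have "scale c x = p (scale c v)" using lin_mapD(3)[OF assms(2)] by simp
    then show "scale c x \<in> p ` S" using v subspace_scale[OF S] by blast
  qed
  then obtain B where B: "E \<subseteq> B" "finite B" "independent B" "span B = p ` S"
    using fin_dim_basis_extend[OF assms(1) _ pS assms(6,5)] by blast
  have T: "fin_dim scale (p ` S)" using B by (auto simp: fin_dim_def)
  have "trace_on scale S (\<lambda>v. (\<lambda>x. x) (p v)) = trace_on scale (p ` S) (\<lambda>w. p w)"
    by (rule P.trace_on_swap[OF assms(1) T]) (use assms pS in \<open>auto simp: lin_map_def\<close>)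
  also have "\<dots> = trace_on scale (p ` S) (\<lambda>w. w)"
    by (rule trace_on_cong[OF T]) (use assms in \<open>auto simp: lin_map_def\<close>)
  also have "\<dots> = of_nat (card B)" using trace_on_id B by metis
  finally show ?thesis using that card_mono[OF B(2,1)] by simp
qed

lemma fin_dim_finite_dim: "finite_dim M = fin_dim (smul M) (carr M)"
  by (simp add: finite_dim_def fin_dim_def)

lemma character_trace:
  "character G M g = (if g \<in> carrier G then trace_on (smul M) (carr M) (act M g) else 0)"
  by (simp add: character_def trace_on_def is_basis_def[abs_def])

section \<open>Intertwiners and orthogonality of characters\<close>

definition intertwiner ::
    "('g, 'r) monoid_scheme \<Rightarrow> ('g, 'v::ab_group_add) gmod \<Rightarrow> ('g, 'w::ab_group_add) gmod \<Rightarrow> ('v \<Rightarrow> 'w) \<Rightarrow> bool" where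
  "intertwiner G M N h \<longleftrightarrow> lin_map (smul M) (carr M) (smul N) (carr N) h \<and>
     (\<forall>g\<in>carrier G. \<forall>v\<in>carr M. h (act M g v) = act N g (h v))"

text \<open>
  Over an algebraically closed field the condition on endomorphisms follows from simplicity by
  Schur's lemma; for Specht modules it comes from an explicit computation, see
  \<open>specht_endomorphism_scalar\<close>.
\<close>

definition abs_simple :: "('g, 'r) monoid_scheme \<Rightarrow> ('g, 'v::ab_group_add) gmod \<Rightarrow> bool" where
  "abs_simple G S \<longleftrightarrow> simple_module G S \<and>
     (\<forall>h. intertwiner G S S h \<longrightarrow> (\<exists>c. \<forall>v\<in>carr S. h v = smul S c v))"

lemma isomorphic_modules_intertwiner:
  "isomorphic_modules G M N \<longleftrightarrow> (\<exists>h. intertwiner G M N h \<and> bij_betw h (carr M) (carr N))"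
  unfolding isomorphic_modules_def intertwiner_def lin_map_def bij_betw_def
  by (intro iff_exI) auto

lemma intertwiner_compose:
  "intertwiner G L M f \<Longrightarrow> intertwiner G M N h \<Longrightarrow> intertwiner G L N (\<lambda>v. h (f v))"
  unfolding intertwiner_def by (auto intro: lin_map_compose simp: lin_mapD(1))

lemma isomorphic_modules_trans:
  assumes "isomorphic_modules G L M" "isomorphic_modules G M N"
  shows "isomorphic_modules G L N"
proof -
  obtain f h where "intertwiner G L M f" "bij_betw f (carr L) (carr M)"
    "intertwiner G M N h" "bij_betw h (carr M) (carr N)"
    using assms unfolding isomorphic_modules_intertwiner by auto
  then have "intertwiner G L N (\<lambda>v. h (f v))" "bij_betw (h \<circ> f) (carr L) (carr N)"
    by (auto intro: intertwiner_compose bij_betw_trans)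
  then show ?thesis unfolding isomorphic_modules_intertwiner comp_def by blast
qed

context gmodule
begin

lemma act_lin_map: "g \<in> carrier G \<Longrightarrow> lin_map (smul M) (carr M) (smul M) (carr M) (act M g)"
  by (rule lin_mapI) (simp_all add: act_closed act_add act_smul)

lemma act_inv:
  assumes "g \<in> carrier G" "v \<in> carr M"
  shows "act M (inv g) (act M g v) = v" "act M g (act M (inv g) v) = v"
  using act_mult[of "inv g" g v] act_mult[of g "inv g" v] assms act_one by auto

lemma submodule_subspace: "submodule G M W \<Longrightarrow> subspace W"
  by (simp add: submodule_def)

lemma submodule_gmodule:
  assumes "submodule G M W"
  shows "gmodule G (M\<lparr>carr := W\<rparr>)"
proof -
  have W: "W \<subseteq> carr M" "subspace W" "\<And>g w. g \<in> carrier G \<Longrightarrow> w \<in> W \<Longrightarrow> act M g w \<in> W"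
    using assms by (auto simp: submodule_def)
  have vs: "vector_space (smul M)" ..
  show ?thesis
    unfolding gmodule_def gmodule_axioms_def using W vs
    by (auto simp: act_add act_smul act_one act_mult is_group subset_iff)
qed

lemma submodule_fin_dim:
  "submodule G M W \<Longrightarrow> fin_dim (smul M) (carr M) \<Longrightarrow> fin_dim (smul M) W"
  by (auto simp: submodule_def intro: fin_dim_subset)

lemma intertwiner_inverse:
  assumes "gmodule G N" "intertwiner G M N h" "bij_betw h (carr M) (carr N)"
  shows "intertwiner G N M (inv_into (carr M) h)"
proof -
  interpret N: gmodule G N by fact
  define k where "k = inv_into (carr M) h"
  have k: "k w \<in> carr M" "h (k w) = w" if "w \<in> carr N" for w
    using that assms(3) unfolding k_def bij_betw_def by (auto simp: f_inv_into_f inv_into_into)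
  have kh: "k (h v) = v" if "v \<in> carr M" for v
    using that assms(3) unfolding k_def bij_betw_def by auto
  have lin: "lin_map (smul M) (carr M) (smul N) (carr N) h"
    and eq: "\<And>g v. g \<in> carrier G \<Longrightarrow> v \<in> carr M \<Longrightarrow> h (act M g v) = act N g (h v)"
    using assms(2) by (auto simp: intertwiner_def)
  have "lin_map (smul N) (carr N) (smul M) (carr M) k"
  proof (rule lin_mapI)
    fix v assume v: "v \<in> carr N"
    then show "k v \<in> carr M" by (rule k)
    show "k (smul N c v) = smul M c (k v)" for c
      using kh[of "smul M c (k v)"] lin_mapD(3)[OF lin, of "k v" c] k[OF v]
        subspace_scale[OF subspace_carr] by simp
    fix w assume w: "w \<in> carr N"
    show "k (v + w) = k v + k w"
      using kh[of "k v + k w"] lin_mapD(2)[OF lin, of "k v" "k w"] k[OF v] k[OF w]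
        subspace_add[OF subspace_carr] by simp
  qed
  moreover have "k (act N g w) = act M g (k w)" if "g \<in> carrier G" "w \<in> carr N" for g w
    using kh[of "act M g (k w)"] eq[of g "k w"] k that by (simp add: act_closed)
  ultimately show ?thesis by (simp add: intertwiner_def k_def)
qed

lemma isomorphic_modules_sym:
  assumes "gmodule G N" "isomorphic_modules G M N"
  shows "isomorphic_modules G N M"
proof -
  obtain h where "intertwiner G M N h" "bij_betw h (carr M) (carr N)"
    using assms(2) unfolding isomorphic_modules_intertwiner by auto
  then show ?thesis
    unfolding isomorphic_modules_intertwiner
    by (intro exI[of _ "inv_into (carr M) h"] conjI intertwiner_inverse[OF assms(1)] bij_betw_inv_into)
qed

text \<open>
  For \<open>k\<close> inverse to \<open>h\<close>, the trace of \<open>g\<close> on \<open>M\<close> is that of \<open>k h g\<close>. Moving \<open>k\<close> to the right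
  gives \<open>h g k\<close>, which is the action of \<open>g\<close> on \<open>N\<close>.
\<close>

lemma character_intertwined:
  assumes "gmodule G N" "fin_dim (smul M) (carr M)" "fin_dim (smul N) (carr N)"
    "intertwiner G M N h" "bij_betw h (carr M) (carr N)"
  shows "character G M = character G N"
proof
  fix g
  interpret N: gmodule G N by fact
  interpret vector_space_pair "smul M" "smul N" ..
  define k where "k = inv_into (carr M) h"
  have k: "k w \<in> carr M" "h (k w) = w" if "w \<in> carr N" for w
    using that assms(5) unfolding k_def bij_betw_def by (auto simp: f_inv_into_f inv_into_into)
  have kh: "k (h v) = v" if "v \<in> carr M" for v
    using that assms(5) unfolding k_def bij_betw_def by auto
  have lin: "lin_map (smul M) (carr M) (smul N) (carr N) h"
    and eq: "\<And>g v. g \<in> carrier G \<Longrightarrow> v \<in> carr M \<Longrightarrow> h (act M g v) = act N g (h v)"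
    using assms(4) by (auto simp: intertwiner_def)
  have lk: "lin_map (smul N) (carr N) (smul M) (carr M) k"
    using intertwiner_inverse[OF assms(1,4,5)] by (simp add: intertwiner_def k_def)
  show "character G M g = character G N g"
  proof (cases "g \<in> carrier G")
    case True
    have "trace_on (smul M) (carr M) (act M g) = trace_on (smul M) (carr M) (\<lambda>v. k (h (act M g v)))"
      by (rule trace_on_cong[OF assms(2)])
         (use lin_map_compose[OF lin_map_compose[OF act_lin_map[OF True] lin] lk] True in
           \<open>auto simp: kh act_closed\<close>)
    also have "\<dots> = trace_on (smul N) (carr N) (\<lambda>w. h (act M g (k w)))"
      by (rule trace_on_swap[OF assms(2,3) _ lk]) (rule lin_map_compose[OF act_lin_map[OF True] lin])
    also have "\<dots> = trace_on (smul N) (carr N) (act N g)"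
      by (rule N.trace_on_cong[OF assms(3)]) (use True k eq N.act_lin_map in auto)
    finally show ?thesis using True by (simp add: character_trace)
  qed (simp add: character_trace)
qed

lemma character_conj:
  assumes "fin_dim (smul M) (carr M)" "g \<in> carrier G" "x \<in> carrier G"
  shows "character G M (x \<otimes> g \<otimes> inv x) = character G M g"
proof -
  interpret vector_space_pair "smul M" "smul M" ..
  let ?t = "trace_on (smul M) (carr M)"
  have "?t (act M (x \<otimes> g \<otimes> inv x)) = ?t (\<lambda>v. act M x (act M (g \<otimes> inv x) v))"
    by (rule trace_on_cong[OF assms(1)])
       (use assms in \<open>auto simp: act_mult[symmetric] m_assoc intro!: lin_map_compose[OF act_lin_map act_lin_map]\<close>)
  also have "\<dots> = ?t (\<lambda>v. act M (g \<otimes> inv x) (act M x v))"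
    by (rule trace_on_swap[OF assms(1,1)]) (use assms act_lin_map in auto)
  also have "\<dots> = ?t (act M g)"
    by (rule trace_on_cong[OF assms(1)])
       (use assms in \<open>auto simp: act_mult[symmetric] m_assoc act_lin_map\<close>)
  finally show ?thesis using assms by (simp add: character_trace)
qed

text \<open>
  Acting by \<open>x\<close> on the argument and reindexing the sum by \<open>g \<otimes> x\<close> pulls \<open>x\<close> out to the left.
\<close>

lemma average_intertwiner:
  assumes "gmodule G N" "lin_map (smul M) (carr M) (smul N) (carr N) T"
  shows "intertwiner G M N (\<lambda>v. \<Sum>g\<in>carrier G. act N (inv g) (T (act M g v)))" (is "intertwiner G M N ?h")
proof -
  interpret N: gmodule G N by fact
  interpret NN: vector_space_pair "smul N" "smul N" ..
  have "lin_map (smul M) (carr M) (smul N) (carr N) (\<lambda>v. act N (inv g) (T (act M g v)))"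
    if "g \<in> carrier G" for g
    using that by (auto intro!: lin_map_compose[OF act_lin_map]
        lin_map_compose[OF assms(2)] N.act_lin_map)
  then have lin: "lin_map (smul M) (carr M) (smul N) (carr N) ?h"
    by (intro N.lin_map_sum_maps N.subspace_carr)
  have "?h (act M x v) = act N x (?h v)" if x: "x \<in> carrier G" and v: "v \<in> carr M" for x v
  proof -
    have *: "T (act M g v) \<in> carr N" if "g \<in> carrier G" for g
      using lin_mapD(1)[OF assms(2)] that v act_closed by simp
    have "?h (act M x v) = (\<Sum>g\<in>carrier G. act N (inv g) (T (act M (g \<otimes> x) v)))"
      using x v by (simp add: act_mult)
    also have "\<dots> = (\<Sum>g\<in>carrier G. act N x (act N (inv g) (T (act M g v))))"
      by (rule sum.reindex_bij_witness[of _ "\<lambda>g. g \<otimes> inv x" "\<lambda>g. g \<otimes> x"])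
         (use x * in \<open>auto simp: m_assoc m_assoc[of x "inv x", symmetric] N.act_mult[symmetric] inv_mult_group\<close>)
    also have "\<dots> = act N x (?h v)"
      by (rule NN.lin_map_sum[OF N.act_lin_map[OF x] N.subspace_carr, symmetric])
         (simp add: N.act_closed *)
    finally show ?thesis .
  qed
  with lin show ?thesis by (auto simp: intertwiner_def)
qed

text \<open>Schur's lemma: the kernel and the image of an intertwiner are submodules.\<close>

lemma intertwiner_simple_bij:
  assumes "gmodule G N" "simple_module G M" "simple_module G N" "intertwiner G M N h"
    "\<exists>v\<in>carr M. h v \<noteq> 0"
  shows "bij_betw h (carr M) (carr N)"
proof -
  interpret N: gmodule G N by fact
  interpret P: vector_space_pair "smul M" "smul N" ..
  have lin: "lin_map (smul M) (carr M) (smul N) (carr N) h"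
    and eq: "\<And>g v. g \<in> carrier G \<Longrightarrow> v \<in> carr M \<Longrightarrow> h (act M g v) = act N g (h v)"
    using assms(4) by (auto simp: intertwiner_def)
  note h = lin_mapD[OF lin]
  have h0: "h 0 = 0" using P.lin_map_zero[OF lin subspace_carr] .
  have N0: "act N g 0 = 0" if "g \<in> carrier G" for g
    using N.act_smul[OF that N.subspace_0[OF N.subspace_carr], of 0] by simp
  have "submodule G M {v \<in> carr M. h v = 0}"
    unfolding submodule_def using subspace_carr
    by (auto simp: subspace_def h h0 act_closed eq N0)
  then have ker: "{v \<in> carr M. h v = 0} = {0}"
    using assms(2,5) unfolding simple_module_def by blast
  have "submodule G N (h ` carr M)"
    unfolding submodule_def
  proof (intro conjI ballI)
    show "h ` carr M \<subseteq> carr N" using h(1) by auto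
    show "N.subspace (h ` carr M)"
    proof (rule N.subspaceI)
      show "0 \<in> h ` carr M" using h0 subspace_0[OF subspace_carr] by force
      show "x + y \<in> h ` carr M" if "x \<in> h ` carr M" "y \<in> h ` carr M" for x y
        using that h(2)[symmetric] subspace_add[OF subspace_carr] by auto
      show "smul N c x \<in> h ` carr M" if "x \<in> h ` carr M" for c x
        using that h(3)[symmetric] subspace_scale[OF subspace_carr] by auto
    qed
    show "act N g w \<in> h ` carr M" if "g \<in> carrier G" "w \<in> h ` carr M" for g w
      using that eq[symmetric] act_closed by auto
  qed
  then have im: "h ` carr M = carr N" using assms(3,5) unfolding simple_module_def by force
  have "inj_on h (carr M)"
  proof (rule inj_onI)
    fix v w assume vw: "v \<in> carr M" "w \<in> carr M" "h v = h w"
    have m: "smul M (-1) w \<in> carr M" using vw(2) subspace_scale[OF subspace_carr] by blast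
    have "h (v + smul M (-1) w) = 0"
      unfolding h(2)[OF vw(1) m] h(3)[OF vw(2)] using vw(3) by simp
    then have "v + smul M (-1) w = 0" using ker vw m subspace_add[OF subspace_carr] by blast
    then show "v = w" by simp
  qed
  then show ?thesis using im by (simp add: bij_betw_def)
qed

text \<open>
  The inner sum on the right is the average over the group of the rank one map taking \<open>v\<close> to \<open>c\<close>
  times its coordinate at \<open>b\<close>, evaluated at \<open>b\<close>. In this form Schur's lemma applies to the
  product of two characters.
\<close>

lemma character_product_sum:
  assumes "gmodule G N"
    and B: "finite B" "independent B" "span B = carr M"
    and C: "finite C" "\<not> module.dependent (smul N) C" "module.span (smul N) C = carr N"
  shows "(\<Sum>g\<in>carrier G. character G M g * character G N (inv g)) =
    (\<Sum>b\<in>B. \<Sum>c\<in>C. module.representation (smul N) C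
       (\<Sum>g\<in>carrier G. act N (inv g) (smul N (representation B (act M g b) b) c)) c)"
proof -
  interpret N: gmodule G N by fact
  have bM: "b \<in> carr M" if "b \<in> B" for b using that B(3) span_base by blast
  have cN: "c \<in> carr N" if "c \<in> C" for c using that C(3) N.span_base by blast
  have rep: "N.representation C (\<Sum>g\<in>carrier G. act N (inv g) (smul N (representation B (act M g b) b) c)) c
     = (\<Sum>g\<in>carrier G. representation B (act M g b) b * N.representation C (act N (inv g) c) c)"
    if "b \<in> B" "c \<in> C" for b c
    by (subst N.representation_sum)
       (auto simp: C cN[OF that(2)] N.act_smul N.act_closed N.representation_scale
           N.subspace_scale[OF N.subspace_carr])
  have ch: "character G M g = (\<Sum>b\<in>B. representation B (act M g b) b)" if "g \<in> carrier G" for g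
    using trace_on_basis[OF B(1,2)] that B(3) act_lin_map by (simp add: character_trace)
  have ch': "character G N g = (\<Sum>b\<in>C. N.representation C (act N g b) b)" if "g \<in> carrier G" for g
    using N.trace_on_basis[OF C(1,2)] that C(3) N.act_lin_map by (simp add: character_trace)
  have "(\<Sum>g\<in>carrier G. character G M g * character G N (inv g)) =
     (\<Sum>g\<in>carrier G. \<Sum>b\<in>B. \<Sum>c\<in>C. representation B (act M g b) b * N.representation C (act N (inv g) c) c)"
    by (simp add: ch ch' sum_product)
  also have "\<dots> = (\<Sum>b\<in>B. \<Sum>c\<in>C. \<Sum>g\<in>carrier G. representation B (act M g b) b * N.representation C (act N (inv g) c) c)"
    by (subst sum.swap, intro sum.cong refl, subst sum.swap, rule refl)
  finally show ?thesis by (simp add: rep)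
qed

lemma rank_one_lin_map:
  assumes "gmodule G N" "finite B" "independent B" "span B = carr M" "c \<in> carr N"
  shows "lin_map (smul M) (carr M) (smul N) (carr N) (\<lambda>v. smul N (representation B v b) c)"
proof -
  interpret N: gmodule G N by fact
  show ?thesis
    by (rule lin_mapI)
       (use assms in \<open>auto simp: N.subspace_scale[OF N.subspace_carr] representation_add
          representation_scale N.scale_left_distrib\<close>)
qed

text \<open>
  The averaged rank one maps are intertwiners from \<open>M\<close> to \<open>N\<close>, hence zero by Schur's lemma.
\<close>

lemma character_orthogonal:
  assumes "gmodule G N" "simple_module G M" "simple_module G N"
    "fin_dim (smul M) (carr M)" "fin_dim (smul N) (carr N)" "\<not> isomorphic_modules G M N"
  shows "(\<Sum>g\<in>carrier G. character G M g * character G N (inv g)) = 0"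
proof -
  interpret N: gmodule G N by fact
  obtain B where B: "finite B" "independent B" "span B = carr M" using fin_dim_basis assms(4) .
  obtain C where C: "finite C" "N.independent C" "N.span C = carr N" using N.fin_dim_basis assms(5) .
  have bM: "b \<in> carr M" if "b \<in> B" for b using that B(3) span_base by blast
  have cN: "c \<in> carr N" if "c \<in> C" for c using that C(3) N.span_base by blast
  have "(\<Sum>g\<in>carrier G. act N (inv g) (smul N (representation B (act M g b) b) c)) = 0"
    if "b \<in> B" "c \<in> C" for b c
  proof (rule ccontr)
    define h where "h v = (\<Sum>g\<in>carrier G. act N (inv g) (smul N (representation B (act M g v) b) c))" for v
    have h: "intertwiner G M N h"
      unfolding h_def
      by (rule average_intertwiner[OF assms(1) rank_one_lin_map[OF assms(1) B cN[OF that(2)]]])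
    assume "\<not> ?thesis"
    then have "h b \<noteq> 0" by (simp add: h_def)
    then have "bij_betw h (carr M) (carr N)"
      using intertwiner_simple_bij[OF assms(1-3) h] bM[OF that(1)] by auto
    then show False using assms(6) h unfolding isomorphic_modules_intertwiner by auto
  qed
  then show ?thesis
    unfolding character_product_sum[OF assms(1) B C] by (simp add: N.representation_zero)
qed

text \<open>
  The average of the rank one map given by \<open>b\<close> and \<open>c\<close> is a scalar \<open>a b c\<close>. Its trace is \<open>a b b\<close>
  times the dimension when \<open>c = b\<close>, and also the order of the group, as every conjugate of the
  rank one map has trace one; only these diagonal scalars enter the sum.
\<close>

lemma character_norm:
  assumes "abs_simple G M" "fin_dim (smul M) (carr M)" "finite (carrier G)"
  shows "(\<Sum>g\<in>carrier G. character G M g * character G M (inv g)) = of_nat (card (carrier G))"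
proof -
  have gm: "gmodule G M" by unfold_locales
  interpret vector_space_pair "smul M" "smul M" ..
  obtain B where B: "finite B" "independent B" "span B = carr M" using fin_dim_basis assms(2) .
  have bM: "b \<in> carr M" if "b \<in> B" for b using that B(3) span_base by blast
  have "carr M \<noteq> {0}" using assms(1) by (simp add: abs_simple_def simple_module_def)
  then have "B \<noteq> {}" using B(3) span_empty by metis
  then have cB: "card B \<noteq> 0" using B(1) by simp
  define h where "h b c v = (\<Sum>g\<in>carrier G. act M (inv g) (smul M (representation B (act M g v) b) c))" for b c v
  have "intertwiner G M M (h b c)" if "c \<in> B" for b c
    unfolding h_def[abs_def] by (rule average_intertwiner[OF gm rank_one_lin_map[OF gm B bM[OF that]]])
  then have "\<exists>a. \<forall>v\<in>carr M. h b c v = smul M a v" if "c \<in> B" for b c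
    using that assms(1) by (auto simp: abs_simple_def)
  then have "\<forall>b. \<forall>c\<in>B. \<exists>a. \<forall>v\<in>carr M. h b c v = smul M a v" by simp
  then obtain a where a: "\<And>b c v. c \<in> B \<Longrightarrow> v \<in> carr M \<Longrightarrow> h b c v = smul M (a b c) v"
    unfolding bchoice_iff choice_iff by auto
  have rep: "representation B (h b c v) x = a b c * representation B v x"
    if "c \<in> B" "v \<in> carr M" for b c v x
    using a[OF that] that B by (simp add: representation_scale)
  have "of_nat (card B) * a b b = of_nat (card (carrier G))" if b: "b \<in> B" for b
  proof -
    have "of_nat (card B) * a b b = (\<Sum>x\<in>B. representation B (h b b x) x)"
      using rep[OF b bM] by (simp add: representation_basis B)
    also have "\<dots> = (\<Sum>x\<in>B. \<Sum>g\<in>carrier G. representation B (act M g x) b * representation B (act M (inv g) b) x)"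
      unfolding h_def
      by (intro sum.cong refl, subst representation_sum)
         (auto simp: B bM[OF b] act_smul act_closed representation_scale subspace_scale[OF subspace_carr])
    also have "\<dots> = (\<Sum>g\<in>carrier G. \<Sum>x\<in>B. representation B (act M (inv g) b) x * representation B (act M g x) b)"
      by (subst sum.swap) (simp add: mult.commute)
    \<comment> \<open>the matrix of \<open>g\<close> times the matrix of its inverse\<close>
    also have "\<dots> = (\<Sum>g\<in>carrier G. representation B (act M g (act M (inv g) b)) b)"
      by (intro sum.cong refl representation_lin_map[symmetric])
         (use B act_lin_map act_closed bM[OF b] in auto)
    also have "\<dots> = of_nat (card (carrier G))"
      using b bM by (simp add: act_inv representation_basis B)
    finally show ?thesis .
  qed
  then have abb: "a b b = of_nat (card (carrier G)) / of_nat (card B)" if "b \<in> B" for b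
    using that cB by (simp add: field_simps)
  have "(\<Sum>g\<in>carrier G. character G M g * character G M (inv g)) =
      (\<Sum>b\<in>B. \<Sum>c\<in>B. representation B (h b c b) c)"
    unfolding h_def by (rule character_product_sum[OF gm B B])
  also have "\<dots> = (\<Sum>b\<in>B. \<Sum>c\<in>B. if c = b then a b b else 0)"
    by (intro sum.cong refl) (auto simp: rep bM representation_basis B)
  also have "\<dots> = (\<Sum>b\<in>B. a b b)" using B by simp
  also have "\<dots> = of_nat (card (carrier G))" using abb cB by simp
  finally show ?thesis .
qed

end

section \<open>Complete reducibility and multiplicities\<close>

lemma (in vector_space) dim_psubset:
  assumes "fin_dim scale S" "subspace W" "W \<subset> S"
  shows "dim W < dim S"
proof -
  obtain B where B: "finite B" "independent B" "span B = W"
    using fin_dim_basis_extend[OF assms(1,2), of "{}"] assms(3) by (auto simp: independent_empty)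
  have BS: "B \<subseteq> S" using B(3) assms(3) span_superset by blast
  obtain C where C: "B \<subseteq> C" "finite C" "independent C" "span C = S"
    using fin_dim_basis_extend[OF assms(1) fin_dim_subspace[OF assms(1)] order_refl BS B(2)] by blast
  have "B \<noteq> C" using B(3) C(4) assms(3) by auto
  then have "card B < card C" using C by (auto intro: psubset_card_mono)
  then show ?thesis
    using dim_span_eq_card_independent[OF B(2)] dim_span_eq_card_independent[OF C(3)] B C by simp
qed

lemma submodule_carr_update:
  "submodule G M W \<Longrightarrow> submodule G (M\<lparr>carr := W\<rparr>) U \<longleftrightarrow> submodule G M U \<and> U \<subseteq> W"
  by (auto simp: submodule_def)

context gmodule
begin

lemma submodule_carr: "submodule G M (carr M)"
  unfolding submodule_def using subspace_carr act_closed by auto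

lemma submodule_zero: "submodule G M {0}"
proof -
  have "act M g 0 = 0" if "g \<in> carrier G" for g
    using act_smul[OF that subspace_0[OF subspace_carr], of 0] by simp
  then show ?thesis unfolding submodule_def using subspace_0[OF subspace_carr] subspace_single_0 by auto
qed

text \<open>A nonzero submodule of least dimension is simple.\<close>

lemma ex_simple_submodule:
  assumes "fin_dim (smul M) (carr M)" "carr M \<noteq> {0}"
  obtains W where "submodule G M W" "W \<noteq> {0}" "simple_module G (M\<lparr>carr := W\<rparr>)"
proof -
  obtain W where W: "submodule G M W" "W \<noteq> {0}"
    and min: "\<And>U. submodule G M U \<Longrightarrow> U \<noteq> {0} \<Longrightarrow> dim W \<le> dim U"
    using exists_least_lemma[of "\<lambda>m. \<exists>W. submodule G M W \<and> W \<noteq> {0} \<and> dim W = m"]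
      ex_has_least_nat[of "\<lambda>W. submodule G M W \<and> W \<noteq> {0}" "carr M" dim] submodule_carr assms(2) by auto
  have "U = {0} \<or> U = W" if U: "submodule G M U" "U \<subseteq> W" for U
  proof (rule ccontr)
    assume neq: "\<not> ?thesis"
    then have "dim U < dim W"
      using dim_psubset[OF submodule_fin_dim[OF W(1) assms(1)] submodule_subspace[OF U(1)]] U(2) by auto
    then show False using min[OF U(1)] neq by auto
  qed
  then have "simple_module G (M\<lparr>carr := W\<rparr>)"
    using W(2) submodule_carr_update[OF W(1)] by (auto simp: simple_module_def)
  then show ?thesis using that W by blast
qed

text \<open>
  Maschke's theorem: averaging a linear projection onto \<open>W\<close> over the group keeps it the identity
  on \<open>W\<close> and makes it equivariant.
\<close>

lemma equivariant_projection:
  assumes "submodule G M W" "fin_dim (smul M) (carr M)" "finite (carrier G)"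
  shows "\<exists>p. intertwiner G M (M\<lparr>carr := W\<rparr>) p \<and> (\<forall>w\<in>W. p w = w)"
proof -
  interpret W: gmodule G "M\<lparr>carr := W\<rparr>" by (rule submodule_gmodule[OF assms(1)])
  have WM: "W \<subseteq> carr M" "subspace W" using assms(1) by (auto simp: submodule_def)
  have WW: "act M g w \<in> W" if "g \<in> carrier G" "w \<in> W" for g w
    using that assms(1) by (auto simp: submodule_def)
  obtain B where B: "finite B" "independent B" "span B = W"
    using fin_dim_basis_extend[OF assms(2) WM(2,1), of "{}"] by (auto simp: independent_empty)
  have BM: "B \<subseteq> carr M" using B(3) WM(1) span_superset by blast
  obtain C where C: "B \<subseteq> C" "finite C" "independent C" "span C = carr M"
    using fin_dim_basis_extend[OF assms(2) subspace_carr order_refl BM B(2)] by blast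
  \<comment> \<open>a linear projection onto \<open>W\<close> that kills the basis vectors in \<open>C\<close> outside \<open>B\<close>\<close>
  define q where "q v = (\<Sum>b\<in>B. smul M (representation C v b) b)" for v
  have q: "lin_map (smul M) (carr M) (smul M) W q"
  proof (rule lin_mapI)
    fix v assume v: "v \<in> carr M"
    show "q v \<in> W" unfolding q_def B(3)[symmetric] by (intro span_sum span_scale span_base)
    show "q (smul M c v) = smul M c (q v)" for c
      using v C by (simp add: q_def representation_scale scale_sum_right)
    show "q (v + w) = q v + q w" if "w \<in> carr M" for w
      using v that C by (simp add: q_def representation_add scale_left_distrib sum.distrib)
  qed
  have qW: "q w = w" if "w \<in> W" for w
    using that B C representation_extend[OF C(3) _ C(1), of w]
    by (simp add: q_def sum_representation_eq)
  define p where "p v = smul M (1 / of_nat (card (carrier G))) (\<Sum>g\<in>carrier G. act M (inv g) (q (act M g v)))" for v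
  have card: "of_nat (card (carrier G)) \<noteq> (0 :: complex)" using assms(3) one_closed by fastforce
  have "lin_map (smul M) (carr M) (smul (M\<lparr>carr := W\<rparr>)) (carr (M\<lparr>carr := W\<rparr>)) q" using q by simp
  from average_intertwiner[OF W.gmodule_axioms this]
  have avg: "intertwiner G M (M\<lparr>carr := W\<rparr>) (\<lambda>v. \<Sum>g\<in>carrier G. act M (inv g) (q (act M g v)))"
    (is "intertwiner G M _ ?a") by simp
  have lin: "lin_map (smul M) (carr M) (smul M) W ?a"
    and eq: "\<And>g v. g \<in> carrier G \<Longrightarrow> v \<in> carr M \<Longrightarrow> ?a (act M g v) = act M g (?a v)"
    using avg by (auto simp: intertwiner_def)
  have aM: "?a v \<in> carr M" if "v \<in> carr M" for v using lin_mapD(1)[OF lin that] WM by blast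
  have pw: "p w = w" if w: "w \<in> W" for w
  proof -
    have "?a w = (\<Sum>g\<in>carrier G. w)"
      using w WM by (intro sum.cong refl) (auto simp: qW WW act_inv)
    then show ?thesis
      using card by (simp add: p_def sum_constant_scale)
  qed
  moreover have "intertwiner G M (M\<lparr>carr := W\<rparr>) p"
    unfolding intertwiner_def
  proof (intro conjI ballI)
    show "lin_map (smul M) (carr M) (smul (M\<lparr>carr := W\<rparr>)) (carr (M\<lparr>carr := W\<rparr>)) p"
      using lin_map_lincomb[of W "{()}" "smul M" "carr M" "\<lambda>_. ?a"
          "\<lambda>_. 1 / of_nat (card (carrier G))"] WM lin
      by (simp add: p_def[abs_def])
    show "p (act M g v) = act (M\<lparr>carr := W\<rparr>) g (p v)" if "g \<in> carrier G" "v \<in> carr M" for g v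
      using eq[OF that] act_smul[OF that(1) aM[OF that(2)]] by (simp add: p_def)
  qed
  ultimately show ?thesis by blast
qed

end

lemma simple_decompositionI:
  assumes "\<And>W. W \<in> set Ws \<Longrightarrow> submodule G M W \<and> simple_module G (M\<lparr>carr := W\<rparr>)"
    and "\<And>v. v \<in> carr M \<Longrightarrow>
      \<exists>!ws. length ws = length Ws \<and> (\<forall>i<length Ws. ws ! i \<in> Ws ! i) \<and> sum_list ws = v"
  shows "simple_decomposition G M Ws"
  using assms unfolding simple_decomposition_def by simp

lemma ex1_Cons: "\<exists>!us. Q us \<Longrightarrow> \<exists>!ws. \<exists>us. ws = a # us \<and> Q us"
  by blast

text \<open>
  Induction on the dimension: a simple submodule \<open>W\<close> splits off, and its complement \<open>U\<close> is the
  kernel of an equivariant projection \<open>p\<close>. The components of \<open>v\<close> are \<open>p v\<close> followed by the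
  components of \<open>v - p v\<close> in \<open>U\<close>.
\<close>

lemma gmodule_ex_simple_decomposition:
  assumes "gmodule G M" "fin_dim (smul M) (carr M)" "finite (carrier G)"
  shows "\<exists>Ws. simple_decomposition G M Ws"
  using assms(1,2)
proof (induction "vector_space.dim (smul M) (carr M)" arbitrary: M rule: less_induct)
  case less
  interpret gmodule G M by (fact less.prems(1))
  note fd = less.prems(2)
  show ?case
  proof (cases "carr M = {0}")
    case True
    then show ?thesis by (intro exI[of _ "[]"] simple_decompositionI) auto
  next
    case False
    obtain W where W: "submodule G M W" "W \<noteq> {0}" "simple_module G (M\<lparr>carr := W\<rparr>)"
      using ex_simple_submodule[OF fd False] .
    have WM: "W \<subseteq> carr M" "subspace W" using W(1) by (auto simp: submodule_def)
    obtain p where p: "intertwiner G M (M\<lparr>carr := W\<rparr>) p" and "\<forall>w\<in>W. p w = w"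
      using equivariant_projection[OF W(1) fd assms(3)] by auto
    then have pid: "\<And>w. w \<in> W \<Longrightarrow> p w = w" by auto
    have plin: "lin_map (smul M) (carr M) (smul M) W p"
      and peq: "\<And>g v. g \<in> carrier G \<Longrightarrow> v \<in> carr M \<Longrightarrow> p (act M g v) = act M g (p v)"
      using p by (auto simp: intertwiner_def)
    interpret VV: vector_space_pair "smul M" "smul M" by unfold_locales
    have p0: "p 0 = 0" using VV.lin_map_zero[OF plin subspace_carr] .
    have act0: "act M g 0 = 0" if "g \<in> carrier G" for g
      using submodule_zero that by (auto simp: submodule_def)
    define U where "U = {v \<in> carr M. p v = 0}"
    have U: "submodule G M U"
      unfolding submodule_def U_def using subspace_carr
      by (auto simp: subspace_def lin_mapD[OF plin] p0 act_closed peq act0)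
    have UM: "U \<subseteq> carr M" "subspace U" using U by (auto simp: submodule_def)
    obtain w where "w \<in> W" "w \<noteq> 0" using W(2) subspace_0[OF WM(2)] by blast
    then have "w \<in> carr M" "w \<notin> U" using pid WM by (auto simp: U_def)
    then have "dim U < dim (carr M)" using UM by (intro dim_psubset[OF fd UM(2)]) auto
    then obtain Us where Us: "simple_decomposition G (M\<lparr>carr := U\<rparr>) Us"
      using less.hyps[of "M\<lparr>carr := U\<rparr>"] submodule_gmodule[OF U] submodule_fin_dim[OF U fd] by auto
    have "simple_decomposition G M (W # Us)"
    proof (rule simple_decompositionI)
      fix X assume X: "X \<in> set (W # Us)"
      show "submodule G M X \<and> simple_module G (M\<lparr>carr := X\<rparr>)"
      proof (cases "X = W")
        case False
        then have "X \<in> set Us" using X by simp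
        then show ?thesis
          using Us submodule_carr_update[OF U] by (simp add: simple_decomposition_def)
      qed (use W in simp)
    next
      fix v assume v: "v \<in> carr M"
      let ?P = "\<lambda>Ws v ws. length ws = length Ws \<and> (\<forall>i<length Ws. ws ! i \<in> Ws ! i) \<and> sum_list ws = v"
      have Ud: "\<exists>!us. ?P Us u us" if "u \<in> U" for u
        using Us that by (simp add: simple_decomposition_def)
      have pvW: "p v \<in> W" using lin_mapD(1)[OF plin v] .
      have diff: "v - p v = v + smul M (-1) (p v)" by simp
      have m: "smul M (-1) (p v) \<in> carr M" using pvW WM(1) subspace_scale[OF subspace_carr] by blast
      have vU: "v - p v \<in> U"
        unfolding U_def mem_Collect_eq diff
        using lin_mapD(2)[OF plin v m] lin_mapD(3)[OF plin, of "p v" "-1"] pid[OF pvW] pvW WM(1)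
          subspace_add[OF subspace_carr v m] by auto
      have Us_sub: "X \<subseteq> U" if "X \<in> set Us" for X
      proof -
        have "submodule G (M\<lparr>carr := U\<rparr>) X" using Us that by (simp add: simple_decomposition_def)
        then show ?thesis by (simp add: submodule_def)
      qed
      have sumU: "sum_list us \<in> U" if "length us = length Us" "\<forall>i<length Us. us ! i \<in> Us ! i" for us
      proof -
        have "us ! i \<in> U" if "i < length Us" for i
          using \<open>\<forall>i<length Us. us ! i \<in> Us ! i\<close> Us_sub[OF nth_mem[OF that]] that by auto
        then show ?thesis
          unfolding sum_list_sum_nth using that(1) by (intro subspace_sum[OF UM(2)]) simp
      qed
      have split: "?P (W # Us) v ws \<longleftrightarrow> (\<exists>us. ws = p v # us \<and> ?P Us (v - p v) us)" for ws
      proof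
        assume ws: "?P (W # Us) v ws"
        then obtain w us where wu: "ws = w # us" by (cases ws) auto
        have us: "length us = length Us" "\<forall>i<length Us. us ! i \<in> Us ! i" and w: "w \<in> W" and s: "w + sum_list us = v"
          using ws unfolding wu by (auto simp: All_less_Suc2)
        have "sum_list us \<in> U" using sumU us by blast
        then have pv: "p v = w"
          using lin_mapD(2)[OF plin, of w "sum_list us"] w WM s pid by (auto simp: U_def)
        have "sum_list us = v - p v" unfolding pv using s by (rule add_implies_diff[OF trans[OF add.commute]])
        then show "\<exists>us. ws = p v # us \<and> ?P Us (v - p v) us" using wu us pv by simp
      next
        assume "\<exists>us. ws = p v # us \<and> ?P Us (v - p v) us"
        then show "?P (W # Us) v ws" using pvW by (auto simp: All_less_Suc2)
      qed
      show "\<exists>!ws. ?P (W # Us) v ws" unfolding split by (rule ex1_Cons[OF Ud[OF vU]])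
    qed
    then show ?thesis by (rule exI)
  qed
qed

text \<open>
  The components of \<open>v\<close> in a direct sum define linear projections adding up to the identity. The
  trace of \<open>g\<close> after such a projection equals, by swapping the two, the trace of \<open>g\<close> on the
  summand.
\<close>

lemma (in gmodule) character_decomposition:
  assumes "simple_decomposition G M Ws" "fin_dim (smul M) (carr M)"
  shows "character G M g = (\<Sum>i<length Ws. character G (M\<lparr>carr := Ws ! i\<rparr>) g)"
proof (cases "g \<in> carrier G")
  case False
  then show ?thesis by (simp add: character_trace)
next
  case g: True
  interpret VV: vector_space_pair "smul M" "smul M" by unfold_locales
  let ?k = "length Ws"
  have sub: "submodule G M (Ws ! i)" if "i < ?k" for i
    using assms(1) that by (simp add: simple_decomposition_def)
  have WM: "Ws ! i \<subseteq> carr M" "subspace (Ws ! i)" if "i < ?k" for i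
    using sub[OF that] by (auto simp: submodule_def)
  define c where "c v = (THE ws. length ws = ?k \<and> (\<forall>i<?k. ws ! i \<in> Ws ! i) \<and> sum_list ws = v)" for v
  have ex1: "\<exists>!ws. length ws = ?k \<and> (\<forall>i<?k. ws ! i \<in> Ws ! i) \<and> sum_list ws = v" if "v \<in> carr M" for v
    using assms(1) that by (simp add: simple_decomposition_def)
  define \<pi> where "\<pi> i v = c v ! i" for i v
  have c: "length (c v) = ?k" "i < ?k \<Longrightarrow> c v ! i \<in> Ws ! i" "sum_list (c v) = v" if "v \<in> carr M" for v i
    using theI'[OF ex1[OF that]] unfolding c_def by auto
  have \<pi>: "\<pi> i v \<in> Ws ! i" if "v \<in> carr M" "i < ?k" for v i
    using c that unfolding \<pi>_def by auto
  have sum\<pi>: "(\<Sum>i<?k. \<pi> i v) = v" if "v \<in> carr M" for v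
    using c(1,3)[OF that] by (simp add: \<pi>_def sum_list_sum_nth atLeast0LessThan)
  have uniq: "\<pi> i v = f i" if "v \<in> carr M" "\<And>i. i < ?k \<Longrightarrow> f i \<in> Ws ! i" "(\<Sum>i<?k. f i) = v" "i < ?k" for v f i
  proof -
    have "c v = map f [0..<?k]"
      unfolding c_def
      by (rule the1_equality[OF ex1[OF that(1)]])
         (use that in \<open>auto simp: sum_list_sum_nth atLeast0LessThan\<close>)
    then show ?thesis using that(4) by (simp add: \<pi>_def)
  qed
  have lin: "lin_map (smul M) (carr M) (smul M) (Ws ! i) (\<pi> i)" if "i < ?k" for i
  proof (rule lin_mapI)
    fix v assume v: "v \<in> carr M"
    show "\<pi> i v \<in> Ws ! i" using \<pi> v that .
    show "\<pi> i (v + w) = \<pi> i v + \<pi> i w" if w: "w \<in> carr M" for w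
      by (rule uniq) (use v w \<pi> sum\<pi> WM subspace_add subspace_carr \<open>i < ?k\<close> in \<open>auto simp: sum.distrib\<close>)
    show "\<pi> i (smul M a v) = smul M a (\<pi> i v)" for a
      by (rule uniq) (use v \<pi> sum\<pi> WM subspace_scale subspace_carr that in \<open>auto simp: scale_sum_right[symmetric]\<close>)
  qed
  have linM: "lin_map (smul M) (carr M) (smul M) (carr M) (\<pi> i)" if "i < ?k" for i
    using lin[OF that] WM[OF that] by (auto simp: lin_map_def)
  have gW: "lin_map (smul M) (Ws ! i) (smul M) (carr M) (act M g)" if "i < ?k" for i
    using act_lin_map[OF g] WM[OF that] by (auto simp: lin_map_def subset_iff)
  have "trace_on (smul M) (carr M) (act M g) = trace_on (smul M) (carr M) (\<lambda>v. \<Sum>i<?k. act M g (\<pi> i v))"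
  proof (rule trace_on_cong[OF assms(2)])
    show "lin_map (smul M) (carr M) (smul M) (carr M) (\<lambda>v. \<Sum>i<?k. act M g (\<pi> i v))"
      by (intro lin_map_sum_maps subspace_carr lin_map_compose[OF linM act_lin_map[OF g]]) auto
    show "act M g v = (\<Sum>i<?k. act M g (\<pi> i v))" if "v \<in> carr M" for v
      using VV.lin_map_sum[OF act_lin_map[OF g] subspace_carr, of "{..<?k}" "\<lambda>i. \<pi> i v"]
        sum\<pi>[OF that] \<pi>[OF that] WM by auto
  qed
  also have "\<dots> = (\<Sum>i<?k. trace_on (smul M) (carr M) (\<lambda>v. act M g (\<pi> i v)))"
    by (intro trace_on_sum[OF assms(2)] lin_map_compose[OF linM act_lin_map[OF g]]) auto
  also have "\<dots> = (\<Sum>i<?k. trace_on (smul M) (Ws ! i) (act M g))"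
  proof (intro sum.cong refl)
    fix i assume "i \<in> {..<?k}"
    then have i: "i < ?k" by simp
    have fW: "fin_dim (smul M) (Ws ! i)" using submodule_fin_dim[OF sub[OF i] assms(2)] .
    have "trace_on (smul M) (carr M) (\<lambda>v. act M g (\<pi> i v)) = trace_on (smul M) (Ws ! i) (\<lambda>w. \<pi> i (act M g w))"
      by (rule VV.trace_on_swap[OF assms(2) fW lin[OF i] gW[OF i]])
    also have "\<dots> = trace_on (smul M) (Ws ! i) (act M g)"
    proof (rule trace_on_cong[OF fW])
      have gi: "act M g w \<in> Ws ! i" if "w \<in> Ws ! i" for w
        using sub[OF i] g that by (auto simp: submodule_def)
      then show "lin_map (smul M) (Ws ! i) (smul M) (Ws ! i) (act M g)"
        using gW[OF i] by (auto simp: lin_map_def)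
      fix w assume "w \<in> Ws ! i"
      then have w: "act M g w \<in> Ws ! i" using gi by blast
      have "\<pi> i (act M g w) = (\<lambda>j. if j = i then act M g w else 0) i"
        by (rule uniq) (use w i WM subspace_0 in auto)
      then show "\<pi> i (act M g w) = act M g w" by simp
    qed
    finally show "trace_on (smul M) (carr M) (\<lambda>v. act M g (\<pi> i v)) = trace_on (smul M) (Ws ! i) (act M g)" .
  qed
  finally show ?thesis using g by (simp add: character_trace)
qed

lemma sum_list_filter_length: "(\<Sum>i<length Ws. if P (Ws ! i) then (1::'a::semiring_1) else 0) = of_nat (length (filter P Ws))"
  by (induction Ws rule: rev_induct) (auto simp: nth_append)

text \<open>
  By orthogonality the inner product of the two characters counts the summands isomorphic to
  \<open>S\<close>. As this holds for every decomposition, the count does not depend on the decomposition and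
  is the multiplicity.
\<close>

theorem (in gmodule) multiplicity_character:
  assumes "fin_dim (smul M) (carr M)" "finite (carrier G)"
    and S: "gmodule G S" "fin_dim (smul S) (carr S)" "abs_simple G S"
  shows "of_nat (multiplicity G S M) * of_nat (card (carrier G)) =
    (\<Sum>g\<in>carrier G. character G M g * character G S (inv g))"
proof -
  interpret S: gmodule G S by (fact S(1))
  let ?n = "of_nat (card (carrier G)) :: complex"
  let ?N = "\<lambda>Ws. length (filter (\<lambda>W. isomorphic_modules G S (M\<lparr>carr := W\<rparr>)) Ws)"
  have card: "?n \<noteq> 0" using assms(2) one_closed by fastforce
  have count: "of_nat (?N Ws) * ?n = (\<Sum>g\<in>carrier G. character G M g * character G S (inv g))"
    if Ws: "simple_decomposition G M Ws" for Ws
  proof -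
    have one: "(\<Sum>g\<in>carrier G. character G (M\<lparr>carr := Ws ! i\<rparr>) g * character G S (inv g)) =
      (if isomorphic_modules G S (M\<lparr>carr := Ws ! i\<rparr>) then 1 else 0) * ?n" if i: "i < length Ws" for i
    proof -
      let ?W = "M\<lparr>carr := Ws ! i\<rparr>"
      have sub: "submodule G M (Ws ! i)" and simple: "simple_module G ?W"
        using Ws i by (simp_all add: simple_decomposition_def)
      interpret W: gmodule G ?W by (rule submodule_gmodule[OF sub])
      have fW: "fin_dim (smul ?W) (carr ?W)" using submodule_fin_dim[OF sub assms(1)] by simp
      show ?thesis
      proof (cases "isomorphic_modules G S ?W")
        case True
        then obtain h where "intertwiner G S ?W h" "bij_betw h (carr S) (carr ?W)"
          unfolding isomorphic_modules_intertwiner by auto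
        then have "character G S = character G ?W"
          using S.character_intertwined[OF W.gmodule_axioms S(2) fW] by blast
        then show ?thesis using S.character_norm[OF S(3,2) assms(2)] True by simp
      next
        case False
        then have "\<not> isomorphic_modules G ?W S"
          using W.isomorphic_modules_sym[OF S(1)] by blast
        then show ?thesis
          using W.character_orthogonal[OF S(1) simple _ fW S(2)] S(3) False
          by (simp add: abs_simple_def)
      qed
    qed
    have "(\<Sum>g\<in>carrier G. character G M g * character G S (inv g)) =
      (\<Sum>i<length Ws. \<Sum>g\<in>carrier G. character G (M\<lparr>carr := Ws ! i\<rparr>) g * character G S (inv g))"
      by (subst sum.swap) (simp add: character_decomposition[OF Ws assms(1)] sum_distrib_right)
    also have "\<dots> = (\<Sum>i<length Ws. (if isomorphic_modules G S (M\<lparr>carr := Ws ! i\<rparr>) then 1 else 0) * ?n)"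
      using one by (intro sum.cong refl) auto
    also have "\<dots> = of_nat (?N Ws) * ?n"
      unfolding sum_distrib_right[symmetric] sum_list_filter_length[of "\<lambda>W. isomorphic_modules G S (M\<lparr>carr := W\<rparr>)"] ..
    finally show ?thesis by simp
  qed
  have gm: "gmodule G M" by unfold_locales
  obtain Ws where Ws: "simple_decomposition G M Ws"
    using gmodule_ex_simple_decomposition[OF gm assms(1,2)] by blast
  have "multiplicity G S M = ?N Ws"
    unfolding multiplicity_def
  proof (rule the_equality)
    show "\<exists>Ws'. simple_decomposition G M Ws' \<and> ?N Ws = ?N Ws'" using Ws by blast
    fix m assume "\<exists>Ws'. simple_decomposition G M Ws' \<and> m = ?N Ws'"
    then obtain Ws' where Ws': "simple_decomposition G M Ws'" "m = ?N Ws'" by blast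
    have "(of_nat m :: complex) = of_nat (?N Ws)"
      unfolding Ws'(2)
      by (rule mult_right_cancel[OF card, THEN iffD1]) (rule trans[OF count[OF Ws'(1)] count[OF Ws, symmetric]])
    then show "m = ?N Ws" by simp
  qed
  then show ?thesis using count[OF Ws] by simp
qed

section \<open>Tensor powers\<close>

interpretation fs: vector_space fscale
  by unfold_locales (auto simp: fscale_def fun_eq_iff algebra_simps)

lemma sum_fun_apply: "(\<Sum>i\<in>I. f i) x = (\<Sum>i\<in>I. f i x)"
  by (induction I rule: infinite_finite_induct) auto

text \<open>
  In a vanishing linear combination take, among the indices with nonzero coefficient, an \<open>i\<close>
  with \<open>f i\<close> maximal: applying \<open>\<psi> i\<close> leaves only the diagonal term.
\<close>

lemma (in vector_space) independent_triangular:
  fixes E :: "'i \<Rightarrow> 'b" and f :: "'i \<Rightarrow> nat"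
  assumes "finite I"
    and lin: "\<And>i. i \<in> I \<Longrightarrow> lin_map scale UNIV (*) UNIV (\<psi> i)"
    and diag: "\<And>i. i \<in> I \<Longrightarrow> \<psi> i (E i) \<noteq> 0"
    and tri: "\<And>i j. i \<in> I \<Longrightarrow> j \<in> I \<Longrightarrow> \<psi> i (E j) \<noteq> 0 \<Longrightarrow> i = j \<or> f i < f j"
  shows "inj_on E I" "independent (E ` I)"
proof -
  interpret P: vector_space_pair scale "(*)"
    by unfold_locales (auto simp: algebra_simps)
  show inj: "inj_on E I"
  proof (rule inj_onI, rule ccontr)
    fix i j assume "i \<in> I" "j \<in> I" "E i = E j" "i \<noteq> j"
    then have "f i < f j" "f j < f i" using tri[of i j] tri[of j i] diag by metis+
    then show False by simp
  qed
  show "independent (E ` I)"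
  proof (rule independent_if_scalars_zero)
    show "finite (E ` I)" using assms(1) by simp
    fix a x assume zero: "(\<Sum>x\<in>E ` I. scale (a x) x) = 0" and x: "x \<in> E ` I"
    define N where "N = {i \<in> I. a (E i) \<noteq> 0}"
    have "N = {}"
    proof (rule ccontr)
      assume "N \<noteq> {}"
      moreover have "finite N" using assms(1) by (simp add: N_def)
      ultimately have "Max (f ` N) \<in> f ` N" and fN: "finite (f ` N)" by auto
      then obtain i where "i \<in> N" "f i = Max (f ` N)" by auto
      then have i: "i \<in> N" "\<And>j. j \<in> N \<Longrightarrow> f j \<le> f i" using Max_ge[OF fN] by auto
      have iI: "i \<in> I" "a (E i) \<noteq> 0" using i by (auto simp: N_def)
      have "0 = \<psi> i (\<Sum>j\<in>I. scale (a (E j)) (E j))"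
        using zero P.lin_map_zero[OF lin[OF iI(1)]] by (simp add: sum.reindex[OF inj])
      also have "\<dots> = (\<Sum>j\<in>I. a (E j) * \<psi> i (E j))"
        by (simp add: P.lin_map_sum[OF lin[OF iI(1)]] lin_mapD(3)[OF lin[OF iI(1)]])
      also have "\<dots> = (\<Sum>j\<in>I. if j = i then a (E i) * \<psi> i (E i) else 0)"
        using tri[OF iI(1)] i(2) by (intro sum.cong refl) (force simp: N_def)
      also have "\<dots> = a (E i) * \<psi> i (E i)" using assms(1) iI by simp
      finally show False using iI diag by simp
    qed
    then show "a x = 0" using x by (auto simp: N_def)
  qed
qed

lemma lists_length_Suc: "{bs. set bs \<subseteq> B \<and> length bs = Suc d} = (\<lambda>(b, bs). b # bs) ` (B \<times> {bs. set bs \<subseteq> B \<and> length bs = d})"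
proof -
  have "xs \<in> (\<lambda>(b, bs). b # bs) ` (B \<times> {bs. set bs \<subseteq> B \<and> length bs = d})"
    if "set xs \<subseteq> B" "length xs = Suc d" for xs
    using that by (cases xs) auto
  then show ?thesis by auto
qed

lemma prod_sum_lists:
  fixes f :: "nat \<Rightarrow> 'b \<Rightarrow> 'a::comm_semiring_1"
  assumes "finite B"
  shows "(\<Prod>i<d. \<Sum>b\<in>B. f i b) = (\<Sum>bs | set bs \<subseteq> B \<and> length bs = d. \<Prod>i<d. f i (bs ! i))"
proof (induction d arbitrary: f)
  case 0
  have "{bs. set bs \<subseteq> B \<and> bs = []} = {[]}" by auto
  then show ?case by simp
next
  case (Suc d)
  let ?L = "{bs. set bs \<subseteq> B \<and> length bs = d}"
  have "inj_on (\<lambda>(b, bs). b # bs) (B \<times> ?L)" by (auto intro: inj_onI)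
  then have "(\<Sum>bs | set bs \<subseteq> B \<and> length bs = Suc d. \<Prod>i<Suc d. f i (bs ! i)) =
      (\<Sum>(b, bs)\<in>B \<times> ?L. f 0 b * (\<Prod>i<d. f (Suc i) (bs ! i)))"
    unfolding lists_length_Suc
    by (subst sum.reindex) (auto simp: prod.lessThan_Suc_shift simp del: prod.lessThan_Suc intro!: sum.cong)
  also have "\<dots> = (\<Sum>b\<in>B. f 0 b) * (\<Sum>bs\<in>?L. \<Prod>i<d. f (Suc i) (bs ! i))"
    by (simp add: sum_product sum.cartesian_product)
  also have "\<dots> = (\<Prod>i<Suc d. \<Sum>b\<in>B. f i b)"
    using Suc[of "\<lambda>i. f (Suc i)"] by (simp add: prod.lessThan_Suc_shift del: prod.lessThan_Suc)
  finally show ?case by simp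
qed

lemma linear_form_lin_map: "linear_form M \<phi> \<longleftrightarrow> lin_map (smul M) (carr M) (*) UNIV \<phi>"
  by (auto simp: linear_form_def lin_map_def)

lemma tensor_power_simps [simp]:
  "smul (tensor_power M d) = fscale"
  "act (tensor_power M d) = (\<lambda>g F \<phi>s. F (map (\<lambda>\<phi>. \<phi> \<circ> act M g) \<phi>s))"
  "carr (tensor_power M d) = fs.span {pure_tensor M vs | vs. length vs = d \<and> set vs \<subseteq> carr M}"
  by (simp_all add: tensor_power_def)

context gmodule
begin

lemma linear_form_act:
  assumes "g \<in> carrier G"
  shows "linear_form M (\<phi> \<circ> act M g) \<longleftrightarrow> linear_form M \<phi>"
proof
  have shift: "linear_form M (\<phi> \<circ> act M g)" if "linear_form M \<phi>" "g \<in> carrier G" for \<phi> g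
    using that by (auto simp: linear_form_def act_add act_smul act_closed)
  show "linear_form M \<phi> \<Longrightarrow> linear_form M (\<phi> \<circ> act M g)" using shift assms by blast
  assume "linear_form M (\<phi> \<circ> act M g)"
  then have l: "linear_form M (\<phi> \<circ> act M g \<circ> act M (inv g))" using shift assms by blast
  have e: "(\<phi> \<circ> act M g \<circ> act M (inv g)) v = \<phi> v" if "v \<in> carr M" for v
    using that assms act_inv by simp
  have mem: "v + w \<in> carr M" "smul M c v \<in> carr M" if "v \<in> carr M" "w \<in> carr M" for v w c
    using that subspace_add[OF subspace_carr] subspace_scale[OF subspace_carr] by auto
  show "linear_form M \<phi>"
    using l unfolding linear_form_def by (metis e mem)
qed

lemma act_pure_tensor:
  assumes "g \<in> carrier G" "set vs \<subseteq> carr M"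
  shows "act (tensor_power M d) g (pure_tensor M vs) = pure_tensor M (map (act M g) vs)"
  using assms by (auto simp: pure_tensor_def fun_eq_iff linear_form_act)

lemma linear_tensor_act: "Vector_Spaces.linear fscale fscale (act (tensor_power M d) g)"
  by unfold_locales (auto simp: fscale_def)

lemma tensor_act_closed:
  assumes "g \<in> carrier G" "F \<in> carr (tensor_power M d)"
  shows "act (tensor_power M d) g F \<in> carr (tensor_power M d)"
  using assms(2) unfolding tensor_power_simps(3)
proof (induction rule: fs.span_induct_alt)
  case base
  show ?case using fs.span_zero by (simp add: zero_fun_def)
next
  case (step c x y)
  then obtain vs where vs: "length vs = d" "set vs \<subseteq> carr M" "x = pure_tensor M vs" by blast
  have "act (tensor_power M d) g x = pure_tensor M (map (act M g) vs)"
    using act_pure_tensor[OF assms(1) vs(2)] vs(3) by simp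
  then have "act (tensor_power M d) g x \<in> fs.span {pure_tensor M vs | vs. length vs = d \<and> set vs \<subseteq> carr M}"
    using vs(1) act_closed[OF assms(1) subsetD[OF vs(2)]]
    by (auto simp del: tensor_power_simps intro!: fs.span_base exI[of _ "map (act M g) vs"])
  then have "fscale c (act (tensor_power M d) g x) + act (tensor_power M d) g y
      \<in> fs.span {pure_tensor M vs | vs. length vs = d \<and> set vs \<subseteq> carr M}"
    using step by (intro fs.span_add fs.span_scale) auto
  moreover have "act (tensor_power M d) g (fscale c x + y) =
      fscale c (act (tensor_power M d) g x) + act (tensor_power M d) g y"
    by (auto simp: fscale_def)
  ultimately show ?case by (simp only:)
qed

lemma tensor_power_gmodule: "gmodule G (tensor_power M d)"
proof -
  let ?T = "tensor_power M d"
  have vs: "vector_space (smul ?T)" unfolding tensor_power_simps by unfold_locales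
  interpret ff: vector_space_pair fscale fscale by unfold_locales
  have one: "act ?T \<one> F = F" if "F \<in> carr ?T" for F
  proof (rule ff.linear_eq_on_span[OF linear_tensor_act fs.linear_ident, of "{pure_tensor M vs |vs. length vs = d \<and> set vs \<subseteq> carr M}"])
    show "F \<in> fs.span {pure_tensor M vs |vs. length vs = d \<and> set vs \<subseteq> carr M}" using that by simp
    fix x assume "x \<in> {pure_tensor M vs |vs. length vs = d \<and> set vs \<subseteq> carr M}"
    then obtain vs where vs: "set vs \<subseteq> carr M" "x = pure_tensor M vs" by blast
    have "map (act M \<one>) vs = vs" using vs(1) act_one by (intro map_idI) auto
    then show "act ?T \<one> x = x" using act_pure_tensor[OF one_closed vs(1), of d] vs(2) by simp
  qed
  have mult: "act ?T (g \<otimes> h) F = act ?T g (act ?T h F)"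
    if "g \<in> carrier G" "h \<in> carrier G" "F \<in> carr ?T" for g h F
  proof -
    have "act ?T (g \<otimes> h) F = (act ?T g \<circ> act ?T h) F"
    proof (rule ff.linear_eq_on_span[OF linear_tensor_act, of "act ?T g \<circ> act ?T h" "{pure_tensor M vs |vs. length vs = d \<and> set vs \<subseteq> carr M}"])
      show "Vector_Spaces.linear fscale fscale (act ?T g \<circ> act ?T h)"
        by (rule Vector_Spaces.linear_compose[OF linear_tensor_act linear_tensor_act])
      show "F \<in> fs.span {pure_tensor M vs |vs. length vs = d \<and> set vs \<subseteq> carr M}" using that by simp
      fix x assume "x \<in> {pure_tensor M vs |vs. length vs = d \<and> set vs \<subseteq> carr M}"
      then obtain vs where vs: "set vs \<subseteq> carr M" "x = pure_tensor M vs" by blast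
      have "set (map (act M h) vs) \<subseteq> carr M" using vs(1) act_closed that by auto
      moreover have "map (act M (g \<otimes> h)) vs = map (act M g) (map (act M h) vs)"
        using vs(1) act_mult that by auto
      ultimately show "act ?T (g \<otimes> h) x = (act ?T g \<circ> act ?T h) x"
        using act_pure_tensor[of _ _ d] vs that by (simp only: m_closed o_def)
    qed
    then show ?thesis by simp
  qed
  show ?thesis
    unfolding gmodule_def gmodule_axioms_def
  proof (intro conjI allI impI)
    show "module.subspace (smul ?T) (carr ?T)" by simp
    show "act ?T g v \<in> carr ?T" if "g \<in> carrier G" "v \<in> carr ?T" for g v
      by (rule tensor_act_closed[OF that])
    show "act ?T g (v + w) = act ?T g v + act ?T g w" for g v w by auto
    show "act ?T g (smul ?T c v) = smul ?T c (act ?T g v)" for g c v by (auto simp: fscale_def)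
  qed (rule is_group vs one mult; assumption)+
qed

text \<open>
  Evaluation at a tuple of coordinate forms separates the pure tensors of basis vectors, which
  are therefore independent; they span because expanding the arguments of a pure tensor in the
  basis expands the tensor. Evaluations at such tuples thus compute coordinates.
\<close>

lemma tensor_power_basis:
  fixes d :: nat
  assumes B: "finite B" "independent B" "span B = carr M"
  defines "L \<equiv> {bs. set bs \<subseteq> B \<and> length bs = d}"
  defines "ev \<equiv> (\<lambda>bs. map (\<lambda>b v. representation B v b) bs)"
  shows "finite L" "inj_on (pure_tensor M) L" "fs.independent (pure_tensor M ` L)"
    "fs.span (pure_tensor M ` L) = carr (tensor_power M d)"
    "\<And>vs cs. set vs \<subseteq> carr M \<Longrightarrow> length vs = d \<Longrightarrow> cs \<in> L \<Longrightarrow>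
       pure_tensor M vs (ev cs) = (\<Prod>i<d. representation B (vs ! i) (cs ! i))"
    "\<And>bs cs. bs \<in> L \<Longrightarrow> cs \<in> L \<Longrightarrow> pure_tensor M bs (ev cs) = (if bs = cs then 1 else 0)"
proof -
  show fin: "finite L" unfolding L_def using finite_lists_length_eq[OF B(1)] by simp
  have BM: "B \<subseteq> carr M" using B(3) span_superset by blast
  have form: "linear_form M (\<lambda>v. representation B v b)" for b
    using B by (simp add: linear_form_def representation_add representation_scale)
  show ev: "pure_tensor M vs (ev cs) = (\<Prod>i<d. representation B (vs ! i) (cs ! i))"
    if "set vs \<subseteq> carr M" "length vs = d" "cs \<in> L" for vs cs
    using that form by (auto simp: pure_tensor_def ev_def L_def)
  show delta: "pure_tensor M bs (ev cs) = (if bs = cs then 1 else 0)" if "bs \<in> L" "cs \<in> L" for bs cs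
  proof -
    have "pure_tensor M bs (ev cs) = (\<Prod>i<d. if cs ! i = bs ! i then 1 else 0)"
      using ev[of bs cs] that BM B(2) nth_mem[of _ bs]
      by (auto simp: L_def representation_basis subset_iff intro!: prod.cong)
    also have "\<dots> = (if bs = cs then 1 else 0)"
    proof (cases "bs = cs")
      case False
      have len: "length bs = d" "length cs = d" using that by (auto simp: L_def)
      then obtain i where "i < d" "cs ! i \<noteq> bs ! i"
        using False nth_equalityI[of bs cs] by metis
      then show ?thesis using False by (auto intro!: prod_zero)
    qed simp
    finally show ?thesis .
  qed
  have lin: "lin_map fscale UNIV (*) UNIV (\<lambda>F. F (ev cs))" for cs
    by (auto simp: lin_map_def fscale_def)
  \<comment> \<open>the evaluations form an identity matrix, so a constant order function will do\<close>
  note tri = fs.independent_triangular[OF fin, where \<psi> = "\<lambda>cs F. F (ev cs)" and f = "\<lambda>_. 0"]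
  show "inj_on (pure_tensor M) L"
    by (rule tri(1), rule lin) (auto simp: delta split: if_splits)
  show "fs.independent (pure_tensor M ` L)"
    by (rule tri(2), rule lin) (auto simp: delta split: if_splits)
  have span: "pure_tensor M vs \<in> fs.span (pure_tensor M ` L)" if vs: "length vs = d" "set vs \<subseteq> carr M" for vs
  proof -
    have "pure_tensor M vs = (\<Sum>bs\<in>L. fscale (\<Prod>i<d. representation B (vs ! i) (bs ! i)) (pure_tensor M bs))"
    proof
      fix \<phi>s
      show "pure_tensor M vs \<phi>s = (\<Sum>bs\<in>L. fscale (\<Prod>i<d. representation B (vs ! i) (bs ! i)) (pure_tensor M bs)) \<phi>s"
      proof (cases "length \<phi>s = d \<and> (\<forall>\<phi>\<in>set \<phi>s. linear_form M \<phi>)")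
        case True
        interpret P: vector_space_pair "smul M" "(*)"
          by unfold_locales (auto simp: algebra_simps)
        have "(\<phi>s ! i) (vs ! i) = (\<Sum>b\<in>B. representation B (vs ! i) b * (\<phi>s ! i) b)" if "i < d" for i
          using P.lin_map_expand[of B UNIV "\<phi>s ! i" "vs ! i"] B True that vs
          by (auto simp: linear_form_lin_map subset_iff)
        then have "pure_tensor M vs \<phi>s = (\<Prod>i<d. \<Sum>b\<in>B. representation B (vs ! i) b * (\<phi>s ! i) b)"
          using True vs by (simp add: pure_tensor_def)
        also have "\<dots> = (\<Sum>bs\<in>L. \<Prod>i<d. representation B (vs ! i) (bs ! i) * (\<phi>s ! i) (bs ! i))"
          unfolding L_def by (rule prod_sum_lists[OF B(1)])
        finally show ?thesis
          using True by (auto simp: sum_fun_apply fscale_def prod.distrib pure_tensor_def L_def intro!: sum.cong)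
      next
        case False
        then have "pure_tensor M us \<phi>s = 0" if "length us = d" for us
          using that by (auto simp: pure_tensor_def)
        then show ?thesis using vs by (simp add: sum_fun_apply fscale_def L_def)
      qed
    qed
    also have "\<dots> \<in> fs.span (pure_tensor M ` L)"
      by (intro fs.span_sum fs.span_scale fs.span_base imageI)
    finally show ?thesis .
  qed
  show "fs.span (pure_tensor M ` L) = carr (tensor_power M d)"
    unfolding tensor_power_simps fs.span_eq
  proof (intro conjI subsetI)
    fix F assume "F \<in> pure_tensor M ` L"
    then show "F \<in> fs.span {pure_tensor M vs |vs. length vs = d \<and> set vs \<subseteq> carr M}"
      using BM by (intro fs.span_base) (auto simp: L_def)
  next
    fix F assume "F \<in> {pure_tensor M vs |vs. length vs = d \<and> set vs \<subseteq> carr M}"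
    then show "F \<in> fs.span (pure_tensor M ` L)" using span by auto
  qed
qed

lemma tensor_power_fin_dim:
  assumes "fin_dim (smul M) (carr M)"
  shows "fin_dim (smul (tensor_power M d)) (carr (tensor_power M d))"
proof -
  obtain B where B: "finite B" "independent B" "span B = carr M" using fin_dim_basis assms .
  show ?thesis
    using tensor_power_basis(1,4)[OF B, where d = d] unfolding fin_dim_def tensor_power_simps(1) by blast
qed

text \<open>
  In the basis of pure tensors of basis vectors, a diagonal entry of \<open>g\<close> is a product of
  diagonal entries of \<open>g\<close> on \<open>M\<close>; the sum over all tuples of basis vectors factors.
\<close>

lemma tensor_power_character:
  assumes "fin_dim (smul M) (carr M)" "g \<in> carrier G"
  shows "character G (tensor_power M d) g = character G M g ^ d"
proof -
  interpret T: gmodule G "tensor_power M d" by (rule tensor_power_gmodule)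
  interpret P: vector_space_pair fscale "(*) :: complex \<Rightarrow> _"
    by unfold_locales (auto simp: algebra_simps)
  obtain B where B: "finite B" "independent B" "span B = carr M" using fin_dim_basis assms(1) .
  have BM: "B \<subseteq> carr M" using B(3) span_superset by blast
  let ?L = "{bs. set bs \<subseteq> B \<and> length bs = d}"
  let ?P = "pure_tensor M ` ?L"
  let ?ev = "\<lambda>bs. map (\<lambda>b v. representation B v b) bs"
  note TB = tensor_power_basis[OF B, where d = d]
  have rep: "fs.representation ?P F (pure_tensor M cs) = F (?ev cs)"
    if "F \<in> fs.span ?P" "cs \<in> ?L" for F cs
  proof -
    have "lin_map fscale (fs.span ?P) (*) UNIV (\<lambda>F. F (?ev cs))"
      by (auto simp: lin_map_def fscale_def)
    then have "F (?ev cs) = (\<Sum>Q\<in>?P. fs.representation ?P F Q * Q (?ev cs))"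
      using P.lin_map_expand[of ?P UNIV "\<lambda>F. F (?ev cs)" F] TB(1,3) that(1) by simp
    also have "\<dots> = (\<Sum>bs\<in>?L. fs.representation ?P F (pure_tensor M bs) * (if bs = cs then 1 else 0))"
      unfolding sum.reindex[OF TB(2)] o_def by (intro sum.cong refl) (simp only: TB(6)[OF _ that(2)])
    also have "\<dots> = fs.representation ?P F (pure_tensor M cs)"
      using that(2) TB(1) by (simp add: if_distrib cong: if_cong)
    finally show ?thesis by simp
  qed
  have "character G (tensor_power M d) g = trace_on fscale (fs.span ?P) (act (tensor_power M d) g)"
    using assms(2) by (simp only: character_trace TB(4) tensor_power_simps(1) if_True)
  also have "\<dots> = (\<Sum>Q\<in>?P. fs.representation ?P (act (tensor_power M d) g Q) Q)"
    by (rule fs.trace_on_basis) (use TB(1,3,4) T.act_lin_map[OF assms(2)] in \<open>simp_all only: finite_imageI tensor_power_simps(1) not_False_eq_True\<close>)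
  also have "\<dots> = (\<Sum>bs\<in>?L. act (tensor_power M d) g (pure_tensor M bs) (?ev bs))"
    unfolding sum.reindex[OF TB(2)] o_def
  proof (intro sum.cong refl rep)
    fix bs assume bs: "bs \<in> ?L"
    then have "pure_tensor M bs \<in> fs.span ?P" by (intro fs.span_base) auto
    then show "act (tensor_power M d) g (pure_tensor M bs) \<in> fs.span ?P"
      unfolding TB(4) by (rule T.act_closed[OF assms(2)])
  qed
  also have "\<dots> = (\<Sum>bs\<in>?L. \<Prod>i<d. representation B (act M g (bs ! i)) (bs ! i))"
  proof (intro sum.cong refl)
    fix bs assume bs: "bs \<in> ?L"
    then have sub: "set bs \<subseteq> carr M" "set (map (act M g) bs) \<subseteq> carr M" "length (map (act M g) bs) = d"
      using BM act_closed[OF assms(2)] by auto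
    show "act (tensor_power M d) g (pure_tensor M bs) (?ev bs) = (\<Prod>i<d. representation B (act M g (bs ! i)) (bs ! i))"
      unfolding act_pure_tensor[OF assms(2) sub(1)] TB(5)[OF sub(2,3) bs]
      using bs by (intro prod.cong) auto
  qed
  also have "\<dots> = (\<Prod>i<d. \<Sum>b\<in>B. representation B (act M g b) b)"
    by (rule prod_sum_lists[OF B(1), symmetric])
  also have "\<dots> = character G M g ^ d"
    using trace_on_basis[OF B(1,2)] B(3) act_lin_map[OF assms(2)] assms(2) by (simp add: character_trace)
  finally show ?thesis .
qed

end

section \<open>Tableaux as bijective fillings\<close>

definition relabel :: "(nat \<Rightarrow> nat) \<Rightarrow> tableau \<Rightarrow> tableau" where
  "relabel \<sigma> t = map (map \<sigma>) t"

text \<open>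
  Rows and columns of entries are meaningful for fillings without repetition; the bottom row and
  the left column have index \<open>0\<close>.
\<close>

definition row_of :: "tableau \<Rightarrow> nat \<Rightarrow> nat" where
  "row_of t a = (THE i. i < length t \<and> a \<in> set (t ! i))"

definition col_of :: "tableau \<Rightarrow> nat \<Rightarrow> nat" where
  "col_of t a = (THE j. \<exists>i<length t. j < length (t ! i) \<and> t ! i ! j = a)"

lemma distinct_concat_cell:
  "distinct (concat t) \<Longrightarrow> i < length t \<Longrightarrow> i' < length t \<Longrightarrow> j < length (t ! i) \<Longrightarrow> j' < length (t ! i')
   \<Longrightarrow> t ! i ! j = t ! i' ! j' \<Longrightarrow> i = i' \<and> j = j'"
proof (induction t arbitrary: i i')
  case (Cons r t)
  have *: "t ! k ! l \<in> set (concat t)" if "k < length t" "l < length (t ! k)" for k l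
    using that by (auto simp: set_concat intro!: bexI[of _ "t ! k"])
  have disj: "x \<noteq> y" if "x \<in> set r" "y \<in> set (concat t)" for x y using Cons.prems(1) that by auto
  note p = Cons.prems
  consider "i = 0" "i' = 0" | k where "i = 0" "i' = Suc k" | k where "i = Suc k" "i' = 0"
    | k k' where "i = Suc k" "i' = Suc k'" by (metis not0_implies_Suc)
  then show ?case
  proof cases
    case 1
    then show ?thesis using p by (simp add: nth_eq_iff_index_eq)
  next
    case 2
    then have "r ! j \<noteq> t ! k ! j'" using p(2-5) by (intro disj *) simp_all
    then show ?thesis using 2 p(6) by simp
  next
    case 3
    then have "r ! j' \<noteq> t ! k ! j" using p(2-5) by (intro disj *) simp_all
    then show ?thesis using 3 p(6) by simp
  next
    case 4
    then show ?thesis using p Cons.IH[of k k'] by simp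
  qed
qed simp

context
  fixes n \<mu> t
  assumes num: "numbering n \<mu> t"
begin

lemma numbering_cell:
  assumes "i < length t" "j < length (t ! i)"
  shows "row_of t (t ! i ! j) = i" "col_of t (t ! i ! j) = j" "t ! i ! j \<in> {1..n}"
proof -
  have d: "distinct (concat t)" "set (concat t) = {1..n}" using num by (auto simp: numbering_def)
  show "row_of t (t ! i ! j) = i"
    unfolding row_of_def
    by (rule the_equality) (use assms distinct_concat_cell[OF d(1)] in \<open>auto simp: in_set_conv_nth\<close>)
  show "col_of t (t ! i ! j) = j"
    unfolding col_of_def
    by (rule the_equality) (use assms distinct_concat_cell[OF d(1)] in \<open>auto\<close>)
  show "t ! i ! j \<in> {1..n}"
    unfolding d(2)[symmetric] set_concat using assms nth_mem[of i t] nth_mem[of j "t ! i"] by blast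
qed

lemma numbering_entry:
  assumes "a \<in> {1..n}"
  shows "row_of t a < length t" "col_of t a < length (t ! row_of t a)" "t ! row_of t a ! col_of t a = a"
proof -
  have "a \<in> set (concat t)" using assms num by (auto simp: numbering_def)
  then obtain i j where "i < length t" "j < length (t ! i)" "a = t ! i ! j"
    by (auto simp: set_concat in_set_conv_nth)
  then show "row_of t a < length t" "col_of t a < length (t ! row_of t a)" "t ! row_of t a ! col_of t a = a"
    using numbering_cell by auto
qed

lemma numbering_row:
  assumes "i < length t"
  shows "set (t ! i) = {a \<in> {1..n}. row_of t a = i}"
proof (intro Set.set_eqI iffI)
  fix a assume "a \<in> set (t ! i)"
  then obtain j where "j < length (t ! i)" "a = t ! i ! j" by (auto simp: in_set_conv_nth)
  then show "a \<in> {a \<in> {1..n}. row_of t a = i}" using numbering_cell[OF assms] by simp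
next
  fix a assume "a \<in> {a \<in> {1..n}. row_of t a = i}"
  then show "a \<in> set (t ! i)" using numbering_entry[of a] by (auto simp: in_set_conv_nth)
qed

lemma numbering_column: "column t j = {a \<in> {1..n}. col_of t a = j}"
proof (intro Set.set_eqI iffI)
  fix a assume "a \<in> column t j"
  then obtain i where "i < length t" "j < length (t ! i)" "a = t ! i ! j"
    by (auto simp: column_def in_set_conv_nth)
  then show "a \<in> {a \<in> {1..n}. col_of t a = j}" using numbering_cell[of i j] by simp
next
  fix a assume "a \<in> {a \<in> {1..n}. col_of t a = j}"
  then have "row_of t a < length t" "j < length (t ! row_of t a)" "a = t ! row_of t a ! j"
    using numbering_entry[of a] by auto
  then show "a \<in> column t j" unfolding column_def by (auto intro!: exI[of _ "t ! row_of t a"])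
qed

lemma numbering_inj: "a \<in> {1..n} \<Longrightarrow> b \<in> {1..n} \<Longrightarrow> row_of t a = row_of t b \<Longrightarrow> col_of t a = col_of t b \<Longrightarrow> a = b"
  using numbering_entry by metis

lemma numbering_length: "length t = length \<mu>" "i < length t \<Longrightarrow> length (t ! i) = \<mu> ! i"
  using num by (auto simp: numbering_def shape_def)

lemma numbering_row_card:
  "card {a \<in> {1..n}. row_of t a = i} = (if i < length \<mu> then \<mu> ! i else 0)"
proof (cases "i < length t")
  case True
  have "distinct (t ! i)" using num True by (auto simp: numbering_def distinct_concat_iff)
  then show ?thesis
    using numbering_row[OF True] numbering_length True distinct_card by metis
next
  case False
  then have "{a \<in> {1..n}. row_of t a = i} = {}" using numbering_entry by auto
  then show ?thesis using False numbering_length by simp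
qed

text \<open>
  Row lengths of a partition decrease upwards, so the column of a box contains all boxes below
  it.
\<close>

lemma numbering_down_closed:
  assumes "is_partition n \<mu>" "a \<in> {1..n}" "i < row_of t a"
  shows "\<exists>b\<in>{1..n}. col_of t b = col_of t a \<and> row_of t b = i"
proof -
  note e = numbering_entry[OF assms(2)]
  have "\<mu> ! row_of t a \<le> \<mu> ! i"
    using assms(1,3) e numbering_length by (auto simp: is_partition_def sorted_wrt_iff_nth_less)
  then have "col_of t a < length (t ! i)" using e assms(3) numbering_length by auto
  moreover have "i < length t" using e assms(3) by simp
  ultimately show ?thesis using numbering_cell[of i "col_of t a"] by (intro bexI[of _ "t ! i ! col_of t a"]) auto
qed

lemma numbering_relabel:
  assumes "\<sigma> permutes {1..n}"
  shows "numbering n \<mu> (relabel \<sigma> t)"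
proof -
  have "concat (relabel \<sigma> t) = map \<sigma> (concat t)" by (simp add: relabel_def map_concat)
  moreover have "shape (relabel \<sigma> t) = shape t" by (simp add: relabel_def shape_def)
  moreover have "inj_on \<sigma> (set (concat t))" using permutes_inj[OF assms] by (rule inj_on_subset) simp
  ultimately show ?thesis
    using num permutes_image[OF assms] unfolding numbering_def by (simp add: distinct_map del: set_concat)
qed

lemma tabloid_nth: "i < length t \<Longrightarrow> tabloid t ! i = {a \<in> {1..n}. row_of t a = i}"
  by (simp add: tabloid_def numbering_row)

lemma relabel_row: "\<sigma> permutes {1..n} \<Longrightarrow> a \<in> {1..n} \<Longrightarrow> row_of (relabel \<sigma> t) (\<sigma> a) = row_of t a"
  and relabel_col: "\<sigma> permutes {1..n} \<Longrightarrow> a \<in> {1..n} \<Longrightarrow> col_of (relabel \<sigma> t) (\<sigma> a) = col_of t a"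
proof -
  assume \<sigma>: "\<sigma> permutes {1..n}" and a: "a \<in> {1..n}"
  have inj: "\<sigma> x = \<sigma> y \<longleftrightarrow> x = y" for x y using permutes_inj[OF \<sigma>] by (auto dest: injD)
  have "(i < length (relabel \<sigma> t) \<and> \<sigma> a \<in> set (relabel \<sigma> t ! i)) \<longleftrightarrow> i < length t \<and> a \<in> set (t ! i)" for i
    by (auto simp: relabel_def inj)
  then show "row_of (relabel \<sigma> t) (\<sigma> a) = row_of t a" by (simp add: row_of_def)
  have "(\<exists>i<length (relabel \<sigma> t). j < length (relabel \<sigma> t ! i) \<and> relabel \<sigma> t ! i ! j = \<sigma> a) \<longleftrightarrow>
     (\<exists>i<length t. j < length (t ! i) \<and> t ! i ! j = a)" for j
    by (auto simp: relabel_def inj)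
  then show "col_of (relabel \<sigma> t) (\<sigma> a) = col_of t a" by (simp add: col_of_def)
qed

end

lemma relabel_relabel: "relabel \<sigma> (relabel \<tau> t) = relabel (\<sigma> \<circ> \<tau>) t"
  by (simp add: relabel_def)

lemma relabel_id [simp]: "relabel id t = t"
  by (simp add: relabel_def)

lemma tabloid_relabel: "tabloid (relabel \<sigma> t) = map ((`) \<sigma>) (tabloid t)"
  by (simp add: tabloid_def relabel_def)

lemma numbering_transitive:
  assumes "numbering n \<mu> s" "numbering n \<mu> t"
  obtains \<sigma> where "\<sigma> permutes {1..n}" "relabel \<sigma> s = t"
proof -
  have s: "distinct (concat s)" "set (concat s) = {1..n}" and t: "distinct (concat t)" "set (concat t) = {1..n}"
    using assms by (auto simp: numbering_def)
  have len: "length (concat s) = n" "length (concat t) = n"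
    using distinct_card[OF s(1)] distinct_card[OF t(1)] s t by auto
  have bs: "bij_betw ((!) (concat s)) {..<n} {1..n}" and bt: "bij_betw ((!) (concat t)) {..<n} {1..n}"
    using bij_betw_nth[OF s(1)] bij_betw_nth[OF t(1)] s t len by auto
  define f where "f = (!) (concat t) \<circ> inv_into {..<n} ((!) (concat s))"
  have f: "bij_betw f {1..n} {1..n}"
    unfolding f_def by (rule bij_betw_trans[OF bij_betw_inv_into[OF bs] bt])
  define \<sigma> where "\<sigma> a = (if a \<in> {1..n} then f a else a)" for a
  have \<sigma>: "\<sigma> permutes {1..n}"
  proof (rule bij_imp_permutes)
    show "bij_betw \<sigma> {1..n} {1..n}"
      using f bij_betw_cong[of "{1..n}" \<sigma> f "{1..n}"] by (simp add: \<sigma>_def)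
    show "\<sigma> x = x" if "x \<notin> {1..n}" for x using that by (auto simp: \<sigma>_def)
  qed
  have "map \<sigma> (concat s) = concat t"
  proof (rule nth_equalityI)
    fix i assume "i < length (map \<sigma> (concat s))"
    then have i: "i < n" using len by simp
    then have "concat s ! i \<in> {1..n}" using bs by (auto simp: bij_betw_def)
    then show "map \<sigma> (concat s) ! i = concat t ! i"
      using i len bs by (simp add: \<sigma>_def f_def bij_betw_def)
  qed (use len in simp)
  then have "concat (relabel \<sigma> s) = concat t" by (simp add: relabel_def map_concat)
  moreover have l: "map length (relabel \<sigma> s) = map length t"
    using assms by (simp add: numbering_def shape_def relabel_def comp_def)
  then have l1: "length (relabel \<sigma> s) = length t" by (rule map_eq_imp_length_eq)
  moreover have "length (relabel \<sigma> s ! i) = length (t ! i)" if "i < length t" for i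
    using arg_cong[OF l, of "\<lambda>xs. xs ! i"] that l1 by simp
  ultimately have "relabel \<sigma> s = t"
    by (intro concat_injective) (auto simp: set_zip)
  then show ?thesis using \<sigma> that by blast
qed

lemma ex_numbering:
  assumes "is_partition n \<mu>"
  shows "\<exists>t. numbering n \<mu> t"
proof -
  have "\<exists>t. map length t = \<mu> \<and> concat t = xs" if "length xs = sum_list \<mu>" for xs :: "nat list"
    using that
  proof (induction \<mu> arbitrary: xs)
    case (Cons m \<mu>)
    have "length (drop m xs) = sum_list \<mu>" using Cons.prems by simp
    from Cons.IH[OF this] obtain t where "map length t = \<mu>" "concat t = drop m xs" by auto
    then show ?case using Cons.prems by (intro exI[of _ "take m xs # t"]) auto
  qed simp
  moreover have "length [1..<Suc n] = sum_list \<mu>" using assms by (simp add: is_partition_def)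
  ultimately obtain t where t: "map length t = \<mu>" "concat t = [1..<Suc n]" by blast
  then have "numbering n \<mu> t"
    by (simp add: numbering_def shape_def atLeastLessThanSuc_atLeastAtMost del: set_concat upt_Suc)
  then show ?thesis ..
qed

lemma finite_numberings: "finite {t. numbering n \<mu> t}"
proof -
  have "{t. numbering n \<mu> t} \<subseteq> {t. set t \<subseteq> {r. set r \<subseteq> {1..n} \<and> length r \<le> Max (insert 0 (set \<mu>))} \<and> length t = length \<mu>}"
    by (auto simp: numbering_def shape_def set_concat)
  then show ?thesis
    by (rule finite_subset) (intro finite_lists_length_eq finite_lists_length_le finite_atLeastAtMost)
qed

section \<open>Rows of one tableau against columns of another\<close>

text \<open>
  If the column \<open>j\<close> reaches row \<open>k\<close> then \<open>r\<close> takes all \<open>k\<close> values below \<open>k\<close> on it, and \<open>r'\<close>,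
  which is injective on columns, takes at most that many. Otherwise all elements of the column
  are counted on the right.
\<close>

lemma column_rank_le:
  fixes r r' c :: "'a \<Rightarrow> nat"
  assumes "finite N"
    and down: "\<And>a i. a \<in> N \<Longrightarrow> i < r a \<Longrightarrow> \<exists>b\<in>N. c b = c a \<and> r b = i"
    and inj': "\<And>a b. a \<in> N \<Longrightarrow> b \<in> N \<Longrightarrow> c a = c b \<Longrightarrow> r' a = r' b \<Longrightarrow> a = b"
  shows "card {a \<in> N. c a = j \<and> r' a < k} \<le> card {a \<in> N. c a = j \<and> r a < k}"
proof (cases "\<exists>a\<in>N. c a = j \<and> r a \<ge> k")
  case True
  then obtain a where a: "a \<in> N" "c a = j" "r a \<ge> k" by blast
  have "{..<k} \<subseteq> r ` {a \<in> N. c a = j \<and> r a < k}" 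
  proof
    fix i assume "i \<in> {..<k}"
    then have "i < r a" "i < k" using a by auto
    then obtain b where "b \<in> N" "c b = c a" "r b = i" using down[OF a(1)] by blast
    then show "i \<in> r ` {a \<in> N. c a = j \<and> r a < k}" using a \<open>i < k\<close> by auto
  qed
  then have "k \<le> card {a \<in> N. c a = j \<and> r a < k}"
    using surj_card_le[of "{a \<in> N. c a = j \<and> r a < k}" "{..<k}" r] assms(1) by simp
  moreover have "card {a \<in> N. c a = j \<and> r' a < k} \<le> card {..<k}"
    by (rule card_inj_on_le[of r']) (use inj' in \<open>auto simp: inj_on_def\<close>)
  ultimately show ?thesis by simp
next
  case False
  then show ?thesis using assms(1) by (intro card_mono) (auto simp: not_le)
qed

lemma card_by_columns:
  "finite N \<Longrightarrow> card {a \<in> N. P a} = (\<Sum>j\<in>c ` N. card {a \<in> N. c a = j \<and> P a})"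
proof -
  assume N: "finite N"
  have "{a \<in> N. P a} = (\<Union>j\<in>c ` N. {a \<in> N. c a = j \<and> P a})" by auto
  also have "card \<dots> = (\<Sum>j\<in>c ` N. card {a \<in> N. c a = j \<and> P a})"
    by (rule card_UN_disjoint) (use N in auto)
  finally show ?thesis .
qed

text \<open>
  Summing \<open>column_rank_le\<close> over the columns gives the dominance inequality. Equality of the sums
  forces equality in each column, so each value that \<open>r\<close> takes on a column is taken there by
  \<open>r'\<close> as well.
\<close>

lemma rank_dominance:
  fixes r r' c :: "'a \<Rightarrow> nat"
  assumes "finite N"
    and down: "\<And>a i. a \<in> N \<Longrightarrow> i < r a \<Longrightarrow> \<exists>b\<in>N. c b = c a \<and> r b = i"
    and inj': "\<And>a b. a \<in> N \<Longrightarrow> b \<in> N \<Longrightarrow> c a = c b \<Longrightarrow> r' a = r' b \<Longrightarrow> a = b"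
  shows "card {a \<in> N. r' a < k} \<le> card {a \<in> N. r a < k}"
    and "(\<And>k. card {a \<in> N. r' a < k} = card {a \<in> N. r a < k}) \<Longrightarrow> a \<in> N \<Longrightarrow> \<exists>b\<in>N. c b = c a \<and> r' b = r a"
proof -
  have cols: "card {a \<in> N. f a < k} = (\<Sum>j\<in>c ` N. card {a \<in> N. c a = j \<and> f a < k})"
    for f :: "'a \<Rightarrow> nat" and k by (rule card_by_columns[OF assms(1)])
  show "card {a \<in> N. r' a < k} \<le> card {a \<in> N. r a < k}"
    unfolding cols[of r'] cols[of r]
    by (rule sum_mono) (rule column_rank_le[OF assms(1) down inj'])
  assume eq: "\<And>k. card {a \<in> N. r' a < k} = card {a \<in> N. r a < k}" and a: "a \<in> N"
  have col: "card {b \<in> N. c b = c a \<and> r' b < k} = card {b \<in> N. c b = c a \<and> r b < k}" for k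
  proof (rule sum_mono_inv[of "\<lambda>j. card {b \<in> N. c b = j \<and> r' b < k}" "c ` N" "\<lambda>j. card {b \<in> N. c b = j \<and> r b < k}"])
    show "(\<Sum>j\<in>c ` N. card {b \<in> N. c b = j \<and> r' b < k}) = (\<Sum>j\<in>c ` N. card {b \<in> N. c b = j \<and> r b < k})"
      using eq unfolding cols[symmetric] .
    show "card {b \<in> N. c b = j \<and> r' b < k} \<le> card {b \<in> N. c b = j \<and> r b < k}" for j
      by (rule column_rank_le[OF assms(1) down inj'])
  qed (use a assms(1) in auto)
  have split: "card {b \<in> N. c b = c a \<and> f b < Suc k} = card {b \<in> N. c b = c a \<and> f b < k} + card {b \<in> N. c b = c a \<and> f b = k}"
    for f :: "'a \<Rightarrow> nat" and k
  proof -
    have "{b \<in> N. c b = c a \<and> f b < Suc k} = {b \<in> N. c b = c a \<and> f b < k} \<union> {b \<in> N. c b = c a \<and> f b = k}"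
      by (auto simp: less_Suc_eq)
    moreover have "{b \<in> N. c b = c a \<and> f b < k} \<inter> {b \<in> N. c b = c a \<and> f b = k} = {}" by auto
    ultimately show ?thesis using assms(1) by (simp add: card_Un_disjoint)
  qed
  have eqc: "card {b \<in> N. c b = c a \<and> r' b = r a} = card {b \<in> N. c b = c a \<and> r b = r a}"
    using col[of "Suc (r a)"] col[of "r a"] unfolding split by simp
  have "a \<in> {b \<in> N. c b = c a \<and> r b = r a}" "finite {b \<in> N. c b = c a \<and> r b = r a}"
    using a assms(1) by simp_all
  then have "0 < card {b \<in> N. c b = c a \<and> r b = r a}" by (metis card_gt_0_iff empty_iff)
  then have "{b \<in> N. c b = c a \<and> r' b = r a} \<noteq> {}" unfolding eqc[symmetric] card_gt_0_iff by blast
  then show "\<exists>b\<in>N. c b = c a \<and> r' b = r a" by blast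
qed

text \<open>
  The tableaux have the same shape, so dominance is an equality: for each box of \<open>t\<close> some entry
  of its column lies in \<open>s\<close> in the row of the box. Sending the entry of the box to that entry
  permutes each column of \<open>t\<close>.
\<close>

lemma no_repeat_column_perm:
  assumes "is_partition n \<mu>" "numbering n \<mu> t" "numbering n \<mu> s"
    and nr: "\<And>a b. a \<in> {1..n} \<Longrightarrow> b \<in> {1..n} \<Longrightarrow> col_of t a = col_of t b \<Longrightarrow> row_of s a = row_of s b \<Longrightarrow> a = b"
  obtains \<pi> where "\<pi> \<in> column_group n t" "tabloid s = tabloid (relabel \<pi> t)"
proof -
  let ?N = "{1..n}"
  have rows: "card {a \<in> ?N. row_of s a < k} = card {a \<in> ?N. row_of t a < k}" for k
  proof -
    have "card {a \<in> ?N. row_of u a < k} = (\<Sum>i<k. if i < length \<mu> then \<mu> ! i else 0)" if u: "numbering n \<mu> u" for u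
    proof -
      have "{a \<in> ?N. row_of u a < k} = (\<Union>i\<in>{..<k}. {a \<in> ?N. row_of u a = i})" by auto
      also have "card \<dots> = (\<Sum>i<k. card {a \<in> ?N. row_of u a = i})"
        by (rule card_UN_disjoint) auto
      finally show ?thesis using numbering_row_card[OF u] by simp
    qed
    then show ?thesis using assms(2,3) by simp
  qed
  \<comment> \<open>the equality case of dominance, rows of \<open>t\<close> against rows of \<open>s\<close> along the columns of \<open>t\<close>\<close>
  have ex: "\<exists>b\<in>?N. col_of t b = col_of t a \<and> row_of s b = row_of t a" if "a \<in> ?N" for a
  proof (rule rank_dominance(2)[of ?N "row_of t" "col_of t" "row_of s"])
    show "\<exists>b\<in>?N. col_of t b = col_of t a \<and> row_of t b = i" if "a \<in> ?N" "i < row_of t a" for a i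
      by (rule numbering_down_closed[OF assms(2,1) that])
    show "a = b" if "a \<in> ?N" "b \<in> ?N" "col_of t a = col_of t b" "row_of s a = row_of s b" for a b
      by (rule nr[OF that])
  qed (rule finite_atLeastAtMost rows that)+
  then have "\<forall>a\<in>?N. \<exists>b. b \<in> ?N \<and> col_of t b = col_of t a \<and> row_of s b = row_of t a" by blast
  then obtain f where "\<forall>a\<in>?N. f a \<in> ?N \<and> col_of t (f a) = col_of t a \<and> row_of s (f a) = row_of t a"
    unfolding bchoice_iff by (rule exE)
  then have f: "\<And>a. a \<in> ?N \<Longrightarrow> f a \<in> ?N \<and> col_of t (f a) = col_of t a \<and> row_of s (f a) = row_of t a" by simp
  define \<pi> where "\<pi> a = (if a \<in> ?N then f a else a)" for a
  have \<pi>: "\<pi> a \<in> ?N" "col_of t (\<pi> a) = col_of t a" "row_of s (\<pi> a) = row_of t a" if "a \<in> ?N" for a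
    using f that by (auto simp: \<pi>_def)
  have inj: "inj_on \<pi> ?N"
  proof (rule inj_onI)
    fix a b assume ab: "a \<in> ?N" "b \<in> ?N" "\<pi> a = \<pi> b"
    then have "row_of t a = row_of t b" "col_of t a = col_of t b" using \<pi>[OF ab(1)] \<pi>[OF ab(2)] by metis+
    then show "a = b" using numbering_inj[OF assms(2) ab(1,2)] by simp
  qed
  have "\<pi> ` ?N \<subseteq> ?N" using \<pi> by blast
  then have "bij_betw \<pi> ?N ?N" using inj by (simp add: bij_betw_def endo_inj_surj)
  then have perm: "\<pi> permutes ?N" by (rule bij_imp_permutes) (auto simp: \<pi>_def)
  have "\<pi> ` column t j = column t j" for j
  proof (rule endo_inj_surj)
    show "\<pi> ` column t j \<subseteq> column t j" "finite (column t j)"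
      using \<pi> unfolding numbering_column[OF assms(2)] by auto
    show "inj_on \<pi> (column t j)"
      using inj unfolding numbering_column[OF assms(2)] by (rule inj_on_subset) auto
  qed
  then have mem: "\<pi> \<in> column_group n t" using perm by (simp add: column_group_def)
  have num': "numbering n \<mu> (relabel \<pi> t)" using numbering_relabel[OF assms(2) perm] .
  have "tabloid s = tabloid (relabel \<pi> t)"
  proof (rule nth_equalityI)
    show "length (tabloid s) = length (tabloid (relabel \<pi> t))"
      using numbering_length(1)[OF assms(3)] numbering_length(1)[OF num'] by (simp add: tabloid_def)
    fix i assume "i < length (tabloid s)"
    then have i: "i < length s" "i < length (relabel \<pi> t)"
      using numbering_length(1)[OF assms(3)] numbering_length(1)[OF num'] by (auto simp: tabloid_def)
    have "row_of s b = row_of (relabel \<pi> t) b" if "b \<in> ?N" for b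
    proof -
      have "b \<in> \<pi> ` ?N" using permutes_image[OF perm] that by simp
      then obtain a where a: "a \<in> ?N" "b = \<pi> a" by (elim imageE)
      show ?thesis unfolding a(2) relabel_row[OF assms(2) perm a(1)] by (rule \<pi>(3)[OF a(1)])
    qed
    then show "tabloid s ! i = tabloid (relabel \<pi> t) ! i"
      unfolding tabloid_nth[OF assms(3) i(1)] tabloid_nth[OF num' i(2)]
      by (intro Collect_cong conj_cong refl) (rule arg_cong[of _ _ "\<lambda>x. x = i"])
  qed
  then show ?thesis using that mem by blast
qed

lemma partition_eqI:
  assumes "is_partition n \<rho>" "is_partition n \<mu>"
    and "\<And>i. (if i < length \<rho> then \<rho> ! i else 0) = (if i < length \<mu> then \<mu> ! i else 0)"
  shows "\<rho> = \<mu>"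
proof -
  have nz: "\<rho> ! i \<noteq> 0" if "i < length \<rho>" for i using assms(1) nth_mem[OF that] by (metis is_partition_def)
  have nz': "\<mu> ! i \<noteq> 0" if "i < length \<mu>" for i using assms(2) nth_mem[OF that] by (metis is_partition_def)
  have iff: "i < length \<rho> \<longleftrightarrow> i < length \<mu>" for i
    using assms(3)[of i] nz[of i] nz'[of i] by (cases "i < length \<rho>"; cases "i < length \<mu>") auto
  have len: "length \<rho> = length \<mu>"
    using iff[of "length \<rho>"] iff[of "length \<mu>"] by (simp add: linorder_neq_iff not_less)
  show ?thesis
  proof (rule nth_equalityI[OF len])
    fix i assume "i < length \<rho>"
    then show "\<rho> ! i = \<mu> ! i" using assms(3)[of i] len by simp
  qed
qed

text \<open>The two hypotheses say that each of the partitions dominates the other.\<close>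

lemma no_repeat_both_eq:
  assumes "is_partition n \<rho>" "is_partition n \<mu>" "numbering n \<rho> t" "numbering n \<mu> s"
    "numbering n \<rho> t'" "numbering n \<mu> s'"
    and "\<And>a b. a \<in> {1..n} \<Longrightarrow> b \<in> {1..n} \<Longrightarrow> col_of t a = col_of t b \<Longrightarrow> row_of s a = row_of s b \<Longrightarrow> a = b"
    and "\<And>a b. a \<in> {1..n} \<Longrightarrow> b \<in> {1..n} \<Longrightarrow> col_of s' a = col_of s' b \<Longrightarrow> row_of t' a = row_of t' b \<Longrightarrow> a = b"
  shows "\<rho> = \<mu>"
proof -
  let ?N = "{1..n}"
  define P where "P \<nu> k = (\<Sum>i<k. if i < length \<nu> then \<nu> ! i else 0)" for \<nu> :: "nat list" and k
  have card: "card {a \<in> ?N. row_of u a < k} = P \<nu> k" if u: "numbering n \<nu> u" for u \<nu> k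
  proof -
    have "{a \<in> ?N. row_of u a < k} = (\<Union>i\<in>{..<k}. {a \<in> ?N. row_of u a = i})" by auto
    also have "card \<dots> = (\<Sum>i<k. card {a \<in> ?N. row_of u a = i})"
      by (rule card_UN_disjoint) auto
    finally show ?thesis using numbering_row_card[OF u] by (simp add: P_def)
  qed
  have "P \<mu> k \<le> P \<rho> k" for k
    unfolding card[OF assms(3), symmetric] card[OF assms(4), symmetric]
    by (rule rank_dominance(1)[where c = "col_of t"], rule finite_atLeastAtMost,
        rule numbering_down_closed[OF assms(3,1)], assumption+, rule assms(7))
  moreover have "P \<rho> k \<le> P \<mu> k" for k
    unfolding card[OF assms(5), symmetric] card[OF assms(6), symmetric]
    by (rule rank_dominance(1)[where c = "col_of s'"], rule finite_atLeastAtMost,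
        rule numbering_down_closed[OF assms(6,2)], assumption+, rule assms(8))
  ultimately have eq: "P \<rho> k = P \<mu> k" for k by (simp add: le_antisym)
  show ?thesis
  proof (rule partition_eqI[OF assms(1,2)])
    show "(if i < length \<rho> then \<rho> ! i else 0) = (if i < length \<mu> then \<mu> ! i else 0)" for i
      using eq[of "Suc i"] eq[of i] by (simp add: P_def)
  qed
qed

section \<open>Polytabloids and column antisymmetrizers\<close>

definition tab_vimage :: "(nat \<Rightarrow> nat) \<Rightarrow> nat set list \<Rightarrow> nat set list" where
  "tab_vimage \<sigma> X = map (vimage \<sigma>) X"

definition csign :: "(nat \<Rightarrow> nat) \<Rightarrow> complex" where
  "csign \<pi> = of_int (sign \<pi>)"

text \<open>
  The inner product of \<open>u\<close> with the polytabloid of \<open>t\<close>, for the form in which tabloids are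
  orthonormal.
\<close>

definition column_pairing :: "nat \<Rightarrow> tableau \<Rightarrow> (nat set list \<Rightarrow> complex) \<Rightarrow> complex" where
  "column_pairing n t u = (\<Sum>\<pi>\<in>column_group n t. csign \<pi> * u (tabloid (relabel \<pi> t)))"

text \<open>
  The signed sum of the column group of \<open>t\<close>, as an element of the group algebra acting on
  functions of tabloids. Unlike the action of a Specht module it is defined on all such
  functions.
\<close>

definition column_antisym :: "nat \<Rightarrow> tableau \<Rightarrow> (nat set list \<Rightarrow> complex) \<Rightarrow> nat set list \<Rightarrow> complex" where
  "column_antisym n t u = (\<lambda>X. \<Sum>\<pi>\<in>column_group n t. csign \<pi> * u (tab_vimage \<pi> X))"

definition on_tabloids :: "nat \<Rightarrow> nat list \<Rightarrow> (nat set list \<Rightarrow> complex) \<Rightarrow> bool" where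
  "on_tabloids n \<mu> u \<longleftrightarrow> (\<forall>X. u X \<noteq> 0 \<longrightarrow> (\<exists>s. numbering n \<mu> s \<and> X = tabloid s))"

lemma csign_compose: "\<pi> permutes {1..n} \<Longrightarrow> \<rho> permutes {1..n} \<Longrightarrow> csign (\<pi> \<circ> \<rho>) = csign \<pi> * csign \<rho>"
  unfolding csign_def by (subst sign_compose) (auto simp: permutation_permutes)

lemma csign_inv: "\<pi> permutes {1..n} \<Longrightarrow> csign (inv' \<pi>) = csign \<pi>"
  unfolding csign_def by (subst sign_inverse) (auto simp: permutation_permutes)

lemma csign_square [simp]: "csign \<pi> * csign \<pi> = 1" "csign \<pi> \<noteq> 0"
  by (auto simp: csign_def sign_def)

lemma tab_vimage_compose: "tab_vimage \<sigma> (tab_vimage \<tau> X) = tab_vimage (\<tau> \<circ> \<sigma>) X"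
  by (simp add: tab_vimage_def vimage_comp)

lemma tab_vimage_tabloid:
  assumes "\<sigma> permutes S"
  shows "tab_vimage \<sigma> (tabloid (relabel \<tau> t)) = tabloid (relabel (inv' \<sigma> \<circ> \<tau>) t)"
proof -
  have "\<sigma> -` (\<tau> ` A) = (inv' \<sigma> \<circ> \<tau>) ` A" for A
    using bij_vimage_eq_inv_image[OF permutes_bij[OF assms]] by (simp add: image_comp)
  then show ?thesis by (simp add: tab_vimage_def tabloid_relabel)
qed

lemma tab_vimage_eq_iff:
  assumes "\<sigma> permutes S"
  shows "tabloid (relabel (\<sigma> \<circ> \<pi>) t) = X \<longleftrightarrow> tabloid (relabel \<pi> t) = tab_vimage \<sigma> X"
proof
  assume "tabloid (relabel (\<sigma> \<circ> \<pi>) t) = X"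
  then have "tab_vimage \<sigma> X = tabloid (relabel (inv' \<sigma> \<circ> (\<sigma> \<circ> \<pi>)) t)"
    using tab_vimage_tabloid[OF assms] by blast
  also have "inv' \<sigma> \<circ> (\<sigma> \<circ> \<pi>) = \<pi>" by (simp add: o_assoc permutes_inv_o[OF assms])
  finally show "tabloid (relabel \<pi> t) = tab_vimage \<sigma> X" by simp
next
  assume *: "tabloid (relabel \<pi> t) = tab_vimage \<sigma> X"
  have "tabloid (relabel (\<sigma> \<circ> \<pi>) t) = map ((`) \<sigma>) (tabloid (relabel \<pi> t))"
    by (simp add: relabel_relabel[symmetric] tabloid_relabel)
  also have "\<dots> = X"
    unfolding * tab_vimage_def using permutes_surj[OF assms] by (simp add: comp_def surj_image_vimage_eq map_idI)
  finally show "tabloid (relabel (\<sigma> \<circ> \<pi>) t) = X" .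
qed

lemma column_groupD: "\<pi> \<in> column_group n t \<Longrightarrow> \<pi> permutes {1..n}"
  by (simp add: column_group_def)

lemma finite_column_group: "finite (column_group n t)"
  by (rule finite_subset[OF _ finite_permutations[of "{1..n}"]]) (auto simp: column_group_def)

lemma column_group_id: "id \<in> column_group n t"
  by (simp add: column_group_def permutes_id)

lemma column_group_compose: "\<pi> \<in> column_group n t \<Longrightarrow> \<rho> \<in> column_group n t \<Longrightarrow> \<pi> \<circ> \<rho> \<in> column_group n t"
  unfolding column_group_def mem_Collect_eq
  by (intro conjI allI) (simp_all only: permutes_compose image_comp[symmetric])

lemma column_group_inv: "\<pi> \<in> column_group n t \<Longrightarrow> inv' \<pi> \<in> column_group n t"
proof -
  assume \<pi>: "\<pi> \<in> column_group n t"
  then have p: "\<pi> permutes {1..n}" and im: "\<pi> ` column t j = column t j" for j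
    by (auto simp: column_group_def)
  have "inv' \<pi> ` column t j = column t j" for j
    by (subst im[symmetric], simp add: image_comp permutes_inv_o[OF p])
  then show ?thesis using permutes_inv[OF p] by (simp add: column_group_def)
qed

lemma column_relabel: "column (relabel \<sigma> t) j = \<sigma> ` column t j"
proof -
  have "column (relabel \<sigma> t) j = {map \<sigma> r ! j | r. r \<in> set t \<and> j < length r}"
    unfolding column_def relabel_def by auto
  also have "\<dots> = {\<sigma> (r ! j) | r. r \<in> set t \<and> j < length r}"
    by (intro Collect_cong ex_cong1) (metis nth_map)
  also have "\<dots> = \<sigma> ` column t j" unfolding column_def by auto
  finally show ?thesis .
qed

lemma column_group_conj:
  assumes "\<sigma> permutes {1..n}" "\<pi> \<in> column_group n t"
  shows "\<sigma> \<circ> \<pi> \<circ> inv' \<sigma> \<in> column_group n (relabel \<sigma> t)"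
proof -
  have "(\<sigma> \<circ> \<pi> \<circ> inv' \<sigma>) ` (\<sigma> ` column t j) = \<sigma> ` column t j" for j
  proof -
    have "(\<sigma> \<circ> \<pi> \<circ> inv' \<sigma>) ` (\<sigma> ` column t j) = \<sigma> ` \<pi> ` ((inv' \<sigma> \<circ> \<sigma>) ` column t j)"
      by (simp add: image_comp o_assoc)
    also have "\<dots> = \<sigma> ` column t j"
      using assms(2) by (simp add: permutes_inv_o[OF assms(1)] column_group_def)
    finally show ?thesis .
  qed
  then show ?thesis
    using assms by (simp add: column_group_def column_relabel permutes_compose permutes_inv)
qed

lemma sum_column_group_relabel:
  assumes "\<sigma> permutes {1..n}"
  shows "(\<Sum>\<pi>\<in>column_group n (relabel \<sigma> t). f \<pi>) = (\<Sum>\<pi>\<in>column_group n t. f (\<sigma> \<circ> \<pi> \<circ> inv' \<sigma>))"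
proof (rule sum.reindex_bij_witness[of _ "\<lambda>\<pi>. \<sigma> \<circ> \<pi> \<circ> inv' \<sigma>" "\<lambda>\<pi>. inv' \<sigma> \<circ> \<pi> \<circ> \<sigma>"])
  fix \<pi> assume \<pi>: "\<pi> \<in> column_group n (relabel \<sigma> t)"
  show 1: "\<sigma> \<circ> (inv' \<sigma> \<circ> \<pi> \<circ> \<sigma>) \<circ> inv' \<sigma> = \<pi>"
    using permutes_inverses[OF assms] by (auto simp: fun_eq_iff)
  then show "f (\<sigma> \<circ> (inv' \<sigma> \<circ> \<pi> \<circ> \<sigma>) \<circ> inv' \<sigma>) = f \<pi>" by (simp only:)
  have "inv' \<sigma> \<circ> \<pi> \<circ> inv' (inv' \<sigma>) \<in> column_group n (relabel (inv' \<sigma>) (relabel \<sigma> t))"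
    by (rule column_group_conj[OF permutes_inv[OF assms] \<pi>])
  then show "inv' \<sigma> \<circ> \<pi> \<circ> \<sigma> \<in> column_group n t"
    by (simp add: relabel_relabel permutes_inv_o[OF assms] permutes_inv_inv[OF assms])
next
  fix \<pi> assume \<pi>: "\<pi> \<in> column_group n t"
  show "inv' \<sigma> \<circ> (\<sigma> \<circ> \<pi> \<circ> inv' \<sigma>) \<circ> \<sigma> = \<pi>"
    using permutes_inverses[OF assms] by (auto simp: fun_eq_iff)
  show "\<sigma> \<circ> \<pi> \<circ> inv' \<sigma> \<in> column_group n (relabel \<sigma> t)" by (rule column_group_conj[OF assms \<pi>])
qed

lemma csign_conj:
  assumes "\<sigma> permutes {1..n}" "\<pi> permutes {1..n}"
  shows "csign (\<sigma> \<circ> \<pi> \<circ> inv' \<sigma>) = csign \<pi>"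
proof -
  have "csign (\<sigma> \<circ> \<pi> \<circ> inv' \<sigma>) = csign \<sigma> * csign \<pi> * csign \<sigma>"
    using assms by (simp only: csign_compose[of _ n] csign_inv[of _ n] permutes_compose permutes_inv)
  also have "\<dots> = csign \<pi> * (csign \<sigma> * csign \<sigma>)" by (simp only: mult_ac)
  finally show ?thesis by simp
qed

lemma polytabloid_eq: "polytabloid n t X = (\<Sum>\<pi>\<in>column_group n t. csign \<pi> * (if tabloid (relabel \<pi> t) = X then 1 else 0))"
  by (simp add: polytabloid_def csign_def relabel_def)

lemma relabel_conj: "\<sigma> permutes S \<Longrightarrow> relabel (\<sigma> \<circ> \<pi> \<circ> inv' \<sigma>) (relabel \<sigma> t) = relabel (\<sigma> \<circ> \<pi>) t"
  by (simp add: relabel_relabel comp_assoc permutes_inv_o)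

lemma polytabloid_relabel:
  assumes "\<sigma> permutes {1..n}"
  shows "polytabloid n (relabel \<sigma> t) X = polytabloid n t (tab_vimage \<sigma> X)"
  unfolding polytabloid_eq sum_column_group_relabel[OF assms]
  by (intro sum.cong refl)
     (simp add: csign_conj[OF assms column_groupD] relabel_conj[OF assms] tab_vimage_eq_iff[OF assms])

lemma column_pairing_relabel:
  assumes "\<sigma> permutes {1..n}"
  shows "column_pairing n (relabel \<sigma> t) (\<lambda>X. u (tab_vimage \<sigma> X)) = column_pairing n t u"
  unfolding column_pairing_def sum_column_group_relabel[OF assms]
proof (intro sum.cong refl)
  fix \<pi> assume \<pi>: "\<pi> \<in> column_group n t"
  have "inv' \<sigma> \<circ> (\<sigma> \<circ> \<pi>) = \<pi>" by (simp add: o_assoc permutes_inv_o[OF assms])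
  then show "csign (\<sigma> \<circ> \<pi> \<circ> inv' \<sigma>) * u (tab_vimage \<sigma> (tabloid (relabel (\<sigma> \<circ> \<pi> \<circ> inv' \<sigma>) (relabel \<sigma> t)))) =
      csign \<pi> * u (tabloid (relabel \<pi> t))"
    by (simp add: csign_conj[OF assms column_groupD[OF \<pi>]] relabel_conj[OF assms] tab_vimage_tabloid[OF assms])
qed

text \<open>Reindexing the sum by \<open>\<pi> \<circ> inv' \<rho>\<close> moves \<open>\<pi>\<close> into the sign.\<close>

lemma column_antisym_own:
  assumes "\<pi> \<in> column_group n t"
  shows "column_antisym n t u (tabloid (relabel \<pi> t)) = csign \<pi> * column_pairing n t u"
proof -
  note p = column_groupD
  have "column_antisym n t u (tabloid (relabel \<pi> t)) =
      (\<Sum>\<rho>\<in>column_group n t. csign \<rho> * u (tabloid (relabel (inv' \<rho> \<circ> \<pi>) t)))"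
    unfolding column_antisym_def by (intro sum.cong refl) (simp add: tab_vimage_tabloid[OF column_groupD])
  also have "\<dots> = (\<Sum>\<rho>\<in>column_group n t. csign \<pi> * (csign \<rho> * u (tabloid (relabel \<rho> t))))"
  proof (rule sum.reindex_bij_witness[of _ "\<lambda>\<rho>. \<pi> \<circ> inv' \<rho>" "\<lambda>\<rho>. inv' \<rho> \<circ> \<pi>"])
    fix \<rho> assume \<rho>: "\<rho> \<in> column_group n t"
    note pp = p[OF \<rho>] p[OF assms]
    have "inv' (inv' \<rho> \<circ> \<pi>) = inv' \<pi> \<circ> \<rho>"
      using o_inv_distrib[OF permutes_bij[OF permutes_inv[OF pp(1)]] permutes_bij[OF pp(2)]]
        permutes_inv_inv[OF pp(1)] by simp
    then show "\<pi> \<circ> inv' (inv' \<rho> \<circ> \<pi>) = \<rho>" by (simp add: o_assoc permutes_inv_o[OF pp(2)])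
    have "inv' (\<pi> \<circ> inv' \<rho>) = \<rho> \<circ> inv' \<pi>"
      using o_inv_distrib[OF permutes_bij[OF pp(2)] permutes_bij[OF permutes_inv[OF pp(1)]]]
        permutes_inv_inv[OF pp(1)] by simp
    then show "inv' (\<pi> \<circ> inv' \<rho>) \<circ> \<pi> = \<rho>" by (simp add: comp_assoc permutes_inv_o[OF pp(2)])
    show "inv' \<rho> \<circ> \<pi> \<in> column_group n t" "\<pi> \<circ> inv' \<rho> \<in> column_group n t"
      using \<rho> assms by (auto intro: column_group_compose column_group_inv)
    have "csign (inv' \<rho> \<circ> \<pi>) = csign \<rho> * csign \<pi>"
      using pp by (simp add: csign_compose[of _ n] permutes_inv csign_inv[of _ n])
    then have "csign \<pi> * csign (inv' \<rho> \<circ> \<pi>) = csign \<rho> * (csign \<pi> * csign \<pi>)" by (simp only: mult_ac)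
    then have "csign \<pi> * csign (inv' \<rho> \<circ> \<pi>) = csign \<rho>" by simp
    then show "csign \<pi> * (csign (inv' \<rho> \<circ> \<pi>) * u (tabloid (relabel (inv' \<rho> \<circ> \<pi>) t))) =
        csign \<rho> * u (tabloid (relabel (inv' \<rho> \<circ> \<pi>) t))"
      by (simp add: mult.assoc[symmetric])
  qed
  finally show ?thesis by (simp add: column_pairing_def sum_distrib_left)
qed

lemma column_group_col_of:
  assumes "numbering n \<mu> t" "\<pi> \<in> column_group n t" "a \<in> {1..n}"
  shows "col_of t (\<pi> a) = col_of t a" "\<pi> a \<in> {1..n}"
proof -
  have "\<pi> ` column t (col_of t a) = column t (col_of t a)" using assms(2) by (simp add: column_group_def)
  moreover have "a \<in> column t (col_of t a)" using numbering_column[OF assms(1)] assms(3) by simp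
  ultimately have "\<pi> a \<in> column t (col_of t a)" by blast
  then show "col_of t (\<pi> a) = col_of t a" "\<pi> a \<in> {1..n}" using numbering_column[OF assms(1)] by auto
qed

lemma row_of_tabloid: "tabloid s = tabloid t \<Longrightarrow> row_of s = row_of t"
proof -
  have *: "(i < length t \<and> a \<in> set (t ! i)) \<longleftrightarrow> (i < length (tabloid t) \<and> a \<in> tabloid t ! i)" for t i a
    by (auto simp: tabloid_def)
  assume "tabloid s = tabloid t"
  then show ?thesis unfolding row_of_def[abs_def] * by (simp only:)
qed

text \<open>Every entry stays in its row and in its column, hence in its box.\<close>

lemma column_group_tabloid_inj:
  assumes "numbering n \<mu> t" "\<pi> \<in> column_group n t" "tabloid (relabel \<pi> t) = tabloid t"
  shows "\<pi> = id"
proof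
  fix a
  have p: "\<pi> permutes {1..n}" using column_groupD[OF assms(2)] .
  show "\<pi> a = id a"
  proof (cases "a \<in> {1..n}")
    case True
    have "row_of t (\<pi> a) = row_of t a"
      using relabel_row[OF assms(1) p True] row_of_tabloid[OF assms(3)] by simp
    then show ?thesis
      using numbering_inj[OF assms(1) column_group_col_of(2)[OF assms(1,2) True] True]
        column_group_col_of(1)[OF assms(1,2) True] by simp
  next
    case False
    then show ?thesis using p by (simp add: permutes_not_in)
  qed
qed

lemma polytabloid_own:
  assumes "numbering n \<mu> t" "\<pi> \<in> column_group n t"
  shows "polytabloid n t (tabloid (relabel \<pi> t)) = csign \<pi>"
proof -
  have "tabloid (relabel \<rho> t) = tabloid (relabel \<pi> t) \<longleftrightarrow> \<pi> = \<rho>" if \<rho>: "\<rho> \<in> column_group n t" for \<rho>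
  proof
    assume eq: "tabloid (relabel \<rho> t) = tabloid (relabel \<pi> t)"
    have p: "\<pi> permutes {1..n}" using column_groupD[OF assms(2)] .
    have "tabloid (relabel (inv' \<pi> \<circ> \<rho>) t) = tabloid (relabel (inv' \<pi> \<circ> \<pi>) t)"
      using arg_cong[OF eq, of "tab_vimage \<pi>"] by (simp only: tab_vimage_tabloid[OF p])
    then have "tabloid (relabel (inv' \<pi> \<circ> \<rho>) t) = tabloid t" by (simp add: permutes_inv_o[OF p])
    then have "inv' \<pi> \<circ> \<rho> = id"
      by (intro column_group_tabloid_inj[OF assms(1)] column_group_compose column_group_inv assms(2) \<rho>)
    then have "\<pi> \<circ> (inv' \<pi> \<circ> \<rho>) = \<pi>" by simp
    then show "\<pi> = \<rho>" by (simp add: o_assoc permutes_inv_o[OF p])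
  qed simp
  then have "polytabloid n t (tabloid (relabel \<pi> t)) = (\<Sum>\<rho>\<in>column_group n t. if \<pi> = \<rho> then csign \<rho> else 0)"
    unfolding polytabloid_eq by (intro sum.cong refl) auto
  then show ?thesis using assms(2) finite_column_group by simp
qed

text \<open>
  The transposition of \<open>a\<close> and \<open>b\<close> lies in the column group of \<open>t\<close> and fixes the tabloid of \<open>s\<close>,
  so reindexing the sum by it reverses the sign. No tabloid in the polytabloid of \<open>t\<close> has two
  entries of a column of \<open>t\<close> in one row, as they would come from one box.
\<close>

lemma repeat_antisym_zero:
  assumes "numbering n \<nu> t" "numbering n \<mu> s" "a \<in> {1..n}" "b \<in> {1..n}" "a \<noteq> b"
    "col_of t a = col_of t b" "row_of s a = row_of s b"
  shows "column_antisym n t u (tabloid s) = 0" "polytabloid n t (tabloid s) = 0"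
proof -
  define \<tau> where "\<tau> = transpose a b"
  have p: "\<tau> permutes {1..n}" unfolding \<tau>_def using assms(3,4) by (rule permutes_swap_id)
  have \<tau>\<tau>: "\<tau> \<circ> \<tau> = id" by (simp add: \<tau>_def)
  have img: "\<tau> ` A = A" if "a \<in> A \<longleftrightarrow> b \<in> A" for A
    using that by (simp add: \<tau>_def transpose_image_eq)
  have mem: "\<tau> \<in> column_group n t"
    using p img assms(3,4,6) by (simp add: column_group_def numbering_column[OF assms(1)])
  have "\<tau> -` tabloid s ! i = tabloid s ! i" if "i < length s" for i
  proof -
    have "\<tau> -` tabloid s ! i = inv' \<tau> ` (tabloid s ! i)"
      using bij_vimage_eq_inv_image[OF permutes_bij[OF p]] .
    also have "inv' \<tau> = \<tau>" by (simp add: \<tau>_def)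
    also have "\<tau> ` (tabloid s ! i) = tabloid s ! i"
      using assms(3,4,7) by (intro img) (simp add: tabloid_nth[OF assms(2) that])
    finally show ?thesis .
  qed
  then have inv_s: "tab_vimage \<tau> (tabloid s) = tabloid s"
    by (intro nth_equalityI) (simp_all add: tab_vimage_def tabloid_def)
  have sg: "csign \<tau> = -1" using assms(5) by (simp add: csign_def \<tau>_def sign_swap_id)
  have "column_antisym n t u (tabloid s) = (\<Sum>\<pi>\<in>column_group n t. csign (\<tau> \<circ> \<pi>) * u (tab_vimage (\<tau> \<circ> \<pi>) (tabloid s)))"
    unfolding column_antisym_def
    by (rule sum.reindex_bij_witness[of _ "\<lambda>\<pi>. \<tau> \<circ> \<pi>" "\<lambda>\<pi>. \<tau> \<circ> \<pi>"])
       (simp_all add: o_assoc \<tau>\<tau> column_group_compose mem)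
  also have "\<dots> = - column_antisym n t u (tabloid s)"
    unfolding column_antisym_def sum_negf[symmetric]
  proof (intro sum.cong refl)
    fix \<pi> assume \<pi>: "\<pi> \<in> column_group n t"
    have "tab_vimage (\<tau> \<circ> \<pi>) (tabloid s) = tab_vimage \<pi> (tabloid s)"
      unfolding tab_vimage_compose[symmetric] inv_s ..
    then show "csign (\<tau> \<circ> \<pi>) * u (tab_vimage (\<tau> \<circ> \<pi>) (tabloid s)) = - (csign \<pi> * u (tab_vimage \<pi> (tabloid s)))"
      by (simp add: csign_compose[OF p column_groupD[OF \<pi>]] sg)
  qed
  finally show "column_antisym n t u (tabloid s) = 0" by (simp add: eq_neg_iff_add_eq_0)
  have "tabloid (relabel \<pi> t) \<noteq> tabloid s" if \<pi>: "\<pi> \<in> column_group n t" for \<pi>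
  proof
    assume eq: "tabloid (relabel \<pi> t) = tabloid s"
    have pp: "\<pi> permutes {1..n}" using column_groupD[OF \<pi>] .
    have pre: "\<exists>y\<in>{1..n}. x = \<pi> y" if "x \<in> {1..n}" for x 
    proof -
      have "x \<in> \<pi> ` {1..n}" using permutes_image[OF pp] that by simp
      then show ?thesis by (elim imageE bexI)
    qed
    obtain a' b' where ab: "a' \<in> {1..n}" "a = \<pi> a'" "b' \<in> {1..n}" "b = \<pi> b'"
      using pre[OF assms(3)] pre[OF assms(4)] by (elim bexE)
    have "col_of t a' = col_of t b'"
      using column_group_col_of(1)[OF assms(1) \<pi> ab(1)] column_group_col_of(1)[OF assms(1) \<pi> ab(3)] ab assms(6) by simp
    moreover have "row_of t a' = row_of t b'"
      using relabel_row[OF assms(1) pp ab(1)] relabel_row[OF assms(1) pp ab(3)] row_of_tabloid[OF eq] ab assms(7) by simp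
    ultimately have "a' = b'" using numbering_inj[OF assms(1) ab(1,3)] by simp
    then show False using ab assms(5) by simp
  qed
  then show "polytabloid n t (tabloid s) = 0" unfolding polytabloid_eq by (intro sum.neutral) auto
qed

lemma antisym_off_tabloids:
  assumes "on_tabloids n \<mu> u" "\<nexists>s. numbering n \<mu> s \<and> X = tabloid s"
  shows "column_antisym n t u X = 0"
  unfolding column_antisym_def
proof (intro sum.neutral ballI)
  fix \<pi> assume \<pi>: "\<pi> \<in> column_group n t"
  have p: "\<pi> permutes {1..n}" using column_groupD[OF \<pi>] .
  have "u (tab_vimage \<pi> X) = 0"
  proof (rule ccontr)
    assume "u (tab_vimage \<pi> X) \<noteq> 0"
    then obtain s where s: "numbering n \<mu> s" "tab_vimage \<pi> X = tabloid s"
      using assms(1) unfolding on_tabloids_def by blast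
    have "tabloid (relabel (\<pi> \<circ> id) s) = X"
      unfolding tab_vimage_eq_iff[OF p] using s(2) by simp
    then show False using assms(2) numbering_relabel[OF s(1) p] by auto
  qed
  then show "csign \<pi> * u (tab_vimage \<pi> X) = 0" by simp
qed

lemma on_tabloids_polytabloid:
  assumes "numbering n \<mu> t"
  shows "on_tabloids n \<mu> (polytabloid n t)"
  unfolding on_tabloids_def
proof (intro allI impI)
  fix X assume "polytabloid n t X \<noteq> 0"
  then obtain \<pi> where "\<pi> \<in> column_group n t"
      "csign \<pi> * (if tabloid (relabel \<pi> t) = X then 1 else 0) \<noteq> 0"
    unfolding polytabloid_eq by (rule sum.not_neutral_contains_not_neutral)
  then have "\<pi> \<in> column_group n t" "tabloid (relabel \<pi> t) = X" by (auto split: if_splits)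
  then show "\<exists>s. numbering n \<mu> s \<and> X = tabloid s"
    using numbering_relabel[OF assms column_groupD] by blast
qed

text \<open>
  James's lemma. Both sides vanish on a tabloid having two entries of a column of \<open>t\<close> in one
  row. Any other tabloid is that of \<open>\<pi> t\<close> for a column permutation \<open>\<pi>\<close>, where both sides are the
  sign of \<open>\<pi>\<close> times the pairing.
\<close>

lemma column_antisym_eq:
  assumes "is_partition n \<mu>" "numbering n \<mu> t" "on_tabloids n \<mu> u"
  shows "column_antisym n t u = fscale (column_pairing n t u) (polytabloid n t)"
proof
  fix X
  show "column_antisym n t u X = fscale (column_pairing n t u) (polytabloid n t) X"
  proof (cases "\<exists>s. numbering n \<mu> s \<and> X = tabloid s")
    case False
    then have "polytabloid n t X = 0" using on_tabloids_polytabloid[OF assms(2)] unfolding on_tabloids_def by blast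
    then show ?thesis using antisym_off_tabloids[OF assms(3) False] by (simp add: fscale_def)
  next
    case True
    then obtain s where s: "numbering n \<mu> s" "X = tabloid s" by blast
    show ?thesis
    proof (cases "\<exists>a\<in>{1..n}. \<exists>b\<in>{1..n}. a \<noteq> b \<and> col_of t a = col_of t b \<and> row_of s a = row_of s b")
      case True
      then obtain a b where "a \<in> {1..n}" "b \<in> {1..n}" "a \<noteq> b" "col_of t a = col_of t b" "row_of s a = row_of s b"
        by blast
      then show ?thesis using repeat_antisym_zero[OF assms(2) s(1)] s(2) by (simp add: fscale_def)
    next
      case False
      obtain \<pi> where \<pi>: "\<pi> \<in> column_group n t" "tabloid s = tabloid (relabel \<pi> t)"
        by (rule no_repeat_column_perm[OF assms(1,2) s(1)]) (use False in blast)+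
      show ?thesis
        unfolding s(2) \<pi>(2) column_antisym_own[OF \<pi>(1)] fscale_def polytabloid_own[OF assms(2) \<pi>(1)] by simp
    qed
  qed
qed

lemma column_antisym_nonzero:
  assumes "numbering n \<nu> t" "on_tabloids n \<mu> u" "column_antisym n t u \<noteq> 0"
  obtains s where "numbering n \<mu> s"
    "\<And>a b. a \<in> {1..n} \<Longrightarrow> b \<in> {1..n} \<Longrightarrow> col_of t a = col_of t b \<Longrightarrow> row_of s a = row_of s b \<Longrightarrow> a = b"
proof -
  obtain X where X: "column_antisym n t u X \<noteq> 0" using assms(3) by (auto simp: fun_eq_iff)
  then obtain s where s: "numbering n \<mu> s" "X = tabloid s" using antisym_off_tabloids[OF assms(2)] by blast
  show ?thesis
    by (rule that[OF s(1)]) (use repeat_antisym_zero(1)[OF assms(1) s(1)] X s(2) in blast)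
qed

section \<open>Specht modules are simple and pairwise nonisomorphic\<close>

lemma specht_simps [simp]:
  "smul (specht n \<mu>) = fscale"
  "act (specht n \<mu>) = (\<lambda>\<sigma> v X. v (tab_vimage \<sigma> X))"
  "carr (specht n \<mu>) = fs.span {polytabloid n t | t. numbering n \<mu> t}"
  by (simp_all add: specht_def tab_vimage_def[abs_def])

lemma sym_group_inv: "\<sigma> permutes {1..n} \<Longrightarrow> inv\<^bsub>sym_group n\<^esub> \<sigma> = inv' \<sigma>"
  by (rule group.inv_equality[OF sym_group_is_group])
     (auto simp: sym_group_def permutes_inv permutes_inv_o)

lemma finite_sym_group: "finite (carrier (sym_group n))"
  by (simp add: sym_group_def finite_permutations)

lemma polytabloid_act:
  "\<sigma> permutes {1..n} \<Longrightarrow> act (specht n \<mu>) \<sigma> (polytabloid n t) = polytabloid n (relabel \<sigma> t)"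
  by (simp add: fun_eq_iff polytabloid_relabel)

lemma polytabloid_in_specht: "numbering n \<mu> t \<Longrightarrow> polytabloid n t \<in> carr (specht n \<mu>)"
  by (auto intro: fs.span_base)

lemma specht_gmodule: "gmodule (sym_group n) (specht n \<mu>)"
proof -
  let ?S = "specht n \<mu>"
  have vs: "vector_space (smul ?S)" unfolding specht_simps by unfold_locales
  have closed: "act ?S g v \<in> carr ?S" if g: "g permutes {1..n}" and v: "v \<in> carr ?S" for g v
    using v unfolding specht_simps(3)
  proof (induction rule: fs.span_induct_alt)
    case base
    show ?case using fs.span_zero by (simp add: zero_fun_def)
  next
    case (step c x y)
    then obtain t where t: "numbering n \<mu> t" "x = polytabloid n t" by blast
    have "act ?S g x = polytabloid n (relabel g t)" unfolding t(2) by (rule polytabloid_act[OF g])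
    then have "act ?S g x \<in> fs.span {polytabloid n t | t. numbering n \<mu> t}"
      using polytabloid_in_specht[OF numbering_relabel[OF t(1) g]] by simp
    then have "fscale c (act ?S g x) + act ?S g y \<in> fs.span {polytabloid n t | t. numbering n \<mu> t}"
      using step by (intro fs.span_add fs.span_scale) auto
    moreover have "act ?S g (fscale c x + y) = fscale c (act ?S g x) + act ?S g y"
      by (auto simp: fscale_def)
    ultimately show ?case by (simp only:)
  qed
  show ?thesis
    unfolding gmodule_def gmodule_axioms_def
  proof (intro conjI allI impI)
    show "module.subspace (smul ?S) (carr ?S)" by simp
    show "act ?S g v \<in> carr ?S" if "g \<in> carrier (sym_group n)" "v \<in> carr ?S" for g v
      by (rule closed) (use that in \<open>simp_all add: sym_group_def\<close>)
    show "act ?S g (v + w) = act ?S g v + act ?S g w" for g v w by auto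
    show "act ?S g (smul ?S c v) = smul ?S c (act ?S g v)" for g c v by (auto simp: fscale_def)
    show "act ?S \<one>\<^bsub>sym_group n\<^esub> v = v" for v
      by (simp add: sym_group_def tab_vimage_def)
    show "act ?S (g \<otimes>\<^bsub>sym_group n\<^esub> h) v = act ?S g (act ?S h v)" for g h v
      by (simp add: sym_group_def tab_vimage_compose)
  qed (rule sym_group_is_group vs)+
qed

lemma specht_fin_dim: "fin_dim (smul (specht n \<mu>)) (carr (specht n \<mu>))"
  unfolding fin_dim_def specht_simps(1,3)
  by (rule exI[of _ "{polytabloid n t | t. numbering n \<mu> t}"])
     (simp add: setcompr_eq_image finite_numberings)

lemma polytabloid_self: "numbering n \<mu> t \<Longrightarrow> polytabloid n t (tabloid t) = 1"
  using polytabloid_own[OF _ column_group_id] by (simp add: csign_def)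

lemma specht_on_tabloids:
  assumes "v \<in> carr (specht n \<mu>)"
  shows "on_tabloids n \<mu> v"
  using assms unfolding specht_simps(3)
proof (induction rule: fs.span_induct_alt)
  case (step c x y)
  then have "on_tabloids n \<mu> x" using on_tabloids_polytabloid by auto
  then show ?case using step.IH unfolding on_tabloids_def
    by (metis add_cancel_right_left fscale_def mult_eq_0_iff plus_fun_apply)
qed (simp add: on_tabloids_def)

lemma column_antisym_act:
  "column_antisym n t v = (\<Sum>\<pi>\<in>column_group n t. fscale (csign \<pi>) (act (specht n \<mu>) \<pi> v))"
  by (simp add: column_antisym_def fun_eq_iff sum_fun_apply fscale_def)

lemma intertwiner_column_antisym:
  assumes "intertwiner (sym_group n) (specht n \<nu>) (specht n \<mu>) h" "v \<in> carr (specht n \<nu>)"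
  shows "h (column_antisym n t v) = column_antisym n t (h v)"
proof -
  interpret gmodule "sym_group n" "specht n \<nu>" by (rule specht_gmodule)
  interpret ff: vector_space_pair fscale fscale by unfold_locales
  have lin: "lin_map fscale (carr (specht n \<nu>)) fscale (carr (specht n \<mu>)) h"
    and eq: "\<And>g v. g \<in> carrier (sym_group n) \<Longrightarrow> v \<in> carr (specht n \<nu>) \<Longrightarrow>
      h (act (specht n \<nu>) g v) = act (specht n \<mu>) g (h v)"
    using assms(1) by (auto simp: intertwiner_def simp del: specht_simps(2,3))
  have \<pi>: "\<pi> \<in> carrier (sym_group n)" if "\<pi> \<in> column_group n t" for \<pi>
    using column_groupD[OF that] by (simp add: sym_group_def)
  have sub: "fs.subspace (carr (specht n \<nu>))" by simp
  have cl: "act (specht n \<nu>) \<pi> v \<in> carr (specht n \<nu>)" if "\<pi> \<in> column_group n t" for \<pi>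
    by (rule act_closed[OF \<pi>[OF that] assms(2)])
  have "h (column_antisym n t v) = (\<Sum>\<pi>\<in>column_group n t. h (fscale (csign \<pi>) (act (specht n \<nu>) \<pi> v)))"
    unfolding column_antisym_act[of n t v \<nu>]
    by (rule ff.lin_map_sum[OF lin sub]) (rule fs.subspace_scale[OF sub cl])
  also have "\<dots> = (\<Sum>\<pi>\<in>column_group n t. fscale (csign \<pi>) (act (specht n \<mu>) \<pi> (h v)))"
    by (intro sum.cong refl) (simp only: lin_mapD(3)[OF lin cl] eq[OF \<pi> assms(2)])
  finally show ?thesis unfolding column_antisym_act[of n t "h v" \<mu>] .
qed

lemma column_antisym_polytabloid:
  assumes "is_partition n \<mu>" "numbering n \<mu> t"
  shows "column_antisym n t (polytabloid n t) = fscale (of_nat (card (column_group n t))) (polytabloid n t)"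
proof -
  have "column_pairing n t (polytabloid n t) = of_nat (card (column_group n t))"
    unfolding column_pairing_def using polytabloid_own[OF assms(2)] by simp
  then show ?thesis using column_antisym_eq[OF assms on_tabloids_polytabloid[OF assms(2)]] by simp
qed

lemma card_column_group: "card (column_group n t) \<noteq> 0"
  using column_group_id[of n t] finite_column_group[of n t] by auto

text \<open>
  The hypothesis makes \<open>u\<close> orthogonal to all polytabloids for the Hermitian form in which
  tabloids are orthonormal, hence orthogonal to itself.
\<close>

lemma specht_separation:
  assumes "u \<in> carr (specht n \<mu>)" "\<And>t. numbering n \<mu> t \<Longrightarrow> column_pairing n t u = 0"
  shows "u = 0"
proof -
  define T where "T = tabloid ` {t. numbering n \<mu> t}"
  have fT: "finite T" unfolding T_def by (intro finite_imageI finite_numberings)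
  have gen: "(\<Sum>X\<in>T. u X * cnj (polytabloid n t X)) = 0" if t: "numbering n \<mu> t" for t
  proof -
    have "(\<Sum>X\<in>T. u X * cnj (polytabloid n t X)) =
        (\<Sum>X\<in>T. \<Sum>\<pi>\<in>column_group n t. csign \<pi> * (if tabloid (relabel \<pi> t) = X then u X else 0))"
      unfolding polytabloid_eq by (auto simp: sum_distrib_left csign_def intro!: sum.cong)
    also have "\<dots> = (\<Sum>\<pi>\<in>column_group n t. csign \<pi> * (\<Sum>X\<in>T. if tabloid (relabel \<pi> t) = X then u X else 0))"
      by (subst sum.swap) (simp add: sum_distrib_left)
    also have "\<dots> = (\<Sum>\<pi>\<in>column_group n t. csign \<pi> * u (tabloid (relabel \<pi> t)))"
    proof (intro sum.cong refl)
      fix \<pi> assume \<pi>: "\<pi> \<in> column_group n t"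
      have "tabloid (relabel \<pi> t) \<in> T"
        unfolding T_def using numbering_relabel[OF t column_groupD[OF \<pi>]] by simp
      then show "csign \<pi> * (\<Sum>X\<in>T. if tabloid (relabel \<pi> t) = X then u X else 0) = csign \<pi> * u (tabloid (relabel \<pi> t))"
        using fT by simp
    qed
    finally show ?thesis using assms(2)[OF t] by (simp add: column_pairing_def)
  qed
  have "(\<Sum>X\<in>T. u X * cnj (w X)) = 0" if "w \<in> carr (specht n \<mu>)" for w
    using that unfolding specht_simps(3)
  proof (induction rule: fs.span_induct_alt)
    case (step c x y)
    then obtain t where "numbering n \<mu> t" "x = polytabloid n t" by blast
    then have "(\<Sum>X\<in>T. u X * cnj (x X)) = 0" using gen by simp
    then have "(\<Sum>X\<in>T. cnj c * (u X * cnj (x X)) + u X * cnj (y X)) = 0"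
      using step.IH by (simp add: sum.distrib sum_distrib_left[symmetric])
    then show ?case by (simp add: fscale_def algebra_simps)
  qed simp
  from this[OF assms(1)] have "of_real (\<Sum>X\<in>T. (cmod (u X))\<^sup>2) = (0::complex)"
    by (simp add: complex_norm_square del: of_real_power)
  then have "(\<Sum>X\<in>T. (cmod (u X))\<^sup>2) = 0" by (simp only: of_real_eq_0_iff)
  then have "u X = 0" if "X \<in> T" for X using that fT by (simp add: sum_nonneg_eq_0_iff)
  moreover have "u X = 0" if "X \<notin> T" for X
    using specht_on_tabloids[OF assms(1)] that unfolding on_tabloids_def T_def by auto
  ultimately show ?thesis by (auto simp: fun_eq_iff)
qed

text \<open>
  By \<open>specht_separation\<close> a nonzero submodule contains an element with nonzero pairing against
  some polytabloid. Antisymmetrizing this element produces a multiple of the polytabloid, whose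
  translates span.
\<close>

lemma specht_simple:
  assumes "is_partition n \<mu>"
  shows "simple_module (sym_group n) (specht n \<mu>)"
  unfolding simple_module_def
proof (intro conjI allI impI)
  obtain t where t: "numbering n \<mu> t" using ex_numbering[OF assms] ..
  have "polytabloid n t \<noteq> 0" using polytabloid_self[OF t] by (auto dest: fun_cong[of _ _ "tabloid t"])
  then show "carr (specht n \<mu>) \<noteq> {0}" using polytabloid_in_specht[OF t] by blast
  fix U assume U: "submodule (sym_group n) (specht n \<mu>) U"
  have sub: "U \<subseteq> carr (specht n \<mu>)" "fs.subspace U"
    and inv: "\<And>g u. g permutes {1..n} \<Longrightarrow> u \<in> U \<Longrightarrow> act (specht n \<mu>) g u \<in> U"
    using U by (auto simp: submodule_def sym_group_def simp del: specht_simps(2,3))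
  show "U = {0} \<or> U = carr (specht n \<mu>)"
  proof (cases "U \<subseteq> {0}")
    case True
    then show ?thesis using fs.subspace_0[OF sub(2)] by blast
  next
    case False
    then obtain u where u: "u \<in> U" "u \<noteq> 0" by blast
    then obtain s where s: "numbering n \<mu> s" "column_pairing n s u \<noteq> 0"
      using specht_separation[of u n \<mu>] sub(1) by blast
    have "column_antisym n s u \<in> U"
      unfolding column_antisym_act[of n s u \<mu>]
      by (intro fs.subspace_sum[OF sub(2)] fs.subspace_scale[OF sub(2)] inv column_groupD u(1))
    then have "fscale (column_pairing n s u) (polytabloid n s) \<in> U"
      using column_antisym_eq[OF assms s(1) specht_on_tabloids] u(1) sub(1) by (metis subsetD)
    then have "fscale (1 / column_pairing n s u) (fscale (column_pairing n s u) (polytabloid n s)) \<in> U"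
      by (rule fs.subspace_scale[OF sub(2)])
    then have es: "polytabloid n s \<in> U" using s(2) by simp
    have "polytabloid n r \<in> U" if r: "numbering n \<mu> r" for r
    proof -
      obtain \<sigma> where \<sigma>: "\<sigma> permutes {1..n}" "relabel \<sigma> s = r" using numbering_transitive[OF s(1) r] .
      show ?thesis using inv[OF \<sigma>(1) es] unfolding polytabloid_act[OF \<sigma>(1)] \<sigma>(2) .
    qed
    then have "carr (specht n \<mu>) \<subseteq> U"
      unfolding specht_simps(3) by (intro fs.span_minimal sub(2)) auto
    then show ?thesis using sub(1) by blast
  qed
qed

text \<open>
  The column antisymmetrizer multiplies the polytabloid of \<open>t\<close> by a nonzero number and commutes
  with \<open>h\<close>; so \<open>h\<close> maps this polytabloid to a multiple of itself. Its translates span, which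
  makes \<open>h\<close> a scalar everywhere.
\<close>

lemma specht_endomorphism_scalar:
  assumes "is_partition n \<mu>" "intertwiner (sym_group n) (specht n \<mu>) (specht n \<mu>) h"
    "numbering n \<mu> t" "v \<in> carr (specht n \<mu>)"
  shows "h v = fscale (h (polytabloid n t) (tabloid t)) v"
proof -
  let ?S = "specht n \<mu>"
  have lin: "lin_map fscale (carr ?S) fscale (carr ?S) h"
    and eq: "\<And>g v. g permutes {1..n} \<Longrightarrow> v \<in> carr ?S \<Longrightarrow> h (act ?S g v) = act ?S g (h v)"
    using assms(2) by (auto simp: intertwiner_def sym_group_def simp del: specht_simps(2,3))
  let ?m = "of_nat (card (column_group n t)) :: complex"
  let ?e = "polytabloid n t"
  have et: "?e \<in> carr ?S" using polytabloid_in_specht assms(3) .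
  have "fscale ?m (h ?e) = h (column_antisym n t ?e)"
    unfolding column_antisym_polytabloid[OF assms(1,3)] lin_mapD(3)[OF lin et] ..
  also have "\<dots> = column_antisym n t (h ?e)" by (rule intertwiner_column_antisym[OF assms(2) et])
  also have "\<dots> = fscale (column_pairing n t (h ?e)) ?e"
    by (rule column_antisym_eq[OF assms(1,3) specht_on_tabloids[OF lin_mapD(1)[OF lin et]]])
  finally have m: "fscale ?m (h ?e) = fscale (column_pairing n t (h ?e)) ?e" .
  define c where "c = column_pairing n t (h ?e) / ?m"
  have m0: "?m \<noteq> 0" using card_column_group by simp
  have "fscale (1 / ?m) (fscale ?m (h ?e)) = fscale c ?e" unfolding m fs.scale_scale c_def by simp
  then have he: "h ?e = fscale c ?e" using m0 by simp
  have "h ?e (tabloid t) = c" unfolding he using polytabloid_self[OF assms(3)] by (simp add: fscale_def)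
  moreover have "v \<in> carr ?S \<and> h v = fscale c v"
    using assms(4) unfolding specht_simps(3)
  proof (induction rule: fs.span_induct_alt)
    case base
    interpret ff: vector_space_pair fscale fscale by unfold_locales
    have "h 0 = 0" by (rule ff.lin_map_zero[OF lin]) simp
    then show ?case unfolding fs.scale_zero_right using fs.span_zero by blast
  next
    case (step a x y)
    then obtain s where s: "numbering n \<mu> s" "x = polytabloid n s" by blast
    obtain \<sigma> where \<sigma>: "\<sigma> permutes {1..n}" "relabel \<sigma> t = s" using numbering_transitive[OF assms(3) s(1)] .
    have x: "x = act ?S \<sigma> ?e" unfolding polytabloid_act[OF \<sigma>(1)] \<sigma>(2) s(2) ..
    have xS: "x \<in> carr ?S" using s polytabloid_in_specht by blast
    have "h x = act ?S \<sigma> (fscale c ?e)" unfolding x eq[OF \<sigma>(1) et] he ..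
    then have hx: "h x = fscale c x" unfolding x by (simp add: fscale_def)
    have sub: "fs.subspace (carr ?S)" by simp
    have y: "y \<in> carr ?S" "h y = fscale c y" using step.IH by auto
    have ax: "fscale a x \<in> carr ?S" by (rule fs.subspace_scale[OF sub xS])
    have "h (fscale a x + y) = fscale a (h x) + h y"
      using lin_mapD(2)[OF lin ax y(1)] lin_mapD(3)[OF lin xS] by simp
    then have "h (fscale a x + y) = fscale c (fscale a x + y)"
      unfolding hx y(2) by (simp add: fs.scale_right_distrib mult.commute)
    moreover have "fscale a x + y \<in> carr ?S" by (rule fs.subspace_add[OF sub ax y(1)])
    ultimately show ?case unfolding specht_simps(3) by (rule conjI[rotated])
  qed
  ultimately show ?thesis by simp
qed

lemma specht_abs_simple: "is_partition n \<mu> \<Longrightarrow> abs_simple (sym_group n) (specht n \<mu>)"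
  unfolding abs_simple_def specht_simps(1)
  using specht_simple specht_endomorphism_scalar ex_numbering by metis

text \<open>
  The antisymmetrizer of \<open>t\<close> does not annihilate the image of the polytabloid of \<open>t\<close>, so by
  \<open>repeat_antisym_zero\<close> some tabloid of shape \<open>\<mu>\<close> has no two entries of a column of \<open>t\<close> in one
  row.
\<close>

lemma intertwiner_specht_no_repeat:
  assumes "is_partition n \<nu>" "is_partition n \<mu>"
    "intertwiner (sym_group n) (specht n \<nu>) (specht n \<mu>) h"
    "bij_betw h (carr (specht n \<nu>)) (carr (specht n \<mu>))"
  obtains t s where "numbering n \<nu> t" "numbering n \<mu> s"
    "\<forall>a\<in>{1..n}. \<forall>b\<in>{1..n}. col_of t a = col_of t b \<longrightarrow> row_of s a = row_of s b \<longrightarrow> a = b"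
proof -
  obtain t where t: "numbering n \<nu> t" using ex_numbering[OF assms(1)] ..
  interpret ff: vector_space_pair fscale fscale by unfold_locales
  let ?e = "polytabloid n t"
  have lin: "lin_map fscale (carr (specht n \<nu>)) fscale (carr (specht n \<mu>)) h"
    using assms(3) by (auto simp: intertwiner_def simp del: specht_simps(2,3))
  have et: "?e \<in> carr (specht n \<nu>)" using polytabloid_in_specht t .
  have z: "0 \<in> carr (specht n \<nu>)" using fs.span_zero by simp
  have h0: "h 0 = 0" by (rule ff.lin_map_zero[OF lin]) simp
  have "?e \<noteq> 0" using polytabloid_self[OF t] by (auto dest: fun_cong[of _ _ "tabloid t"])
  then have "h ?e \<noteq> h 0" using assms(4) et z unfolding bij_betw_def by (metis inj_onD)
  then have he: "h ?e \<noteq> 0" unfolding h0 .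
  have "column_antisym n t (h ?e) = fscale (of_nat (card (column_group n t))) (h ?e)"
    unfolding intertwiner_column_antisym[OF assms(3) et, symmetric]
      column_antisym_polytabloid[OF assms(1) t] lin_mapD(3)[OF lin et] ..
  then have "column_antisym n t (h ?e) \<noteq> 0" using he card_column_group by simp
  then show ?thesis
    by (rule column_antisym_nonzero[OF t specht_on_tabloids[OF lin_mapD(1)[OF lin et]]])
       (rule that[OF t], assumption, intro ballI impI, assumption)
qed

text \<open>
  Applied to an isomorphism and to its inverse, \<open>intertwiner_specht_no_repeat\<close> makes each of the
  two partitions dominate the other.
\<close>

lemma specht_isomorphic_eq:
  assumes "is_partition n \<nu>" "is_partition n \<mu>" "isomorphic_modules (sym_group n) (specht n \<nu>) (specht n \<mu>)"
  shows "\<nu> = \<mu>"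
proof -
  obtain h where h: "intertwiner (sym_group n) (specht n \<nu>) (specht n \<mu>) h"
    "bij_betw h (carr (specht n \<nu>)) (carr (specht n \<mu>))"
    using assms(3) unfolding isomorphic_modules_intertwiner by auto
  have "isomorphic_modules (sym_group n) (specht n \<mu>) (specht n \<nu>)"
    by (rule gmodule.isomorphic_modules_sym[OF specht_gmodule specht_gmodule assms(3)])
  then obtain k where k: "intertwiner (sym_group n) (specht n \<mu>) (specht n \<nu>) k"
    "bij_betw k (carr (specht n \<mu>)) (carr (specht n \<nu>))"
    unfolding isomorphic_modules_intertwiner by auto
  obtain t s where ts: "numbering n \<nu> t" "numbering n \<mu> s"
    "\<forall>a\<in>{1..n}. \<forall>b\<in>{1..n}. col_of t a = col_of t b \<longrightarrow> row_of s a = row_of s b \<longrightarrow> a = b"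
    by (rule intertwiner_specht_no_repeat[OF assms(1,2) h])
  obtain s' t' where ts': "numbering n \<mu> s'" "numbering n \<nu> t'"
    "\<forall>a\<in>{1..n}. \<forall>b\<in>{1..n}. col_of s' a = col_of s' b \<longrightarrow> row_of t' a = row_of t' b \<longrightarrow> a = b"
    by (rule intertwiner_specht_no_repeat[OF assms(2,1) k])
  show ?thesis
    by (rule no_repeat_both_eq[OF assms(1,2) ts(1,2) ts'(2,1) ts(3)[rule_format] ts'(3)[rule_format]])
qed

section \<open>Specht characters are real\<close>

text \<open>The inner product of the polytabloids of \<open>t\<close> and \<open>s\<close>.\<close>

definition polytabloid_gram :: "nat \<Rightarrow> tableau \<Rightarrow> tableau \<Rightarrow> complex" where
  "polytabloid_gram n t s = column_pairing n t (polytabloid n s)"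

lemma cnj_csign [simp]: "cnj (csign \<pi>) = csign \<pi>"
  by (simp add: csign_def)

lemma polytabloid_real: "cnj (polytabloid n t X) = polytabloid n t X"
  unfolding polytabloid_eq by (auto intro!: sum.cong)

lemma gram_real: "cnj (polytabloid_gram n t s) = polytabloid_gram n t s"
  by (simp add: polytabloid_gram_def column_pairing_def polytabloid_real)

lemma gram_sym: "polytabloid_gram n t s = polytabloid_gram n s t"
  unfolding polytabloid_gram_def column_pairing_def polytabloid_eq sum_distrib_left
  by (subst sum.swap) (auto intro!: sum.cong)

lemma sum_numberings_relabel:
  assumes "\<sigma> permutes {1..n}"
  shows "(\<Sum>t | numbering n \<mu> t. f (relabel \<sigma> t)) = (\<Sum>t | numbering n \<mu> t. f t)"
  by (rule sum.reindex_bij_witness[of _ "relabel (inv' \<sigma>)" "relabel \<sigma>"])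
     (simp_all only: relabel_relabel permutes_inv_o[OF assms] relabel_id mem_Collect_eq
        numbering_relabel[OF _ assms] numbering_relabel[OF _ permutes_inv[OF assms]])

lemma column_pairing_lin: "lin_map fscale S (*) UNIV (column_pairing n t)"
  by (rule lin_mapI) (simp_all add: column_pairing_def fscale_def algebra_simps sum.distrib sum_distrib_left)

text \<open>
  The sum \<open>P\<close> over all \<open>t\<close> of the rank one maps \<open>v \<mapsto> \<langle>e\<^sub>t, v\<rangle> e\<^sub>t\<close> commutes with the group. So it
  is a scalar \<open>a\<close>, which is real, and nonzero by positivity of the inner product. The trace of
  \<open>\<sigma>\<close> is then \<open>1 / a\<close> times the trace of \<open>\<sigma> P\<close>, a sum of traces of rank one maps. From this
  formula characters are seen to be real and invariant under inversion.
\<close>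

lemma specht_character_gram:
  assumes "is_partition n \<mu>"
  obtains c where "cnj c = c"
    "\<And>\<sigma>. \<sigma> permutes {1..n} \<Longrightarrow> character (sym_group n) (specht n \<mu>) \<sigma> =
      c * (\<Sum>t | numbering n \<mu> t. polytabloid_gram n t (relabel \<sigma> t))"
proof -
  let ?S = "specht n \<mu>"
  let ?N = "{t. numbering n \<mu> t}"
  interpret gmodule "sym_group n" ?S by (rule specht_gmodule)
  have fd: "fin_dim fscale (carr ?S)" using specht_fin_dim[of n \<mu>] unfolding specht_simps(1) .
  have subS: "fs.subspace (carr ?S)" by simp
  define P where "P v = (\<Sum>t\<in>?N. fscale (column_pairing n t v) (polytabloid n t))" for v
  obtain t0 where t0: "numbering n \<mu> t0" using ex_numbering[OF assms] ..
  let ?e = "polytabloid n t0"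
  have et: "polytabloid n t \<in> carr ?S" if "t \<in> ?N" for t using that polytabloid_in_specht by blast
  have lin1: "lin_map fscale (carr ?S) fscale (carr ?S) (\<lambda>v. fscale (column_pairing n t v) (polytabloid n t))" if "t \<in> ?N" for t
    by (rule lin_mapI)
       (simp_all only: fs.subspace_scale[OF subS et[OF that]] lin_mapD[OF column_pairing_lin[of UNIV n t], OF UNIV_I]
          lin_mapD(2)[OF column_pairing_lin[of UNIV n t], OF UNIV_I UNIV_I] fs.scale_left_distrib fs.scale_scale)
  have linP: "lin_map fscale (carr ?S) fscale (carr ?S) P"
    unfolding P_def[abs_def] by (rule fs.lin_map_sum_maps[OF subS lin1])
  have eqP: "P (act ?S \<sigma> v) = act ?S \<sigma> (P v)" if \<sigma>: "\<sigma> permutes {1..n}" for \<sigma> v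
  proof -
    have "P (act ?S \<sigma> v) = (\<Sum>t\<in>?N. fscale (column_pairing n (relabel \<sigma> t) (act ?S \<sigma> v)) (polytabloid n (relabel \<sigma> t)))"
      unfolding P_def by (rule sum_numberings_relabel[OF \<sigma>, symmetric])
    also have "\<dots> = (\<Sum>t\<in>?N. fscale (column_pairing n t v) (act ?S \<sigma> (polytabloid n t)))"
      unfolding polytabloid_act[OF \<sigma>] unfolding specht_simps(2) column_pairing_relabel[OF \<sigma>] ..
    also have "\<dots> = act ?S \<sigma> (P v)" by (simp add: P_def fun_eq_iff sum_fun_apply fscale_def)
    finally show ?thesis .
  qed
  have iP: "intertwiner (sym_group n) ?S ?S P"
    using linP eqP by (auto simp: intertwiner_def sym_group_def simp del: specht_simps(2,3))
  define a where "a = P ?e (tabloid t0)"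
  have Pa: "P v = fscale a v" if "v \<in> carr ?S" for v
    unfolding a_def by (rule specht_endomorphism_scalar[OF assms iP t0 that])
  have areal: "cnj a = a"
    by (simp add: a_def P_def sum_fun_apply fscale_def polytabloid_real gram_real[unfolded polytabloid_gram_def])
  have "column_pairing n t0 (P ?e) = (\<Sum>t\<in>?N. polytabloid_gram n t t0 * polytabloid_gram n t t0)"
  proof -
    interpret L: vector_space_pair fscale "(*) :: complex \<Rightarrow> _"
      by unfold_locales (auto simp: algebra_simps)
    have "column_pairing n t0 (P ?e) = (\<Sum>t\<in>?N. column_pairing n t0 (fscale (column_pairing n t ?e) (polytabloid n t)))"
      unfolding P_def by (rule L.lin_map_sum[OF column_pairing_lin[of UNIV]]; simp)
    also have "\<dots> = (\<Sum>t\<in>?N. polytabloid_gram n t t0 * polytabloid_gram n t0 t)"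
      by (simp add: lin_mapD(3)[OF column_pairing_lin[of UNIV n t0]] polytabloid_gram_def)
    finally show ?thesis by (simp add: gram_sym[of n t0])
  qed
  \<comment> \<open>a sum of squares of real numbers, with a positive term at \<open>t0\<close>\<close>
  also have "\<dots> = of_real (\<Sum>t\<in>?N. (Re (polytabloid_gram n t t0))\<^sup>2)"
  proof -
    define r where "r t = Re (polytabloid_gram n t t0)" for t
    have "polytabloid_gram n t t0 = of_real (r t)" for t
      using gram_real[of n t t0] by (simp add: complex_eq_iff r_def)
    then show ?thesis by (simp add: power2_eq_square)
  qed
  finally have pr: "column_pairing n t0 (P ?e) = of_real (\<Sum>t\<in>?N. (Re (polytabloid_gram n t t0))\<^sup>2)" .
  have "polytabloid_gram n t0 t0 = of_nat (card (column_group n t0))"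
    unfolding polytabloid_gram_def column_pairing_def using polytabloid_own[OF t0] by simp
  then have "0 < (Re (polytabloid_gram n t0 t0))\<^sup>2" using card_column_group by simp
  also have "\<dots> \<le> (\<Sum>t\<in>?N. (Re (polytabloid_gram n t t0))\<^sup>2)"
    by (rule member_le_sum) (use t0 finite_numberings in auto)
  finally have "column_pairing n t0 (P ?e) \<noteq> 0" unfolding pr of_real_eq_0_iff by (rule less_imp_neq[symmetric])
  moreover have "column_pairing n t0 (P ?e) = a * column_pairing n t0 ?e"
    using Pa[OF et] t0 lin_mapD(3)[OF column_pairing_lin[of UNIV n t0]] by simp
  ultimately have a0: "a \<noteq> 0" by auto
  have "character (sym_group n) ?S \<sigma> = 1 / a * (\<Sum>t\<in>?N. polytabloid_gram n t (relabel \<sigma> t))"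
    if \<sigma>: "\<sigma> permutes {1..n}" for \<sigma>
  proof -
    have \<sigma>': "\<sigma> \<in> carrier (sym_group n)" using \<sigma> by (simp add: sym_group_def)
    have e\<sigma>: "polytabloid n (relabel \<sigma> t) \<in> carr ?S" if "t \<in> ?N" for t
      using numbering_relabel[OF _ \<sigma>] that by (intro polytabloid_in_specht) blast
    have lin2: "lin_map fscale (carr ?S) fscale (carr ?S) (\<lambda>v. fscale (column_pairing n t v) (polytabloid n (relabel \<sigma> t)))" if "t \<in> ?N" for t
      by (rule lin_mapI)
         (simp_all only: fs.subspace_scale[OF subS e\<sigma>[OF that]] lin_mapD[OF column_pairing_lin[of UNIV n t], OF UNIV_I]
            lin_mapD(2)[OF column_pairing_lin[of UNIV n t], OF UNIV_I UNIV_I] fs.scale_left_distrib fs.scale_scale)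
    have "trace_on fscale (carr ?S) (act ?S \<sigma>) =
      trace_on fscale (carr ?S) (\<lambda>v. \<Sum>t\<in>?N. fscale (1 / a) (fscale (column_pairing n t v) (polytabloid n (relabel \<sigma> t))))"
    proof (rule fs.trace_on_cong[OF fd])
      show "lin_map fscale (carr ?S) fscale (carr ?S) (\<lambda>v. \<Sum>t\<in>?N. fscale (1 / a) (fscale (column_pairing n t v) (polytabloid n (relabel \<sigma> t))))"
        by (rule fs.lin_map_lincomb[OF subS lin2])
      fix v assume v: "v \<in> carr ?S"
      have "v = fscale (1 / a) (P v)" unfolding Pa[OF v] using a0 by simp
      then have "act ?S \<sigma> v = act ?S \<sigma> (fscale (1 / a) (P v))" by (rule arg_cong)
      also have "\<dots> = fscale (1 / a) (act ?S \<sigma> (P v))" by (simp add: fscale_def)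
      also have "act ?S \<sigma> (P v) = (\<Sum>t\<in>?N. fscale (column_pairing n t v) (polytabloid n (relabel \<sigma> t)))"
        unfolding polytabloid_act[OF \<sigma>, of \<mu>, symmetric]
        by (simp add: P_def fun_eq_iff sum_fun_apply fscale_def)
      finally show "act ?S \<sigma> v = (\<Sum>t\<in>?N. fscale (1 / a) (fscale (column_pairing n t v) (polytabloid n (relabel \<sigma> t))))"
        unfolding fs.scale_sum_right .
    qed
    also have "\<dots> = (\<Sum>t\<in>?N. 1 / a * trace_on fscale (carr ?S) (\<lambda>v. fscale (column_pairing n t v) (polytabloid n (relabel \<sigma> t))))"
      by (rule fs.trace_on_lincomb[OF fd lin2])
    also have "\<dots> = (\<Sum>t\<in>?N. 1 / a * polytabloid_gram n t (relabel \<sigma> t))"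
      unfolding polytabloid_gram_def
      by (intro sum.cong refl arg_cong2[of _ _ _ _ "(*)"] fs.trace_on_rank_one[OF fd column_pairing_lin e\<sigma>])
    finally show ?thesis
      unfolding character_trace specht_simps(1) using \<sigma>' by (simp only: if_True sum_distrib_left)
  qed
  moreover have "cnj (1 / a) = 1 / a" using areal by simp
  ultimately show ?thesis using that by blast
qed

lemma specht_character_real:
  assumes "is_partition n \<mu>"
  shows "cnj (character (sym_group n) (specht n \<mu>) \<sigma>) = character (sym_group n) (specht n \<mu>) \<sigma>"
proof (cases "\<sigma> permutes {1..n}")
  case True
  show ?thesis by (rule specht_character_gram[OF assms]) (use True in \<open>simp add: gram_real\<close>)
qed (simp add: character_trace sym_group_def)

text \<open>
  Reindex the sum in \<open>specht_character_gram\<close> by \<open>relabel \<sigma>\<close>; the Gram matrix is symmetric.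
\<close>

lemma specht_character_inv:
  assumes "is_partition n \<mu>" "\<sigma> permutes {1..n}"
  shows "character (sym_group n) (specht n \<mu>) (inv' \<sigma>) = character (sym_group n) (specht n \<mu>) \<sigma>"
proof (rule specht_character_gram[OF assms(1)])
  fix c assume c: "\<And>\<sigma>. \<sigma> permutes {1..n} \<Longrightarrow> character (sym_group n) (specht n \<mu>) \<sigma> =
      c * (\<Sum>t | numbering n \<mu> t. polytabloid_gram n t (relabel \<sigma> t))"
  have "(\<Sum>t | numbering n \<mu> t. polytabloid_gram n t (relabel (inv' \<sigma>) t)) =
      (\<Sum>t | numbering n \<mu> t. polytabloid_gram n (relabel \<sigma> t) (relabel (inv' \<sigma>) (relabel \<sigma> t)))"
    by (rule sum_numberings_relabel[OF assms(2), symmetric])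
  also have "\<dots> = (\<Sum>t | numbering n \<mu> t. polytabloid_gram n t (relabel \<sigma> t))"
    by (simp add: relabel_relabel permutes_inv_o[OF assms(2)] gram_sym[of n "relabel \<sigma> _"])
  finally show ?thesis using c[OF assms(2)] c[OF permutes_inv[OF assms(2)]] by simp
qed

section \<open>The trivial module\<close>

text \<open>There is a single tabloid with one row, and the columns have one entry each.\<close>

lemma trivial_specht_isomorphic:
  assumes "n \<ge> 1"
  shows "isomorphic_modules (sym_group n) trivial_module (specht n [n])"
proof -
  have part: "is_partition n [n]" using assms by (simp add: is_partition_def)
  obtain t where t: "numbering n [n] t" using ex_numbering[OF part] ..
  let ?e = "polytabloid n t"
  have tab: "tabloid s = [{1..n}]" if s: "numbering n [n] s" for s
  proof -
    have "length s = 1" using s by (auto simp: numbering_def shape_def)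
    then obtain r where "s = [r]" by (auto simp: length_Suc_conv)
    then show ?thesis using s by (simp add: tabloid_def numbering_def)
  qed
  have "column_group n s = {id}" if s: "numbering n [n] s" for s
  proof -
    have "\<pi> = id" if \<pi>: "\<pi> \<in> column_group n s" for \<pi>
      by (rule column_group_tabloid_inj[OF s \<pi>]) (simp only: tab[OF s] tab[OF numbering_relabel[OF s column_groupD[OF \<pi>]]])
    then show ?thesis using column_group_id[of n s] by blast
  qed
  then have poly: "polytabloid n s = ?e" if "numbering n [n] s" for s
    using that t tab by (simp add: polytabloid_eq fun_eq_iff)
  have carr: "carr (specht n [n]) = range (\<lambda>c. fscale c ?e)"
  proof -
    have "{polytabloid n s | s. numbering n [n] s} = {?e}" using poly t by blast
    then show ?thesis by (simp add: fs.span_singleton)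
  qed
  have inj: "c = d" if "fscale c ?e = fscale d ?e" for c d
    using fun_cong[OF that, of "tabloid t"] polytabloid_self[OF t] by (simp add: fscale_def)
  define h where "h c = fscale c ?e" for c
  have "bij_betw h UNIV (carr (specht n [n]))"
    unfolding carr bij_betw_def h_def[abs_def] using inj by (auto intro!: injI)
  moreover have "h c = act (specht n [n]) \<sigma> (h c)" if \<sigma>: "\<sigma> permutes {1..n}" for c \<sigma>
  proof -
    have "act (specht n [n]) \<sigma> (fscale c ?e) = fscale c (act (specht n [n]) \<sigma> ?e)" by (simp add: fscale_def)
    also have "act (specht n [n]) \<sigma> ?e = ?e"
      unfolding polytabloid_act[OF \<sigma>] by (rule poly[OF numbering_relabel[OF t \<sigma>]])
    finally show ?thesis by (simp only: h_def)
  qed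
  moreover have "h (c + d) = h c + h d" "h (c * d) = fscale c (h d)" for c d
    by (simp_all add: h_def fs.scale_left_distrib)
  ultimately show ?thesis
    unfolding isomorphic_modules_def trivial_module_def specht_simps(1)
    by (intro exI[of _ h]) (simp add: sym_group_def del: specht_simps)
qed

section \<open>Invariants of a subgroup\<close>

text \<open>
  Averaging over \<open>H\<close> is an idempotent endomorphism with the invariants of \<open>H\<close> as its image. Its
  trace is the average of the character over \<open>H\<close>, and also the dimension of the invariants.
\<close>

lemma (in gmodule) invariants_ge:
  assumes "fin_dim (smul M) (carr M)" "subgroup H G" "finite H"
    and E: "finite E" "independent E" "E \<subseteq> carr M" "\<And>h v. h \<in> H \<Longrightarrow> v \<in> E \<Longrightarrow> act M h v = v"
  obtains m where "m \<ge> card E" "(\<Sum>h\<in>H. character G M h) = of_nat (card H) * of_nat m"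
proof -
  interpret VV: vector_space_pair "smul M" "smul M" by unfold_locales
  note HG = subgroup.mem_carrier[OF assms(2)]
  let ?n = "of_nat (card H) :: complex"
  have n0: "?n \<noteq> 0" using assms(3) subgroup.one_closed[OF assms(2)] by fastforce
  define p where "p v = (\<Sum>h\<in>H. smul M (1 / ?n) (act M h v))" for v
  have lin: "lin_map (smul M) (carr M) (smul M) (carr M) p"
    unfolding p_def[abs_def] by (rule lin_map_lincomb[OF subspace_carr act_lin_map[OF HG]])
  have inv: "act M k (p v) = p v" if k: "k \<in> H" and v: "v \<in> carr M" for k v
  proof -
    have cl: "act M h v \<in> carr M" if "h \<in> H" for h using act_closed[OF HG[OF that] v] .
    have "act M k (p v) = (\<Sum>h\<in>H. act M k (smul M (1 / ?n) (act M h v)))"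
      unfolding p_def
      by (rule VV.lin_map_sum[OF act_lin_map[OF HG[OF k]] subspace_carr]) (rule subspace_scale[OF subspace_carr cl])
    also have "\<dots> = (\<Sum>h\<in>H. smul M (1 / ?n) (act M (k \<otimes> h) v))"
      by (intro sum.cong refl) (simp add: act_smul[OF HG[OF k] cl] act_mult[OF HG[OF k] HG v])
    also have "\<dots> = p v"
      unfolding p_def
      by (rule sum.reindex_bij_witness[of _ "\<lambda>h. inv k \<otimes> h" "\<lambda>h. k \<otimes> h"])
         (simp_all add: k HG m_assoc[symmetric] subgroup.m_closed[OF assms(2)] subgroup.m_inv_closed[OF assms(2)])
    finally show ?thesis .
  qed
  have fixed: "p v = v" if "\<And>h. h \<in> H \<Longrightarrow> act M h v = v" for v
  proof -
    have "p v = (\<Sum>h\<in>H. smul M (1 / ?n) v)" unfolding p_def using that by simp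
    then show ?thesis using n0 by (simp add: sum_constant_scale)
  qed
  have idem: "p (p v) = p v" if "v \<in> carr M" for v using fixed inv[OF _ that] by simp
  have sub: "E \<subseteq> p ` carr M" using fixed E(3,4) by (metis image_eqI subset_iff)
  obtain m where m: "trace_on (smul M) (carr M) p = of_nat m" "m \<ge> card E"
    by (rule trace_on_idempotent_ge[OF assms(1) lin idem E(1,2) sub])
  have "of_nat m = (\<Sum>h\<in>H. 1 / ?n * trace_on (smul M) (carr M) (act M h))"
    unfolding m(1)[symmetric] p_def[abs_def] by (rule trace_on_lincomb[OF assms(1) act_lin_map[OF HG]])
  also have "\<dots> = 1 / ?n * (\<Sum>h\<in>H. character G M h)"
    unfolding sum_distrib_left by (intro sum.cong refl) (simp add: character_trace HG)
  finally have "(\<Sum>h\<in>H. character G M h) = ?n * of_nat m" using n0 by (simp add: field_simps)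
  then show ?thesis using that m(2) by blast
qed

section \<open>Words and minimal coset representatives\<close>

abbreviation Perm :: "nat \<Rightarrow> (nat \<Rightarrow> nat) set" where
  "Perm n \<equiv> {\<sigma>. \<sigma> permutes {1..n}}"

text \<open>
  The elements of \<open>A\<close> cut \<open>1, \<dots>, n\<close> into blocks, with a cut after each of them; \<open>block A i\<close> is
  the index of the block containing \<open>i\<close>. As a word, \<open>block A\<close> is weakly increasing with steps at
  \<open>A\<close>.
\<close>

definition block :: "nat set \<Rightarrow> nat \<Rightarrow> nat" where
  "block A i = card {a \<in> A. a < i}"

text \<open>For \<open>q = block A\<close> this is the Young subgroup permuting each block of \<open>A\<close>.\<close>

definition word_stab :: "nat \<Rightarrow> (nat \<Rightarrow> 'c) \<Rightarrow> (nat \<Rightarrow> nat) set" where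
  "word_stab n q = {h \<in> Perm n. q \<circ> h = q}"

definition word_orbit :: "nat \<Rightarrow> (nat \<Rightarrow> 'c) \<Rightarrow> (nat \<Rightarrow> 'c) set" where
  "word_orbit n q = (\<lambda>\<rho>. q \<circ> \<rho>) ` Perm n"

text \<open>The character of the permutation module on the rearrangements of \<open>q\<close>.\<close>

definition fixed_words :: "nat \<Rightarrow> (nat \<Rightarrow> 'c) \<Rightarrow> (nat \<Rightarrow> nat) \<Rightarrow> nat" where
  "fixed_words n q \<tau> = card {u \<in> word_orbit n q. u \<circ> \<tau> = u}"

definition block_increasing :: "nat \<Rightarrow> nat set \<Rightarrow> (nat \<Rightarrow> nat) \<Rightarrow> bool" where
  "block_increasing n A p \<longleftrightarrow> (\<forall>i\<in>{1..<n} - A. p i \<le> p (Suc i))"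

lemma finite_Perm: "finite (Perm n)"
  by (simp add: finite_permutations)

lemma perm_cancel:
  assumes "\<sigma> permutes S"
  shows "\<sigma> \<circ> inv' \<sigma> = id" "inv' \<sigma> \<circ> \<sigma> = id" "f \<circ> \<sigma> \<circ> inv' \<sigma> = f" "f \<circ> inv' \<sigma> \<circ> \<sigma> = f"
    "\<sigma> \<circ> (inv' \<sigma> \<circ> g) = g" "inv' \<sigma> \<circ> (\<sigma> \<circ> g) = g"
  using permutes_inv_o[OF assms] by (simp_all add: comp_assoc) (simp_all add: o_assoc)

lemma perm_inv_comp: "\<sigma> permutes S \<Longrightarrow> \<tau> permutes S \<Longrightarrow> inv' (\<sigma> \<circ> \<tau>) = inv' \<tau> \<circ> inv' \<sigma>"
  by (intro o_inv_distrib permutes_bij)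

lemma block_Suc: "finite A \<Longrightarrow> block A (Suc i) = block A i + (if i \<in> A then 1 else 0)"
proof -
  assume "finite A"
  moreover have "{a \<in> A. a < Suc i} = {a \<in> A. a < i} \<union> (if i \<in> A then {i} else {})" by (auto simp: less_Suc_eq)
  ultimately show ?thesis by (auto simp: block_def)
qed

lemma block_mono: "finite A \<Longrightarrow> i \<le> j \<Longrightarrow> block A i \<le> block A j"
  unfolding block_def by (intro card_mono) auto

lemma block_eq_between:
  assumes "finite A" "block A i = block A j" "i \<le> k" "k < j"
  shows "k \<notin> A"
proof
  assume "k \<in> A"
  then have "block A k < block A (Suc k)" using block_Suc[OF assms(1)] by simp
  moreover have "block A i \<le> block A k" "block A (Suc k) \<le> block A j"
    by (rule block_mono[OF assms(1)], use assms(3,4) in simp)+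
  ultimately show False using assms(2) by simp
qed

lemma word_stab_iff: "h \<in> word_stab n q \<longleftrightarrow> h permutes {1..n} \<and> q \<circ> h = q"
  by (simp add: word_stab_def)

lemma word_stab_inv: "h \<in> word_stab n q \<Longrightarrow> inv' h \<in> word_stab n q"
  unfolding word_stab_iff by (metis perm_cancel(3) permutes_inv)

lemma word_stab_id: "id \<in> word_stab n q"
  by (simp add: word_stab_iff permutes_id)

lemma finite_word_stab: "finite (word_stab n q)"
  unfolding word_stab_def using finite_Perm by simp

lemma card_word_stab: "card (word_stab n q) > 0"
  using word_stab_id finite_word_stab by (metis card_gt_0_iff empty_iff)

lemma word_orbit_self: "q \<in> word_orbit n q"
  unfolding word_orbit_def by (rule image_eqI[of _ _ id]) (simp_all add: permutes_id)

lemma word_orbitE: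
  assumes "u \<in> word_orbit n q"
  obtains \<rho> where "\<rho> permutes {1..n}" "u = q \<circ> \<rho>"
proof -
  from assms obtain \<rho> where "u = q \<circ> \<rho>" "\<rho> \<in> Perm n" unfolding word_orbit_def by (rule imageE)
  then show ?thesis by (intro that[of \<rho>]) (simp_all only: mem_Collect_eq)
qed

lemma word_orbit_comp: "u \<in> word_orbit n q \<Longrightarrow> \<rho> permutes {1..n} \<Longrightarrow> u \<circ> \<rho> \<in> word_orbit n q"
  unfolding word_orbit_def by (auto simp: comp_assoc intro!: imageI permutes_compose)

lemma finite_word_orbit: "finite (word_orbit n q)"
  unfolding word_orbit_def using finite_Perm by simp

lemma swap_in_block_stab:
  assumes "finite A" "i \<in> {1..<n} - A"
  shows "transpose i (Suc i) \<in> word_stab n (block A)"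
proof -
  have "block A (Suc i) = block A i" using block_Suc[OF assms(1)] assms(2) by simp
  then have "block A \<circ> transpose i (Suc i) = block A" by (auto simp: fun_eq_iff transpose_def)
  moreover have "transpose i (Suc i) permutes {1..n}" by (rule permutes_swap_id) (use assms(2) in auto)
  ultimately show ?thesis by (simp add: word_stab_iff)
qed

text \<open>
  Among the rearrangements of \<open>p\<close> inside the blocks take one with the largest sum of positions
  times letters: exchanging a descent at two neighbouring positions of a block would enlarge the
  sum.
\<close>

lemma ex_block_sort:
  assumes "finite A"
  shows "\<exists>h\<in>word_stab n (block A). block_increasing n A (p \<circ> h)"
proof -
  let ?W = "\<lambda>h. \<Sum>j\<in>{1..n}. j * p (h j)"
  have "Max (?W ` word_stab n (block A)) \<in> ?W ` word_stab n (block A)"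
    by (rule Max_in) (use finite_word_stab word_stab_id in blast)+
  then obtain h where h: "h \<in> word_stab n (block A)" "?W h = Max (?W ` word_stab n (block A))" by auto
  have max: "?W k \<le> ?W h" if "k \<in> word_stab n (block A)" for k
    unfolding h(2) by (rule Max_ge) (use finite_word_stab that in blast)+
  have "p (h i) \<le> p (h (Suc i))" if i: "i \<in> {1..<n} - A" for i
  proof (rule ccontr)
    assume less: "\<not> p (h i) \<le> p (h (Suc i))"
    define \<tau> where "\<tau> = transpose i (Suc i)"
    have \<tau>: "\<tau> \<in> word_stab n (block A)" unfolding \<tau>_def by (rule swap_in_block_stab[OF assms i])
    have "h \<circ> \<tau> \<in> word_stab n (block A)"
      using h(1) \<tau> by (auto simp: word_stab_iff permutes_compose o_assoc)
    then have le: "?W (h \<circ> \<tau>) \<le> ?W h" by (rule max)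
    have split: "(\<Sum>j\<in>{1..n}. j * q j) = (\<Sum>j\<in>{1..n} - {i, Suc i}. j * q j) + (i * q i + Suc i * q (Suc i))"
      for q :: "nat \<Rightarrow> nat"
      using sum.subset_diff[of "{i, Suc i}" "{1..n}" "\<lambda>j. j * q j"] i by simp
    have "(\<Sum>j\<in>{1..n} - {i, Suc i}. j * p ((h \<circ> \<tau>) j)) = (\<Sum>j\<in>{1..n} - {i, Suc i}. j * p (h j))"
      by (intro sum.cong refl) (simp add: \<tau>_def transpose_def)
    moreover have "\<tau> i = Suc i" "\<tau> (Suc i) = i" by (simp_all add: \<tau>_def)
    ultimately show False
      using le less split[of "\<lambda>j. p (h j)"] split[of "\<lambda>j. p ((h \<circ> \<tau>) j)"] by simp
  qed
  then have "block_increasing n A (p \<circ> h)" unfolding block_increasing_def by simp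
  then show ?thesis using h(1) by (rule bexI)
qed

text \<open>
  Prefixing each letter with the index of its block turns both words into sorted words with the
  same multiset of letters.
\<close>

lemma block_sort_unique:
  assumes "finite A" "h \<in> word_stab n (block A)" "block_increasing n A p" "block_increasing n A (p \<circ> h)"
    "i \<in> {1..n}"
  shows "p (h i) = p i"
proof -
  have h: "h permutes {1..n}" "\<And>j. block A (h j) = block A j"
    using assms(2) by (auto simp: word_stab_iff fun_eq_iff)
  define N where "N = Suc (Max (p ` {1..n}))"
  have N: "p j < N" if "j \<in> {1..n}" for j using that by (simp add: N_def less_Suc_eq_le)
  \<comment> \<open>block index and letter in one number, ordered lexicographically because letters are less than
    \<open>N\<close>\<close>
  define key where "key q j = block A j * N + q j" for q j
  have sorted: "sorted (map (key q) [1..<Suc n])" if q: "block_increasing n A q" "\<And>j. j \<in> {1..n} \<Longrightarrow> q j < N" for q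
  proof -
    have "key q j \<le> key q (Suc j)" if j: "j \<in> {1..<n}" for j
    proof (cases "j \<in> A")
      case True
      then show ?thesis using block_Suc[OF assms(1), of j] q(2)[of j] j by (simp add: key_def)
    next
      case False
      then show ?thesis using block_Suc[OF assms(1), of j] q(1) j by (simp add: key_def block_increasing_def)
    qed
    then have "\<And>k. Suc k < n \<Longrightarrow> key q (Suc k) \<le> key q (Suc (Suc k))" by simp
    then show ?thesis by (simp add: sorted_iff_nth_Suc del: upt_Suc)
  qed
  have "key (p \<circ> h) = key p \<circ> h" by (simp add: fun_eq_iff key_def h(2))
  then have "mset (map (key (p \<circ> h)) [1..<Suc n]) = image_mset (key p) (image_mset h (mset [1..<Suc n]))"
    by (simp only: mset_map multiset.map_comp)
  also have "image_mset h (mset [1..<Suc n]) = mset [1..<Suc n]"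
  proof -
    have "image_mset h (mset_set {1..n}) = mset_set (h ` {1..n})"
      by (rule image_mset_mset_set[OF permutes_inj_on[OF h(1)]])
    then show ?thesis unfolding permutes_image[OF h(1)] mset_upt atLeastLessThanSuc_atLeastAtMost .
  qed
  finally have "mset (map (key (p \<circ> h)) [1..<Suc n]) = mset (map (key p) [1..<Suc n])" by (simp only: mset_map)
  then have "sort (map (key p) [1..<Suc n]) = map (key (p \<circ> h)) [1..<Suc n]"
    by (rule properties_for_sort) (rule sorted[OF assms(4)], use N permutes_in_image[OF h(1)] in simp)
  moreover have "sort (map (key p) [1..<Suc n]) = map (key p) [1..<Suc n]"
    by (rule sort_key_id_if_sorted[of "\<lambda>x. x", simplified]) (rule sorted[OF assms(3) N])
  ultimately have "map (key (p \<circ> h)) [1..<Suc n] = map (key p) [1..<Suc n]" by simp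
  moreover have "i \<in> set [1..<Suc n]" using assms(5) by (simp del: upt_Suc)
  ultimately have "key (p \<circ> h) i = key p i" unfolding map_eq_conv by (rule bspec)
  then show ?thesis by (simp add: key_def)
qed

text \<open>
  These permutations increase along each block of \<open>A\<close>: they are the representatives of minimal
  length of the left cosets of the Young subgroup.
\<close>

definition des_below :: "nat \<Rightarrow> nat set \<Rightarrow> (nat \<Rightarrow> nat) set" where
  "des_below n A = {g \<in> Perm n. perm_Des n g \<subseteq> A}"

lemma des_below_iff: "g \<in> des_below n A \<longleftrightarrow> g permutes {1..n} \<and> block_increasing n A g"
  unfolding des_below_def perm_Des_def block_increasing_def by (auto simp flip: not_less)

lemma des_below_unique:
  assumes "finite A" "g \<in> des_below n A" "g \<circ> k \<in> des_below n A" "k \<in> word_stab n (block A)"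
  shows "g \<circ> k = g"
proof
  fix i
  show "(g \<circ> k) i = g i"
  proof (cases "i \<in> {1..n}")
    case True
    then show ?thesis using block_sort_unique[OF assms(1,4) _ _ True, of g] assms(2,3) by (simp add: des_below_iff)
  next
    case False
    then show ?thesis using assms(4) by (auto simp: word_stab_iff permutes_not_in)
  qed
qed

text \<open>
  Rearrangements of the word of \<open>A\<close> correspond to cosets of the Young subgroup. Sorting a
  permutation inside the blocks yields a representative of its coset without descents in the
  blocks, and only one.
\<close>

lemma bij_des_below_words:
  assumes "finite A"
  shows "bij_betw (\<lambda>g. block A \<circ> inv' g) (des_below n A) (word_orbit n (block A))"
  unfolding bij_betw_def
proof (intro conjI inj_onI Set.set_eqI iffI)
  fix g g' assume g: "g \<in> des_below n A" "g' \<in> des_below n A" "block A \<circ> inv' g = block A \<circ> inv' g'"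
  then have p: "g permutes {1..n}" "g' permutes {1..n}" by (auto simp: des_below_iff)
  have "block A \<circ> (inv' g \<circ> g') = block A"
    using g(3) by (simp add: o_assoc perm_cancel(4)[OF p(2)])
  then have k: "inv' g \<circ> g' \<in> word_stab n (block A)"
    using p by (simp add: word_stab_iff permutes_compose permutes_inv)
  have "g \<circ> (inv' g \<circ> g') = g'" by (rule perm_cancel(5)[OF p(1)])
  then show "g = g'" using des_below_unique[OF assms g(1) _ k] g(2) by simp
next
  fix u assume "u \<in> (\<lambda>g. block A \<circ> inv' g) ` des_below n A"
  then show "u \<in> word_orbit n (block A)"
    by (auto simp: word_orbit_def des_below_iff permutes_inv)
next
  fix u assume "u \<in> word_orbit n (block A)"
  then obtain \<rho> where \<rho>: "\<rho> permutes {1..n}" "u = block A \<circ> \<rho>" by (rule word_orbitE)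
  obtain h where h: "h \<in> word_stab n (block A)" "block_increasing n A (inv' \<rho> \<circ> h)"
    using ex_block_sort[OF assms, of n "inv' \<rho>"] by blast
  have hp: "h permutes {1..n}" using h(1) by (simp add: word_stab_iff)
  have g: "inv' \<rho> \<circ> h \<in> des_below n A"
    using h \<rho>(1) hp by (simp add: des_below_iff permutes_compose permutes_inv)
  have "inv' (inv' \<rho> \<circ> h) = inv' h \<circ> \<rho>"
    by (simp add: perm_inv_comp[OF permutes_inv[OF \<rho>(1)] hp] permutes_inv_inv[OF \<rho>(1)])
  then have "u = block A \<circ> inv' (inv' \<rho> \<circ> h)"
    using word_stab_inv[OF h(1)] by (simp add: word_stab_iff o_assoc \<rho>(2))
  then show "u \<in> (\<lambda>g. block A \<circ> inv' g) ` des_below n A" using g by blast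
qed

text \<open>
  Representatives of the orbits of the Young subgroup of \<open>B\<close> on the rearrangements of the word
  of \<open>A\<close>. They index the terms in the product of two generators of the descent algebra as well
  as those in the product of two permutation characters.
\<close>

definition inc_words :: "nat \<Rightarrow> nat set \<Rightarrow> nat set \<Rightarrow> (nat \<Rightarrow> nat) set" where
  "inc_words n A B = {p \<in> word_orbit n (block A). block_increasing n B p}"

text \<open>The blocks of this set are those of \<open>B\<close>, cut further wherever \<open>p\<close> changes its letter.\<close>

definition word_cuts :: "nat \<Rightarrow> nat set \<Rightarrow> (nat \<Rightarrow> nat) \<Rightarrow> nat set" where
  "word_cuts n B p = B \<union> {i \<in> {1..<n}. p i \<noteq> p (Suc i)}"

lemma finite_inc_words: "finite (inc_words n A B)"
  unfolding inc_words_def by (rule finite_subset[OF _ finite_word_orbit]) blast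

text \<open>
  A factorization \<open>\<sigma> = g k\<close> with \<open>g\<close> increasing on the blocks of \<open>A\<close> is determined by the word
  \<open>block A \<circ> k\<close>. The positions \<open>k i\<close> and \<open>k (Suc i)\<close> are in order if and only if their blocks
  are in weak order and, in case of a descent of \<open>\<sigma>\<close> at \<open>i\<close>, are different, because \<open>g\<close>
  increases inside a block. So \<open>k\<close> increases on the blocks of \<open>B\<close> exactly if the word does and
  changes its letter at the descents of \<open>\<sigma>\<close> inside blocks of \<open>B\<close>. The left side is the
  coefficient of \<open>\<sigma>\<close> in the product of two generators of the descent algebra.
\<close>

lemma card_factorizations:
  assumes A: "finite A" and \<sigma>: "\<sigma> permutes {1..n}"
  shows "card {g \<in> des_below n A. inv' g \<circ> \<sigma> \<in> des_below n B} =
    card {p \<in> inc_words n A B. perm_Des n \<sigma> \<subseteq> word_cuts n B p}"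
proof (rule bij_betw_same_card)
  let ?F = "\<lambda>g. block A \<circ> inv' g \<circ> \<sigma>"
  have bij: "bij_betw ?F (des_below n A) (word_orbit n (block A))"
  proof -
    have "bij_betw (\<lambda>u. u \<circ> \<sigma>) (word_orbit n (block A)) (word_orbit n (block A))"
      by (rule bij_betw_byWitness[of _ "\<lambda>u. u \<circ> inv' \<sigma>"])
         (use word_orbit_comp[OF _ \<sigma>] word_orbit_comp[OF _ permutes_inv[OF \<sigma>]] in
           \<open>auto simp: perm_cancel[OF \<sigma>]\<close>)
    from bij_betw_trans[OF bij_des_below_words[OF A] this] show ?thesis by (simp add: comp_def)
  qed
  have iff: "inv' g \<circ> \<sigma> \<in> des_below n B \<longleftrightarrow> block_increasing n B (?F g) \<and> perm_Des n \<sigma> \<subseteq> word_cuts n B (?F g)"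
    if g: "g \<in> des_below n A" for g
  proof -
    have gp: "g permutes {1..n}" and gi: "block_increasing n A g" using g by (auto simp: des_below_iff)
    have gmono: "g x \<le> g y" if "x \<le> y" "block A x = block A y" "1 \<le> x" "y \<le> n" for x y
      using that
    proof (induction y rule: dec_induct)
      case (step k)
      have "block A x \<le> block A k" "block A k \<le> block A (Suc k)"
        by (rule block_mono[OF A], use step.hyps in simp)+
      then have e: "block A x = block A k" "block A k = block A (Suc k)" using step.prems by auto
      have "k \<notin> A" by (rule block_eq_between[OF A e(2)]) auto
      then have "g k \<le> g (Suc k)" using gi step by (auto simp: block_increasing_def)
      then show ?case using step.IH e(1) step.prems by simp
    qed simp
    have key: "inv' g (\<sigma> i) \<le> inv' g (\<sigma> (Suc i)) \<longleftrightarrow>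
        ?F g i \<le> ?F g (Suc i) \<and> (\<sigma> i > \<sigma> (Suc i) \<longrightarrow> ?F g i \<noteq> ?F g (Suc i))" if i: "i \<in> {1..<n}" for i
    proof -
      define x y where "x = inv' g (\<sigma> i)" and "y = inv' g (\<sigma> (Suc i))"
      have ig: "inv' g permutes {1..n}" by (rule permutes_inv[OF gp])
      have xy: "g x = \<sigma> i" "g y = \<sigma> (Suc i)" using permutes_inverses(1)[OF gp] by (auto simp: x_def y_def)
      have rng: "x \<in> {1..n}" "y \<in> {1..n}"
        using i permutes_in_image[OF \<sigma>] permutes_in_image[OF ig] by (auto simp: x_def y_def)
      have "\<sigma> i \<noteq> \<sigma> (Suc i)" using permutes_inj[OF \<sigma>] by (metis injD n_not_Suc_n)
      then have ne: "x \<noteq> y" "g x \<noteq> g y" using xy by auto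
      have main: "x \<le> y \<longleftrightarrow> block A x \<le> block A y \<and> (g x > g y \<longrightarrow> block A x \<noteq> block A y)"
      proof
        assume "x \<le> y"
        then show "block A x \<le> block A y \<and> (g x > g y \<longrightarrow> block A x \<noteq> block A y)"
          using block_mono[OF A] gmono[of x y] rng by fastforce
      next
        assume *: "block A x \<le> block A y \<and> (g x > g y \<longrightarrow> block A x \<noteq> block A y)"
        show "x \<le> y"
        proof (rule ccontr)
          assume "\<not> x \<le> y"
          then have "block A y \<le> block A x" using block_mono[OF A] by simp
          then have e: "block A y = block A x" using * by simp
          then have "g y \<le> g x" using gmono[of y x] rng \<open>\<not> x \<le> y\<close> by simp
          then show False using * e ne by simp
        qed
      qed
      have F: "?F g i = block A x" "?F g (Suc i) = block A y" by (simp_all add: x_def y_def)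
      show ?thesis unfolding F x_def[symmetric] y_def[symmetric] using main unfolding xy .
    qed
    have "inv' g \<circ> \<sigma> permutes {1..n}" using gp \<sigma> by (simp add: permutes_compose permutes_inv)
    then have "inv' g \<circ> \<sigma> \<in> des_below n B \<longleftrightarrow> (\<forall>i\<in>{1..<n} - B. inv' g (\<sigma> i) \<le> inv' g (\<sigma> (Suc i)))"
      by (simp add: des_below_iff block_increasing_def)
    also have "\<dots> \<longleftrightarrow> (\<forall>i\<in>{1..<n} - B. ?F g i \<le> ?F g (Suc i) \<and> (\<sigma> i > \<sigma> (Suc i) \<longrightarrow> ?F g i \<noteq> ?F g (Suc i)))"
      using key by simp
    also have "\<dots> \<longleftrightarrow> block_increasing n B (?F g) \<and> perm_Des n \<sigma> \<subseteq> word_cuts n B (?F g)"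
      unfolding block_increasing_def perm_Des_def word_cuts_def by blast
    finally show ?thesis .
  qed
  show "bij_betw ?F {g \<in> des_below n A. inv' g \<circ> \<sigma> \<in> des_below n B} {p \<in> inc_words n A B. perm_Des n \<sigma> \<subseteq> word_cuts n B p}"
    unfolding inc_words_def
    using iff bij_betw_Collect[OF bij, of "\<lambda>p. block_increasing n B p \<and> perm_Des n \<sigma> \<subseteq> word_cuts n B p" "\<lambda>g. inv' g \<circ> \<sigma> \<in> des_below n B"]
    by (simp add: conj_assoc)
qed

section \<open>Permutation characters on words\<close>

text \<open>
  The permutations that turn \<open>q\<close> into a given rearrangement form a coset of the stabilizer.
\<close>

lemma card_orbit_fibre:
  assumes "\<rho> permutes {1..n}"
  shows "card {\<sigma> \<in> Perm n. q \<circ> \<sigma> = q \<circ> \<rho>} = card (word_stab n q)"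
proof (rule bij_betw_same_card[symmetric])
  show "bij_betw (\<lambda>h. h \<circ> \<rho>) (word_stab n q) {\<sigma> \<in> Perm n. q \<circ> \<sigma> = q \<circ> \<rho>}"
  proof (rule bij_betw_byWitness[of _ "\<lambda>\<sigma>. \<sigma> \<circ> inv' \<rho>"])
    show "\<forall>a\<in>word_stab n q. a \<circ> \<rho> \<circ> inv' \<rho> = a" "\<forall>a\<in>{\<sigma> \<in> Perm n. q \<circ> \<sigma> = q \<circ> \<rho>}. a \<circ> inv' \<rho> \<circ> \<rho> = a"
      by (simp_all add: perm_cancel[OF assms])
    show "(\<lambda>h. h \<circ> \<rho>) ` word_stab n q \<subseteq> {\<sigma> \<in> Perm n. q \<circ> \<sigma> = q \<circ> \<rho>}"
    proof (rule image_subsetI)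
      fix h assume "h \<in> word_stab n q"
      then have h: "h permutes {1..n}" "q \<circ> h = q" by (simp_all only: word_stab_iff)
      have "q \<circ> (h \<circ> \<rho>) = q \<circ> \<rho>" by (simp only: o_assoc h(2))
      then show "h \<circ> \<rho> \<in> {\<sigma> \<in> Perm n. q \<circ> \<sigma> = q \<circ> \<rho>}" using permutes_compose[OF assms h(1)] by blast
    qed
    show "(\<lambda>\<sigma>. \<sigma> \<circ> inv' \<rho>) ` {\<sigma> \<in> Perm n. q \<circ> \<sigma> = q \<circ> \<rho>} \<subseteq> word_stab n q"
    proof (rule image_subsetI)
      fix \<sigma> assume "\<sigma> \<in> {\<sigma> \<in> Perm n. q \<circ> \<sigma> = q \<circ> \<rho>}"
      then have \<sigma>: "\<sigma> permutes {1..n}" "q \<circ> \<sigma> = q \<circ> \<rho>" by auto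
      have "q \<circ> (\<sigma> \<circ> inv' \<rho>) = q \<circ> \<rho> \<circ> inv' \<rho>" by (simp only: o_assoc \<sigma>(2))
      also have "\<dots> = q" by (rule perm_cancel(3)[OF assms])
      finally show "\<sigma> \<circ> inv' \<rho> \<in> word_stab n q"
        using permutes_compose[OF permutes_inv[OF assms] \<sigma>(1)] by (simp add: word_stab_iff)
    qed
  qed
qed

lemma conj_in_stab_iff:
  assumes "\<rho> permutes {1..n}" "\<tau> permutes {1..n}"
  shows "\<rho> \<circ> \<tau> \<circ> inv' \<rho> \<in> word_stab n q \<longleftrightarrow> q \<circ> \<rho> \<circ> \<tau> = q \<circ> \<rho>"
proof -
  have p: "\<rho> \<circ> \<tau> \<circ> inv' \<rho> permutes {1..n}"
    by (rule permutes_compose[OF permutes_inv[OF assms(1)] permutes_compose[OF assms(2,1)]])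
  have "q \<circ> (\<rho> \<circ> \<tau> \<circ> inv' \<rho>) = q \<longleftrightarrow> q \<circ> \<rho> \<circ> \<tau> = q \<circ> \<rho>"
  proof
    assume "q \<circ> (\<rho> \<circ> \<tau> \<circ> inv' \<rho>) = q"
    then have "q \<circ> \<rho> \<circ> \<tau> \<circ> inv' \<rho> \<circ> \<rho> = q \<circ> \<rho>" by (simp only: o_assoc)
    then show "q \<circ> \<rho> \<circ> \<tau> = q \<circ> \<rho>" by (simp only: perm_cancel(4)[OF assms(1)])
  next
    assume "q \<circ> \<rho> \<circ> \<tau> = q \<circ> \<rho>"
    then have "q \<circ> \<rho> \<circ> \<tau> \<circ> inv' \<rho> = q" by (simp only: perm_cancel(3)[OF assms(1)])
    then show "q \<circ> (\<rho> \<circ> \<tau> \<circ> inv' \<rho>) = q" by (simp only: o_assoc)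
  qed
  then show ?thesis using p by (simp add: word_stab_iff)
qed

text \<open>
  A permutation \<open>\<rho>\<close> conjugates \<open>\<tau>\<close> into the stabilizer of \<open>q\<close> if and only if \<open>\<tau>\<close> fixes \<open>q \<circ> \<rho>\<close>,
  and each rearrangement arises from as many \<open>\<rho>\<close> as the stabilizer has elements. This is the
  formula for an induced character.
\<close>

lemma card_stab_fixed_words:
  assumes \<tau>: "\<tau> permutes {1..n}"
  shows "card (word_stab n q) * fixed_words n q \<tau> = card {\<rho> \<in> Perm n. \<rho> \<circ> \<tau> \<circ> inv' \<rho> \<in> word_stab n q}"
proof -
  let ?O = "{u \<in> word_orbit n q. u \<circ> \<tau> = u}"
  have set: "{\<rho> \<in> Perm n. \<rho> \<circ> \<tau> \<circ> inv' \<rho> \<in> word_stab n q} = (\<Union>u\<in>?O. {\<rho> \<in> Perm n. q \<circ> \<rho> = u})"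
  proof (intro Set.set_eqI iffI)
    fix \<rho> assume "\<rho> \<in> {\<rho> \<in> Perm n. \<rho> \<circ> \<tau> \<circ> inv' \<rho> \<in> word_stab n q}"
    then have p: "\<rho> permutes {1..n}" and "\<rho> \<circ> \<tau> \<circ> inv' \<rho> \<in> word_stab n q" by (simp_all only: mem_Collect_eq)
    then have \<rho>: "\<rho> \<in> Perm n" "q \<circ> \<rho> \<circ> \<tau> = q \<circ> \<rho>" by (simp_all only: conj_in_stab_iff[OF p \<tau>] mem_Collect_eq)
    then have "q \<circ> \<rho> \<in> ?O" unfolding word_orbit_def by blast
    then show "\<rho> \<in> (\<Union>u\<in>?O. {\<rho> \<in> Perm n. q \<circ> \<rho> = u})" using \<rho>(1) by blast
  next
    fix \<rho> assume "\<rho> \<in> (\<Union>u\<in>?O. {\<rho> \<in> Perm n. q \<circ> \<rho> = u})"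
    then have p: "\<rho> permutes {1..n}" and "q \<circ> \<rho> \<circ> \<tau> = q \<circ> \<rho>" by blast+
    then show "\<rho> \<in> {\<rho> \<in> Perm n. \<rho> \<circ> \<tau> \<circ> inv' \<rho> \<in> word_stab n q}"
      by (simp only: conj_in_stab_iff[OF p \<tau>] mem_Collect_eq)
  qed
  have "card {\<rho> \<in> Perm n. \<rho> \<circ> \<tau> \<circ> inv' \<rho> \<in> word_stab n q} = (\<Sum>u\<in>?O. card {\<rho> \<in> Perm n. q \<circ> \<rho> = u})"
    unfolding set
  proof (rule card_UN_disjoint)
    show "finite ?O" by (rule finite_subset[OF _ finite_word_orbit]) blast
    show "\<forall>u\<in>?O. finite {\<rho> \<in> Perm n. q \<circ> \<rho> = u}" by (intro ballI finite_subset[OF _ finite_Perm]) blast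
  qed blast
  also have "\<dots> = (\<Sum>u\<in>?O. card (word_stab n q))"
  proof (rule sum.cong[OF refl])
    fix u assume "u \<in> ?O"
    then have "u \<in> word_orbit n q" by simp
    then obtain \<rho> where \<rho>: "\<rho> permutes {1..n}" "u = q \<circ> \<rho>" by (rule word_orbitE)
    show "card {\<rho> \<in> Perm n. q \<circ> \<rho> = u} = card (word_stab n q)" unfolding \<rho>(2) by (rule card_orbit_fibre[OF \<rho>(1)])
  qed
  also have "\<dots> = card (word_stab n q) * fixed_words n q \<tau>"
    unfolding fixed_words_def sum_constant by (simp only: of_nat_id mult.commute)
  finally show ?thesis by (rule sym)
qed

text \<open>
  By \<open>card_stab_fixed_words\<close> the permutation character depends on the word only through its
  stabilizer.
\<close>

lemma fixed_words_cong:
  assumes "\<tau> permutes {1..n}" "word_stab n q = word_stab n q'"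
  shows "fixed_words n q \<tau> = fixed_words n q' \<tau>"
proof -
  have "card (word_stab n q) * fixed_words n q \<tau> = card (word_stab n q) * fixed_words n q' \<tau>"
    using card_stab_fixed_words[OF assms(1), of q] card_stab_fixed_words[OF assms(1), of q'] assms(2) by simp
  then show ?thesis using card_word_stab[of n q] by simp
qed

text \<open>
  Frobenius reciprocity for the permutation module, by exchanging the sums in the induced
  character formula \<open>card_stab_fixed_words\<close>.
\<close>

lemma sum_fixed_words_class:
  fixes \<chi> :: "(nat \<Rightarrow> nat) \<Rightarrow> 'a::field_char_0"
  assumes "\<And>\<rho> h. \<rho> permutes {1..n} \<Longrightarrow> h permutes {1..n} \<Longrightarrow> \<chi> (\<rho> \<circ> h \<circ> inv' \<rho>) = \<chi> h"
  shows "of_nat (card (word_stab n q)) * (\<Sum>\<tau>\<in>Perm n. of_nat (fixed_words n q \<tau>) * \<chi> \<tau>) =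
    of_nat (card (Perm n)) * (\<Sum>h\<in>word_stab n q. \<chi> h)"
proof -
  let ?P = "Perm n"
  have "of_nat (card (word_stab n q)) * (\<Sum>\<tau>\<in>?P. of_nat (fixed_words n q \<tau>) * \<chi> \<tau>) =
    (\<Sum>\<tau>\<in>?P. of_nat (card {\<rho> \<in> ?P. \<rho> \<circ> \<tau> \<circ> inv' \<rho> \<in> word_stab n q}) * \<chi> \<tau>)"
    unfolding sum_distrib_left
  proof (rule sum.cong[OF refl])
    fix \<tau> assume "\<tau> \<in> ?P"
    then have \<tau>: "\<tau> permutes {1..n}" by (rule CollectD)
    show "of_nat (card (word_stab n q)) * (of_nat (fixed_words n q \<tau>) * \<chi> \<tau>) =
        of_nat (card {\<rho> \<in> ?P. \<rho> \<circ> \<tau> \<circ> inv' \<rho> \<in> word_stab n q}) * \<chi> \<tau>"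
      by (simp only: card_stab_fixed_words[OF \<tau>, symmetric] of_nat_mult mult.assoc)
  qed
  also have "\<dots> = (\<Sum>\<tau>\<in>?P. \<Sum>\<rho>\<in>?P. if \<rho> \<circ> \<tau> \<circ> inv' \<rho> \<in> word_stab n q then \<chi> \<tau> else 0)"
    using finite_Perm[of n] by (intro sum.cong refl) (simp add: sum.inter_filter[symmetric])
  also have "\<dots> = (\<Sum>\<rho>\<in>?P. \<Sum>\<tau>\<in>?P. if \<rho> \<circ> \<tau> \<circ> inv' \<rho> \<in> word_stab n q then \<chi> \<tau> else 0)"
    by (rule sum.swap)
  also have "\<dots> = (\<Sum>\<rho>\<in>?P. \<Sum>h\<in>?P. if h \<in> word_stab n q then \<chi> h else 0)"
  proof (rule sum.cong[OF refl])
    fix \<rho> assume "\<rho> \<in> ?P"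
    then have \<rho>: "\<rho> permutes {1..n}" by simp
    show "(\<Sum>\<tau>\<in>?P. if \<rho> \<circ> \<tau> \<circ> inv' \<rho> \<in> word_stab n q then \<chi> \<tau> else 0) = (\<Sum>h\<in>?P. if h \<in> word_stab n q then \<chi> h else 0)"
    proof (rule sum.reindex_bij_witness[of _ "\<lambda>h. inv' \<rho> \<circ> h \<circ> \<rho>" "\<lambda>\<tau>. \<rho> \<circ> \<tau> \<circ> inv' \<rho>"])
      fix a assume a: "a \<in> ?P"
      show "inv' \<rho> \<circ> (\<rho> \<circ> a \<circ> inv' \<rho>) \<circ> \<rho> = a" "\<rho> \<circ> (inv' \<rho> \<circ> a \<circ> \<rho>) \<circ> inv' \<rho> = a"
        using permutes_inverses[OF \<rho>] by (simp_all add: fun_eq_iff)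
      show "\<rho> \<circ> a \<circ> inv' \<rho> \<in> ?P" "inv' \<rho> \<circ> a \<circ> \<rho> \<in> ?P"
        using \<rho> a permutes_inv[OF \<rho>] by (auto intro!: permutes_compose simp del: o_apply)
      show "(if \<rho> \<circ> a \<circ> inv' \<rho> \<in> word_stab n q then \<chi> (\<rho> \<circ> a \<circ> inv' \<rho>) else 0) =
          (if \<rho> \<circ> a \<circ> inv' \<rho> \<in> word_stab n q then \<chi> a else 0)"
        using assms[OF \<rho>, of a] a by simp
    qed
  qed
  also have "\<dots> = of_nat (card ?P) * (\<Sum>h\<in>word_stab n q. \<chi> h)"
    using finite_Perm[of n] by (simp add: sum.inter_filter[symmetric] word_stab_def)
  finally show ?thesis .
qed

lemma sum_fixed_words: "(\<Sum>\<tau>\<in>Perm n. fixed_words n q \<tau>) = card (Perm n)"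
proof -
  have "real (card (word_stab n q)) * (\<Sum>\<tau>\<in>Perm n. real (fixed_words n q \<tau>)) = real (card (Perm n)) * real (card (word_stab n q))"
    using sum_fixed_words_class[of n "\<lambda>_. 1::real" q] by simp
  then have "real (\<Sum>\<tau>\<in>Perm n. fixed_words n q \<tau>) = real (card (Perm n))" using card_word_stab[of n q] by simp
  then show ?thesis by (simp only: of_nat_eq_iff)
qed

text \<open>
  Along a block of \<open>B\<close> the word \<open>p\<close> increases weakly, so two positions in the block carry the
  same letter if and only if no change of letter separates them.
\<close>

lemma refined_word_stab:
  assumes B: "finite B" and p: "p \<in> inc_words n A B"
  shows "word_stab n (\<lambda>i. (p i, block B i)) = word_stab n (block (word_cuts n B p))"
proof -
  let ?C = "word_cuts n B p"
  have C: "finite ?C" using B by (simp add: word_cuts_def)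
  have pinc: "block_increasing n B p" using p by (simp add: inc_words_def)
  have eq: "block ?C i = block ?C j \<longleftrightarrow> p i = p j \<and> block B i = block B j"
    if ij: "i \<in> {1..n}" "j \<in> {1..n}" "i \<le> j" for i j
    using ij(3,2)
  proof (induction j rule: dec_induct)
    case (step k)
    have k: "k \<in> {1..<n}" "k \<in> {1..n}" using step ij(1) by auto
    note IH = step.IH[OF k(2)]
    have mono: "block ?C i \<le> block ?C k" "block B i \<le> block B k" "block B k \<le> block B (Suc k)"
      using step.hyps by (auto intro!: block_mono C B)
    show ?case
    proof (cases "k \<in> ?C")
      case True
      then have "block ?C (Suc k) = Suc (block ?C k)" using block_Suc[OF C] by simp
      then have l: "block ?C i \<noteq> block ?C (Suc k)" using mono(1) by simp
      have "\<not> (p i = p (Suc k) \<and> block B i = block B (Suc k))"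
      proof
        assume *: "p i = p (Suc k) \<and> block B i = block B (Suc k)"
        then have "k \<notin> B" using mono block_Suc[OF B, of k] by auto
        then have ne: "p k \<noteq> p (Suc k)" using True by (simp add: word_cuts_def)
        have "p i \<le> p k"
        proof -
          have "p i \<le> p m" if "i \<le> m" "m \<le> k" for m
            using that
          proof (induction m rule: dec_induct)
            case (step l)
            have "l \<notin> B" by (rule block_eq_between[OF B _ step(1), of "Suc k"]) (use * step in auto)
            then have "p l \<le> p (Suc l)" using pinc step k ij(1) by (simp add: block_increasing_def)
            then show ?case using step by simp
          qed simp
          then show ?thesis using step.hyps by simp
        qed
        moreover have "p k \<le> p (Suc k)" using pinc k \<open>k \<notin> B\<close> by (simp add: block_increasing_def)
        ultimately show False using * ne by simp
      qed
      then show ?thesis using l by simp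
    next
      case False
      then have "k \<notin> B" "p k = p (Suc k)" using k by (auto simp: word_cuts_def)
      then show ?thesis using IH block_Suc[OF C, of k] block_Suc[OF B, of k] False by simp
    qed
  qed simp
  have eq': "block ?C i = block ?C j \<longleftrightarrow> p i = p j \<and> block B i = block B j"
    if "i \<in> {1..n}" "j \<in> {1..n}" for i j
    using eq[OF that] eq[OF that(2,1)] by (cases "i \<le> j") auto
  show ?thesis
  proof (rule Set.set_eqI)
    fix h
    show "h \<in> word_stab n (\<lambda>i. (p i, block B i)) \<longleftrightarrow> h \<in> word_stab n (block ?C)"
    proof (cases "h permutes {1..n}")
      case True
      have "p (h i) = p i \<and> block B (h i) = block B i \<longleftrightarrow> block ?C (h i) = block ?C i" for i
      proof (cases "i \<in> {1..n}")
        case i: True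
        then have "h i \<in> {1..n}" using permutes_in_image[OF True] by simp
        then show ?thesis using eq'[OF _ i] by simp
      qed (simp add: permutes_not_in[OF True])
      then show ?thesis using True by (simp add: word_stab_iff fun_eq_iff)
    qed (simp add: word_stab_iff)
  qed
qed

lemma nonemptyE: "S \<noteq> {} \<Longrightarrow> (\<And>x. x \<in> S \<Longrightarrow> P) \<Longrightarrow> P"
  by blast

text \<open>
  A pair of fixed rearrangements is a fixed word in pairs of letters. Bringing the second word
  into the form \<open>block B\<close> and then sorting the first inside the blocks of \<open>B\<close> shows that each
  orbit of pairs contains exactly one word of pairs \<open>(p i, block B i)\<close> with \<open>p\<close> in
  \<open>inc_words n A B\<close>; by \<open>refined_word_stab\<close> its permutation character is that of
  \<open>word_cuts n B p\<close>.
\<close>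

lemma fixed_words_product:
  assumes A: "finite A" and B: "finite B" and \<tau>: "\<tau> permutes {1..n}"
  shows "fixed_words n (block A) \<tau> * fixed_words n (block B) \<tau> =
    (\<Sum>p\<in>inc_words n A B. fixed_words n (block (word_cuts n B p)) \<tau>)"
proof -
  define q where "q p i = (p i, block B i)" for p :: "nat \<Rightarrow> nat" and i
  let ?I = "inc_words n A B"
  let ?U = "{u \<in> word_orbit n (block A). u \<circ> \<tau> = u}" and ?V = "{v \<in> word_orbit n (block B). v \<circ> \<tau> = v}"
  have pair: "bij_betw (\<lambda>(u, v) i. (u i, v i)) (?U \<times> ?V) (\<Union>p\<in>?I. {w \<in> word_orbit n (q p). w \<circ> \<tau> = w})"
  proof (rule bij_betw_byWitness[of _ "\<lambda>w. (fst \<circ> w, snd \<circ> w)"])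
    show "(\<lambda>(u, v) i. (u i, v i)) ` (?U \<times> ?V) \<subseteq> (\<Union>p\<in>?I. {w \<in> word_orbit n (q p). w \<circ> \<tau> = w})"
    proof (rule image_subsetI, clarify)
      fix u v assume u: "u \<in> word_orbit n (block A)" "u \<circ> \<tau> = u" and v: "v \<in> word_orbit n (block B)" "v \<circ> \<tau> = v"
      obtain \<rho> where \<rho>: "\<rho> permutes {1..n}" "v = block B \<circ> \<rho>" using v(1) by (rule word_orbitE)
      obtain h where h: "h \<in> word_stab n (block B)" "block_increasing n B (u \<circ> inv' \<rho> \<circ> h)"
        using ex_block_sort[OF B, of n "u \<circ> inv' \<rho>"] by blast
      have hp: "h permutes {1..n}" using h(1) by (simp add: word_stab_iff)
      define p where "p = u \<circ> inv' \<rho> \<circ> h"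
      have "p \<in> word_orbit n (block A)"
        unfolding p_def by (intro word_orbit_comp u(1) permutes_inv \<rho>(1) hp)
      then have pI: "p \<in> ?I" using h(2) by (simp add: inc_words_def p_def)
      have "p \<circ> (inv' h \<circ> \<rho>) = u"
        by (simp add: p_def o_assoc perm_cancel[OF hp] perm_cancel[OF \<rho>(1)])
      moreover have "block B \<circ> (inv' h \<circ> \<rho>) = v"
        using word_stab_inv[OF h(1)] by (simp add: o_assoc \<rho>(2) word_stab_iff)
      ultimately have "(\<lambda>i. (u i, v i)) = q p \<circ> (inv' h \<circ> \<rho>)" by (auto simp: q_def fun_eq_iff)
      then have "(\<lambda>i. (u i, v i)) \<in> word_orbit n (q p)"
        unfolding word_orbit_def using permutes_compose[OF \<rho>(1) permutes_inv[OF hp]] by blast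
      moreover have "(\<lambda>i. (u i, v i)) \<circ> \<tau> = (\<lambda>i. (u i, v i))" using u(2) v(2) by (auto simp: fun_eq_iff)
      ultimately show "(\<lambda>i. (u i, v i)) \<in> (\<Union>p\<in>?I. {w \<in> word_orbit n (q p). w \<circ> \<tau> = w})" using pI by blast
    qed
    show "(\<lambda>w. (fst \<circ> w, snd \<circ> w)) ` (\<Union>p\<in>?I. {w \<in> word_orbit n (q p). w \<circ> \<tau> = w}) \<subseteq> ?U \<times> ?V"
    proof (rule image_subsetI)
      fix w assume "w \<in> (\<Union>p\<in>?I. {w \<in> word_orbit n (q p). w \<circ> \<tau> = w})"
      then obtain p \<rho> where p: "p \<in> word_orbit n (block A)" and \<rho>: "\<rho> permutes {1..n}" "w = q p \<circ> \<rho>" and w: "w \<circ> \<tau> = w"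
      proof -
        obtain p where p: "p \<in> ?I" "w \<in> word_orbit n (q p)" "w \<circ> \<tau> = w"
          using \<open>w \<in> (\<Union>p\<in>?I. {w \<in> word_orbit n (q p). w \<circ> \<tau> = w})\<close> by (elim UN_E CollectE conjE)
        obtain \<rho> where "\<rho> permutes {1..n}" "w = q p \<circ> \<rho>" using p(2) by (rule word_orbitE)
        moreover have "p \<in> word_orbit n (block A)" using p(1) by (simp add: inc_words_def)
        ultimately show thesis using p(3) by (intro that)
      qed
      have "fst \<circ> w = p \<circ> \<rho>" "snd \<circ> w = block B \<circ> \<rho>" by (auto simp: \<rho>(2) q_def fun_eq_iff)
      then have "fst \<circ> w \<in> word_orbit n (block A)" "snd \<circ> w \<in> word_orbit n (block B)"
        using word_orbit_comp[OF p \<rho>(1)] word_orbit_comp[OF word_orbit_self \<rho>(1)] by auto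
      then show "(fst \<circ> w, snd \<circ> w) \<in> ?U \<times> ?V" using w by (auto simp: comp_assoc)
    qed
  qed auto
  have disj: "p = p'" if pI: "p \<in> ?I" "p' \<in> ?I" and w: "w \<in> word_orbit n (q p)" "w \<in> word_orbit n (q p')" for p p' w
  proof -
    obtain \<rho> where \<rho>1: "\<rho> permutes {1..n}" "w = q p \<circ> \<rho>" using w(1) by (rule word_orbitE)
    obtain \<rho>' where \<rho>2: "\<rho>' permutes {1..n}" "w = q p' \<circ> \<rho>'" using w(2) by (rule word_orbitE)
    note \<rho> = \<rho>1(1) \<rho>2(1) \<rho>1(2) \<rho>2(2)
    define h where "h = \<rho> \<circ> inv' \<rho>'"
    have hp: "h permutes {1..n}" unfolding h_def by (intro permutes_compose permutes_inv \<rho>)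
    have "q p \<circ> \<rho> \<circ> inv' \<rho>' = q p' \<circ> \<rho>' \<circ> inv' \<rho>'" unfolding \<rho>(3)[symmetric] \<rho>(4)[symmetric] ..
    also have "\<dots> = q p'" by (rule perm_cancel(3)[OF \<rho>(2)])
    finally have "q p \<circ> \<rho> \<circ> inv' \<rho>' = q p'" .
    then have qh: "q p \<circ> h = q p'" unfolding h_def o_assoc .
    have ph: "p (h i) = p' i" and bh: "block B (h i) = block B i" for i
      using fun_cong[OF qh, of i] by (simp_all add: q_def)
    have hs: "h \<in> word_stab n (block B)" using hp bh by (simp add: word_stab_iff fun_eq_iff)
    have inc: "block_increasing n B p" "block_increasing n B p'" using pI by (simp_all add: inc_words_def)
    have comp: "p \<circ> h = p'" by (rule ext) (simp add: ph)
    have "p (h i) = p i" for i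
    proof (cases "i \<in> {1..n}")
      case True
      show ?thesis by (rule block_sort_unique[OF B hs inc(1) inc(2)[folded comp] True])
    next
      case False
      show ?thesis unfolding permutes_not_in[OF hp False] ..
    qed
    then show "p = p'" unfolding ph by (intro ext) (rule sym)
  qed
  have "fixed_words n (block A) \<tau> * fixed_words n (block B) \<tau> = card (?U \<times> ?V)"
    by (simp add: fixed_words_def card_cartesian_product)
  also have "\<dots> = card (\<Union>p\<in>?I. {w \<in> word_orbit n (q p). w \<circ> \<tau> = w})"
    by (rule bij_betw_same_card[OF pair])
  also have "\<dots> = (\<Sum>p\<in>?I. card {w \<in> word_orbit n (q p). w \<circ> \<tau> = w})"
  proof (rule card_UN_disjoint)
    show "finite ?I" by (rule finite_inc_words)
    show "\<forall>p\<in>?I. finite {w \<in> word_orbit n (q p). w \<circ> \<tau> = w}"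
      by (intro ballI finite_subset[OF _ finite_word_orbit]) (rule Collect_restrict)
    show "\<forall>p\<in>?I. \<forall>p'\<in>?I. p \<noteq> p' \<longrightarrow> {w \<in> word_orbit n (q p). w \<circ> \<tau> = w} \<inter> {w \<in> word_orbit n (q p'). w \<circ> \<tau> = w} = {}"
    proof (intro ballI impI, rule ccontr)
      fix p p' assume pp: "p \<in> ?I" "p' \<in> ?I" "p \<noteq> p'"
        and "{w \<in> word_orbit n (q p). w \<circ> \<tau> = w} \<inter> {w \<in> word_orbit n (q p'). w \<circ> \<tau> = w} \<noteq> {}"
      then obtain w where "w \<in> word_orbit n (q p)" "w \<in> word_orbit n (q p')"
        by (elim nonemptyE IntE CollectE conjE)
      then show False using disj[OF pp(1,2)] pp(3) by simp
    qed
  qed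
  also have "\<dots> = (\<Sum>p\<in>?I. fixed_words n (block (word_cuts n B p)) \<tau>)"
  proof (rule sum.cong[OF refl])
    fix p assume p: "p \<in> ?I"
    have "word_stab n (q p) = word_stab n (block (word_cuts n B p))"
      using refined_word_stab[OF B p] by (simp add: q_def[abs_def])
    then show "card {w \<in> word_orbit n (q p). w \<circ> \<tau> = w} = fixed_words n (block (word_cuts n B p)) \<tau>"
      unfolding fixed_words_def[symmetric] by (rule fixed_words_cong[OF \<tau>])
  qed
  finally show ?thesis .
qed

text \<open>
  The square of the permutation character is a sum of permutation characters of transitive
  actions, each of average value one. The number of terms is given by \<open>card_factorizations\<close> at
  the identity.
\<close>

lemma fixed_words_norm:
  assumes "finite A"
  shows "(\<Sum>\<tau>\<in>Perm n. fixed_words n (block A) \<tau> * fixed_words n (block A) \<tau>) =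
    card (Perm n) * card {g \<in> des_below n A. inv' g \<in> des_below n A}"
proof -
  have "perm_Des n id = {}" by (simp add: perm_Des_def)
  then have c: "card {g \<in> des_below n A. inv' g \<in> des_below n A} = card (inc_words n A A)"
    using card_factorizations[OF assms permutes_id, of n A] by simp
  have "(\<Sum>\<tau>\<in>Perm n. fixed_words n (block A) \<tau> * fixed_words n (block A) \<tau>) =
      (\<Sum>\<tau>\<in>Perm n. \<Sum>p\<in>inc_words n A A. fixed_words n (block (word_cuts n A p)) \<tau>)"
    by (intro sum.cong refl fixed_words_product assms) simp
  also have "\<dots> = (\<Sum>p\<in>inc_words n A A. card (Perm n))"
    by (subst sum.swap) (simp only: sum_fixed_words)
  finally show ?thesis by (simp add: c)
qed

lemma word_stab_subgroup: "subgroup (word_stab n q) (sym_group n)"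
proof
  show "word_stab n q \<subseteq> carrier (sym_group n)" by (auto simp: word_stab_iff sym_group_def)
  show "x \<otimes>\<^bsub>sym_group n\<^esub> y \<in> word_stab n q" if "x \<in> word_stab n q" "y \<in> word_stab n q" for x y
  proof -
    have xy: "x permutes {1..n}" "y permutes {1..n}" "q \<circ> x = q" "q \<circ> y = q"
      using that by (simp_all only: word_stab_iff)
    have "q \<circ> (x \<circ> y) = q" by (simp only: o_assoc xy)
    then show ?thesis unfolding sym_group_mult word_stab_iff using permutes_compose[OF xy(2,1)] by (rule conjI[rotated])
  qed
  show "\<one>\<^bsub>sym_group n\<^esub> \<in> word_stab n q" by (simp add: sym_group_def word_stab_id)
  show "inv\<^bsub>sym_group n\<^esub> x \<in> word_stab n q" if "x \<in> word_stab n q" for x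
  proof -
    have "x permutes {1..n}" using that by (simp only: word_stab_iff)
    then have "inv\<^bsub>sym_group n\<^esub> x = inv' x" by (rule sym_group_inv)
    then show ?thesis using word_stab_inv[OF that] by simp
  qed
qed

lemma fixed_words_empty: "fixed_words n (block {}) \<tau> = 1"
proof -
  have b: "block {} i = 0" for i by (simp add: block_def)
  have "{u \<in> word_orbit n (block {}). u \<circ> \<tau> = u} = {block {}}"
  proof (intro equalityI subsetI singletonI CollectI conjI)
    fix u assume "u \<in> {u \<in> word_orbit n (block {}). u \<circ> \<tau> = u}"
    then have "u \<in> word_orbit n (block {})" by simp
    then obtain \<rho> where "u = block {} \<circ> \<rho>" by (rule word_orbitE)
    then have "u = block {}" by (intro ext) (simp add: b)
    then show "u \<in> {block {}}" by simp
  next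
    fix u assume "u \<in> {block {}}"
    then have u: "u = block {}" by simp
    show "u \<in> word_orbit n (block {})" unfolding u by (rule word_orbit_self)
    show "u \<circ> \<tau> = u" unfolding u by (intro ext) (simp add: b)
  qed
  then show ?thesis by (simp add: fixed_words_def)
qed

lemma des_below_empty: "des_below n {} = {id}"
proof -
  have "g = id" if g: "g \<in> des_below n {}" for g
  proof -
    have gp: "g permutes {1..n}" using g by (simp add: des_below_iff)
    have "g \<in> word_stab n (block {})" using gp by (simp add: word_stab_iff block_def fun_eq_iff)
    moreover have "id \<in> des_below n {}" by (simp add: des_below_def perm_Des_def permutes_id)
    ultimately have "id \<circ> g = id" using g by (intro des_below_unique[of "{}"]) auto
    then show ?thesis by simp
  qed
  moreover have "id \<in> des_below n {}" by (simp add: des_below_def perm_Des_def permutes_id)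
  ultimately show ?thesis by blast
qed

section \<open>Robinson-Schensted insertion\<close>

text \<open>The condition for \<open>s\<close> to be the row above \<open>r\<close> in a tableau with increasing columns.\<close>

definition fits :: "nat list \<Rightarrow> nat list \<Rightarrow> bool" where
  "fits r s \<longleftrightarrow> length s \<le> length r \<and> (\<forall>j<length s. r ! j < s ! j)"

text \<open>
  Standardness in a form that suits recursion over rows, for tableaux with arbitrary entries.
\<close>

fun standard :: "tableau \<Rightarrow> bool" where
  "standard [] \<longleftrightarrow> True"
| "standard (r # t) \<longleftrightarrow> r \<noteq> [] \<and> sorted_wrt (<) r \<and> standard t \<and> (t \<noteq> [] \<longrightarrow> fits r (hd t))"

lemma all_nat_cases: "(\<forall>i. P i) \<longleftrightarrow> P 0 \<and> (\<forall>i. P (Suc i))"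
  by (metis not0_implies_Suc)

lemma standard_iff:
  "standard t \<longleftrightarrow> (\<forall>i<length t. t ! i \<noteq> [] \<and> sorted_wrt (<) (t ! i)) \<and>
     (\<forall>i. Suc i < length t \<longrightarrow> fits (t ! i) (t ! Suc i))"
proof (induction t)
  case (Cons r t)
  have fst_fits: "(t \<noteq> [] \<longrightarrow> fits r (hd t)) \<longleftrightarrow> (0 < length t \<longrightarrow> fits r (t ! 0))"
    by (auto simp: hd_conv_nth)
  have split: "(\<forall>i. Suc i < length (r # t) \<longrightarrow> fits ((r # t) ! i) ((r # t) ! Suc i)) \<longleftrightarrow>
      (0 < length t \<longrightarrow> fits r (t ! 0)) \<and> (\<forall>i. Suc i < length t \<longrightarrow> fits (t ! i) (t ! Suc i))"
    by (subst all_nat_cases) simp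
  show ?case unfolding split using Cons fst_fits by (simp add: All_less_Suc2) blast
qed simp

lemma row_insert_None:
  "row_insert x r = (r', None) \<Longrightarrow> r' = r @ [x] \<and> (\<forall>z\<in>set r. \<not> x < z)"
  by (induction r arbitrary: r') (auto split: if_splits prod.splits)

lemma row_insert_Some:
  "row_insert x r = (r', Some y) \<Longrightarrow>
    \<exists>r1 r2. r = r1 @ y # r2 \<and> r' = r1 @ x # r2 \<and> x < y \<and> (\<forall>z\<in>set r1. \<not> x < z)"
proof (induction r arbitrary: r')
  case (Cons z r)
  show ?case
  proof (cases "x < z")
    case True
    then show ?thesis using Cons.prems by (intro exI[of _ "[]"] exI[of _ r]) auto
  next
    case False
    then obtain s where s: "row_insert x r = (s, Some y)" "r' = z # s"
      using Cons.prems by (auto split: prod.splits)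
    obtain r1 r2 where "r = r1 @ y # r2 \<and> s = r1 @ x # r2 \<and> x < y \<and> (\<forall>z\<in>set r1. \<not> x < z)"
      using Cons.IH[OF s(1)] by (elim exE)
    then show ?thesis using False s(2) by (intro exI[of _ "z # r1"] exI[of _ r2]) simp
  qed
qed simp

lemma tab_insert_cases:
  assumes "tab_insert x P = (P', i)"
  obtains (empty) "P = []" "P' = [[x]]" "i = 0"
  | (append) r rs where "P = r # rs" "P' = (r @ [x]) # rs" "i = 0" "\<forall>z\<in>set r. \<not> x < z"
  | (bump) r1 y r2 rs rs' j where "P = (r1 @ y # r2) # rs" "P' = (r1 @ x # r2) # rs'" "i = Suc j"
      "x < y" "\<forall>z\<in>set r1. \<not> x < z" "tab_insert y rs = (rs', j)"
      "row_insert x (r1 @ y # r2) = (r1 @ x # r2, Some y)"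
proof (cases P)
  case Nil
  then show ?thesis using assms by (intro empty) auto
next
  case (Cons r rs)
  obtain r' b where rb: "row_insert x r = (r', b)" by (cases "row_insert x r")
  show ?thesis
  proof (cases b)
    case None
    then have "P' = r' # rs" "i = 0" using assms Cons rb by auto
    then show ?thesis using append[of r rs] row_insert_None rb None Cons by blast
  next
    case (Some y)
    obtain rs' j where rj: "tab_insert y rs = (rs', j)" by (cases "tab_insert y rs")
    have P': "P' = r' # rs'" "i = Suc j" using assms Cons rb Some rj by auto
    obtain r1 r2 where r: "r = r1 @ y # r2 \<and> r' = r1 @ x # r2 \<and> x < y \<and> (\<forall>z\<in>set r1. \<not> x < z)"
      using row_insert_Some[of x r r' y] rb Some by auto
    show ?thesis by (rule bump[of r1 y r2 rs rs' j]) (use r Cons P' rj rb Some in simp_all)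
  qed
qed

lemma tab_insert_mset: "tab_insert x P = (P', i) \<Longrightarrow> mset (concat P') = add_mset x (mset (concat P))"
proof (induction P arbitrary: x P' i)
  case (Cons s t)
  from Cons.prems show ?case
  proof (cases rule: tab_insert_cases)
    case (bump r1 y r2 rs rs' j)
    then show ?thesis using Cons.IH[of y rs' j] by simp
  qed simp_all
qed simp

lemma tab_insert_set: "tab_insert x P = (P', i) \<Longrightarrow> set (concat P') = insert x (set (concat P))"
  using tab_insert_mset[of x P P' i] by (metis set_mset_add_mset_insert set_mset_mset)

definition inc_shape :: "nat \<Rightarrow> nat list \<Rightarrow> nat list" where
  "inc_shape i \<mu> = (if i < length \<mu> then \<mu>[i := Suc (\<mu> ! i)] else \<mu> @ [1])"

lemma inc_shape_Cons: "inc_shape 0 (m # \<mu>) = Suc m # \<mu>" "inc_shape (Suc i) (m # \<mu>) = m # inc_shape i \<mu>"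
  by (auto simp: inc_shape_def)

lemma tab_insert_shape: "tab_insert x P = (P', i) \<Longrightarrow> shape P' = inc_shape i (shape P) \<and> i \<le> length P"
proof (induction P arbitrary: x P' i)
  case Nil
  then show ?case by (auto simp: shape_def inc_shape_def)
next
  case (Cons s t)
  from Cons.prems show ?case
  proof (cases rule: tab_insert_cases)
    case (bump r1 y r2 rs rs' j)
    then show ?thesis using Cons.IH[of y rs' j] by (simp add: shape_def inc_shape_Cons)
  qed (simp_all add: shape_def inc_shape_Cons)
qed

lemma shape_length: "shape P = shape Q \<Longrightarrow> length P = length Q"
  unfolding shape_def by (rule map_eq_imp_length_eq)

lemma add_box_shape: "shape (add_box i k Q) = inc_shape i (shape Q)"
  by (simp add: add_box_def shape_def inc_shape_def map_update)

text \<open>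
  An entry \<open>y\<close> bumped from position \<open>p\<close> meets a larger entry in row \<open>s\<close> at \<open>p\<close>, if there is one,
  so it is inserted at \<open>p\<close> or to the left, where all entries below are smaller than \<open>y\<close> once \<open>x\<close>
  has replaced it.
\<close>

lemma fits_insert:
  assumes f: "fits (r1 @ y # r2) s" and xy: "x < y" and r1: "\<forall>z\<in>set r1. z < y"
    and ins: "row_insert y s = (s', b)"
  shows "fits (r1 @ x # r2) s'"
proof -
  let ?r = "r1 @ y # r2" and ?r' = "r1 @ x # r2" and ?p = "length r1"
  have len: "length s \<le> length ?r" and lt: "\<And>j. j < length s \<Longrightarrow> ?r ! j < s ! j" using f by (auto simp: fits_def)
  have le: "?r' ! j \<le> ?r ! j" for j using xy by (auto simp: nth_append nth_Cons')
  have low: "?r' ! j < y" if "j \<le> ?p" for j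
    using that xy r1 by (cases "j = ?p") (auto simp: nth_append)
  show ?thesis
  proof (cases b)
    case None
    then have s': "s' = s @ [y]" "\<forall>z\<in>set s. \<not> y < z" using row_insert_None[of y s s'] ins by auto
    have "length s \<le> ?p"
    proof (rule ccontr)
      assume *: "\<not> length s \<le> ?p"
      then have "y < s ! ?p" using lt[of ?p] by simp
      then show False using s'(2) * by simp
    qed
    then show ?thesis
      unfolding fits_def s'(1)
      using lt le low[of "length s"] by (auto simp: nth_append[of s] less_Suc_eq intro: le_less_trans)
  next
    case (Some z)
    obtain s1 s2 where s: "s = s1 @ z # s2 \<and> s' = s1 @ y # s2 \<and> y < z \<and> (\<forall>w\<in>set s1. \<not> y < w)"
      using row_insert_Some[of y s s' z] ins Some by auto
    have q: "length s1 \<le> ?p"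
    proof (rule ccontr)
      assume *: "\<not> length s1 \<le> ?p"
      then have "y < s ! ?p" using lt[of ?p] s by simp
      moreover have "s ! ?p \<in> set s1" using * s by (simp add: nth_append)
      ultimately show False using s by blast
    qed
    have "?r' ! j < s' ! j" if j: "j < length s'" for j
    proof (cases "j = length s1")
      case True
      then show ?thesis using low[of j] q s by simp
    next
      case False
      then have "s' ! j = s ! j" using s by (auto simp: nth_append nth_Cons')
      then show ?thesis using le[of j] lt[of j] j s by auto
    qed
    then show ?thesis using len s by (simp add: fits_def)
  qed
qed

lemma tab_insert_standard:
  "tab_insert x P = (P', i) \<Longrightarrow> standard P \<Longrightarrow> distinct (x # concat P) \<Longrightarrow> standard P'"
proof (induction P arbitrary: x P' i)
  case (Cons s t)
  from Cons.prems(1) show ?case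
  proof (cases rule: tab_insert_cases)
    case (append r rs)
    have x: "\<forall>z\<in>set r. z < x" using append Cons.prems(3) by (auto simp: not_less order.order_iff_strict)
    have "fits (r @ [x]) (hd rs)" if "rs \<noteq> []"
      using that append Cons.prems(2) by (auto simp: fits_def nth_append)
    then show ?thesis using append x Cons.prems(2) by (simp add: sorted_wrt_append)
  next
    case (bump r1 y r2 rs rs' j)
    have so: "sorted_wrt (<) (r1 @ y # r2)" "standard rs" and ft: "rs \<noteq> [] \<Longrightarrow> fits (r1 @ y # r2) (hd rs)"
      using bump Cons.prems(2) by auto
    have r1y: "\<forall>z\<in>set r1. z < y" using so by (auto simp: sorted_wrt_append)
    have r1x: "\<forall>z\<in>set r1. z < x" using bump Cons.prems(3) by (auto simp: not_less order.order_iff_strict)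
    have "distinct (y # concat rs)" using bump Cons.prems(3) by auto
    then have st: "standard rs'" using Cons.IH[of y rs' j] bump so by simp
    have "fits (r1 @ x # r2) (hd rs')"
    proof (cases rs)
      case Nil
      then have "hd rs' = [y]" using bump by auto
      then show ?thesis using bump r1y by (cases r1) (auto simp: fits_def)
    next
      case (Cons u us)
      obtain u' b where ub: "row_insert y u = (u', b)" by (cases "row_insert y u")
      have "hd rs' = u'" using bump(6) Cons ub by (auto split: option.splits prod.splits)
      then show ?thesis using fits_insert[of r1 y r2 u x u' b] ft Cons bump r1y ub by simp
    qed
    moreover have "sorted_wrt (<) (r1 @ x # r2)" using so r1x bump by (auto simp: sorted_wrt_append)
    ultimately show ?thesis using bump st by simp
  qed auto
qed simp

section \<open>Descents of the recording tableau\<close>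

text \<open>
  While both insertions bump, the order of the two inserted entries is passed on to the bumped
  entries, and the comparison continues in the next row. If the first insertion appends \<open>x\<close> to a
  row, the second appends a larger \<open>x'\<close> there, whereas a smaller one bumps. If only the second
  insertion appends, its entry is larger than \<open>x\<close>.
\<close>

lemma bump_compare:
  "tab_insert x P = (P1, i) \<Longrightarrow> tab_insert x' P1 = (P2, j) \<Longrightarrow> standard P \<Longrightarrow> distinct (x # concat P) \<Longrightarrow>
     x' \<notin> set (concat P1) \<Longrightarrow> (x < x' \<longrightarrow> j \<le> i) \<and> (x' < x \<longrightarrow> i < j)"
proof (induction P arbitrary: x x' P1 P2 i j)
  case Nil
  then show ?case by auto
next
  case (Cons s t)
  from Cons.prems(1) show ?case
  proof (cases rule: tab_insert_cases)
    case (append r rs)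
    from Cons.prems(2) show ?thesis
    proof (cases rule: tab_insert_cases)
      case (append q qs)
      then show ?thesis using \<open>P1 = (r @ [x]) # rs\<close> \<open>i = 0\<close> by auto
    next
      case (bump q1 y' q2 qs qs' k)
      have row: "q1 @ y' # q2 = r @ [x]" using bump(1) \<open>P1 = (r @ [x]) # rs\<close> by simp
      have "\<not> x < x'"
      proof
        assume "x < x'"
        have "y' \<in> set r \<or> y' = x" using arg_cong[OF row, of set] by auto
        then show False using \<open>x < x'\<close> bump(4) \<open>\<forall>z\<in>set r. \<not> x < z\<close> by auto
      qed
      then show ?thesis using bump \<open>i = 0\<close> by simp
    qed (use append in simp)
  next
    case b: (bump r1 y r2 rs rs' k)
    have so: "sorted_wrt (<) (r1 @ y # r2)" "standard rs" using b Cons.prems(3) by auto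
    have dist: "distinct (y # concat rs)" using b Cons.prems(4) by auto
    have r1x: "\<forall>z\<in>set r1. z < x" using b Cons.prems(4) by (auto simp: not_less order.order_iff_strict)
    have r2y: "\<forall>z\<in>set r2. y < z" using so by (auto simp: sorted_wrt_append)
    from Cons.prems(2) show ?thesis
    proof (cases rule: tab_insert_cases)
      case (append q qs)
      have "x \<in> set q" using append(1) b(2) by auto
      then have "\<not> x' < x" using append(4) by blast
      then show ?thesis using append by simp
    next
      case c: (bump q1 y' q2 qs qs' l)
      have q: "q1 @ y' # q2 = r1 @ x # r2" and qs: "qs = rs'" using c(1) b(2) by auto
      have ne: "x' \<noteq> x" "x' \<noteq> y" "y' \<noteq> x'"
        using Cons.prems(5) b tab_insert_set[OF b(6)] c by (auto simp del: set_concat)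
      have y'in: "y' \<in> set r1 \<or> y' = x \<or> y' \<in> set r2"
        using arg_cong[OF q, of set] by auto
      have yy': "y' \<noteq> y" using r2y r1x b(4) y'in by auto
      have "y \<notin> set (concat rs)" using dist by simp
      have "y' \<notin> set (concat rs')"
      proof -
        have "y' \<in> set (r1 @ x # r2)" using y'in by auto
        moreover have "distinct ((r1 @ x # r2) @ concat rs)" using b(1) Cons.prems(4) by auto
        ultimately have "y' \<notin> set (concat rs)" by auto
        then show ?thesis using tab_insert_set[OF b(6)] yy' by (simp del: set_concat)
      qed
      then have IH: "(y < y' \<longrightarrow> l \<le> k) \<and> (y' < y \<longrightarrow> k < l)"
        using Cons.IH[of y rs' k y' qs' l] b c qs so dist by simp
      have 1: "y < y'" if "x < x'" using that c(4) y'in r1x r2y by auto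
      have 2: "y' < y" if "x' < x"
      proof -
        have "x \<notin> set q1" using c(5) that by blast
        then have "x = y' \<or> x \<in> set q2" using arg_cong[OF q, of set] by auto
        moreover have "sorted_wrt (<) (r1 @ x # r2)" using so r1x r2y b(4) by (auto simp: sorted_wrt_append)
        ultimately have "y' \<le> x" unfolding q[symmetric] by (auto simp: sorted_wrt_append)
        then show ?thesis using b(4) by simp
      qed
      show ?thesis using IH 1 2 c(3) b(3) by auto
    qed (use b in simp)
  qed auto
qed

section \<open>Injectivity of the Robinson-Schensted correspondence\<close>

text \<open>
  The bumped entry \<open>y\<close> can be put back into its row in one way only, in place of the last entry
  smaller than \<open>y\<close>.
\<close>

lemma sorted_split_unique:
  assumes "sorted_wrt (<) (r1 @ y # r2)" "sorted_wrt (<) (q1 @ y # q2)" "r1 @ x # r2 = q1 @ x' # q2"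
    "x < y" "x' < (y::nat)"
  shows "r1 = q1 \<and> x = x' \<and> r2 = q2"
proof -
  have tw: "takeWhile (\<lambda>z. z < y) (p1 @ w # p2) = p1 @ [w]"
    if "sorted_wrt (<) (p1 @ y # p2)" "w < y" for p1 p2 w
  proof -
    have "takeWhile (\<lambda>z. z < y) p2 = []" using that(1) by (cases p2) (auto simp: sorted_wrt_append)
    then show ?thesis using that by (simp add: takeWhile_append sorted_wrt_append)
  qed
  have "takeWhile (\<lambda>z. z < y) (r1 @ x # r2) = r1 @ [x]" using tw[OF assms(1,4)] .
  moreover have "takeWhile (\<lambda>z. z < y) (q1 @ x' # q2) = q1 @ [x']" using tw[OF assms(2,5)] .
  ultimately have "r1 @ [x] = q1 @ [x']" using assms(3) by simp
  then show ?thesis using assms(3) by simp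
qed

text \<open>
  Reverse bumping: starting from the row of the new box, \<open>sorted_split_unique\<close> recovers the
  entry inserted into each row.
\<close>

lemma tab_insert_inj:
  "tab_insert x P = (P', i) \<Longrightarrow> tab_insert x' R = (P', i) \<Longrightarrow> standard P \<Longrightarrow> standard R \<Longrightarrow> x = x' \<and> P = R"
proof (induction P arbitrary: x x' R P' i)
  case Nil
  then have "P' = [[x]]" "i = 0" by auto
  with Nil.prems(2) show ?case
    by (cases rule: tab_insert_cases) (use Nil.prems(4) in auto)
next
  case (Cons s t)
  from Cons.prems(1) show ?case
  proof (cases rule: tab_insert_cases)
    case (append r rs)
    from Cons.prems(2) show ?thesis
      by (cases rule: tab_insert_cases) (use append Cons.prems(3) in auto)
  next
    case b: (bump r1 y r2 rs rs' k)
    from Cons.prems(2) show ?thesis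
    proof (cases rule: tab_insert_cases)
      case c: (bump q1 y' q2 qs qs' l)
      have t: "t = rs" using b(1) by simp
      have "y = y' \<and> rs = qs"
        by (rule Cons.IH[of y rs' k y' qs, unfolded t])
           (use b c Cons.prems(3,4) in auto)
      then have y: "y' = y" "qs = rs" by simp_all
      have "r1 = q1 \<and> x = x' \<and> r2 = q2"
        by (rule sorted_split_unique[of r1 y r2 q1 q2 x x'])
           (use b c y Cons.prems(3,4) in auto)
      then show ?thesis using b c y by simp
    qed (use b in auto)
  qed auto
qed

lemma add_box_mem:
  assumes "i \<le> length Q"
  shows "r < length (add_box i k Q) \<and> j \<in> set (add_box i k Q ! r) \<longleftrightarrow>
    r = i \<and> j = k \<or> r < length Q \<and> j \<in> set (Q ! r)"
  using assms by (cases "i < length Q") (auto simp: add_box_def nth_append nth_list_update less_Suc_eq)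

lemma concat_mem: "j \<in> set (concat Q) \<longleftrightarrow> (\<exists>r<length Q. j \<in> set (Q ! r))"
proof -
  have "(\<exists>q\<in>set Q. j \<in> set q) \<longleftrightarrow> (\<exists>r<length Q. j \<in> set (Q ! r))"
    unfolding set_conv_nth[of Q] by blast
  then show ?thesis by simp
qed

lemma add_box_inj:
  assumes "add_box i k Q = add_box i' k Q'" "i \<le> length Q" "i' \<le> length Q'"
    "k \<notin> set (concat Q)" "k \<notin> set (concat Q')" "[] \<notin> set Q" "[] \<notin> set Q'"
  shows "i = i' \<and> Q = Q'"
proof -
  have ii: "i = i'"
  proof -
    have "i < length (add_box i k Q) \<and> k \<in> set (add_box i k Q ! i)"
      unfolding add_box_mem[OF assms(2)] by simp
    then have "i = i' \<and> k = k \<or> i < length Q' \<and> k \<in> set (Q' ! i)"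
      unfolding assms(1) add_box_mem[OF assms(3)] .
    then show ?thesis using assms(5) unfolding concat_mem by blast
  qed
  moreover have "Q = Q'"
  proof -
    consider "i < length Q" "i < length Q'" | "i = length Q" "i = length Q'"
      | "i < length Q" "i = length Q'" | "i = length Q" "i < length Q'"
      using assms(2,3) ii by linarith
    then show ?thesis
    proof cases
      case 1
      have e: "Q[i := Q ! i @ [k]] = Q'[i := Q' ! i @ [k]]"
        using assms(1) unfolding add_box_def ii[symmetric] if_P[OF 1(1)] if_P[OF 1(2)] .
      have len: "length Q = length Q'" by (rule arg_cong[OF e, of length, unfolded length_list_update])
      show ?thesis
      proof (rule nth_equalityI[OF len])
        fix j assume j: "j < length Q"
        have ej: "Q[i := Q ! i @ [k]] ! j = Q'[i := Q' ! i @ [k]] ! j" by (rule arg_cong[OF e])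
        show "Q ! j = Q' ! j"
        proof (cases "j = i")
          case True
          then show ?thesis using ej 1 by simp
        next
          case False
          then show ?thesis using ej by simp
        qed
      qed
    next
      case 2
      then have n: "\<not> i < length Q" "\<not> i < length Q'" by simp_all
      have "Q @ [[k]] = Q' @ [[k]]"
        using assms(1) unfolding add_box_def ii[symmetric] if_not_P[OF n(1)] if_not_P[OF n(2)] .
      then show ?thesis by simp
    next
      case 3
      then have n: "\<not> i < length Q'" by simp
      have e: "Q[i := Q ! i @ [k]] = Q' @ [[k]]"
        using assms(1) unfolding add_box_def ii[symmetric] if_P[OF 3(1)] if_not_P[OF n] .
      have "Q[i := Q ! i @ [k]] ! i = (Q' @ [[k]]) ! i" by (rule arg_cong[OF e])
      then have "Q ! i = []" using 3 by (simp add: nth_append)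
      then have "[] \<in> set Q" using nth_mem[OF 3(1)] by simp
      then show ?thesis using assms(6) by simp
    next
      case 4
      then have n: "\<not> i < length Q" by simp
      have e: "Q @ [[k]] = Q'[i := Q' ! i @ [k]]"
        using assms(1) unfolding add_box_def ii[symmetric] if_not_P[OF n] if_P[OF 4(2)] .
      have "(Q @ [[k]]) ! i = Q'[i := Q' ! i @ [k]] ! i" by (rule arg_cong[OF e])
      then have "Q' ! i = []" using 4 by (simp add: nth_append)
      then have "[] \<in> set Q'" using nth_mem[OF 4(2)] by simp
      then show ?thesis using assms(7) by simp
    qed
  qed
  ultimately show ?thesis using ii by simp
qed

lemma add_box_mset: "i \<le> length Q \<Longrightarrow> mset (concat (add_box i k Q)) = add_mset k (mset (concat Q))"
proof (induction Q arbitrary: i)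
  case Nil
  then show ?case by (simp add: add_box_def)
next
  case (Cons r Q)
  show ?case
  proof (cases i)
    case (Suc j)
    then have "add_box i k (r # Q) = r # add_box j k Q" by (simp add: add_box_def)
    then show ?thesis using Cons Suc by simp
  qed (simp add: add_box_def)
qed

text \<open>
  An entry larger than all others does no harm at the end of a row as long as the row does not
  become longer than the one below it. This holds since the shape is that of a standard tableau
  \<open>P\<close>.
\<close>

lemma add_box_standard:
  assumes Q: "standard Q" "i \<le> length Q" "\<forall>j\<in>set (concat Q). j < k"
    and P: "standard P" "shape P = shape (add_box i k Q)"
  shows "standard (add_box i k Q)"
proof -
  let ?Q = "add_box i k Q"
  have lenP: "length P = length ?Q" "\<And>r. r < length ?Q \<Longrightarrow> length (P ! r) = length (?Q ! r)"
  proof -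
    have m: "map length P = map length ?Q" using P(2) by (simp add: shape_def)
    show l: "length P = length ?Q" by (rule map_eq_imp_length_eq[OF m])
    show "length (P ! r) = length (?Q ! r)" if "r < length ?Q" for r
      using arg_cong[OF m, of "\<lambda>xs. xs ! r"] that l by simp
  qed
  have small: "Q ! r ! j < k" if "r < length Q" "j < length (Q ! r)" for r j
  proof -
    have "Q ! r ! j \<in> set (concat Q)" unfolding concat_mem using that nth_mem by blast
    then show ?thesis using Q(3) by blast
  qed
  have rows: "\<And>r. r < length Q \<Longrightarrow> Q ! r \<noteq> [] \<and> sorted_wrt (<) (Q ! r)"
    and cols: "\<And>r. Suc r < length Q \<Longrightarrow> fits (Q ! r) (Q ! Suc r)" using Q(1) unfolding standard_iff by auto
  have row: "?Q ! r = (if r = i then (if i < length Q then Q ! i else []) @ [k] else Q ! r)" if "r < length ?Q" for r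
    using that Q(2) by (auto simp: add_box_def nth_append split: if_splits)
  have rl: "r < length Q" if "r < length ?Q" "r \<noteq> i" for r
    using that Q(2) by (auto simp: add_box_def split: if_splits)
  show ?thesis
    unfolding standard_iff
  proof (intro conjI allI impI)
    fix r assume r: "r < length ?Q"
    show "?Q ! r \<noteq> []" unfolding row[OF r] using rows rl[OF r] by auto
    show "sorted_wrt (<) (?Q ! r)"
    proof (cases "r = i")
      case True
      have "\<forall>z\<in>set (Q ! i). z < k" if "i < length Q"
        using small[OF that] by (auto simp: in_set_conv_nth)
      then show ?thesis unfolding row[OF r] using True rows[of i] by (auto simp: sorted_wrt_append)
    next
      case False
      then show ?thesis unfolding row[OF r] using rows rl[OF r] by auto
    qed
  next
    fix r assume r: "Suc r < length ?Q"
    then have r': "r < length ?Q" by simp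
    have len: "length (?Q ! Suc r) \<le> length (?Q ! r)"
    proof -
      have "fits (P ! r) (P ! Suc r)" using P(1) lenP(1) r unfolding standard_iff by simp
      then show ?thesis using lenP(2)[OF r] lenP(2)[OF r'] by (simp add: fits_def)
    qed
    have "?Q ! r ! j < ?Q ! Suc r ! j" if j: "j < length (?Q ! Suc r)" for j
    proof (cases "Suc r = i")
      case True
      have rQ: "r < length Q" using True Q(2) by simp
      have e: "?Q ! r = Q ! r" using row[OF r'] True by simp
      show ?thesis
      proof (cases "i < length Q")
        case il: True
        have e2: "?Q ! Suc r = Q ! i @ [k]" using row[OF r] True il by simp
        show ?thesis
        proof (cases "j < length (Q ! i)")
          case jl: True
          then show ?thesis using cols[of r] True il unfolding e e2 fits_def by (simp add: nth_append)
        next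
          case False
          then have "j = length (Q ! i)" using j e2 by simp
          then show ?thesis using small[OF rQ, of j] len j e e2 by (simp add: nth_append)
        qed
      next
        case False
        have e2: "?Q ! Suc r = [k]" using row[OF r] True False by simp
        then show ?thesis using small[OF rQ, of j] rows[OF rQ] j e by simp
      qed
    next
      case False
      have sr: "Suc r < length Q" using rl[OF r False] .
      have e2: "?Q ! Suc r = Q ! Suc r" using row[OF r] False by simp
      have "j < length (Q ! r)" "Q ! r ! j < Q ! Suc r ! j"
        using cols[OF sr] j unfolding e2 fits_def by auto
      then show ?thesis unfolding e2 row[OF r'] using sr by (auto simp: nth_append)
    qed
    then show "fits (?Q ! r) (?Q ! Suc r)" using len by (simp add: fits_def)
  qed
qed

lemma standard_STab:
  assumes "standard t" "distinct (concat t)" "set (concat t) = {1..n}"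
  shows "t \<in> STab n"
proof -
  have rows: "\<And>r. r < length t \<Longrightarrow> t ! r \<noteq> [] \<and> sorted_wrt (<) (t ! r)"
    and cols: "\<And>r. Suc r < length t \<Longrightarrow> fits (t ! r) (t ! Suc r)" using assms(1) unfolding standard_iff by auto
  have "sorted_wrt (\<ge>) (shape t)"
    by (subst sorted_wrt_iff_nth_Suc_transp) (use cols in \<open>auto simp: shape_def fits_def transp_def\<close>)
  moreover have "0 \<notin> set (shape t)" using rows by (auto simp: shape_def in_set_conv_nth)
  moreover have "sum_list (shape t) = n"
    using distinct_card[OF assms(2)] assms(3) by (simp add: shape_def length_concat)
  ultimately show ?thesis
    using assms rows cols unfolding STab_def is_partition_def numbering_def
    by (auto simp: in_set_conv_nth fits_def)
qed

lemma RS_0: "RS 0 \<sigma> = ([], [])"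
  by (simp add: RS_def)

lemma RS_Suc: "tab_insert (\<sigma> (Suc k)) (fst (RS k \<sigma>)) = (P', i) \<Longrightarrow> RS (Suc k) \<sigma> = (P', add_box i (Suc k) (snd (RS k \<sigma>)))"
proof -
  have "RS (Suc k) \<sigma> = (\<lambda>(P, Q) k. let (P', i) = tab_insert (\<sigma> k) P in (P', add_box i k Q)) (RS k \<sigma>) (Suc k)"
    by (simp add: RS_def upt_rec[of 1])
  moreover assume "tab_insert (\<sigma> (Suc k)) (fst (RS k \<sigma>)) = (P', i)"
  ultimately show ?thesis by (simp add: split_beta)
qed

text \<open>
  The row of the box created in step \<open>k\<close>, which is the row of \<open>k\<close> in the recording tableau.
\<close>

definition rs_row :: "(nat \<Rightarrow> nat) \<Rightarrow> nat \<Rightarrow> nat" where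
  "rs_row \<sigma> k = snd (tab_insert (\<sigma> k) (fst (RS (k - 1) \<sigma>)))"

lemma RS_step:
  obtains P' where "tab_insert (\<sigma> (Suc k)) (fst (RS k \<sigma>)) = (P', rs_row \<sigma> (Suc k))"
    "RS (Suc k) \<sigma> = (P', add_box (rs_row \<sigma> (Suc k)) (Suc k) (snd (RS k \<sigma>)))"
proof -
  obtain P' i where t: "tab_insert (\<sigma> (Suc k)) (fst (RS k \<sigma>)) = (P', i)"
    by (cases "tab_insert (\<sigma> (Suc k)) (fst (RS k \<sigma>))")
  then have "i = rs_row \<sigma> (Suc k)" by (simp add: rs_row_def)
  then show ?thesis using that t RS_Suc[OF t] by simp
qed

lemma RS_invariant:
  assumes "inj \<sigma>"
  shows "standard (fst (RS k \<sigma>)) \<and> standard (snd (RS k \<sigma>)) \<and> shape (fst (RS k \<sigma>)) = shape (snd (RS k \<sigma>)) \<and>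
    distinct (concat (fst (RS k \<sigma>))) \<and> set (concat (fst (RS k \<sigma>))) = \<sigma> ` {1..k} \<and>
    distinct (concat (snd (RS k \<sigma>))) \<and> set (concat (snd (RS k \<sigma>))) = {1..k}"
proof (induction k)
  case 0
  then show ?case by (simp add: RS_0 shape_def)
next
  case (Suc k)
  let ?P = "fst (RS k \<sigma>)" and ?Q = "snd (RS k \<sigma>)" and ?i = "rs_row \<sigma> (Suc k)"
  obtain P' where P': "tab_insert (\<sigma> (Suc k)) ?P = (P', ?i)" "RS (Suc k) \<sigma> = (P', add_box ?i (Suc k) ?Q)"
    by (rule RS_step)
  from Suc have IH: "standard ?P" "standard ?Q" "shape ?P = shape ?Q" "distinct (concat ?P)"
    "set (concat ?P) = \<sigma> ` {1..k}" "distinct (concat ?Q)" "set (concat ?Q) = {1..k}"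
    by blast+
  have "Suc k \<notin> {1..k}" by simp
  then have new: "\<sigma> (Suc k) \<notin> \<sigma> ` {1..k}" using inj_image_mem_iff[OF assms] by blast
  have d: "distinct (\<sigma> (Suc k) # concat ?P)"
    unfolding distinct.simps IH(5) using new IH(4) by (rule conjI)
  have dQ: "distinct (Suc k # concat ?Q)" unfolding distinct.simps IH(7) using IH(6) by simp
  have sP: "standard P'" by (rule tab_insert_standard[OF P'(1) IH(1) d])
  have ilen: "?i \<le> length ?Q"
    using tab_insert_shape[OF P'(1)] unfolding shape_length[OF IH(3)] by (rule conjunct2)
  have sh: "shape P' = shape (add_box ?i (Suc k) ?Q)"
    using tab_insert_shape[OF P'(1)] unfolding add_box_shape IH(3) by (rule conjunct1)
  have small: "\<forall>j\<in>set (concat ?Q). j < Suc k" unfolding IH(7) by simp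
  have sQ: "standard (add_box ?i (Suc k) ?Q)"
    by (rule add_box_standard[OF IH(2) ilen small sP sh])
  have mP: "mset (concat P') = mset (\<sigma> (Suc k) # concat ?P)"
    unfolding mset.simps by (rule tab_insert_mset[OF P'(1)])
  have mQ: "mset (concat (add_box ?i (Suc k) ?Q)) = mset (Suc k # concat ?Q)"
    unfolding mset.simps by (rule add_box_mset[OF ilen])
  have iv: "{1..Suc k} = insert (Suc k) {1..k}" by auto
  have "distinct (concat P')" using d unfolding mset_eq_imp_distinct_iff[OF mP] .
  moreover have "distinct (concat (add_box ?i (Suc k) ?Q))" using dQ unfolding mset_eq_imp_distinct_iff[OF mQ] .
  moreover have "set (concat P') = \<sigma> ` {1..Suc k}"
    unfolding mset_eq_setD[OF mP] list.set(2) IH(5) iv by (rule image_insert[symmetric])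
  moreover have "set (concat (add_box ?i (Suc k) ?Q)) = {1..Suc k}"
    unfolding mset_eq_setD[OF mQ] list.set(2) IH(7) iv ..
  ultimately show ?case unfolding P'(2) fst_conv snd_conv using sP sQ sh by (intro conjI)
qed

lemma RS_invD:
  assumes "inj \<sigma>"
  shows "standard (fst (RS k \<sigma>))" "standard (snd (RS k \<sigma>))" "shape (fst (RS k \<sigma>)) = shape (snd (RS k \<sigma>))"
    "distinct (concat (fst (RS k \<sigma>)))" "set (concat (fst (RS k \<sigma>))) = \<sigma> ` {1..k}"
    "distinct (concat (snd (RS k \<sigma>)))" "set (concat (snd (RS k \<sigma>))) = {1..k}"
  using RS_invariant[OF assms, of k] by blast+

lemma RS_fresh: "inj \<sigma> \<Longrightarrow> \<sigma> (Suc k) \<notin> set (concat (fst (RS k \<sigma>)))"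
proof -
  assume inj: "inj \<sigma>"
  have "Suc k \<notin> {1..k}" by simp
  then show ?thesis unfolding RS_invD(5)[OF inj] using inj_image_mem_iff[OF inj] by blast
qed

lemma RS_distinct: "inj \<sigma> \<Longrightarrow> distinct (\<sigma> (Suc k) # concat (fst (RS k \<sigma>)))"
  unfolding distinct.simps using RS_fresh RS_invD(4) by (intro conjI)

lemma RS_row_le: "inj \<sigma> \<Longrightarrow> rs_row \<sigma> (Suc k) \<le> length (snd (RS k \<sigma>))"
proof -
  assume inj: "inj \<sigma>"
  obtain P' where P': "tab_insert (\<sigma> (Suc k)) (fst (RS k \<sigma>)) = (P', rs_row \<sigma> (Suc k))"
    by (rule RS_step) (rule that)
  show ?thesis
    using tab_insert_shape[OF P'] unfolding shape_length[OF RS_invD(3)[OF inj]] by (rule conjunct2)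
qed

lemma RS_rows:
  assumes "inj \<sigma>"
  shows "r < length (snd (RS k \<sigma>)) \<and> j \<in> set (snd (RS k \<sigma>) ! r) \<longleftrightarrow> j \<in> {1..k} \<and> r = rs_row \<sigma> j"
proof (induction k)
  case 0
  then show ?case by (simp add: RS_0)
next
  case (Suc k)
  obtain P' where P': "RS (Suc k) \<sigma> = (P', add_box (rs_row \<sigma> (Suc k)) (Suc k) (snd (RS k \<sigma>)))"
    by (rule RS_step) (rule that)
  show ?case
    unfolding P' snd_conv add_box_mem[OF RS_row_le[OF assms]] Suc by (auto simp: le_Suc_eq)
qed

lemma rs_row_compare:
  assumes "inj \<sigma>"
  shows "rs_row \<sigma> (Suc k) < rs_row \<sigma> (Suc (Suc k)) \<longleftrightarrow> \<sigma> (Suc k) > \<sigma> (Suc (Suc k))"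
proof -
  obtain P1 where P1: "tab_insert (\<sigma> (Suc k)) (fst (RS k \<sigma>)) = (P1, rs_row \<sigma> (Suc k))"
    "RS (Suc k) \<sigma> = (P1, add_box (rs_row \<sigma> (Suc k)) (Suc k) (snd (RS k \<sigma>)))" by (rule RS_step)
  obtain P2 where P2: "tab_insert (\<sigma> (Suc (Suc k))) (fst (RS (Suc k) \<sigma>)) = (P2, rs_row \<sigma> (Suc (Suc k)))"
    by (rule RS_step) (rule that)
  have P2': "tab_insert (\<sigma> (Suc (Suc k))) P1 = (P2, rs_row \<sigma> (Suc (Suc k)))" using P2 unfolding P1(2) fst_conv .
  have n2: "\<sigma> (Suc (Suc k)) \<notin> set (concat P1)" using RS_fresh[OF assms, of "Suc k"] unfolding P1(2) fst_conv .
  have ne: "\<sigma> (Suc k) \<noteq> \<sigma> (Suc (Suc k))" using assms by (simp add: inj_eq)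
  have "(\<sigma> (Suc k) < \<sigma> (Suc (Suc k)) \<longrightarrow> rs_row \<sigma> (Suc (Suc k)) \<le> rs_row \<sigma> (Suc k)) \<and>
        (\<sigma> (Suc (Suc k)) < \<sigma> (Suc k) \<longrightarrow> rs_row \<sigma> (Suc k) < rs_row \<sigma> (Suc (Suc k)))"
    by (rule bump_compare[OF P1(1) P2' RS_invD(1)[OF assms] RS_distinct[OF assms] n2])
  then show ?thesis using ne by linarith
qed

text \<open>
  By \<open>bump_compare\<close> the box of step \<open>Suc k\<close> lies above that of step \<open>k\<close> exactly if a smaller
  number is inserted.
\<close>

theorem recording_tableau_Des:
  assumes "\<sigma> permutes {1..n}"
  shows "tab_Des (recording_tableau n \<sigma>) = perm_Des n \<sigma>"
proof -
  have inj: "inj \<sigma>" using permutes_inj[OF assms] .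
  note rows = RS_rows[OF inj, of _ n]
  have "i \<in> tab_Des (snd (RS n \<sigma>)) \<longleftrightarrow> i \<in> perm_Des n \<sigma>" for i
  proof -
    have "i \<in> tab_Des (snd (RS n \<sigma>)) \<longleftrightarrow> (\<exists>r s. r < s \<and> (r < length (snd (RS n \<sigma>)) \<and> i \<in> set (snd (RS n \<sigma>) ! r)) \<and>
        (s < length (snd (RS n \<sigma>)) \<and> Suc i \<in> set (snd (RS n \<sigma>) ! s)))"
      unfolding tab_Des_def using less_trans by blast
    also have "\<dots> \<longleftrightarrow> i \<in> {1..n} \<and> Suc i \<in> {1..n} \<and> rs_row \<sigma> i < rs_row \<sigma> (Suc i)"
      unfolding rows by blast
    also have "\<dots> \<longleftrightarrow> i \<in> perm_Des n \<sigma>"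
      using rs_row_compare[OF inj, of "i - 1"] by (cases i) (auto simp: perm_Des_def)
    finally show ?thesis .
  qed
  then show ?thesis unfolding recording_tableau_def by blast
qed

text \<open>
  The recording tableau tells the row in which the last box was created, and by \<open>tab_insert_inj\<close>
  the last insertion can be undone.
\<close>

lemma RS_inj:
  assumes "inj \<sigma>" "inj \<tau>" "RS n \<sigma> = RS n \<tau>"
  shows "\<forall>k\<in>{1..n}. \<sigma> k = \<tau> k"
  using assms(3)
proof (induction n)
  case (Suc k)
  obtain P where P: "tab_insert (\<sigma> (Suc k)) (fst (RS k \<sigma>)) = (P, rs_row \<sigma> (Suc k))"
    "RS (Suc k) \<sigma> = (P, add_box (rs_row \<sigma> (Suc k)) (Suc k) (snd (RS k \<sigma>)))" by (rule RS_step)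
  obtain P' where P': "tab_insert (\<tau> (Suc k)) (fst (RS k \<tau>)) = (P', rs_row \<tau> (Suc k))"
    "RS (Suc k) \<tau> = (P', add_box (rs_row \<tau> (Suc k)) (Suc k) (snd (RS k \<tau>)))" by (rule RS_step)
  have e: "P = P'" "add_box (rs_row \<sigma> (Suc k)) (Suc k) (snd (RS k \<sigma>)) = add_box (rs_row \<tau> (Suc k)) (Suc k) (snd (RS k \<tau>))"
    using Suc.prems P(2) P'(2) by simp_all
  note I = RS_invD[OF assms(1), of k] and I' = RS_invD[OF assms(2), of k]
  have nil: "[] \<notin> set t" if "standard t" for t using that by (induction t) auto
  have new: "Suc k \<notin> {1..k}" by simp
  have "rs_row \<sigma> (Suc k) = rs_row \<tau> (Suc k) \<and> snd (RS k \<sigma>) = snd (RS k \<tau>)"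
    by (rule add_box_inj[OF e(2) RS_row_le[OF assms(1)] RS_row_le[OF assms(2)]
          new[folded I(7)] new[folded I'(7)] nil[OF I(2)] nil[OF I'(2)]])
  then have r: "rs_row \<tau> (Suc k) = rs_row \<sigma> (Suc k)" "snd (RS k \<sigma>) = snd (RS k \<tau>)" by simp_all
  have "\<sigma> (Suc k) = \<tau> (Suc k) \<and> fst (RS k \<sigma>) = fst (RS k \<tau>)"
    by (rule tab_insert_inj[OF P(1) P'(1)[folded e(1), unfolded r(1)] I(1) I'(1)])
  then have "\<sigma> (Suc k) = \<tau> (Suc k)" "RS k \<sigma> = RS k \<tau>" using r(2) by (simp_all add: prod_eq_iff)
  then show ?case using Suc.IH by (auto simp: atLeastAtMostSuc_conv)
qed simp

section \<open>Descents of the insertion tableau\<close>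

definition before :: "'a \<Rightarrow> 'a \<Rightarrow> 'a list \<Rightarrow> bool" where
  "before b a w \<longleftrightarrow> (\<exists>u v. w = u @ v \<and> b \<in> set u \<and> a \<in> set v)"

lemma before_append: "before b a (u @ v) \<longleftrightarrow> before b a u \<or> before b a v \<or> b \<in> set u \<and> a \<in> set v"
proof
  assume "before b a (u @ v)"
  then obtain w z where w: "u @ v = w @ z" "b \<in> set w" "a \<in> set z" by (auto simp: before_def)
  then consider us where "u = w @ us" "us @ v = z" | us where "u @ us = w" "v = us @ z"
    by (auto simp: append_eq_append_conv2)
  then show "before b a u \<or> before b a v \<or> b \<in> set u \<and> a \<in> set v"
    using w(2,3) unfolding before_def by cases auto
next
  assume "before b a u \<or> before b a v \<or> b \<in> set u \<and> a \<in> set v"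
  then show "before b a (u @ v)"
    unfolding before_def by (metis Un_iff append.assoc set_append)
qed

lemma before_Nil [simp]: "\<not> before b a []" and before_single [simp]: "\<not> before b a [x]"
  by (auto simp: before_def Cons_eq_append_conv)

lemma before_Cons: "before b a (x # v) \<longleftrightarrow> before b a v \<or> b = x \<and> a \<in> set v"
  using before_append[of b a "[x]" v] by auto

text \<open>
  Rows are read from top to bottom. When \<open>x\<close> bumps \<open>y\<close>, the only pairs of letters brought into
  inverted order are those of \<open>y\<close> with the entries to its left, which are smaller than \<open>x\<close>; as
  \<open>x\<close> lies strictly between, these are never \<open>Suc a\<close> and \<open>a\<close>.
\<close>

lemma tab_insert_before:
  "tab_insert x P = (P', i) \<Longrightarrow> standard P \<Longrightarrow> x \<notin> set (concat P) \<Longrightarrow> distinct (concat P) \<Longrightarrow>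
     before (Suc a) a (concat (rev P')) \<Longrightarrow> before (Suc a) a (concat (rev P) @ [x])"
proof (induction P arbitrary: x P' i)
  case (Cons s t)
  from Cons.prems(1) show ?case
  proof (cases rule: tab_insert_cases)
    case (bump r1 y r2 rs rs' j)
    have t: "t = rs" using bump(1) by simp
    have so: "sorted_wrt (<) (r1 @ y # r2)" "standard rs" using bump Cons.prems(2) by auto
    have r2y: "\<forall>z\<in>set r2. y < z" using so by (auto simp: sorted_wrt_append)
    have r1x: "\<forall>z\<in>set r1. z < x" using bump Cons.prems(3) by (auto simp: not_less order.order_iff_strict)
    have yx: "x < y" using bump by simp
    have IH: "before (Suc a) a (concat (rev rs'))\<Longrightarrow> before (Suc a) a (concat (rev rs) @ [y])"
      by (rule Cons.IH[of y rs' j, unfolded t]) (use bump so Cons.prems(4) in auto)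
    have set': "set (concat (rev rs')) = insert y (set (concat (rev rs)))"
      using tab_insert_set[OF bump(6)] by simp
    have pre: "before (Suc a) a (concat (rev rs') @ r1 @ x # r2)" using Cons.prems(5) bump by simp
    show ?thesis
      using pre IH r2y r1x yx unfolding before_append set'
      by (auto simp: bump(1) before_append before_Cons)
  qed (use Cons.prems in auto)
qed simp

lemma RS_before:
  assumes "inj \<sigma>"
  shows "before (Suc a) a (concat (rev (fst (RS k \<sigma>)))) \<Longrightarrow> before (Suc a) a (map \<sigma> [1..<Suc k])"
proof -
  have "before (Suc a) a (concat (rev (fst (RS k \<sigma>))) @ w) \<Longrightarrow> before (Suc a) a (map \<sigma> [1..<Suc k] @ w)" for w
  proof (induction k arbitrary: w)
    case 0
    then show ?case by (simp add: RS_0)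
  next
    case (Suc k)
    obtain P where P: "tab_insert (\<sigma> (Suc k)) (fst (RS k \<sigma>)) = (P, rs_row \<sigma> (Suc k))"
      "RS (Suc k) \<sigma> = (P, add_box (rs_row \<sigma> (Suc k)) (Suc k) (snd (RS k \<sigma>)))" by (rule RS_step)
    have step: "before (Suc a) a (concat (rev P)) \<Longrightarrow> before (Suc a) a (concat (rev (fst (RS k \<sigma>))) @ [\<sigma> (Suc k)])"
      by (rule tab_insert_before[OF P(1) RS_invD(1)[OF assms] RS_fresh[OF assms] RS_invD(4)[OF assms]])
    have set: "set (concat (rev P)) = set (concat (rev (fst (RS k \<sigma>))) @ [\<sigma> (Suc k)])"
      using tab_insert_set[OF P(1)] by simp
    have "before (Suc a) a (concat (rev P) @ w)" using Suc.prems P(2) by simp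
    then have "before (Suc a) a ((concat (rev (fst (RS k \<sigma>))) @ [\<sigma> (Suc k)]) @ w)"
      using step unfolding before_append[of _ _ "concat (rev P)"] before_append[of _ _ "_ @ [_]" w] set by blast
    then have "before (Suc a) a (map \<sigma> [1..<Suc k] @ ([\<sigma> (Suc k)] @ w))"
      by (intro Suc.IH) simp
    then show ?case by simp
  qed
  from this[of "[]"] show "before (Suc a) a (concat (rev (fst (RS k \<sigma>)))) \<Longrightarrow> before (Suc a) a (map \<sigma> [1..<Suc k])" by simp
qed

text \<open>
  If \<open>Suc a\<close> lies above \<open>a\<close> in the insertion tableau, it precedes \<open>a\<close> in the reading word, and
  by \<open>RS_before\<close> also among the values of \<open>\<sigma>\<close>.
\<close>

lemma insertion_tableau_Des:
  assumes "\<sigma> permutes {1..n}"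
  shows "tab_Des (fst (RS n \<sigma>)) \<subseteq> perm_Des n (inv' \<sigma>)"
proof
  fix a assume "a \<in> tab_Des (fst (RS n \<sigma>))"
  then obtain r s where rs: "r < s" "s < length (fst (RS n \<sigma>))" "a \<in> set (fst (RS n \<sigma>) ! r)" "Suc a \<in> set (fst (RS n \<sigma>) ! s)"
    unfolding tab_Des_def by blast
  have inj: "inj \<sigma>" using permutes_inj[OF assms] .
  define t where "t = fst (RS n \<sigma>)"
  have "t = take s t @ t ! s # drop (Suc s) t" using rs(2) by (simp add: t_def id_take_nth_drop)
  then have "concat (rev t) = concat (rev (drop (Suc s) t)) @ t ! s @ concat (rev (take s t))"
    by (metis append.assoc append_Cons append_Nil concat.simps(2) concat_append rev.simps(2) rev_append)
  moreover have "a \<in> set (concat (rev (take s t)))"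
  proof -
    have "t ! r \<in> set (take s t)"
      using nth_mem[of r "take s t"] rs(1,2) unfolding t_def[symmetric] by simp
    then show ?thesis using rs(3) unfolding t_def[symmetric] by auto
  qed
  ultimately have "before (Suc a) a (concat (rev t))" using rs(4) by (simp add: before_append t_def[symmetric])
  then have "before (Suc a) a (map \<sigma> [1..<Suc n])" using RS_before[OF inj] by (simp add: t_def)
  then obtain u v where uv: "map \<sigma> [1..<Suc n] = u @ v" "Suc a \<in> set u" "a \<in> set v" unfolding before_def by blast
  obtain us vs where w: "[1..<Suc n] = us @ vs" "u = map \<sigma> us" "v = map \<sigma> vs"
    using uv(1) by (auto simp: map_eq_append_conv)
  obtain i j where ij: "i \<in> set us" "Suc a = \<sigma> i" "j \<in> set vs" "a = \<sigma> j" using uv w by auto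
  have "sorted_wrt (<) (us @ vs)" unfolding w(1)[symmetric] by (rule sorted_wrt_upt)
  then have lt: "i < j" using ij by (auto simp: sorted_wrt_append)
  have "i \<in> set [1..<Suc n]" "j \<in> set [1..<Suc n]" unfolding w(1) using ij by auto
  then have rng: "i \<in> {1..n}" "j \<in> {1..n}" by auto
  have "a \<in> {1..n}" "Suc a \<in> {1..n}" using permutes_in_image[OF assms] rng ij by metis+
  then have "a \<in> {1..<n}" by simp
  moreover have "inv' \<sigma> (Suc a) = i" unfolding ij(2) by (rule permutes_inverses(2)[OF assms])
  moreover have "inv' \<sigma> a = j" unfolding ij(4) by (rule permutes_inverses(2)[OF assms])
  ultimately show "a \<in> perm_Des n (inv' \<sigma>)" using lt by (simp add: perm_Des_def)
qed

lemma RS_STab: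
  assumes "\<sigma> permutes {1..n}"
  shows "fst (RS n \<sigma>) \<in> STab n" "snd (RS n \<sigma>) \<in> STab n" "shape (fst (RS n \<sigma>)) = shape (snd (RS n \<sigma>))"
proof -
  note I = RS_invD[OF permutes_inj[OF assms], of n]
  show "fst (RS n \<sigma>) \<in> STab n"
    by (rule standard_STab[OF I(1,4)]) (unfold I(5), rule permutes_image[OF assms])
  show "snd (RS n \<sigma>) \<in> STab n" by (rule standard_STab[OF I(2,6,7)])
  show "shape (fst (RS n \<sigma>)) = shape (snd (RS n \<sigma>))" by (rule I(3))
qed

section \<open>Invariants of Young subgroups in Specht modules\<close>

lemma STabD:
  assumes "t \<in> STab n"
  shows "is_partition n (shape t)" "numbering n (shape t) t" "\<And>r. r < length t \<Longrightarrow> sorted_wrt (<) (t ! r)"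
    "\<And>i j. Suc i < length t \<Longrightarrow> j < length (t ! Suc i) \<Longrightarrow> t ! i ! j < t ! Suc i ! j"
  using assms by (auto simp: STab_def)

lemma STab_length_le:
  assumes "t \<in> STab n"
  shows "length t \<le> n"
proof -
  have "length \<mu> \<le> sum_list \<mu>" if "0 \<notin> set \<mu>" for \<mu> :: "nat list"
    using that by (induction \<mu>) auto
  from this[of "shape t"] have "length (shape t) \<le> sum_list (shape t)"
    using STabD(1)[OF assms] by (simp add: is_partition_def)
  then show ?thesis using STabD(1)[OF assms] by (simp add: is_partition_def shape_def)
qed

lemma finite_STab: "finite (STab n)"
proof -
  have "t \<in> {t. set t \<subseteq> {r. set r \<subseteq> {1..n} \<and> length r \<le> n} \<and> length t \<le> n}" if t: "t \<in> STab n" for t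
  proof -
    have "set r \<subseteq> {1..n} \<and> length r \<le> n" if r: "r \<in> set t" for r
    proof
      have num: "distinct (concat t)" "set (concat t) = {1..n}"
        using STabD(2)[OF t] by (simp_all add: numbering_def)
      show sub: "set r \<subseteq> {1..n}" using num(2) r by auto
      have "distinct r" using num(1) r by (simp add: distinct_concat_iff)
      then have "length r = card (set r)" by (simp add: distinct_card)
      also have "\<dots> \<le> card {1..n}" by (rule card_mono[OF _ sub]) simp
      finally show "length r \<le> n" by simp
    qed
    then show ?thesis using STab_length_le[OF t] by auto
  qed
  then have "STab n \<subseteq> {t. set t \<subseteq> {r. set r \<subseteq> {1..n} \<and> length r \<le> n} \<and> length t \<le> n}" by blast
  then show ?thesis
    by (rule finite_subset) (intro finite_lists_length_le finite_atLeastAtMost)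
qed

lemma STab_row_eqI:
  assumes "s \<in> STab n" "t \<in> STab n" "shape s = shape t" "\<And>a. a \<in> {1..n} \<Longrightarrow> row_of s a = row_of t a"
  shows "s = t"
proof (rule nth_equalityI)
  show len: "length s = length t" by (rule shape_length[OF assms(3)])
  fix r assume r: "r < length s"
  have "set (s ! r) = set (t ! r)"
    unfolding numbering_row[OF STabD(2)[OF assms(1)] r] numbering_row[OF STabD(2)[OF assms(2)] r[unfolded len]]
    using assms(4) by auto
  then show "s ! r = t ! r"
    using STabD(3)[OF assms(1) r] STabD(3)[OF assms(2)] r len
    by (intro strict_sorted_equal) simp_all
qed

lemma STab_Des_row:
  assumes t: "t \<in> STab n" and i: "i \<in> {1..<n}" "i \<notin> tab_Des t"
  shows "row_of t (Suc i) \<le> row_of t i"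
proof (rule ccontr)
  assume "\<not> ?thesis"
  then have lt: "row_of t i < row_of t (Suc i)" by simp
  have m: "i \<in> {1..n}" "Suc i \<in> {1..n}" using i(1) by auto
  note e = numbering_entry[OF STabD(2)[OF t] m(1)] and e' = numbering_entry[OF STabD(2)[OF t] m(2)]
  have "i \<in> set (t ! row_of t i)" "Suc i \<in> set (t ! row_of t (Suc i))"
    using nth_mem[OF e(2)] nth_mem[OF e'(2)] e(3) e'(3) by simp_all
  then have "i \<in> tab_Des t" unfolding tab_Des_def using lt e'(1) by blast
  then show False using i(2) by simp
qed

definition young_tableaux :: "nat \<Rightarrow> nat set \<Rightarrow> nat list \<Rightarrow> tableau set" where
  "young_tableaux n A \<mu> = {t \<in> STab n. shape t = \<mu> \<and> tab_Des t \<subseteq> A}"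

text \<open>Inside a block of \<open>A\<close> the tableau has no descents.\<close>

lemma block_rows_decrease:
  assumes A: "finite A" and t: "t \<in> STab n" "tab_Des t \<subseteq> A" and ab: "1 \<le> a" "a \<le> b" "b \<le> n" "block A a = block A b"
  shows "row_of t b \<le> row_of t a"
  using ab(2-4)
proof (induction b rule: dec_induct)
  case (step k)
  have "block A a \<le> block A k" "block A k \<le> block A (Suc k)"
    by (rule block_mono[OF A], use step.hyps in simp)+
  then have e: "block A a = block A k" "block A k = block A (Suc k)" using step.prems by simp_all
  have "k \<notin> A" by (rule block_eq_between[OF A e(2)]) simp_all
  then have "row_of t (Suc k) \<le> row_of t k"
    using t ab(1) step by (intro STab_Des_row[OF t(1)]) auto
  then show ?case using step e by simp
qed simp

lemma STab_column_increasing: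
  assumes t: "t \<in> STab n" and ab: "a \<in> {1..n}" "b \<in> {1..n}" "col_of t a = col_of t b" "row_of t a < row_of t b"
  shows "a < b"
proof -
  note num = STabD(2)[OF t]
  have step: "t ! i ! j < t ! (i + d) ! j" if "0 < d" "i + d < length t" "j < length (t ! (i + d))" for i j d
    using that
  proof (induction d)
    case (Suc d)
    have "length (t ! (i + d)) \<ge> length (t ! Suc (i + d))"
      using STabD(1)[OF t] Suc.prems
      by (auto simp: is_partition_def shape_def sorted_wrt_iff_nth_less)
    moreover have "t ! (i + d) ! j < t ! Suc (i + d) ! j" using STabD(4)[OF t] Suc.prems by simp
    ultimately show ?case using Suc by (cases "d = 0") auto
  qed simp
  have "t ! row_of t a ! col_of t b < t ! row_of t b ! col_of t b"
    using step[of "row_of t b - row_of t a" "row_of t a" "col_of t b"] ab(4)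
      numbering_entry[OF num ab(2)] by simp
  then show ?thesis using numbering_entry(3)[OF num ab(1)] numbering_entry(3)[OF num ab(2)] ab(3) by simp
qed

text \<open>
  Going up a column the entries increase, but inside a block of \<open>A\<close> larger entries are not in
  higher rows.
\<close>

lemma column_blocks_increasing:
  assumes A: "finite A" and t: "t \<in> STab n" "tab_Des t \<subseteq> A"
    and ab: "a \<in> {1..n}" "b \<in> {1..n}" "col_of t a = col_of t b" "row_of t a < row_of t b"
  shows "block A a < block A b"
proof -
  have lt: "a < b" by (rule STab_column_increasing[OF t(1) ab])
  then have "block A a \<le> block A b" by (intro block_mono[OF A]) simp
  moreover have "block A a \<noteq> block A b"
    using block_rows_decrease[OF A t, of a b] ab lt by auto
  ultimately show ?thesis by simp
qed

text \<open>
  The base exceeds \<open>n * n\<close>, so that a change of a row index in one block outweighs all changes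
  in the blocks before it.
\<close>

definition row_weight :: "nat \<Rightarrow> nat set \<Rightarrow> tableau \<Rightarrow> nat" where
  "row_weight n A t = (\<Sum>a\<in>{1..n}. (n * n + 1) ^ block A a * row_of t a)"

lemma row_weight_stab:
  assumes "numbering n \<mu> t" "k \<in> word_stab n (block A)"
  shows "row_weight n A (relabel k t) = row_weight n A t"
proof -
  have k: "k permutes {1..n}" "\<And>a. block A (k a) = block A a"
    using assms(2) by (auto simp: word_stab_iff fun_eq_iff)
  have "row_weight n A (relabel k t) = (\<Sum>a\<in>k ` {1..n}. (n * n + 1) ^ block A a * row_of (relabel k t) a)"
    unfolding row_weight_def permutes_image[OF k(1)] ..
  also have "\<dots> = (\<Sum>a\<in>{1..n}. (n * n + 1) ^ block A (k a) * row_of (relabel k t) (k a))"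
    by (rule sum.reindex[OF permutes_inj_on[OF k(1)], unfolded comp_def])
  also have "\<dots> = row_weight n A t"
    unfolding row_weight_def k(2) by (intro sum.cong refl) (simp only: relabel_row[OF assms(1) k(1)])
  finally show ?thesis .
qed

lemma sum_split_Collect:
  assumes "finite N"
  shows "sum f N = sum f {a \<in> N. P a} + sum f {a \<in> N. \<not> P a}"
proof -
  have "N = {a \<in> N. P a} \<union> {a \<in> N. \<not> P a}" by blast
  then have "sum f N = sum f ({a \<in> N. P a} \<union> {a \<in> N. \<not> P a})" by (rule arg_cong)
  also have "\<dots> = sum f {a \<in> N. P a} + sum f {a \<in> N. \<not> P a}"
    using assms by (intro sum.union_disjoint) auto
  finally show ?thesis .
qed

text \<open>
  Look at the last block containing an entry moved by \<open>\<pi>\<close>. A moved entry of this block takes the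
  place of an entry of its column that does not lie in a later block, hence moves to a lower row
  by \<open>column_blocks_increasing\<close>. Entries in later blocks stay, and those in earlier blocks have
  too little weight to matter.
\<close>

lemma row_weight_column_perm:
  assumes A: "finite A" and s: "s \<in> STab n" "tab_Des s \<subseteq> A" and \<pi>: "\<pi> \<in> column_group n s" "\<pi> \<noteq> id"
  shows "row_weight n A (relabel \<pi> s) < row_weight n A s"
proof -
  note num = STabD(2)[OF s(1)]
  have p: "\<pi> permutes {1..n}" using column_groupD[OF \<pi>(1)] .
  let ?N = "{1..n}" and ?W = "\<lambda>a. (n * n + 1) ^ block A a"
  define r where "r = row_of s"
  define r' where "r' = row_of (relabel \<pi> s)"
  define q where "q = inv' \<pi>"
  have qm: "q \<in> column_group n s" unfolding q_def by (rule column_group_inv[OF \<pi>(1)])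
  have \<pi>q: "\<pi> (q a) = a" for a unfolding q_def by (rule permutes_inverses(1)[OF p])
  have qN: "q a \<in> ?N" and qc: "col_of s (q a) = col_of s a" if "a \<in> ?N" for a
    using column_group_col_of[OF num qm that] by simp_all
  have r'q: "r' a = r (q a)" if "a \<in> ?N" for a
    using relabel_row[OF num p qN[OF that]] by (simp only: \<pi>q r_def r'_def)
  define Mv where "Mv = {a \<in> ?N. q a \<noteq> a}"
  have "Mv \<noteq> {}"
  proof
    assume "Mv = {}"
    then have "\<pi> a = a" if "a \<in> ?N" for a using that \<pi>q[of a] by (auto simp: Mv_def)
    then have "\<pi> = id" using permutes_not_in[OF p] by (intro ext) (metis id_apply)
    then show False using \<pi>(2) by simp
  qed
  have fM: "finite (block A ` Mv)" "block A ` Mv \<noteq> {}" using \<open>Mv \<noteq> {}\<close> by (auto simp: Mv_def)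
  define m where "m = Max (block A ` Mv)"
  obtain a0 where a0: "a0 \<in> Mv" "block A a0 = m" using Max_in[OF fM] unfolding m_def by auto
  have mmax: "block A a \<le> m" if "a \<in> Mv" for a unfolding m_def by (rule Max_ge[OF fM(1)]) (use that in simp)
  have qMv: "q a \<in> Mv" if "a \<in> Mv" for a
  proof -
    have aN: "a \<in> ?N" "q a \<noteq> a" using that by (auto simp: Mv_def)
    have "q (q a) \<noteq> q a" using \<pi>q aN(2) by metis
    then show ?thesis using qN[OF aN(1)] by (simp add: Mv_def)
  qed
  \<comment> \<open>in \<open>\<pi> s\<close> the entry \<open>a\<close> is in the row that \<open>q a\<close> has in \<open>s\<close>\<close>
  have top: "r' a < r a" if a: "a \<in> Mv" "block A a = m" for a
  proof -
    have aN: "a \<in> ?N" "q a \<noteq> a" using a by (auto simp: Mv_def)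
    have "\<not> r a \<le> r (q a)"
    proof
      assume le: "r a \<le> r (q a)"
      have "r a \<noteq> r (q a)" using numbering_inj[OF num aN(1) qN[OF aN(1)]] qc[OF aN(1)] aN(2) unfolding r_def by metis
      then have "r a < r (q a)" using le by simp
      then have "block A a < block A (q a)"
        unfolding r_def by (intro column_blocks_increasing[OF A s aN(1) qN[OF aN(1)] qc[OF aN(1), symmetric]])
      then show False using mmax[OF qMv[OF a(1)]] a(2) by simp
    qed
    then show ?thesis using r'q[OF aN(1)] by simp
  qed
  have high: "r' a \<le> r a" if "a \<in> ?N" "block A a \<ge> m" for a
  proof (cases "a \<in> Mv")
    case True
    then show ?thesis using top[OF True] mmax[OF True] that(2) by simp
  next
    case False
    then show ?thesis using r'q[OF that(1)] that(1) by (simp add: Mv_def)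
  qed
  have rn: "r' a \<le> n" if "a \<in> ?N" for a
    using r'q[OF that] numbering_entry(1)[OF num qN[OF that]] STab_length_le[OF s(1)] by (simp add: r_def)
  let ?H = "{a \<in> ?N. block A a \<ge> m}" and ?L = "{a \<in> ?N. block A a < m}"
  have split: "(\<Sum>a\<in>?N. f a) = (\<Sum>a\<in>?H. f a) + (\<Sum>a\<in>?L. f a)" for f :: "nat \<Rightarrow> nat"
    using sum_split_Collect[of ?N f "\<lambda>a. block A a \<ge> m"] by (simp add: not_le)
  have a0H: "a0 \<in> ?H" using a0 by (simp add: Mv_def)
  have "(\<Sum>a\<in>?H. ?W a * r' a) + ?W a0 \<le> (\<Sum>a\<in>?H. ?W a * r a)"
  proof -
    have "(\<Sum>a\<in>?H - {a0}. ?W a * r' a) \<le> (\<Sum>a\<in>?H - {a0}. ?W a * r a)"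
      by (intro sum_mono mult_left_mono high) auto
    moreover have "?W a0 * r' a0 + ?W a0 \<le> ?W a0 * r a0"
      using mult_left_mono[of "Suc (r' a0)" "r a0" "?W a0"] top[OF a0] by simp
    ultimately show ?thesis
      using sum.remove[OF _ a0H, of "\<lambda>a. ?W a * r' a"] sum.remove[OF _ a0H, of "\<lambda>a. ?W a * r a"] by simp
  qed
  \<comment> \<open>at most \<open>n\<close> entries, in rows at most \<open>n\<close>, with a weight lower by one power of the base\<close>
  moreover have "(\<Sum>a\<in>?L. ?W a * r' a) < ?W a0"
  proof (cases m)
    case 0
    then show ?thesis by simp
  next
    case (Suc m')
    have "(\<Sum>a\<in>?L. ?W a * r' a) \<le> (\<Sum>a\<in>?L. (n * n + 1) ^ m' * n)"
      by (intro sum_mono mult_mono power_increasing rn) (auto simp: Suc)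
    also have "\<dots> = card ?L * ((n * n + 1) ^ m' * n)" by simp
    also have "\<dots> \<le> n * ((n * n + 1) ^ m' * n)"
    proof (rule mult_right_mono)
      have "card ?L \<le> card ?N" by (rule card_mono) auto
      then show "card ?L \<le> n" by simp
    qed simp
    also have "\<dots> < ?W a0" using a0(2) Suc by (simp add: algebra_simps)
    finally show ?thesis .
  qed
  ultimately show ?thesis
    unfolding row_weight_def r_def[symmetric] r'_def[symmetric] split by linarith
qed

text \<open>
  In both tableaux row indices weakly decrease along the blocks, and words that are sorted
  inside the blocks and differ by a permutation inside the blocks are equal.
\<close>

lemma same_block_tabloid_eq:
  assumes A: "finite A" and s: "s \<in> STab n" "tab_Des s \<subseteq> A" and t: "t \<in> STab n" "tab_Des t \<subseteq> A"
    and "shape s = shape t" and k: "k \<in> word_stab n (block A)" and eq: "tabloid s = tabloid (relabel k t)"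
  shows "s = t"
proof -
  have kp: "k permutes {1..n}" using k by (simp add: word_stab_iff)
  have row: "row_of s (k a) = row_of t a" if "a \<in> {1..n}" for a
    using relabel_row[OF STabD(2)[OF t(1)] kp that] row_of_tabloid[OF eq] by simp
  \<comment> \<open>rows counted from above, so that \<open>p\<close> increases along the blocks\<close>
  define p where "p a = n - row_of s a" for a
  have inc: "block_increasing n A (\<lambda>a. n - row_of u a)" if "u \<in> STab n" "tab_Des u \<subseteq> A" for u
    unfolding block_increasing_def
  proof
    fix i assume "i \<in> {1..<n} - A"
    then have "i \<in> {1..<n}" "i \<notin> tab_Des u" using that(2) by blast+
    then show "n - row_of u i \<le> n - row_of u (Suc i)" by (intro diff_le_mono2 STab_Des_row[OF that(1)])
  qed
  have pk: "block_increasing n A (p \<circ> k)"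
    unfolding block_increasing_def
  proof
    fix i assume i: "i \<in> {1..<n} - A"
    then have "i \<in> {1..n}" "Suc i \<in> {1..n}" by auto
    then show "(p \<circ> k) i \<le> (p \<circ> k) (Suc i)"
      using bspec[OF inc[OF t, unfolded block_increasing_def] i] row by (simp only: p_def o_apply)
  qed
  have "row_of s a = row_of t a" if a: "a \<in> {1..n}" for a
  proof -
    have "p (k a) = p a"
      by (rule block_sort_unique[OF A k _ pk a]) (unfold p_def[abs_def], rule inc[OF s])
    then have "n - row_of t a = n - row_of s a" using row[OF a] by (simp add: p_def)
    moreover have "row_of t a < n" "row_of s a < n"
      using numbering_entry(1)[OF STabD(2)[OF t(1)] a] STab_length_le[OF t(1)]
        numbering_entry(1)[OF STabD(2)[OF s(1)] a] STab_length_le[OF s(1)] by simp_all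
    ultimately show ?thesis by simp
  qed
  then show ?thesis by (rule STab_row_eqI[OF s(1) t(1) assms(6)])
qed

definition symmetrized_polytabloid :: "nat \<Rightarrow> nat set \<Rightarrow> tableau \<Rightarrow> nat set list \<Rightarrow> complex" where
  "symmetrized_polytabloid n A t = (\<Sum>h\<in>word_stab n (block A). polytabloid n (relabel h t))"

definition orbit_functional :: "nat \<Rightarrow> nat set \<Rightarrow> tableau \<Rightarrow> (nat set list \<Rightarrow> complex) \<Rightarrow> complex" where
  "orbit_functional n A t v = (\<Sum>h\<in>word_stab n (block A). v (tabloid (relabel h t)))"

lemma word_stab_perm: "h \<in> word_stab n q \<Longrightarrow> h permutes {1..n}"
  by (simp only: word_stab_iff)

lemma word_stab_compose:
  assumes "h \<in> word_stab n q" "k \<in> word_stab n q"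
  shows "h \<circ> k \<in> word_stab n q"
proof -
  have "q \<circ> (h \<circ> k) = q" using assms by (simp only: word_stab_iff o_assoc)
  then show ?thesis unfolding word_stab_iff using permutes_compose[OF word_stab_perm[OF assms(2)] word_stab_perm[OF assms(1)]] by (rule conjI[rotated])
qed

lemma orbit_functional_symmetrized:
  "orbit_functional n A t (symmetrized_polytabloid n A s) =
    (\<Sum>h\<in>word_stab n (block A). \<Sum>k\<in>word_stab n (block A). polytabloid n s (tabloid (relabel (inv' k \<circ> h) t)))"
  unfolding orbit_functional_def symmetrized_polytabloid_def sum_fun_apply
proof (rule sum.cong[OF refl], rule sum.cong[OF refl])
  fix h k assume k: "k \<in> word_stab n (block A)"
  show "polytabloid n (relabel k s) (tabloid (relabel h t)) = polytabloid n s (tabloid (relabel (inv' k \<circ> h) t))"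
    unfolding polytabloid_relabel[OF word_stab_perm[OF k]] tab_vimage_tabloid[OF word_stab_perm[OF k]] ..
qed

text \<open>
  A tabloid occurring in the polytabloid of \<open>s\<close> is that of \<open>\<pi> s\<close> for some column permutation
  \<open>\<pi>\<close>, which decreases the row weight unless it is the identity, while \<open>k\<close> preserves the row
  weight.
\<close>

lemma polytabloid_triangular:
  assumes A: "finite A" and s: "s \<in> young_tableaux n A \<mu>" and t: "t \<in> young_tableaux n A \<mu>"
    and k: "k \<in> word_stab n (block A)" and nz: "polytabloid n s (tabloid (relabel k t)) \<noteq> 0"
  shows "s = t \<and> polytabloid n s (tabloid (relabel k t)) = 1 \<or> row_weight n A t < row_weight n A s"
proof -
  have S: "s \<in> STab n" "tab_Des s \<subseteq> A" "shape s = \<mu>" and T: "t \<in> STab n" "tab_Des t \<subseteq> A" "shape t = \<mu>"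
    using s t by (simp_all add: young_tableaux_def)
  have nums: "numbering n \<mu> s" "numbering n \<mu> t" using STabD(2)[OF S(1)] STabD(2)[OF T(1)] S(3) T(3) by simp_all
  from nz obtain \<pi> where "\<pi> \<in> column_group n s"
      "csign \<pi> * (if tabloid (relabel \<pi> s) = tabloid (relabel k t) then 1 else 0) \<noteq> 0"
    unfolding polytabloid_eq by (rule sum.not_neutral_contains_not_neutral)
  then have \<pi>: "\<pi> \<in> column_group n s" and eq: "tabloid (relabel \<pi> s) = tabloid (relabel k t)"
    by (auto split: if_splits)
  show ?thesis
  proof (cases "\<pi> = id")
    case True
    then have eq': "tabloid s = tabloid (relabel k t)" using eq by simp
    have "s = t" by (rule same_block_tabloid_eq[OF A S(1,2) T(1,2) _ k eq']) (simp add: S T)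
    moreover have "polytabloid n s (tabloid (relabel k t)) = 1"
      unfolding eq'[symmetric] by (rule polytabloid_self[OF nums(1)])
    ultimately show ?thesis by blast
  next
    case False
    have "row_weight n A t = row_weight n A (relabel k t)" by (rule row_weight_stab[OF nums(2) k, symmetric])
    also have "\<dots> = row_weight n A (relabel \<pi> s)" unfolding row_weight_def row_of_tabloid[OF eq] ..
    also have "\<dots> < row_weight n A s" by (rule row_weight_column_perm[OF A S(1,2) \<pi> False])
    finally show ?thesis ..
  qed
qed

text \<open>
  By \<open>polytabloid_triangular\<close> the pairings with sums over orbits of tabloids form a triangular
  matrix with respect to the row weight. Its diagonal entries are sums of zeros and ones, not
  all zero.
\<close>

lemma symmetrized_independent:
  assumes A: "finite A"
  shows "inj_on (symmetrized_polytabloid n A) (young_tableaux n A \<mu>)"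
    "fs.independent (symmetrized_polytabloid n A ` young_tableaux n A \<mu>)"
proof -
  let ?T = "young_tableaux n A \<mu>" and ?H = "word_stab n (block A)"
  have fin: "finite ?T" unfolding young_tableaux_def using finite_STab by simp
  have lin: "lin_map fscale UNIV (*) UNIV (orbit_functional n A t)" for t
    by (rule lin_mapI) (simp_all add: orbit_functional_def fscale_def sum.distrib sum_distrib_left)
  have mem: "inv' k \<circ> h \<in> ?H" if "h \<in> ?H" "k \<in> ?H" for h k
    by (rule word_stab_compose[OF word_stab_inv[OF that(2)] that(1)])
  have diag: "orbit_functional n A t (symmetrized_polytabloid n A t) \<noteq> 0" if t: "t \<in> ?T" for t
  proof -
    define c where "c h k = (if polytabloid n t (tabloid (relabel (inv' k \<circ> h) t)) = 0 then 0 else 1 :: nat)" for h k :: "nat \<Rightarrow> nat"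
    have "polytabloid n t (tabloid (relabel (inv' k \<circ> h) t)) = of_nat (c h k)" if "h \<in> ?H" "k \<in> ?H" for h k
      using polytabloid_triangular[OF A t t mem[OF that]] by (auto simp: c_def)
    then have val: "orbit_functional n A t (symmetrized_polytabloid n A t) = of_nat (\<Sum>h\<in>?H. \<Sum>k\<in>?H. c h k)"
      unfolding orbit_functional_symmetrized by simp
    have num: "numbering n \<mu> t" using t STabD(2)[of t n] by (auto simp: young_tableaux_def)
    have "c id id = 1" using polytabloid_self[OF num] by (simp add: c_def)
    then have "1 \<le> (\<Sum>k\<in>?H. c id k)"
      using member_le_sum[of id ?H "c id"] word_stab_id[of n "block A"] finite_word_stab[of n "block A"] by simp
    also have "\<dots> \<le> (\<Sum>h\<in>?H. \<Sum>k\<in>?H. c h k)"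
      using member_le_sum[of id ?H "\<lambda>h. \<Sum>k\<in>?H. c h k"] word_stab_id[of n "block A"] finite_word_stab[of n "block A"] by simp
    finally show ?thesis unfolding val of_nat_eq_0_iff by linarith
  qed
  have tri: "t = s \<or> row_weight n A t < row_weight n A s"
    if ts: "t \<in> ?T" "s \<in> ?T" and nz: "orbit_functional n A t (symmetrized_polytabloid n A s) \<noteq> 0" for t s
  proof -
    from nz obtain h where h: "h \<in> ?H" "(\<Sum>k\<in>?H. polytabloid n s (tabloid (relabel (inv' k \<circ> h) t))) \<noteq> 0"
      unfolding orbit_functional_symmetrized by (rule sum.not_neutral_contains_not_neutral)
    from h(2) obtain k where k: "k \<in> ?H" "polytabloid n s (tabloid (relabel (inv' k \<circ> h) t)) \<noteq> 0"
      by (rule sum.not_neutral_contains_not_neutral)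
    show ?thesis using polytabloid_triangular[OF A ts(2,1) mem[OF h(1) k(1)] k(2)] by blast
  qed
  show "inj_on (symmetrized_polytabloid n A) ?T"
    by (rule fs.independent_triangular(1)[OF fin lin diag tri])
  show "fs.independent (symmetrized_polytabloid n A ` ?T)"
    by (rule fs.independent_triangular(2)[OF fin lin diag tri])
qed

abbreviation specht_char :: "nat \<Rightarrow> nat list \<Rightarrow> (nat \<Rightarrow> nat) \<Rightarrow> complex" where
  "specht_char n \<mu> \<equiv> character (sym_group n) (specht n \<mu>)"

lemma specht_char_conj:
  assumes "\<rho> permutes {1..n}" "h permutes {1..n}"
  shows "specht_char n \<mu> (\<rho> \<circ> h \<circ> inv' \<rho>) = specht_char n \<mu> h"
  using gmodule.character_conj[OF specht_gmodule specht_fin_dim, of h n \<rho> \<mu>] assms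
  unfolding sym_group_carrier sym_group_mult sym_group_inv[OF assms(1)] by simp

text \<open>
  By Frobenius reciprocity the inner product is the dimension of the invariants of the Young
  subgroup in the Specht module, and the symmetrized polytabloids are independent invariants.
\<close>

lemma fixed_words_specht_pairing:
  assumes A: "finite A"
  obtains m where "m \<ge> card (young_tableaux n A \<mu>)"
    "(\<Sum>\<tau>\<in>Perm n. of_nat (fixed_words n (block A) \<tau>) * specht_char n \<mu> \<tau>) = of_nat (card (Perm n)) * of_nat m"
proof -
  interpret gmodule "sym_group n" "specht n \<mu>" by (rule specht_gmodule)
  let ?S = "specht n \<mu>" and ?H = "word_stab n (block A)" and ?T = "young_tableaux n A \<mu>"
  let ?E = "symmetrized_polytabloid n A ` ?T"
  have num: "numbering n \<mu> t" if "t \<in> ?T" for t using that STabD(2)[of t n] by (auto simp: young_tableaux_def)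
  have finE: "finite ?E" unfolding young_tableaux_def using finite_STab by simp
  have subS: "fs.subspace (carr ?S)" by simp
  have sub: "?E \<subseteq> carr ?S"
  proof (rule image_subsetI)
    fix t assume "t \<in> ?T"
    then show "symmetrized_polytabloid n A t \<in> carr ?S"
      unfolding symmetrized_polytabloid_def
      by (intro fs.subspace_sum[OF subS] polytabloid_in_specht numbering_relabel num word_stab_perm)
  qed
  have fixed: "act ?S h v = v" if h: "h \<in> ?H" and v: "v \<in> ?E" for h v
  proof -
    obtain t where t: "v = symmetrized_polytabloid n A t" using v by blast
    have "act ?S h v = (\<Sum>k\<in>?H. act ?S h (polytabloid n (relabel k t)))"
      unfolding t symmetrized_polytabloid_def by (simp add: fun_eq_iff sum_fun_apply)
    also have "\<dots> = (\<Sum>k\<in>?H. polytabloid n (relabel (h \<circ> k) t))"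
      unfolding polytabloid_act[OF word_stab_perm[OF h]] relabel_relabel ..
    also have "\<dots> = (\<Sum>k\<in>?H. polytabloid n (relabel k t))"
      by (rule sum.reindex_bij_witness[of _ "\<lambda>k. inv' h \<circ> k" "\<lambda>k. h \<circ> k"])
         (simp_all only: perm_cancel[OF word_stab_perm[OF h]] word_stab_compose[OF h] word_stab_compose[OF word_stab_inv[OF h]])
    finally show ?thesis unfolding t symmetrized_polytabloid_def .
  qed
  have ind: "\<not> module.dependent (smul ?S) ?E"
    unfolding specht_simps(1) by (rule symmetrized_independent(2)[OF A])
  have finH: "finite ?H" by (rule finite_word_stab)
  obtain m where m: "m \<ge> card ?E" "(\<Sum>h\<in>?H. specht_char n \<mu> h) = of_nat (card ?H) * of_nat m"
    by (rule invariants_ge[OF specht_fin_dim word_stab_subgroup finH finE ind sub fixed])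
  have cE: "card ?E = card ?T" by (rule card_image[OF symmetrized_independent(1)[OF A]])
  have H0: "of_nat (card ?H) \<noteq> (0 :: complex)" using card_word_stab[of n "block A"] by simp
  have "of_nat (card ?H) * (\<Sum>\<tau>\<in>Perm n. of_nat (fixed_words n (block A) \<tau>) * specht_char n \<mu> \<tau>) =
      of_nat (card (Perm n)) * (\<Sum>h\<in>?H. specht_char n \<mu> h)"
    by (rule sum_fixed_words_class[OF specht_char_conj])
  also have "\<dots> = of_nat (card ?H) * (of_nat (card (Perm n)) * of_nat m)"
    unfolding m(2) by (rule mult.left_commute)
  finally have "(\<Sum>\<tau>\<in>Perm n. of_nat (fixed_words n (block A) \<tau>) * specht_char n \<mu> \<tau>) = of_nat (card (Perm n)) * of_nat m"
    by (rule mult_left_cancel[OF H0, THEN iffD1])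
  then show ?thesis using m(1) unfolding cE by (intro that)
qed

lemma specht_char_orthonormal:
  assumes "is_partition n \<mu>" "is_partition n \<nu>"
  shows "(\<Sum>\<tau>\<in>Perm n. specht_char n \<mu> \<tau> * specht_char n \<nu> \<tau>) = (if \<mu> = \<nu> then of_nat (card (Perm n)) else 0)"
proof -
  interpret gmodule "sym_group n" "specht n \<mu>" by (rule specht_gmodule)
  have car: "carrier (sym_group n) = Perm n" by (simp add: sym_group_def)
  have "(\<Sum>\<tau>\<in>Perm n. specht_char n \<mu> \<tau> * specht_char n \<nu> \<tau>) =
      (\<Sum>\<tau>\<in>carrier (sym_group n). specht_char n \<mu> \<tau> * specht_char n \<nu> (inv\<^bsub>sym_group n\<^esub> \<tau>))"
    unfolding car
  proof (rule sum.cong[OF refl])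
    fix \<tau> assume "\<tau> \<in> Perm n"
    then have \<tau>: "\<tau> permutes {1..n}" by (rule CollectD)
    show "specht_char n \<mu> \<tau> * specht_char n \<nu> \<tau> = specht_char n \<mu> \<tau> * specht_char n \<nu> (inv\<^bsub>sym_group n\<^esub> \<tau>)"
      unfolding sym_group_inv[OF \<tau>] specht_character_inv[OF assms(2) \<tau>] ..
  qed
  also have "\<dots> = (if \<mu> = \<nu> then of_nat (card (Perm n)) else 0)"
  proof (cases "\<mu> = \<nu>")
    case True
    then show ?thesis
      using character_norm[OF specht_abs_simple[OF assms(1)] specht_fin_dim finite_sym_group] by (simp add: car)
  next
    case False
    then have "\<not> isomorphic_modules (sym_group n) (specht n \<mu>) (specht n \<nu>)"
      using specht_isomorphic_eq[OF assms] by blast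
    then show ?thesis
      using character_orthogonal[OF specht_gmodule specht_simple[OF assms(1)] specht_simple[OF assms(2)] specht_fin_dim specht_fin_dim] False
      by simp
  qed
  finally show ?thesis .
qed

text \<open>
  The Robinson-Schensted correspondence is injective, and the two tableaux of \<open>g\<close> have their
  descents among those of the inverse of \<open>g\<close> and of \<open>g\<close>.
\<close>

lemma card_des_pairs_le:
  "card {g \<in> des_below n A. inv' g \<in> des_below n A} \<le> (\<Sum>\<mu>\<in>shape ` STab n. card (young_tableaux n A \<mu>) ^ 2)"
proof -
  let ?G = "{g \<in> des_below n A. inv' g \<in> des_below n A}"
  let ?U = "\<Union>\<mu>\<in>shape ` STab n. young_tableaux n A \<mu> \<times> young_tableaux n A \<mu>"
  have fin: "finite (young_tableaux n A \<mu>)" for \<mu> unfolding young_tableaux_def using finite_STab by simp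
  have perm: "g permutes {1..n}" if "g \<in> ?G" for g using that by (simp add: des_below_def)
  have inj: "inj_on (RS n) ?G"
  proof (rule inj_onI)
    fix g h assume gh: "g \<in> ?G" "h \<in> ?G" "RS n g = RS n h"
    have "\<forall>k\<in>{1..n}. g k = h k"
      by (rule RS_inj[OF permutes_inj[OF perm[OF gh(1)]] permutes_inj[OF perm[OF gh(2)]] gh(3)])
    then have "g k = h k" for k
      by (cases "k \<in> {1..n}") (simp_all add: permutes_not_in[OF perm[OF gh(1)]] permutes_not_in[OF perm[OF gh(2)]])
    then show "g = h" by (rule ext)
  qed
  have "RS n ` ?G \<subseteq> ?U"
  proof (rule image_subsetI)
    fix g assume g: "g \<in> ?G"
    note gp = perm[OF g]
    note st = RS_STab[OF gp]
    have "tab_Des (fst (RS n g)) \<subseteq> A" "tab_Des (snd (RS n g)) \<subseteq> A"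
      using insertion_tableau_Des[OF gp] recording_tableau_Des[OF gp] g
      by (auto simp: des_below_def recording_tableau_def)
    then have "RS n g \<in> young_tableaux n A (shape (fst (RS n g))) \<times> young_tableaux n A (shape (fst (RS n g)))"
      using st by (simp add: young_tableaux_def mem_Times_iff)
    then show "RS n g \<in> ?U" using st(1) by auto
  qed
  then have "card ?G \<le> card ?U"
    using card_mono[of ?U "RS n ` ?G"] card_image[OF inj] fin finite_STab by simp
  also have "\<dots> \<le> (\<Sum>\<mu>\<in>shape ` STab n. card (young_tableaux n A \<mu> \<times> young_tableaux n A \<mu>))"
    by (rule card_UN_le) (use finite_STab in simp)
  finally show ?thesis by (simp add: card_cartesian_product power2_eq_square)
qed

section \<open>Young's rule\<close>

text \<open>
  For \<open>S = \<Sum>\<mu>. K \<mu> * x \<mu>\<close> the hypotheses yield \<open>\<langle>M, M\<rangle> \<le> \<langle>S, S\<rangle> \<le> \<langle>M, S\<rangle>\<close>, so that \<open>M - S\<close> has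
  norm at most zero.
\<close>

lemma orthogonal_projection_equality:
  fixes M :: "'g \<Rightarrow> real" and x :: "'m \<Rightarrow> 'g \<Rightarrow> real" and K :: "'m \<Rightarrow> real"
  assumes "finite G" "finite I"
    and orth: "\<And>\<mu> \<nu>. \<mu> \<in> I \<Longrightarrow> \<nu> \<in> I \<Longrightarrow> (\<Sum>g\<in>G. x \<mu> g * x \<nu> g) = (if \<mu> = \<nu> then N else 0)"
    and ge: "\<And>\<mu>. \<mu> \<in> I \<Longrightarrow> N * K \<mu> \<le> (\<Sum>g\<in>G. M g * x \<mu> g)"
    and K: "\<And>\<mu>. \<mu> \<in> I \<Longrightarrow> 0 \<le> K \<mu>"
    and norm: "(\<Sum>g\<in>G. M g * M g) \<le> N * (\<Sum>\<mu>\<in>I. K \<mu> * K \<mu>)"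
    and "g \<in> G"
  shows "M g = (\<Sum>\<mu>\<in>I. K \<mu> * x \<mu> g)"
proof -
  define S where "S g = (\<Sum>\<mu>\<in>I. K \<mu> * x \<mu> g)" for g
  define Q where "Q = (\<Sum>\<mu>\<in>I. K \<mu> * K \<mu>)"
  have MS: "N * Q \<le> (\<Sum>g\<in>G. M g * S g)"
  proof -
    have "N * Q = (\<Sum>\<mu>\<in>I. K \<mu> * (N * K \<mu>))"
      unfolding Q_def sum_distrib_left by (intro sum.cong refl) simp
    also have "\<dots> \<le> (\<Sum>\<mu>\<in>I. K \<mu> * (\<Sum>g\<in>G. M g * x \<mu> g))"
      by (intro sum_mono mult_left_mono ge K)
    also have "\<dots> = (\<Sum>\<mu>\<in>I. \<Sum>g\<in>G. M g * (K \<mu> * x \<mu> g))"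
      unfolding sum_distrib_left by (intro sum.cong refl) simp
    also have "\<dots> = (\<Sum>g\<in>G. M g * S g)" unfolding S_def sum_distrib_left by (rule sum.swap)
    finally show ?thesis .
  qed
  have SS: "(\<Sum>g\<in>G. S g * S g) = N * Q"
  proof -
    have "(\<Sum>g\<in>G. S g * S g) = (\<Sum>g\<in>G. \<Sum>\<mu>\<in>I. \<Sum>\<nu>\<in>I. K \<mu> * K \<nu> * (x \<mu> g * x \<nu> g))"
      unfolding S_def sum_product by (intro sum.cong refl) simp
    also have "\<dots> = (\<Sum>\<mu>\<in>I. \<Sum>g\<in>G. \<Sum>\<nu>\<in>I. K \<mu> * K \<nu> * (x \<mu> g * x \<nu> g))" by (rule sum.swap)
    also have "\<dots> = (\<Sum>\<mu>\<in>I. \<Sum>\<nu>\<in>I. \<Sum>g\<in>G. K \<mu> * K \<nu> * (x \<mu> g * x \<nu> g))"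
      by (rule sum.cong[OF refl]) (rule sum.swap)
    also have "\<dots> = (\<Sum>\<mu>\<in>I. \<Sum>\<nu>\<in>I. K \<mu> * K \<nu> * (if \<mu> = \<nu> then N else 0))"
      by (intro sum.cong refl) (simp only: sum_distrib_left[symmetric] orth)
    also have "\<dots> = (\<Sum>\<mu>\<in>I. \<Sum>\<nu>\<in>I. if \<mu> = \<nu> then N * (K \<mu> * K \<mu>) else 0)"
      by (intro sum.cong refl) simp
    also have "\<dots> = N * Q" unfolding Q_def sum_distrib_left using assms(2) by (intro sum.cong refl) simp
    finally show ?thesis .
  qed
  have "(\<Sum>g\<in>G. (M g - S g)\<^sup>2) = (\<Sum>g\<in>G. M g * M g) - 2 * (\<Sum>g\<in>G. M g * S g) + (\<Sum>g\<in>G. S g * S g)"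
    unfolding sum_distrib_left sum_subtractf[symmetric] sum.distrib[symmetric]
    by (intro sum.cong refl) (simp add: power2_eq_square algebra_simps)
  also have "\<dots> \<le> 0" using MS SS norm[folded Q_def] by simp
  finally have "(\<Sum>g\<in>G. (M g - S g)\<^sup>2) = 0" by (intro order.antisym sum_nonneg) simp_all
  then have "(M g - S g)\<^sup>2 = 0" using assms(1,7) by (simp add: sum_nonneg_eq_0_iff)
  then show ?thesis by (simp add: S_def)
qed

lemma sum_by_shape:
  "(\<Sum>\<mu>\<in>shape ` STab n. of_nat (card (young_tableaux n A \<mu>)) * f \<mu>) =
    (\<Sum>t | t \<in> STab n \<and> tab_Des t \<subseteq> A. f (shape t) :: 'a::comm_semiring_1)"
proof -
  let ?S = "{t. t \<in> STab n \<and> tab_Des t \<subseteq> A}"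
  have "(\<Sum>t\<in>?S. f (shape t)) = (\<Sum>\<mu>\<in>shape ` STab n. \<Sum>t\<in>{t \<in> ?S. shape t = \<mu>}. f (shape t))"
    by (rule sum.group[symmetric]) (use finite_STab[of n] in auto)
  also have "\<dots> = (\<Sum>\<mu>\<in>shape ` STab n. \<Sum>t\<in>young_tableaux n A \<mu>. f \<mu>)"
    by (rule sum.cong[OF refl], rule sum.cong) (auto simp: young_tableaux_def)
  finally show ?thesis by simp
qed

text \<open>
  The multiplicities in the permutation character are at least the numbers of tableaux with
  descents in \<open>A\<close>, by \<open>fixed_words_specht_pairing\<close>, and its norm is at most the sum of the
  squares of these numbers, by \<open>fixed_words_norm\<close> and \<open>card_des_pairs_le\<close>. This leaves no room
  for anything else.
\<close>

theorem young_rule: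
  assumes A: "finite A" and \<tau>: "\<tau> permutes {1..n}"
  shows "of_nat (fixed_words n (block A) \<tau>) = (\<Sum>t | t \<in> STab n \<and> tab_Des t \<subseteq> A. specht_char n (shape t) \<tau>)"
proof -
  let ?I = "shape ` STab n"
  define N where "N = real (card (Perm n))"
  define M where "M g = real (fixed_words n (block A) g)" for g
  define K where "K \<mu> = real (card (young_tableaux n A \<mu>))" for \<mu>
  define x where "x \<mu> g = Re (specht_char n \<mu> g)" for \<mu> g
  have part: "is_partition n \<mu>" if "\<mu> \<in> ?I" for \<mu> using that STabD(1) by auto
  have chi: "specht_char n \<mu> g = of_real (x \<mu> g)" if "\<mu> \<in> ?I" for \<mu> g
    using specht_character_real[OF part[OF that], of g] by (simp add: x_def complex_eq_iff)
  have "M \<tau> = (\<Sum>\<mu>\<in>?I. K \<mu> * x \<mu> \<tau>)"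
  proof (rule orthogonal_projection_equality[where G = "Perm n" and N = N and M = M and K = K and x = x and I = ?I])
    show "finite (Perm n)" by (rule finite_Perm)
    show "finite ?I" by (rule finite_imageI[OF finite_STab])
    show "(\<Sum>g\<in>Perm n. x \<mu> g * x \<nu> g) = (if \<mu> = \<nu> then N else 0)" if "\<mu> \<in> ?I" "\<nu> \<in> ?I" for \<mu> \<nu>
    proof -
      have "complex_of_real (\<Sum>g\<in>Perm n. x \<mu> g * x \<nu> g) = (\<Sum>g\<in>Perm n. specht_char n \<mu> g * specht_char n \<nu> g)"
        by (simp add: chi[OF that(1)] chi[OF that(2)])
      also have "\<dots> = of_real (if \<mu> = \<nu> then N else 0)"
        unfolding specht_char_orthonormal[OF part[OF that(1)] part[OF that(2)]] by (simp add: N_def)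
      finally show ?thesis by (simp only: of_real_eq_iff)
    qed
    show "N * K \<mu> \<le> (\<Sum>g\<in>Perm n. M g * x \<mu> g)" if "\<mu> \<in> ?I" for \<mu>
    proof -
      obtain m where m: "m \<ge> card (young_tableaux n A \<mu>)"
        "(\<Sum>g\<in>Perm n. of_nat (fixed_words n (block A) g) * specht_char n \<mu> g) = of_nat (card (Perm n)) * of_nat m"
        by (rule fixed_words_specht_pairing[OF A])
      have "complex_of_real (\<Sum>g\<in>Perm n. M g * x \<mu> g) = of_real (N * real m)"
        using m(2) by (simp add: chi[OF that] M_def N_def)
      then have "(\<Sum>g\<in>Perm n. M g * x \<mu> g) = N * real m" by (simp only: of_real_eq_iff)
      moreover have "K \<mu> \<le> real m" using m(1) by (simp add: K_def)
      ultimately show ?thesis by (simp add: N_def mult_left_mono)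
    qed
    show "0 \<le> K \<mu>" for \<mu> by (simp add: K_def)
    show "(\<Sum>g\<in>Perm n. M g * M g) \<le> N * (\<Sum>\<mu>\<in>?I. K \<mu> * K \<mu>)"
    proof -
      have "(\<Sum>g\<in>Perm n. M g * M g) = real (\<Sum>g\<in>Perm n. fixed_words n (block A) g * fixed_words n (block A) g)"
        by (simp add: M_def)
      also have "\<dots> = N * real (card {g \<in> des_below n A. inv' g \<in> des_below n A})"
        unfolding fixed_words_norm[OF A] by (simp add: N_def)
      also have "\<dots> \<le> N * real (\<Sum>\<mu>\<in>?I. card (young_tableaux n A \<mu>) ^ 2)"
        by (intro mult_left_mono of_nat_mono card_des_pairs_le) (simp add: N_def)
      finally show ?thesis by (simp add: K_def power2_eq_square)
    qed
    show "\<tau> \<in> Perm n" using \<tau> by simp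
  qed
  then have "complex_of_real (M \<tau>) = of_real (\<Sum>\<mu>\<in>?I. K \<mu> * x \<mu> \<tau>)" by simp
  also have "\<dots> = (\<Sum>\<mu>\<in>?I. of_nat (card (young_tableaux n A \<mu>)) * specht_char n \<mu> \<tau>)"
    unfolding of_real_sum by (intro sum.cong refl) (simp add: chi K_def)
  also have "\<dots> = (\<Sum>t | t \<in> STab n \<and> tab_Des t \<subseteq> A. specht_char n (shape t) \<tau>)" by (rule sum_by_shape)
  finally show ?thesis by (simp add: M_def)
qed

section \<open>Solomon's morphism\<close>

text \<open>
  The graph of Solomon's map, in the basis of the sums of permutations with descents in \<open>A\<close>: \<open>f\<close>
  and \<open>\<psi>\<close> have common coefficients with respect to these sums and to the permutation characters.
  A relation avoids computing the coefficients, which are alternating sums of values of \<open>f\<close>.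
\<close>

definition lifts_to :: "nat \<Rightarrow> ((nat \<Rightarrow> nat) \<Rightarrow> rat) \<Rightarrow> ((nat \<Rightarrow> nat) \<Rightarrow> complex) \<Rightarrow> bool" where
  "lifts_to n f \<psi> \<longleftrightarrow> (\<exists>b :: nat set \<Rightarrow> rat.
     (\<forall>\<sigma>\<in>Perm n. f \<sigma> = (\<Sum>A\<in>Pow {1..<n}. if perm_Des n \<sigma> \<subseteq> A then b A else 0)) \<and>
     (\<forall>\<tau>\<in>Perm n. \<psi> \<tau> = (\<Sum>A\<in>Pow {1..<n}. of_rat (b A) * of_nat (fixed_words n (block A) \<tau>))))"

text \<open>The product of the group algebra.\<close>

definition convolution :: "nat \<Rightarrow> ((nat \<Rightarrow> nat) \<Rightarrow> rat) \<Rightarrow> ((nat \<Rightarrow> nat) \<Rightarrow> rat) \<Rightarrow> (nat \<Rightarrow> nat) \<Rightarrow> rat" where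
  "convolution n f g \<sigma> = (\<Sum>\<rho>\<in>Perm n. f \<rho> * g (inv' \<rho> \<circ> \<sigma>))"

text \<open>
  Moebius inversion over the sets containing \<open>K\<close>. One element \<open>u\<close> is added at a time: the
  coefficients of sets with \<open>u\<close> come from the values at sets with \<open>u\<close>, and those of sets without
  \<open>u\<close> from the differences.
\<close>

lemma superset_sum_inversion:
  fixes c :: "'a set \<Rightarrow> 'b::ab_group_add"
  assumes "finite U"
  shows "\<exists>b. \<forall>K\<in>Pow U. c K = (\<Sum>A\<in>Pow U. if K \<subseteq> A then b A else 0)"
  using assms
proof (induction U arbitrary: c rule: finite_induct)
  case empty
  then show ?case by (intro exI[of _ c]) simp
next
  case (insert u U)
  obtain b1 where b1: "\<forall>K\<in>Pow U. c (insert u K) = (\<Sum>A\<in>Pow U. if K \<subseteq> A then b1 A else 0)"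
    using insert.IH[of "\<lambda>K. c (insert u K)"] by auto
  obtain b2 where b2: "\<forall>K\<in>Pow U. c K - c (insert u K) = (\<Sum>A\<in>Pow U. if K \<subseteq> A then b2 A else 0)"
    using insert.IH[of "\<lambda>K. c K - c (insert u K)"] by auto
  define b where "b A = (if u \<in> A then b1 (A - {u}) else b2 A)" for A
  have inj: "inj_on (insert u) (Pow U)"
    using insert.hyps(2) by (auto intro!: inj_onI)
  have "c K = (\<Sum>A\<in>Pow (insert u U). if K \<subseteq> A then b A else 0)" if K: "K \<in> Pow (insert u U)" for K
  proof -
    have "(\<Sum>A\<in>Pow (insert u U). if K \<subseteq> A then b A else 0) =
        (\<Sum>A\<in>Pow U. if K \<subseteq> A then b A else 0) + (\<Sum>A\<in>insert u ` Pow U. if K \<subseteq> A then b A else 0)"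
      unfolding Pow_insert using insert.hyps by (intro sum.union_disjoint) auto
    also have "(\<Sum>A\<in>insert u ` Pow U. if K \<subseteq> A then b A else 0) = (\<Sum>A\<in>Pow U. if K - {u} \<subseteq> A then b1 A else 0)"
      unfolding sum.reindex[OF inj]
    proof (rule sum.cong[OF refl])
      fix A assume "A \<in> Pow U"
      then have "insert u A - {u} = A" using insert.hyps(2) by auto
      then show "((\<lambda>A. if K \<subseteq> A then b A else 0) \<circ> insert u) A = (if K - {u} \<subseteq> A then b1 A else 0)"
        by (simp add: b_def subset_insert_iff)
    qed
    also have "\<dots> = c (insert u (K - {u}))"
      by (rule bspec[OF b1, THEN sym]) (use K in auto)
    also have "(\<Sum>A\<in>Pow U. if K \<subseteq> A then b A else 0) = (if u \<in> K then 0 else c K - c (insert u K))"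
    proof (cases "u \<in> K")
      case True
      then have "\<not> K \<subseteq> A" if "A \<in> Pow U" for A using that insert.hyps(2) by blast
      then show ?thesis using True by (simp add: sum.neutral)
    next
      case False
      have "b A = b2 A" if "A \<in> Pow U" for A using that insert.hyps(2) by (auto simp: b_def)
      then have "(\<Sum>A\<in>Pow U. if K \<subseteq> A then b A else 0) = (\<Sum>A\<in>Pow U. if K \<subseteq> A then b2 A else 0)"
        by (intro sum.cong refl) simp
      moreover have "K \<in> Pow U" using False K by auto
      ultimately show ?thesis using b2 False by simp
    qed
    finally show ?thesis by (cases "u \<in> K") (simp_all add: insert_absorb)
  qed
  then show ?case by blast
qed

lemma sum_theta_D:
  assumes A: "A \<subseteq> {1..<n}" and \<tau>: "\<tau> permutes {1..n}"
  shows "(\<Sum>K\<in>Pow {1..<n}. if K \<subseteq> A then theta_D n K \<tau> else 0) = of_nat (fixed_words n (block A) \<tau>)"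
proof -
  have fA: "finite A" using A finite_subset by blast
  let ?S = "{t. t \<in> STab n \<and> tab_Des t \<subseteq> A}"
  have "(\<Sum>K\<in>Pow {1..<n}. if K \<subseteq> A then theta_D n K \<tau> else 0) = (\<Sum>K\<in>Pow A. theta_D n K \<tau>)"
    by (rule sum.mono_neutral_cong_right) (use A in auto)
  also have "\<dots> = (\<Sum>K\<in>Pow A. \<Sum>t\<in>{t \<in> ?S. tab_Des t = K}. specht_char n (shape t) \<tau>)"
    unfolding theta_D_def by (intro sum.cong refl) auto
  also have "\<dots> = (\<Sum>t\<in>?S. specht_char n (shape t) \<tau>)"
    by (rule sum.group) (use finite_STab[of n] fA in auto)
  finally show ?thesis unfolding young_rule[OF fA \<tau>] .
qed

lemma perm_Des_subset: "perm_Des n \<sigma> \<in> Pow {1..<n}"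
  by (auto simp: perm_Des_def)

text \<open>
  Passing from the basis \<open>D n K\<close> to the sums over \<open>K \<subseteq> A\<close>, whose images under \<open>theta\<close> are the
  permutation characters by Young's rule.
\<close>

lemma theta_lifts:
  assumes "f \<in> descent_algebra n" "theta n f = \<psi>"
  shows "lifts_to n f \<psi>"
proof -
  obtain c where f: "f = (\<lambda>\<sigma>. \<Sum>K\<in>Pow {1..<n}. c K * D n K \<sigma>)"
    using assms(1) by (auto simp: descent_algebra_def)
  have \<psi>: "\<psi> = (\<lambda>\<sigma>. \<Sum>K\<in>Pow {1..<n}. of_rat (c K) * theta_D n K \<sigma>)"
    using assms(2) unfolding f theta_eq by (rule sym)
  obtain b where b: "\<And>K. K \<in> Pow {1..<n} \<Longrightarrow> c K = (\<Sum>A\<in>Pow {1..<n}. if K \<subseteq> A then b A else 0)"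
    using superset_sum_inversion[of "{1..<n}" c] by auto
  have "f \<sigma> = (\<Sum>A\<in>Pow {1..<n}. if perm_Des n \<sigma> \<subseteq> A then b A else 0)" if "\<sigma> \<in> Perm n" for \<sigma>
  proof -
    have "f \<sigma> = (\<Sum>K\<in>Pow {1..<n}. if perm_Des n \<sigma> = K then c K else 0)"
      unfolding f using that by (intro sum.cong refl) (auto simp: D_def)
    also have "\<dots> = c (perm_Des n \<sigma>)" using perm_Des_subset[of n \<sigma>] by simp
    finally show ?thesis using b[OF perm_Des_subset] by simp
  qed
  moreover have "\<psi> \<tau> = (\<Sum>A\<in>Pow {1..<n}. of_rat (b A) * of_nat (fixed_words n (block A) \<tau>))" if "\<tau> \<in> Perm n" for \<tau>
  proof -
    have \<tau>: "\<tau> permutes {1..n}" using that by simp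
    have "\<psi> \<tau> = (\<Sum>K\<in>Pow {1..<n}. \<Sum>A\<in>Pow {1..<n}. of_rat (b A) * (if K \<subseteq> A then theta_D n K \<tau> else 0))"
      unfolding \<psi>
    proof (rule sum.cong[OF refl])
      fix K assume K: "K \<in> Pow {1..<n}"
      show "of_rat (c K) * theta_D n K \<tau> = (\<Sum>A\<in>Pow {1..<n}. of_rat (b A) * (if K \<subseteq> A then theta_D n K \<tau> else 0))"
        unfolding b[OF K] of_rat_sum sum_distrib_right by (intro sum.cong refl) simp
    qed
    also have "\<dots> = (\<Sum>A\<in>Pow {1..<n}. of_rat (b A) * (\<Sum>K\<in>Pow {1..<n}. if K \<subseteq> A then theta_D n K \<tau> else 0))"
      unfolding sum_distrib_left by (rule sum.swap)
    also have "\<dots> = (\<Sum>A\<in>Pow {1..<n}. of_rat (b A) * of_nat (fixed_words n (block A) \<tau>))"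
      by (intro sum.cong refl) (simp only: sum_theta_D[OF _ \<tau>] Pow_iff)
    finally show ?thesis .
  qed
  ultimately show ?thesis unfolding lifts_to_def by blast
qed

lemma lifts_to_lincomb:
  assumes "finite I" "\<And>i. i \<in> I \<Longrightarrow> lifts_to n (f i) (\<psi> i)"
    "\<And>\<sigma>. \<sigma> \<in> Perm n \<Longrightarrow> g \<sigma> = (\<Sum>i\<in>I. a i * f i \<sigma>)"
    "\<And>\<tau>. \<tau> \<in> Perm n \<Longrightarrow> \<phi> \<tau> = (\<Sum>i\<in>I. of_rat (a i) * \<psi> i \<tau>)"
  shows "lifts_to n g \<phi>"
proof -
  let ?U = "Pow {1..<n}"
  have "\<forall>i\<in>I. \<exists>b. (\<forall>\<sigma>\<in>Perm n. f i \<sigma> = (\<Sum>A\<in>?U. if perm_Des n \<sigma> \<subseteq> A then b A else 0)) \<and>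
     (\<forall>\<tau>\<in>Perm n. \<psi> i \<tau> = (\<Sum>A\<in>?U. of_rat (b A) * of_nat (fixed_words n (block A) \<tau>)))"
    using assms(2) unfolding lifts_to_def by (rule ballI)
  then obtain b where b: "\<forall>i\<in>I. (\<forall>\<sigma>\<in>Perm n. f i \<sigma> = (\<Sum>A\<in>?U. if perm_Des n \<sigma> \<subseteq> A then b i A else 0)) \<and>
     (\<forall>\<tau>\<in>Perm n. \<psi> i \<tau> = (\<Sum>A\<in>?U. of_rat (b i A) * of_nat (fixed_words n (block A) \<tau>)))"
    unfolding bchoice_iff by (rule exE)
  define b' where "b' A = (\<Sum>i\<in>I. a i * b i A)" for A
  have "g \<sigma> = (\<Sum>A\<in>?U. if perm_Des n \<sigma> \<subseteq> A then b' A else 0)" if \<sigma>: "\<sigma> \<in> Perm n" for \<sigma>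
  proof -
    have "g \<sigma> = (\<Sum>i\<in>I. \<Sum>A\<in>?U. a i * (if perm_Des n \<sigma> \<subseteq> A then b i A else 0))"
      unfolding assms(3)[OF \<sigma>] sum_distrib_left[symmetric]
      by (rule sum.cong[OF refl]) (use b \<sigma> in simp)
    also have "\<dots> = (\<Sum>A\<in>?U. \<Sum>i\<in>I. a i * (if perm_Des n \<sigma> \<subseteq> A then b i A else 0))" by (rule sum.swap)
    also have "\<dots> = (\<Sum>A\<in>?U. if perm_Des n \<sigma> \<subseteq> A then b' A else 0)"
      by (rule sum.cong[OF refl]) (simp add: b'_def)
    finally show ?thesis .
  qed
  moreover have "\<phi> \<tau> = (\<Sum>A\<in>?U. of_rat (b' A) * of_nat (fixed_words n (block A) \<tau>))" if \<tau>: "\<tau> \<in> Perm n" for \<tau>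
  proof -
    have "\<phi> \<tau> = (\<Sum>i\<in>I. \<Sum>A\<in>?U. of_rat (a i) * (of_rat (b i A) * of_nat (fixed_words n (block A) \<tau>)))"
      unfolding assms(4)[OF \<tau>] sum_distrib_left[symmetric]
      by (rule sum.cong[OF refl]) (use b \<tau> in simp)
    also have "\<dots> = (\<Sum>A\<in>?U. \<Sum>i\<in>I. of_rat (a i) * (of_rat (b i A) * of_nat (fixed_words n (block A) \<tau>)))" by (rule sum.swap)
    also have "\<dots> = (\<Sum>A\<in>?U. of_rat (b' A) * of_nat (fixed_words n (block A) \<tau>))"
      by (rule sum.cong[OF refl]) (simp add: b'_def of_rat_sum of_rat_mult sum_distrib_right mult.assoc)
    finally show ?thesis .
  qed
  ultimately show ?thesis unfolding lifts_to_def by blast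
qed

lemma lifts_to_generator:
  assumes "A \<subseteq> {1..<n}"
  shows "lifts_to n (\<lambda>\<sigma>. if perm_Des n \<sigma> \<subseteq> A then 1 else 0) (\<lambda>\<tau>. of_nat (fixed_words n (block A) \<tau>))"
proof -
  have *: "(\<Sum>C\<in>Pow {1..<n}. if P C then (if C = A then 1 else 0) else 0) = (if P A then 1 else (0::rat))" for P
  proof -
    have "(\<Sum>C\<in>Pow {1..<n}. if P C then (if C = A then 1 else 0) else 0) = (\<Sum>C\<in>Pow {1..<n}. if C = A then (if P A then 1 else (0::rat)) else 0)"
      by (intro sum.cong refl) auto
    then show ?thesis using assms by simp
  qed
  have **: "(\<Sum>C\<in>Pow {1..<n}. of_rat (if C = A then 1 else 0) * h C) = (h A :: complex)" for h
  proof -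
    have "(\<Sum>C\<in>Pow {1..<n}. of_rat (if C = A then 1 else 0) * h C) = (\<Sum>C\<in>Pow {1..<n}. if C = A then h A else 0)"
      by (intro sum.cong refl) auto
    then show ?thesis using assms by simp
  qed
  show ?thesis unfolding lifts_to_def by (intro exI[of _ "\<lambda>C. if C = A then 1 else 0"]) (simp only: * ** ball_simps simp_thms)
qed

text \<open>
  Both products are the sum over the same words \<open>p\<close> of the generators belonging to
  \<open>word_cuts n B p\<close>: on the one side by \<open>card_factorizations\<close>, on the other by
  \<open>fixed_words_product\<close>.
\<close>

lemma convolution_generators:
  assumes A: "A \<subseteq> {1..<n}" and B: "B \<subseteq> {1..<n}"
  shows "lifts_to n
    (convolution n (\<lambda>\<sigma>. if perm_Des n \<sigma> \<subseteq> A then 1 else 0) (\<lambda>\<sigma>. if perm_Des n \<sigma> \<subseteq> B then 1 else 0))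
    (\<lambda>\<tau>. of_nat (fixed_words n (block A) \<tau>) * of_nat (fixed_words n (block B) \<tau>))"
proof -
  have fA: "finite A" and fB: "finite B" using A B finite_subset by blast+
  show ?thesis
  proof (rule lifts_to_lincomb[where I = "inc_words n A B" and a = "\<lambda>_. 1"
        and f = "\<lambda>p \<sigma>. if perm_Des n \<sigma> \<subseteq> word_cuts n B p then 1 else 0"
        and \<psi> = "\<lambda>p \<tau>. of_nat (fixed_words n (block (word_cuts n B p)) \<tau>)"])
    show "finite (inc_words n A B)" by (rule finite_inc_words)
    show "lifts_to n (\<lambda>\<sigma>. if perm_Des n \<sigma> \<subseteq> word_cuts n B p then 1 else 0)
        (\<lambda>\<tau>. of_nat (fixed_words n (block (word_cuts n B p)) \<tau>))" for p
      by (rule lifts_to_generator) (use B in \<open>auto simp: word_cuts_def\<close>)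
    fix \<sigma> assume "\<sigma> \<in> Perm n"
    then have \<sigma>: "\<sigma> permutes {1..n}" by (rule CollectD)
    have "convolution n (\<lambda>\<sigma>. if perm_Des n \<sigma> \<subseteq> A then 1 else 0) (\<lambda>\<sigma>. if perm_Des n \<sigma> \<subseteq> B then 1 else 0) \<sigma> =
        (\<Sum>\<rho>\<in>Perm n. if \<rho> \<in> des_below n A \<and> inv' \<rho> \<circ> \<sigma> \<in> des_below n B then 1 else 0)"
      unfolding convolution_def
    proof (rule sum.cong[OF refl])
      fix \<rho> assume "\<rho> \<in> Perm n"
      then have "\<rho> permutes {1..n}" "inv' \<rho> \<circ> \<sigma> permutes {1..n}"
        using permutes_compose[OF \<sigma>] permutes_inv by auto
      then show "(if perm_Des n \<rho> \<subseteq> A then 1 else 0) * (if perm_Des n (inv' \<rho> \<circ> \<sigma>) \<subseteq> B then 1 else 0) =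
          (if \<rho> \<in> des_below n A \<and> inv' \<rho> \<circ> \<sigma> \<in> des_below n B then 1 else (0::rat))"
        unfolding des_below_def by simp
    qed
    also have "\<dots> = of_nat (card {\<rho> \<in> Perm n. \<rho> \<in> des_below n A \<and> inv' \<rho> \<circ> \<sigma> \<in> des_below n B})"
      using finite_Perm[of n] by (simp add: sum.inter_filter[symmetric])
    also have "{\<rho> \<in> Perm n. \<rho> \<in> des_below n A \<and> inv' \<rho> \<circ> \<sigma> \<in> des_below n B} = {\<rho> \<in> des_below n A. inv' \<rho> \<circ> \<sigma> \<in> des_below n B}"
      by (auto simp: des_below_def)
    also have "card \<dots> = card {p \<in> inc_words n A B. perm_Des n \<sigma> \<subseteq> word_cuts n B p}"
      by (rule card_factorizations[OF fA \<sigma>])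
    also have "of_nat \<dots> = (\<Sum>p\<in>inc_words n A B. if perm_Des n \<sigma> \<subseteq> word_cuts n B p then 1 else (0::rat))"
      using finite_inc_words[of n A B] by (simp add: sum.inter_filter[symmetric])
    finally show "convolution n (\<lambda>\<sigma>. if perm_Des n \<sigma> \<subseteq> A then 1 else 0) (\<lambda>\<sigma>. if perm_Des n \<sigma> \<subseteq> B then 1 else 0) \<sigma> =
        (\<Sum>p\<in>inc_words n A B. 1 * (if perm_Des n \<sigma> \<subseteq> word_cuts n B p then 1 else 0))" by simp
  next
    fix \<tau> assume "\<tau> \<in> Perm n"
    then have \<tau>: "\<tau> permutes {1..n}" by (rule CollectD)
    show "of_nat (fixed_words n (block A) \<tau>) * of_nat (fixed_words n (block B) \<tau>) =
        (\<Sum>p\<in>inc_words n A B. of_rat 1 * complex_of_nat (fixed_words n (block (word_cuts n B p)) \<tau>))"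
      using arg_cong[OF fixed_words_product[OF fA fB \<tau>], of complex_of_nat] by simp
  qed
qed

text \<open>Multiplicativity of Solomon's map, by bilinearity from \<open>convolution_generators\<close>.\<close>

lemma lifts_to_convolution:
  assumes f: "lifts_to n f \<psi>" and g: "lifts_to n g \<phi>"
  shows "lifts_to n (convolution n f g) (\<lambda>\<tau>. \<psi> \<tau> * \<phi> \<tau>)"
proof -
  let ?U = "Pow {1..<n}"
  define \<beta> where "\<beta> A \<sigma> = (if perm_Des n \<sigma> \<subseteq> A then 1 else 0 :: rat)" for A \<sigma>
  obtain a where *: "\<forall>\<sigma>\<in>Perm n. f \<sigma> = (\<Sum>A\<in>?U. if perm_Des n \<sigma> \<subseteq> A then a A else 0)"
    "\<forall>\<tau>\<in>Perm n. \<psi> \<tau> = (\<Sum>A\<in>?U. of_rat (a A) * of_nat (fixed_words n (block A) \<tau>))"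
    using f unfolding lifts_to_def by (elim exE conjE) (rule that)
  note af = bspec[OF *(1)] and a\<psi> = bspec[OF *(2)]
  obtain b where *: "\<forall>\<sigma>\<in>Perm n. g \<sigma> = (\<Sum>A\<in>?U. if perm_Des n \<sigma> \<subseteq> A then b A else 0)"
    "\<forall>\<tau>\<in>Perm n. \<phi> \<tau> = (\<Sum>A\<in>?U. of_rat (b A) * of_nat (fixed_words n (block A) \<tau>))"
    using g unfolding lifts_to_def by (elim exE conjE) (rule that)
  note bg = bspec[OF *(1)] and b\<phi> = bspec[OF *(2)]
  have f\<beta>: "f \<sigma> = (\<Sum>A\<in>?U. a A * \<beta> A \<sigma>)" if "\<sigma> \<in> Perm n" for \<sigma>
    unfolding af[OF that] by (intro sum.cong refl) (simp add: \<beta>_def)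
  have g\<beta>: "g \<sigma> = (\<Sum>A\<in>?U. b A * \<beta> A \<sigma>)" if "\<sigma> \<in> Perm n" for \<sigma>
    unfolding bg[OF that] by (intro sum.cong refl) (simp add: \<beta>_def)
  show ?thesis
  proof (rule lifts_to_lincomb[where I = "?U \<times> ?U" and a = "\<lambda>(A, B). a A * b B"
        and f = "\<lambda>(A, B). convolution n (\<beta> A) (\<beta> B)"
        and \<psi> = "\<lambda>(A, B) \<tau>. of_nat (fixed_words n (block A) \<tau>) * of_nat (fixed_words n (block B) \<tau>)"])
    show "finite (?U \<times> ?U)" by simp
    fix i assume "i \<in> ?U \<times> ?U"
    then obtain A B where i: "i = (A, B)" "A \<subseteq> {1..<n}" "B \<subseteq> {1..<n}" by blast
    show "lifts_to n (case i of (A, B) \<Rightarrow> convolution n (\<beta> A) (\<beta> B))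
        (case i of (A, B) \<Rightarrow> \<lambda>\<tau>. of_nat (fixed_words n (block A) \<tau>) * of_nat (fixed_words n (block B) \<tau>))"
      unfolding i(1) prod.case \<beta>_def[abs_def] by (rule convolution_generators[OF i(2,3)])
  next
    fix \<sigma> assume "\<sigma> \<in> Perm n"
    then have \<sigma>: "\<sigma> permutes {1..n}" by (rule CollectD)
    have "convolution n f g \<sigma> = (\<Sum>\<rho>\<in>Perm n. \<Sum>A\<in>?U. \<Sum>B\<in>?U. a A * b B * (\<beta> A \<rho> * \<beta> B (inv' \<rho> \<circ> \<sigma>)))"
      unfolding convolution_def
    proof (rule sum.cong[OF refl])
      fix \<rho> assume \<rho>: "\<rho> \<in> Perm n"
      then have "\<rho> permutes {1..n}" by (rule CollectD)
      then have "inv' \<rho> \<circ> \<sigma> permutes {1..n}" by (intro permutes_compose[OF \<sigma>] permutes_inv)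
      then have "inv' \<rho> \<circ> \<sigma> \<in> Perm n" by (simp only: mem_Collect_eq)
      then show "f \<rho> * g (inv' \<rho> \<circ> \<sigma>) = (\<Sum>A\<in>?U. \<Sum>B\<in>?U. a A * b B * (\<beta> A \<rho> * \<beta> B (inv' \<rho> \<circ> \<sigma>)))"
        unfolding f\<beta>[OF \<rho>] g\<beta>[OF \<open>inv' \<rho> \<circ> \<sigma> \<in> Perm n\<close>] sum_product
        by (intro sum.cong refl) (simp only: mult_ac)
    qed
    also have "\<dots> = (\<Sum>A\<in>?U. \<Sum>\<rho>\<in>Perm n. \<Sum>B\<in>?U. a A * b B * (\<beta> A \<rho> * \<beta> B (inv' \<rho> \<circ> \<sigma>)))" by (rule sum.swap)
    also have "\<dots> = (\<Sum>A\<in>?U. \<Sum>B\<in>?U. \<Sum>\<rho>\<in>Perm n. a A * b B * (\<beta> A \<rho> * \<beta> B (inv' \<rho> \<circ> \<sigma>)))"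
      by (rule sum.cong[OF refl]) (rule sum.swap)
    also have "\<dots> = (\<Sum>A\<in>?U. \<Sum>B\<in>?U. a A * b B * convolution n (\<beta> A) (\<beta> B) \<sigma>)"
      unfolding convolution_def sum_distrib_left ..
    also have "\<dots> = (\<Sum>i\<in>?U \<times> ?U. (case i of (A, B) \<Rightarrow> a A * b B) * (case i of (A, B) \<Rightarrow> convolution n (\<beta> A) (\<beta> B)) \<sigma>)"
      unfolding sum.cartesian_product by (rule sum.cong[OF refl]) (simp add: split_beta)
    finally show "convolution n f g \<sigma> = \<dots>" .
  next
    fix \<tau> assume \<tau>: "\<tau> \<in> Perm n"
    show "\<psi> \<tau> * \<phi> \<tau> = (\<Sum>i\<in>?U \<times> ?U. of_rat (case i of (A, B) \<Rightarrow> a A * b B) *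
        (case i of (A, B) \<Rightarrow> \<lambda>\<tau>. of_nat (fixed_words n (block A) \<tau>) * of_nat (fixed_words n (block B) \<tau>)) \<tau>)"
      unfolding a\<psi>[OF \<tau>] b\<phi>[OF \<tau>] sum_product sum.cartesian_product
      by (rule sum.cong[OF refl]) (simp add: split_beta of_rat_mult mult_ac)
  qed
qed

section \<open>Words in the Cayley graph\<close>

text \<open>
  The coefficient of \<open>\<sigma>\<close> in the \<open>d\<close>-th power of \<open>f\<close> in the group algebra, see \<open>word_sum_Suc\<close>.
\<close>

definition word_sum :: "nat \<Rightarrow> ((nat \<Rightarrow> nat) \<Rightarrow> rat) \<Rightarrow> nat \<Rightarrow> (nat \<Rightarrow> nat) \<Rightarrow> rat" where
  "word_sum n f d \<sigma> = (\<Sum>w\<in>cayley_words (sym_group n) (supp f) \<sigma> d. word_weight f w)"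

lemma finite_cayley_words: "finite S \<Longrightarrow> finite (cayley_words G S g d)"
  by (rule finite_subset[OF _ finite_lists_length_eq[of S d]]) (auto simp: cayley_words_def)

lemma word_sum_0: "word_sum n f 0 \<sigma> = (if \<sigma> = id then 1 else 0)"
proof -
  have "cayley_words (sym_group n) (supp f) \<sigma> 0 = (if \<sigma> = id then {[]} else {})"
    by (auto simp: cayley_words_def sym_group_def)
  then show ?thesis by (simp add: word_sum_def word_weight_def)
qed

text \<open>
  Split off the first letter \<open>s\<close>: the rest of the word reduces to the product of the inverse of
  \<open>s\<close> with \<open>\<sigma>\<close>.
\<close>

lemma word_sum_Suc:
  assumes supp: "supp f \<subseteq> Perm n"
  shows "word_sum n f (Suc d) \<sigma> = convolution n f (word_sum n f d) \<sigma>"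
proof -
  let ?W = "\<lambda>g d. cayley_words (sym_group n) (supp f) g d"
  have finS: "finite (supp f)" by (rule finite_subset[OF supp finite_Perm])
  have shift: "s \<circ> x = \<sigma> \<longleftrightarrow> x = inv' s \<circ> \<sigma>" if "s \<in> supp f" for s x
  proof -
    have s: "s permutes {1..n}" using that supp by blast
    show ?thesis
    proof
      assume "s \<circ> x = \<sigma>"
      from this[symmetric] show "x = inv' s \<circ> \<sigma>" by (simp only: perm_cancel(6)[OF s])
    next
      assume "x = inv' s \<circ> \<sigma>"
      then show "s \<circ> x = \<sigma>" by (simp only: perm_cancel(5)[OF s])
    qed
  qed
  have mem: "s # w \<in> ?W \<sigma> (Suc d) \<longleftrightarrow> s \<in> supp f \<and> w \<in> ?W (inv' s \<circ> \<sigma>) d" for s w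
  proof (cases "s \<in> supp f")
    case True
    show ?thesis
      unfolding cayley_words_def mem_Collect_eq foldr.simps comp_apply sym_group_mult shift[OF True]
      using True by simp
  next
    case False
    then show ?thesis by (simp add: cayley_words_def)
  qed
  have "word_sum n f (Suc d) \<sigma> = (\<Sum>(s, w)\<in>Sigma (supp f) (\<lambda>s. ?W (inv' s \<circ> \<sigma>) d). f s * word_weight f w)"
    unfolding word_sum_def
  proof (rule sum.reindex_bij_witness[of _ "\<lambda>(s, w). s # w" "\<lambda>w. (hd w, tl w)"])
    fix w assume w: "w \<in> ?W \<sigma> (Suc d)"
    then obtain s v where sv: "w = s # v" by (cases w) (auto simp: cayley_words_def)
    show "(case (hd w, tl w) of (s, w) \<Rightarrow> s # w) = w" unfolding sv by simp
    show "(hd w, tl w) \<in> Sigma (supp f) (\<lambda>s. ?W (inv' s \<circ> \<sigma>) d)" using w mem[of s v] unfolding sv by simp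
    show "(case (hd w, tl w) of (s, w) \<Rightarrow> f s * word_weight f w) = word_weight f w"
      unfolding sv by (simp add: word_weight_def)
  next
    fix p assume "p \<in> Sigma (supp f) (\<lambda>s. ?W (inv' s \<circ> \<sigma>) d)"
    then obtain s v where p: "p = (s, v)" "s \<in> supp f" "v \<in> ?W (inv' s \<circ> \<sigma>) d" by (elim SigmaE)
    show "(hd (case p of (s, w) \<Rightarrow> s # w), tl (case p of (s, w) \<Rightarrow> s # w)) = p" unfolding p(1) by simp
    show "(case p of (s, w) \<Rightarrow> s # w) \<in> ?W \<sigma> (Suc d)" unfolding p(1) using mem[of s v] p(2,3) by simp
  qed
  also have "\<dots> = (\<Sum>s\<in>supp f. \<Sum>w\<in>?W (inv' s \<circ> \<sigma>) d. f s * word_weight f w)"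
    by (rule sum.Sigma[symmetric, OF finS]) (intro ballI finite_cayley_words[OF finS])
  also have "\<dots> = (\<Sum>s\<in>supp f. f s * word_sum n f d (inv' s \<circ> \<sigma>))"
    unfolding word_sum_def sum_distrib_left ..
  also have "\<dots> = (\<Sum>s\<in>Perm n. f s * word_sum n f d (inv' s \<circ> \<sigma>))"
    by (rule sum.mono_neutral_left[OF finite_Perm supp]) (simp add: supp_def)
  finally show ?thesis by (simp only: convolution_def)
qed

lemma lifts_to_cong:
  assumes "lifts_to n f \<psi>" "\<And>\<sigma>. \<sigma> \<in> Perm n \<Longrightarrow> g \<sigma> = f \<sigma>" "\<And>\<tau>. \<tau> \<in> Perm n \<Longrightarrow> \<phi> \<tau> = \<psi> \<tau>"
  shows "lifts_to n g \<phi>"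
  by (rule lifts_to_lincomb[where I = "{()}" and a = "\<lambda>_. 1" and f = "\<lambda>_. f" and \<psi> = "\<lambda>_. \<psi>"])
     (simp_all add: assms)

lemma word_sum_lifts:
  assumes f: "lifts_to n f \<psi>" and supp: "supp f \<subseteq> Perm n"
  shows "lifts_to n (word_sum n f d) (\<lambda>\<tau>. \<psi> \<tau> ^ d)"
proof (induction d)
  case 0
  have "(perm_Des n \<sigma> \<subseteq> {}) = (\<sigma> = id)" if "\<sigma> \<in> Perm n" for \<sigma>
    using des_below_empty[of n] that unfolding des_below_def by blast
  then show ?case
    by (intro lifts_to_cong[OF lifts_to_generator[of "{}" n]])
       (simp_all add: word_sum_0 fixed_words_empty del: subset_empty)
next
  case (Suc d)
  show ?case
    by (rule lifts_to_cong[OF lifts_to_convolution[OF f Suc]]) (simp_all add: word_sum_Suc[OF supp])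
qed

text \<open>Expand the permutation character by Young's rule and use orthonormality.\<close>

lemma fixed_words_specht_product:
  assumes A: "A \<subseteq> {1..<n}" and \<mu>: "is_partition n \<mu>"
  shows "(\<Sum>\<tau>\<in>Perm n. of_nat (fixed_words n (block A) \<tau>) * specht_char n \<mu> \<tau>) =
    of_nat (card (Perm n)) * of_nat (card (young_tableaux n A \<mu>))"
proof -
  have fA: "finite A" using A finite_subset by blast
  let ?S = "{t. t \<in> STab n \<and> tab_Des t \<subseteq> A}"
  have fS: "finite ?S" using finite_STab by simp
  have S: "{t \<in> ?S. shape t = \<mu>} = young_tableaux n A \<mu>" by (auto simp: young_tableaux_def)
  have "(\<Sum>\<tau>\<in>Perm n. of_nat (fixed_words n (block A) \<tau>) * specht_char n \<mu> \<tau>) =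
      (\<Sum>\<tau>\<in>Perm n. \<Sum>t\<in>?S. specht_char n (shape t) \<tau> * specht_char n \<mu> \<tau>)"
  proof (rule sum.cong[OF refl])
    fix \<tau> assume "\<tau> \<in> Perm n"
    then have \<tau>: "\<tau> permutes {1..n}" by (rule CollectD)
    show "of_nat (fixed_words n (block A) \<tau>) * specht_char n \<mu> \<tau> = (\<Sum>t\<in>?S. specht_char n (shape t) \<tau> * specht_char n \<mu> \<tau>)"
      unfolding young_rule[OF fA \<tau>] by (rule sum_distrib_right)
  qed
  also have "\<dots> = (\<Sum>t\<in>?S. \<Sum>\<tau>\<in>Perm n. specht_char n (shape t) \<tau> * specht_char n \<mu> \<tau>)" by (rule sum.swap)
  also have "\<dots> = (\<Sum>t\<in>?S. if shape t = \<mu> then of_nat (card (Perm n)) else 0)"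
    by (rule sum.cong[OF refl], rule specht_char_orthonormal[OF STabD(1) \<mu>]) blast
  also have "\<dots> = (\<Sum>t\<in>{t \<in> ?S. shape t = \<mu>}. of_nat (card (Perm n)))"
    using fS by (rule sum.inter_filter[symmetric])
  finally show ?thesis unfolding S by (simp add: mult.commute)
qed

text \<open>
  Write \<open>f\<^sup>d\<close> and the character of the tensor power with common coefficients \<open>b A\<close>. The
  multiplicity is the sum over \<open>A\<close> of \<open>b A\<close> times the number of tableaux with descents in \<open>A\<close>;
  collecting the terms of each tableau \<open>t\<close> gives the coefficient of \<open>f\<^sup>d\<close> at every permutation
  with the descents of \<open>t\<close>.
\<close>

lemma multiplicity_word_sum:
  assumes V: "gmodule (sym_group n) V" "finite_dim V"
    and f: "f \<in> descent_algebra n" "theta n f = character (sym_group n) V" and \<mu>: "is_partition n \<mu>"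
    and \<sigma>: "\<And>t. t \<in> STab n \<Longrightarrow> \<sigma> t \<in> Perm n \<and> perm_Des n (\<sigma> t) = tab_Des t"
  shows "of_nat (multiplicity (sym_group n) (specht n \<mu>) (tensor_power V d)) =
    (\<Sum>t | t \<in> STab n \<and> shape t = \<mu>. word_sum n f d (\<sigma> t))"
proof -
  let ?G = "sym_group n" and ?T = "tensor_power V d" and ?U = "Pow {1..<n}" and ?N = "of_nat (card (Perm n)) :: complex"
  let ?Y = "{t. t \<in> STab n \<and> shape t = \<mu>}"
  interpret V: gmodule ?G V by (rule V(1))
  interpret T: gmodule ?G ?T by (rule V.tensor_power_gmodule)
  have fV: "fin_dim (smul V) (carr V)" using V(2) by (simp only: fin_dim_finite_dim)
  have car: "carrier ?G = Perm n" by (simp add: sym_group_def)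
  have supp: "supp f \<subseteq> Perm n"
  proof
    fix \<tau> assume "\<tau> \<in> supp f"
    moreover obtain c where "f = (\<lambda>\<sigma>. \<Sum>K\<in>?U. c K * D n K \<sigma>)"
      using f(1) unfolding descent_algebra_def mem_Collect_eq by (rule exE)
    ultimately have "\<exists>K\<in>?U. D n K \<tau> \<noteq> 0" unfolding supp_def by (auto intro: ccontr)
    then show "\<tau> \<in> Perm n" by (auto simp: D_def split: if_splits)
  qed
  obtain b where *: "\<forall>\<sigma>\<in>Perm n. word_sum n f d \<sigma> = (\<Sum>A\<in>?U. if perm_Des n \<sigma> \<subseteq> A then b A else 0)"
    "\<forall>\<tau>\<in>Perm n. character ?G V \<tau> ^ d = (\<Sum>A\<in>?U. of_rat (b A) * of_nat (fixed_words n (block A) \<tau>))"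
    using word_sum_lifts[OF theta_lifts[OF f] supp, of d] unfolding lifts_to_def by (elim exE conjE) (rule that)
  note bw = bspec[OF *(1)] and b\<chi> = bspec[OF *(2)]
  have "of_nat (multiplicity ?G (specht n \<mu>) ?T) * ?N =
      (\<Sum>\<tau>\<in>Perm n. character ?G ?T \<tau> * specht_char n \<mu> (inv\<^bsub>?G\<^esub> \<tau>))"
    using T.multiplicity_character[OF V.tensor_power_fin_dim[OF fV] finite_sym_group specht_gmodule specht_fin_dim specht_abs_simple[OF \<mu>]]
    unfolding car .
  also have "\<dots> = (\<Sum>\<tau>\<in>Perm n. \<Sum>A\<in>?U. of_rat (b A) * (of_nat (fixed_words n (block A) \<tau>) * specht_char n \<mu> \<tau>))"
  proof (rule sum.cong[OF refl])
    fix \<tau> assume \<tau>: "\<tau> \<in> Perm n"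
    then have \<tau>': "\<tau> permutes {1..n}" by (rule CollectD)
    have "character ?G ?T \<tau> = character ?G V \<tau> ^ d"
      by (rule V.tensor_power_character[OF fV]) (use \<tau> in \<open>simp only: car\<close>)
    then show "character ?G ?T \<tau> * specht_char n \<mu> (inv\<^bsub>?G\<^esub> \<tau>) =
        (\<Sum>A\<in>?U. of_rat (b A) * (of_nat (fixed_words n (block A) \<tau>) * specht_char n \<mu> \<tau>))"
      unfolding sym_group_inv[OF \<tau>'] specht_character_inv[OF \<mu> \<tau>'] b\<chi>[OF \<tau>]
      by (simp only: sum_distrib_right mult.assoc)
  qed
  also have "\<dots> = (\<Sum>A\<in>?U. \<Sum>\<tau>\<in>Perm n. of_rat (b A) * (of_nat (fixed_words n (block A) \<tau>) * specht_char n \<mu> \<tau>))"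
    by (rule sum.swap)
  also have "\<dots> = (\<Sum>A\<in>?U. of_rat (b A) * of_nat (card (young_tableaux n A \<mu>)) * ?N)"
    by (rule sum.cong[OF refl]) (simp only: sum_distrib_left[symmetric] fixed_words_specht_product[OF _ \<mu>] Pow_iff mult_ac)
  also have "\<dots> = (\<Sum>A\<in>?U. of_rat (b A) * of_nat (card (young_tableaux n A \<mu>))) * ?N"
    by (rule sum_distrib_right[symmetric])
  finally have "of_nat (multiplicity ?G (specht n \<mu>) ?T) = (\<Sum>A\<in>?U. of_rat (b A) * of_nat (card (young_tableaux n A \<mu>)) :: complex)"
  proof (rule mult_right_cancel[THEN iffD1, rotated])
    have "id \<in> Perm n" by (simp add: permutes_id)
    then have "card (Perm n) \<noteq> 0" using finite_Perm[of n] card_0_eq by blast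
    then show "?N \<noteq> 0" by simp
  qed
  also have "\<dots> = of_rat (\<Sum>A\<in>?U. \<Sum>t\<in>?Y. if tab_Des t \<subseteq> A then b A else 0)"
    unfolding of_rat_sum[of _ ?U]
  proof (rule sum.cong[OF refl])
    fix A
    have "(\<Sum>t\<in>?Y. if tab_Des t \<subseteq> A then b A else 0) = (\<Sum>t\<in>{t \<in> ?Y. tab_Des t \<subseteq> A}. b A)"
      by (rule sum.inter_filter[symmetric]) (use finite_STab[of n] in simp)
    moreover have "{t \<in> ?Y. tab_Des t \<subseteq> A} = young_tableaux n A \<mu>" by (auto simp: young_tableaux_def)
    ultimately have "(\<Sum>t\<in>?Y. if tab_Des t \<subseteq> A then b A else 0) = b A * of_nat (card (young_tableaux n A \<mu>))"
      by (simp only: sum_constant mult.commute)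
    then show "of_rat (b A) * of_nat (card (young_tableaux n A \<mu>)) = (of_rat (\<Sum>t\<in>?Y. if tab_Des t \<subseteq> A then b A else 0) :: complex)"
      by (simp only: of_rat_mult of_rat_of_nat_eq)
  qed
  \<comment> \<open>for fixed \<open>t\<close>, the sum of \<open>b A\<close> over the sets \<open>A\<close> containing the descents of \<open>t\<close> is a
    coefficient of \<open>f\<^sup>d\<close>\<close>
  also have "(\<Sum>A\<in>?U. \<Sum>t\<in>?Y. if tab_Des t \<subseteq> A then b A else 0) = (\<Sum>t\<in>?Y. \<Sum>A\<in>?U. if tab_Des t \<subseteq> A then b A else 0)"
    by (rule sum.swap)
  also have "\<dots> = (\<Sum>t\<in>?Y. word_sum n f d (\<sigma> t))"
  proof (rule sum.cong[OF refl])
    fix t assume "t \<in> ?Y"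
    then have "\<sigma> t \<in> Perm n" "perm_Des n (\<sigma> t) = tab_Des t" using \<sigma> by blast+
    then show "(\<Sum>A\<in>?U. if tab_Des t \<subseteq> A then b A else 0) = word_sum n f d (\<sigma> t)" using bw[of "\<sigma> t"] by simp
  qed
  finally have "of_rat (of_nat (multiplicity ?G (specht n \<mu>) ?T)) = (of_rat (\<Sum>t\<in>?Y. word_sum n f d (\<sigma> t)) :: complex)"
    by (simp only: of_rat_of_nat_eq)
  then show ?thesis by (simp only: of_rat_eq_iff)
qed

lemma trivial_gmodule: "gmodule (sym_group n) trivial_module"
proof -
  interpret vector_space "(*) :: complex \<Rightarrow> complex \<Rightarrow> complex" by unfold_locales (auto simp: algebra_simps)
  show ?thesis
    unfolding gmodule_def gmodule_axioms_def trivial_module_def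
    using sym_group_is_group[of n] vector_space_axioms subspace_UNIV by simp
qed

lemma multiplicity_trivial:
  fixes M :: "(nat \<Rightarrow> nat, 'b::ab_group_add) gmod"
  assumes "n \<ge> 1"
  shows "multiplicity (sym_group n) trivial_module M = multiplicity (sym_group n) (specht n [n]) M"
proof -
  let ?G = "sym_group n"
  have iso: "isomorphic_modules ?G trivial_module (specht n [n])" by (rule trivial_specht_isomorphic[OF assms])
  have iso': "isomorphic_modules ?G (specht n [n]) trivial_module"
    by (rule gmodule.isomorphic_modules_sym[OF trivial_gmodule specht_gmodule iso])
  have "isomorphic_modules ?G trivial_module N = isomorphic_modules ?G (specht n [n]) N"
    for N :: "(nat \<Rightarrow> nat, 'b) gmod"
  proof
    show "isomorphic_modules ?G (specht n [n]) N" if "isomorphic_modules ?G trivial_module N"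
      by (rule isomorphic_modules_trans[OF iso' that])
    show "isomorphic_modules ?G trivial_module N" if "isomorphic_modules ?G (specht n [n]) N"
      by (rule isomorphic_modules_trans[OF iso that])
  qed
  then show ?thesis unfolding multiplicity_def by simp
qed

lemma one_row_tableau:
  assumes "n \<ge> 1"
  shows "{t. t \<in> STab n \<and> shape t = [n]} = {[[1..<Suc n]]}"
proof (intro equalityI subsetI)
  fix t assume "t \<in> {t. t \<in> STab n \<and> shape t = [n]}"
  then have t: "t \<in> STab n" "shape t = [n]" by simp_all
  obtain r where r: "t = [r]" using t(2) by (auto simp: shape_def)
  have "sorted_wrt (<) r" using STabD(3)[OF t(1), of 0] r by simp
  moreover have "set r = {1..n}" using STabD(2)[OF t(1)] r by (simp add: numbering_def)
  moreover have "set [1..<Suc n] = {1..n}" by auto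
  ultimately have "r = [1..<Suc n]" by (intro strict_sorted_equal sorted_wrt_upt) simp_all
  then show "t \<in> {[[1..<Suc n]]}" using r by simp
next
  fix t assume "t \<in> {[[1..<Suc n]]}"
  then have t: "t = [[1..<Suc n]]" by simp
  have "set [1..<Suc n] = {1..n}" by auto
  then have "t \<in> STab n"
    unfolding t by (intro standard_STab) (use assms in \<open>simp_all del: upt_Suc\<close>)
  then show "t \<in> {t. t \<in> STab n \<and> shape t = [n]}" using t by (simp add: shape_def del: upt_Suc)
qed

theorem theorem4p6:
  fixes n :: nat
    and V :: "(nat \<Rightarrow> nat, 'v::ab_group_add) gmod"
    and f :: "(nat \<Rightarrow> nat) \<Rightarrow> rat"
    and \<sigma> :: "tableau \<Rightarrow> nat \<Rightarrow> nat"
  assumes "n \<ge> 1"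
    and "gmodule (sym_group n) V" and "finite_dim V"
    and "f \<in> descent_algebra n"
    and "theta n f = character (sym_group n) V"
    and "\<And>t. t \<in> STab n \<Longrightarrow> \<sigma> t \<in> carrier (sym_group n) \<and> recording_tableau n (\<sigma> t) = t"
  shows "(\<forall>\<mu> d. is_partition n \<mu> \<longrightarrow>
            of_nat (multiplicity (sym_group n) (specht n \<mu>) (tensor_power V d)) =
              (\<Sum>t | t \<in> STab n \<and> shape t = \<mu>.
                 \<Sum>w\<in>cayley_words (sym_group n) (supp f) (\<sigma> t) d. word_weight f w))
       \<and> (\<forall>d. of_nat (multiplicity (sym_group n) trivial_module (tensor_power V d)) =
              (\<Sum>w\<in>cayley_words (sym_group n) (supp f) \<one>\<^bsub>sym_group n\<^esub> d. word_weight f w))"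
proof -
  have \<sigma>: "\<sigma> t \<in> Perm n \<and> perm_Des n (\<sigma> t) = tab_Des t" if "t \<in> STab n" for t
  proof -
    have p: "\<sigma> t permutes {1..n}" using assms(6)[OF that] by (simp only: sym_group_carrier)
    have "perm_Des n (\<sigma> t) = tab_Des t"
      using recording_tableau_Des[OF p] assms(6)[OF that] by simp
    then show ?thesis using p by simp
  qed
  have main: "of_nat (multiplicity (sym_group n) (specht n \<mu>) (tensor_power V d)) =
      (\<Sum>t | t \<in> STab n \<and> shape t = \<mu>. word_sum n f d (\<sigma> t))" if "is_partition n \<mu>" for \<mu> d
    by (rule multiplicity_word_sum[OF assms(2-5) that \<sigma>])
  \<comment> \<open>the one-row tableau has no descents, and the identity is the only such permutation\<close>
  have "of_nat (multiplicity (sym_group n) trivial_module (tensor_power V d)) = word_sum n f d \<one>\<^bsub>sym_group n\<^esub>" for d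
  proof -
    let ?t = "[[1..<Suc n]]"
    have part: "is_partition n [n]" using assms(1) by (simp add: is_partition_def)
    have "?t \<in> STab n" using one_row_tableau[OF assms(1)] by blast
    then have "\<sigma> ?t \<in> des_below n {}" using \<sigma>[of ?t] by (simp add: des_below_def tab_Des_def)
    then have "\<sigma> ?t = \<one>\<^bsub>sym_group n\<^esub>" unfolding des_below_empty sym_group_one by simp
    then show ?thesis
      unfolding multiplicity_trivial[OF assms(1)] main[OF part] one_row_tableau[OF assms(1)] by simp
  qed
  then show ?thesis using main unfolding word_sum_def by simp
qed

end
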